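(* Assume that $m$ is Lebesgue measure on $\mathbb R^d$ and that $J(x,\mathrm dy)=j(y-x)\,\mathrm dy$ for a strictly positive function $j:\mathbb R^d\setminus\{0\}\to\mathbb R_+$, and that $J$ satisfies the regularity assumption (R) stated in the context. Let $\bar\mu_i=\bar\rho_im\in\mathscr P(\mathbb R^d)$, $i=0,1$, be such that $\mathcal I(\bar\mu_i)$ is finite. Then $$\mathcal W(\bar\mu_0,\bar\mu_1)^2=\inf\Big\{\int_0^1\mathcal A'(\rho_t,\psi_t)\,\mathrm dt:\ (\rho,\psi)\in\mathcal{CE}'_1(\bar\rho_0,\bar\rho_1)\Big\}.$$
   Context: Notation. $\mathbb R_+=[0,\infty)$. $\mathscr P(\mathbb R^d)$ is the set of Borel probability measures on $\mathbb R^d$ with the topology of weak convergence. $G=\{(x,y)\in\mathbb R^d\times\mathbb R^d: x\neq y\}$, and $\mathcal M_{loc}(G)$ is the space of signed Radon measures on $G$. $\bar\nabla\varphi(x,y)=\varphi(y)-\varphi(x)$. $Jm$ is the measure $J(x,\mathrm dy)m(\mathrm dx)$ on $G$. Setting. $\theta(s,t)=\int_0^1s^at^{1-a}\mathrm da$ is the logarithmic mean on $\mathbb R_+\times\mathbb R_+$ ($=\frac{s-t}{\log s-\log t}$ for $s\neq t$ positive), and $\hat\rho(x,y)=\theta(\rho(x),\rho(y))$. The measure $\nu(\mathrm dy)=j(y)\mathrm dy$ is a L\'evy measure, $\int(1\wedge|y|^2)\nu(\mathrm dy)<\infty$, and $J$ is reversible w.r.t. $m$, i.e. $Jm$ is symmetric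 (equivalently $\nu$ is symmetric). Regularity assumption (R). Let $\mathcal L\rho(x)=\int(\rho(x+y)-\rho(x)-y\cdot\nabla\rho(x)\mathbf 1_{\{|y|\le1\}})\nu(\mathrm dy)$ and let $X$ be the L\'evy process with $\mathbb E[e^{i\langle\xi,X_t\rangle}]=e^{t\eta(\xi)}$, $\eta(\xi)=\int(e^{i\langle y,\xi\rangle}-1-i\langle y,\xi\rangle\mathbf 1_{\{|y|\le1\}})\nu(\mathrm dy)$. The law of $X_t$ has a density $p_t$ with $p_t>0$ for all $t>0$, and $p_t$, $\mathcal Lp_t$ are rapidly decreasing functions locally uniformly in $t\in(0,\infty)$ (a smooth $f$ is rapidly decreasing if $|x^\beta D^\alpha f(x)|\to0$ as $|x|\to\infty$ for all multi-indices $\alpha,\beta$). Non-local Fisher information. $\mathcal I(\mu)=\frac12\int_G\bar\nabla\rho\,\bar\nabla\log\rho\,\mathrm d(Jm)$ if $\mu=\rho m$ with $\rho>0$; $\mathcal I(\mu)=+\infty$ otherwise. The distance $\mathcal W$. $\alpha(w,s,t)=\frac{w^2}{2\theta(s,t)}$ if $\theta(s,t)\ne0$, $=0$ if $\theta(s,t)=0=w$, $=+\infty$ if $\theta(s,t)=0$ and $w\ne0$. For $\mu\in\mathscr P(\mathbb R^d)$ let $\mu^1(\mathrm dx,\mathrm dy)=J(x,\mathrm dy)\mu(\mathrm dx)$, $\mu^2(\mathrm dx,\mathrm dy)=J(y,\mathrm dx)\mu(\mathrm dy)$. For $\boldsymbol\nu\in\mathcal M_{loc}(G)$ choose nonnegative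 $\sigma\in\mathcal M_{loc}(G)$ with $\mu^i=\rho^i\sigma$, $\boldsymbol\nu=w\sigma$ and set $\mathcal A(\mu,\boldsymbol\nu)=\int_G\alpha(w,\rho^1,\rho^2)\mathrm d\sigma$ (independent of $\sigma$). $\mathcal{CE}_1(\bar\mu_0,\bar\mu_1)$ is the set of pairs $(\mu,\boldsymbol\nu)$ with: $\mu:[0,1]\to\mathscr P(\mathbb R^d)$ weakly continuous, $\mu_0=\bar\mu_0$, $\mu_1=\bar\mu_1$; $(\boldsymbol\nu_t)_{t\in[0,1]}$ a Borel family in $\mathcal M_{loc}(G)$ with $\int_0^1\int_G(1\wedge|x-y|)|\boldsymbol\nu_t|(\mathrm dx,\mathrm dy)\mathrm dt<\infty$; and $\int_0^1\int\partial_t\varphi_t\,\mathrm d\mu_t\mathrm dt+\frac12\int_0^1\int_G\bar\nabla\varphi_t\,\mathrm d\boldsymbol\nu_t\mathrm dt=0$ for all $\varphi\in C_c^\infty((0,1)\times\mathbb R^d)$. $\mathcal W(\bar\mu_0,\bar\mu_1)^2:=\inf\{\int_0^1\mathcal A(\mu_t,\boldsymbol\nu_t)\mathrm dt:(\mu,\boldsymbol\nu)\in\mathcal{CE}_1(\bar\mu_0,\bar\mu_1)\}\in[0,\infty]$. The right-hand side. For $\rho:\mathbb R^d\to\mathbb R_+$, $\psi:\mathbb R^d\to\mathbb R$: $\mathcal A'(\rho,\psi)=\frac12\int(\psi(y)-\psi(x))^2\hat\rho(x,y)J(x,\mathrm dy)m(\mathrm dx)$. For probability densities $\bar\rho_0,\bar\rho_1$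 w.r.t. $m$, $\mathcal{CE}'_1(\bar\rho_0,\bar\rho_1)$ is the set of pairs $(\rho,\psi)$ with: (i) $\rho:[0,1]\times\mathbb R^d\to\mathbb R_+$ measurable; (ii) $\rho_t$ a probability density for all $t\in[0,1]$; (iii) $t\mapsto\rho_tm$ weakly continuous; (iv) $\psi:[0,1]\times\mathbb R^d\to\mathbb R$ measurable; (v) $\rho_0=\bar\rho_0$, $\rho_1=\bar\rho_1$ and for all $\varphi\in C_c^\infty((0,1)\times\mathbb R^d)$: $\int_0^1\int\partial_t\varphi\,\rho_t\,\mathrm dm\,\mathrm dt+\frac12\int_0^1\int\bar\nabla\varphi_t(x,y)\bar\nabla\psi_t(x,y)\hat\rho_t(x,y)J(x,\mathrm dy)m(\mathrm dx)\mathrm dt=0$. *)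

theory Defs
  imports "HOL-Probability.Probability"
begin

section \<open>Measures on the off-diagonal set\<close>

definition offdiag :: "('a \<times> 'a) set"
  where "offdiag = {(x, y). x \<noteq> y}"

definition offdiag_borel :: "('a::topological_space \<times> 'a) measure"
  where "offdiag_borel = restrict_space borel offdiag"

definition radon_offdiag :: "('a::topological_space \<times> 'a) measure \<Rightarrow> bool"
  where "radon_offdiag \<sigma> \<longleftrightarrow> sets \<sigma> = sets offdiag_borel \<and>
    (\<forall>K. compact K \<and> K \<subseteq> offdiag \<longrightarrow> emeasure \<sigma> K < \<infinity>)"

text \<open>
  A signed Radon measure on the noncompact space \<open>offdiag\<close> may have infinite positive and
  infinite negative part, so it is not a set function on all Borel sets. It is represented by its
  Jordan decomposition, the unique pair \<open>(N\<^sub>+, N\<^sub>-)\<close> of mutually singular nonnegative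
  Radon measures with difference \<open>N\<close>.
\<close>

type_synonym 'b signed_measure = "'b measure \<times> 'b measure"

definition signed_radon_offdiag :: "('a::topological_space \<times> 'a) signed_measure \<Rightarrow> bool"
  where "signed_radon_offdiag N \<longleftrightarrow> radon_offdiag (fst N) \<and> radon_offdiag (snd N) \<and>
    (\<exists>A\<in>sets offdiag_borel. emeasure (fst N) A = 0 \<and> emeasure (snd N) (offdiag - A) = 0)"

definition signed_measure_value :: "'b signed_measure \<Rightarrow> 'b set \<Rightarrow> real"
  where "signed_measure_value N B = measure (fst N) B - measure (snd N) B"

definition signed_integral :: "'b signed_measure \<Rightarrow> ('b \<Rightarrow> real) \<Rightarrow> real"
  where "signed_integral N f = integral\<^sup>L (fst N) f - integral\<^sup>L (snd N) f"

definition total_variation_nn_integral :: "'b signed_measure \<Rightarrow> ('b \<Rightarrow> ennreal) \<Rightarrow> ennreal"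
  where "total_variation_nn_integral N f = integral\<^sup>N (fst N) f + integral\<^sup>N (snd N) f"

text \<open>The signed measure \<open>w \<sigma>\<close>; recall that \<open>ennreal\<close> maps negative numbers to 0.\<close>

definition signed_density :: "'b measure \<Rightarrow> ('b \<Rightarrow> real) \<Rightarrow> 'b signed_measure"
  where "signed_density \<sigma> w =
    (density \<sigma> (\<lambda>p. ennreal (w p)), density \<sigma> (\<lambda>p. ennreal (- w p)))"

text \<open>The values are only tested on Borel sets that are relatively compact in \<open>offdiag\<close>.\<close>

definition borel_family_offdiag :: "(real \<Rightarrow> ('a::topological_space \<times> 'a) signed_measure) \<Rightarrow> bool"
  where "borel_family_offdiag N \<longleftrightarrow> (\<forall>t\<in>{0..1}. signed_radon_offdiag (N t)) \<and>
    (\<forall>B K. B \<in> sets borel \<and> compact K \<and> B \<subseteq> K \<and> K \<subseteq> offdiag \<longrightarrow>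
      (\<lambda>t. signed_measure_value (N t) B) \<in> borel_measurable (restrict_space borel {0..1}))"


section \<open>Jump kernels\<close>

text \<open>The measure \<open>J(x,dy) \<mu>(dx)\<close> on \<open>offdiag\<close>.\<close>

definition jump_measure :: "'a::topological_space measure \<Rightarrow> ('a \<Rightarrow> 'a measure) \<Rightarrow> ('a \<times> 'a) measure"
  where "jump_measure \<mu> J = measure_of offdiag (sets offdiag_borel)
    (\<lambda>A. \<integral>\<^sup>+ x. emeasure (J x) {y. (x, y) \<in> A} \<partial>\<mu>)"

definition jump_measure_swap :: "'a::topological_space measure \<Rightarrow> ('a \<Rightarrow> 'a measure) \<Rightarrow> ('a \<times> 'a) measure"
  where "jump_measure_swap \<mu> J = distr (jump_measure \<mu> J) offdiag_borel prod.swap"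

definition reversible :: "'a::topological_space measure \<Rightarrow> ('a \<Rightarrow> 'a measure) \<Rightarrow> bool"
  where "reversible m J \<longleftrightarrow> jump_measure_swap m J = jump_measure m J"

text \<open>
  The value \<open>j 0\<close> is irrelevant in both definitions below, as \<open>lborel\<close> has no atoms.
\<close>

definition translation_kernel :: "('a::euclidean_space \<Rightarrow> real) \<Rightarrow> 'a \<Rightarrow> 'a measure"
  where "translation_kernel j x = density lborel (\<lambda>y. ennreal (j (y - x)))"

definition jump_law :: "('a::euclidean_space \<Rightarrow> real) \<Rightarrow> 'a measure"
  where "jump_law j = density lborel (\<lambda>y. ennreal (j y))"

definition levy_measure :: "'a::euclidean_space measure \<Rightarrow> bool"
  where "levy_measure \<nu> \<longleftrightarrow> sets \<nu> = sets borel \<and> emeasure \<nu> {0} = 0 \<and>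
    (\<integral>\<^sup>+ y. ennreal (min 1 ((norm y)\<^sup>2)) \<partial>\<nu>) < \<infinity>"


section \<open>Smooth functions\<close>

text \<open>
  Multi-indices of derivatives are encoded as lists of basis vectors. If every iterated partial
  derivative is totally differentiable, then all of them are continuous, so \<open>smooth\<close> is
  \<open>C\<^sup>\<infinity>\<close>, and the order of the list does not matter.
\<close>

primrec partial_deriv :: "'a::euclidean_space list \<Rightarrow> ('a \<Rightarrow> real) \<Rightarrow> 'a \<Rightarrow> real"
  where
    "partial_deriv [] f = f"
  | "partial_deriv (b # bs) f = (\<lambda>x. frechet_derivative (partial_deriv bs f) (at x) b)"

definition smooth :: "('a::euclidean_space \<Rightarrow> real) \<Rightarrow> bool"
  where "smooth f \<longleftrightarrow> (\<forall>bs\<in>lists Basis. partial_deriv bs f differentiable_on UNIV)"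

text \<open>Elements of \<open>C\<^sub>c\<^sup>\<infinity>((0,1) \<times> \<real>\<^sup>d)\<close>, extended by 0 to \<open>\<real> \<times> \<real>\<^sup>d\<close>.\<close>

definition test_function :: "(real \<times> 'a::euclidean_space \<Rightarrow> real) \<Rightarrow> bool"
  where "test_function \<phi> \<longleftrightarrow> smooth \<phi> \<and> compact (closure {z. \<phi> z \<noteq> 0}) \<and>
    closure {z. \<phi> z \<noteq> 0} \<subseteq> {0<..<1} \<times> UNIV"

definition monomial :: "('a::euclidean_space \<Rightarrow> nat) \<Rightarrow> 'a \<Rightarrow> real"
  where "monomial \<beta> x = (\<Prod>b\<in>Basis. (x \<bullet> b) ^ \<beta> b)"

definition rapidly_decreasing_loc_unif :: "(real \<Rightarrow> 'a::euclidean_space \<Rightarrow> real) \<Rightarrow> bool"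
  where "rapidly_decreasing_loc_unif f \<longleftrightarrow> (\<forall>t>0. smooth (f t)) \<and>
    (\<forall>K. compact K \<and> K \<subseteq> {0<..} \<longrightarrow> (\<forall>bs\<in>lists Basis. \<forall>\<beta>.
      uniform_limit K (\<lambda>x t. monomial \<beta> x * partial_deriv bs (f t) x) (\<lambda>t. 0) at_infinity))"


section \<open>The regularity assumption\<close>

text \<open>The term \<open>y \<bullet> \<nabla>f(x)\<close> is the Frechet derivative at \<open>x\<close> applied to \<open>y\<close>.\<close>

definition levy_generator :: "'a::euclidean_space measure \<Rightarrow> ('a \<Rightarrow> real) \<Rightarrow> 'a \<Rightarrow> real"
  where "levy_generator \<nu> f x =
    (LINT y|\<nu>. f (x + y) - f x - frechet_derivative f (at x) y * indicator (cball 0 1) y)"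

definition levy_exponent :: "'a::euclidean_space measure \<Rightarrow> 'a \<Rightarrow> complex"
  where "levy_exponent \<nu> \<xi> =
    (LINT y|\<nu>. iexp (y \<bullet> \<xi>) - 1 - \<i> * complex_of_real (y \<bullet> \<xi>) * indicator (cball 0 1) y)"

definition levy_process :: "'w measure \<Rightarrow> (real \<Rightarrow> 'w \<Rightarrow> 'a::euclidean_space) \<Rightarrow> bool"
  where "levy_process M X \<longleftrightarrow> prob_space M \<and>
    (\<forall>t\<ge>0. X t \<in> borel_measurable M) \<and>
    (AE \<omega> in M. X 0 \<omega> = 0) \<and>
    (\<forall>(n::nat) \<tau>. 0 \<le> \<tau> 0 \<and> mono \<tau> \<longrightarrow>
      prob_space.indep_vars M (\<lambda>_. borel) (\<lambda>i \<omega>. X (\<tau> (Suc i)) \<omega> - X (\<tau> i) \<omega>) {..<n}) \<and>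
    (\<forall>s t. 0 \<le> s \<and> s \<le> t \<longrightarrow>
      distr M borel (\<lambda>\<omega>. X t \<omega> - X s \<omega>) = distr M borel (X (t - s))) \<and>
    (AE \<omega> in M. (\<forall>t\<ge>0. continuous (at_right t) (\<lambda>s. X s \<omega>)) \<and>
      (\<forall>t>0. \<exists>l. ((\<lambda>s. X s \<omega>) \<longlongrightarrow> l) (at_left t)))"

definition regularity_assumption ::
    "'a::euclidean_space measure \<Rightarrow> 'w measure \<Rightarrow> (real \<Rightarrow> 'w \<Rightarrow> 'a) \<Rightarrow> bool"
  where "regularity_assumption \<nu> M X \<longleftrightarrow> levy_process M X \<and>
    (\<forall>t\<ge>0. \<forall>\<xi>. (LINT \<omega>|M. iexp (\<xi> \<bullet> X t \<omega>)) = exp (complex_of_real t * levy_exponent \<nu> \<xi>)) \<and>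
    (\<exists>p. (\<forall>t>0. distributed M lborel (X t) (\<lambda>x. ennreal (p t x)) \<and> (\<forall>x. 0 < p t x)) \<and>
      rapidly_decreasing_loc_unif p \<and>
      rapidly_decreasing_loc_unif (\<lambda>t. levy_generator \<nu> (p t)))"


section \<open>Logarithmic mean and Fisher information\<close>

definition log_mean :: "real \<Rightarrow> real \<Rightarrow> real"
  where "log_mean s t = (LINT a:{0..1}|lborel. s powr a * t powr (1 - a))"

text \<open>
  The set consists of at most one value when \<open>J\<close> is reversible with respect to \<open>m\<close>, and it is
  empty, with infimum \<open>\<infinity>\<close>, when \<open>\<mu>\<close> has no positive density.
\<close>

definition fisher_information ::
    "'a::topological_space measure \<Rightarrow> ('a \<Rightarrow> 'a measure) \<Rightarrow> 'a measure \<Rightarrow> ennreal"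
  where "fisher_information m J \<mu> =
    Inf {(\<integral>\<^sup>+ (x, y). ennreal ((\<rho> y - \<rho> x) * (ln (\<rho> y) - ln (\<rho> x))) \<partial>jump_measure m J) / 2 | \<rho>.
      \<rho> \<in> borel_measurable m \<and> (\<forall>x. 0 < \<rho> x) \<and> \<mu> = density m (\<lambda>x. ennreal (\<rho> x))}"


section \<open>The distance\<close>

definition action_density :: "real \<Rightarrow> real \<Rightarrow> real \<Rightarrow> ennreal"
  where "action_density w s t =
    (if log_mean s t \<noteq> 0 then ennreal (w\<^sup>2 / (2 * log_mean s t)) else if w = 0 then 0 else \<infinity>)"

text \<open>
  By 1-homogeneity of the action density the value does not depend on the reference measure
  \<open>\<sigma>\<close>, so the infimum is taken over a one-point set.
\<close>

definition action ::
    "('a::topological_space \<Rightarrow> 'a measure) \<Rightarrow> 'a measure \<Rightarrow> ('a \<times> 'a) signed_measure \<Rightarrow> ennreal"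
  where "action J \<mu> N =
    Inf {(\<integral>\<^sup>+ p. action_density (w p) (\<rho>\<^sub>1 p) (\<rho>\<^sub>2 p) \<partial>\<sigma>) | \<sigma> w \<rho>\<^sub>1 \<rho>\<^sub>2.
      radon_offdiag \<sigma> \<and>
      w \<in> borel_measurable \<sigma> \<and> \<rho>\<^sub>1 \<in> borel_measurable \<sigma> \<and> \<rho>\<^sub>2 \<in> borel_measurable \<sigma> \<and>
      (\<forall>p. 0 \<le> \<rho>\<^sub>1 p \<and> 0 \<le> \<rho>\<^sub>2 p) \<and>
      jump_measure \<mu> J = density \<sigma> (\<lambda>p. ennreal (\<rho>\<^sub>1 p)) \<and>
      jump_measure_swap \<mu> J = density \<sigma> (\<lambda>p. ennreal (\<rho>\<^sub>2 p)) \<and>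
      N = signed_density \<sigma> w}"

definition weakly_continuous_curve :: "(real \<Rightarrow> 'a::topological_space measure) \<Rightarrow> bool"
  where "weakly_continuous_curve \<mu> \<longleftrightarrow> (\<forall>t\<in>{0..1}. \<mu> t \<in> space (prob_algebra borel)) \<and>
    (\<forall>f :: 'a \<Rightarrow> real. continuous_on UNIV f \<and> bounded (range f) \<longrightarrow>
      continuous_on {0..1} (\<lambda>t. LINT x|\<mu> t. f x))"

definition CE :: "'a::euclidean_space measure \<Rightarrow> 'a measure \<Rightarrow>
    ((real \<Rightarrow> 'a measure) \<times> (real \<Rightarrow> ('a \<times> 'a) signed_measure)) set"
  where "CE \<mu>\<^sub>0 \<mu>\<^sub>1 = {(\<mu>, N).
    weakly_continuous_curve \<mu> \<and> \<mu> 0 = \<mu>\<^sub>0 \<and> \<mu> 1 = \<mu>\<^sub>1 \<and>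
    borel_family_offdiag N \<and>
    (\<integral>\<^sup>+ t\<in>{0..1}. total_variation_nn_integral (N t) (\<lambda>(x, y). ennreal (min 1 (dist x y))) \<partial>lborel) < \<infinity> \<and>
    (\<forall>\<phi>. test_function \<phi> \<longrightarrow>
      (LINT t:{0..1}|lborel. LINT x|\<mu> t. deriv (\<lambda>s. \<phi> (s, x)) t) +
      1 / 2 * (LINT t:{0..1}|lborel. signed_integral (N t) (\<lambda>(x, y). \<phi> (t, y) - \<phi> (t, x))) = 0)}"

definition W :: "('a::euclidean_space \<Rightarrow> 'a measure) \<Rightarrow> 'a measure \<Rightarrow> 'a measure \<Rightarrow> ennreal"
  where "W J \<mu>\<^sub>0 \<mu>\<^sub>1 =
    (let c = (INF (\<mu>, N)\<in>CE \<mu>\<^sub>0 \<mu>\<^sub>1. \<integral>\<^sup>+ t\<in>{0..1}. action J (\<mu> t) (N t) \<partial>lborel)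
     in if c = \<infinity> then \<infinity> else ennreal (sqrt (enn2real c)))"


section \<open>The variational problem over densities and potentials\<close>

definition action' :: "'a::topological_space measure \<Rightarrow> ('a \<Rightarrow> 'a measure) \<Rightarrow>
    ('a \<Rightarrow> real) \<Rightarrow> ('a \<Rightarrow> real) \<Rightarrow> ennreal"
  where "action' m J \<rho> \<psi> =
    (\<integral>\<^sup>+ (x, y). ennreal ((\<psi> y - \<psi> x)\<^sup>2 * log_mean (\<rho> x) (\<rho> y)) \<partial>jump_measure m J) / 2"

text \<open>
  The finiteness condition says that the flux integral exists; without it the Bochner integral
  could take the default value 0. It holds for all pairs of finite action.
\<close>

definition CE' :: "'a::euclidean_space measure \<Rightarrow> ('a \<Rightarrow> 'a measure) \<Rightarrow> ('a \<Rightarrow> real) \<Rightarrow> ('a \<Rightarrow> real) \<Rightarrow>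
    ((real \<Rightarrow> 'a \<Rightarrow> real) \<times> (real \<Rightarrow> 'a \<Rightarrow> real)) set"
  where "CE' m J \<rho>\<^sub>0 \<rho>\<^sub>1 = {(\<rho>, \<psi>).
    (\<lambda>(t, x). \<rho> t x) \<in> borel_measurable (restrict_space borel ({0..1} \<times> UNIV)) \<and>
    (\<forall>t\<in>{0..1}. (\<forall>x. 0 \<le> \<rho> t x) \<and> (\<integral>\<^sup>+ x. ennreal (\<rho> t x) \<partial>m) = 1) \<and>
    weakly_continuous_curve (\<lambda>t. density m (\<lambda>x. ennreal (\<rho> t x))) \<and>
    (\<lambda>(t, x). \<psi> t x) \<in> borel_measurable (restrict_space borel ({0..1} \<times> UNIV)) \<and>
    \<rho> 0 = \<rho>\<^sub>0 \<and> \<rho> 1 = \<rho>\<^sub>1 \<and>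
    (\<forall>\<phi>. test_function \<phi> \<longrightarrow>
      (\<integral>\<^sup>+ t\<in>{0..1}. (\<integral>\<^sup>+ (x, y). ennreal (\<bar>(\<phi> (t, y) - \<phi> (t, x)) * (\<psi> t y - \<psi> t x)\<bar> *
         log_mean (\<rho> t x) (\<rho> t y)) \<partial>jump_measure m J) \<partial>lborel) < \<infinity> \<and>
      (LINT t:{0..1}|lborel. LINT x|m. deriv (\<lambda>s. \<phi> (s, x)) t * \<rho> t x) +
      1 / 2 * (LINT t:{0..1}|lborel. LINT (x, y)|jump_measure m J.
        (\<phi> (t, y) - \<phi> (t, x)) * (\<psi> t y - \<psi> t x) * log_mean (\<rho> t x) (\<rho> t y)) = 0)}"

end

theory Submission
  imports Defs "HOL-Computational_Algebra.Polynomial" "HOL-Real_Asymp.Real_Asymp"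
begin

text \<open>
  A potential \<open>\<psi>\<close> induces the flux \<open>(\<psi> y - \<psi> x) log_mean (\<rho> x) (\<rho> y) Jm\<close>, whose action is the one of
  the pair \<open>(\<rho>, \<psi>)\<close>; this gives one inequality. For the other one, it suffices to find, for a curve of
  action \<open>c\<close> and \<open>\<delta> > 0\<close>, a curve \<open>\<rho>\<close> of positive densities with the same end points such that twice the
  negative pairing of \<open>\<rho>\<close> with the time derivative of a test function \<open>\<phi>\<close> is at most \<open>c + \<delta>\<close> plus the action
  of \<open>(\<rho>, \<phi>)\<close>: minimising the quadratic functional over the closure of the gradients of test functions
  then yields a potential of action at most \<open>c + \<delta>\<close>. Such dual bounds add up when pieces of curves are
  joined, so no flux has to be constructed for the pieces.

  The middle piece is the convolution of the given curve with a symmetric probability density \<open>k\<close>, run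
  at a slightly higher speed. Its dual bound follows by testing the given curve with all translates of \<open>\<phi>\<close>
  and bounding the logarithmic mean by its tangent planes at the values of the convolution. An end piece
  joins a density \<open>\<sigma>\<close> of finite Fisher information to its convolution with \<open>k\<close> by a quadratic
  interpolation. Since convolution moves mass along jumps, this costs a multiple of \<open>\<epsilon>\<^sup>2\<close> times the Fisher
  information if \<open>k \<le> \<epsilon> j\<close>. Such \<open>k\<close> exist for all \<open>\<epsilon>\<close> because \<open>j\<close> is not integrable: otherwise the
  characteristic function of \<open>X\<^sub>1\<close> would be bounded away from 0, contradicting the Riemann-Lebesgue lemma.
\<close>

subsection \<open>The logarithmic mean\<close>

text \<open>Minimisation only yields an L2 limit of gradients, which then has to be recognised as a
  gradient. If the weight \<open>log_mean\<close> times j vanished on a set of pairs, convergence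
  there would be lost; hence the insistence on curves and kernels that are positive everywhere. With
  full support, the potential is the limit of the test functions normalised at one base point, the
  same for almost all times.

  Convolution provides positivity and respects the translation invariant equation, but it spoils the
  end points. Here the Fisher information enters: with \<theta> the logarithmic mean, its integrand
  is (s - t)^2 / \<theta>(s, t). For an interpolation with weight g on the original density, the
  mean of the interpolated density is at least g \<theta>(s, t), so the cost is governed by g'^2 /
  g. This quotient is constant for g = t^2, whereas for g = t it is not integrable at 0.

  Test functions do not vanish at the joints of the pieces, so every partial bound carries boundary
  terms; these telescope, and they are zero at the times 0 and 1.\<close>

lemma powr_product_integrable:
  fixes s t :: real
  assumes "0 < s" "0 < t"
  shows "set_integrable lborel {0..1} (\<lambda>a. s powr a * t powr (1 - a))"
  using assms by (intro borel_integrable_atLeastAtMost' continuous_intros) auto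

text \<open>\<open>0 powr a = 0\<close> also for a = 0, so the integrand vanishes for every
  a.\<close>

lemma log_mean_zero [simp]:
  "log_mean 0 t = 0" "log_mean s 0 = 0"
  by (simp_all add: log_mean_def)

lemma log_mean_nonneg: "0 \<le> log_mean s t"
  unfolding log_mean_def set_lebesgue_integral_def
  by (intro integral_nonneg_AE) auto

lemma log_mean_measurable [measurable (raw)]:
  assumes [measurable]: "f \<in> borel_measurable M" "g \<in> borel_measurable M"
  shows "(\<lambda>x. log_mean (f x) (g x)) \<in> borel_measurable M"
proof -
  have [measurable]: "(\<lambda>(p, a). indicator {0..1} a *\<^sub>R (fst p powr a * snd p powr (1 - a)))
     \<in> borel_measurable ((borel \<Otimes>\<^sub>M borel) \<Otimes>\<^sub>M (lborel :: real measure))"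
    by measurable
  have "(\<lambda>p. log_mean (fst p) (snd p)) \<in> borel_measurable (borel \<Otimes>\<^sub>M borel)"
    unfolding log_mean_def set_lebesgue_integral_def
    by (rule lborel.borel_measurable_lebesgue_integral) measurable
  from measurable_compose[OF _ this, of "\<lambda>x. (f x, g x)" M] show ?thesis by simp
qed

text \<open>The partial derivative of \<open>log_mean\<close> in its first argument at (A, B),
  obtained by differentiating under the integral. By symmetry of the mean,
  \<open>log_mean_slope B A\<close> is the partial derivative in the second argument.\<close>

definition log_mean_slope :: "real \<Rightarrow> real \<Rightarrow> real"
  where "log_mean_slope A B = (LINT a:{0..1}|lborel. a * (A powr (a - 1) * B powr (1 - a)))"

lemma log_mean_slope_nonneg: "0 \<le> log_mean_slope A B"
  unfolding log_mean_slope_def set_lebesgue_integral_def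
  by (intro integral_nonneg_AE) (auto simp: indicator_def)

lemma log_mean_slope_measurable [measurable (raw)]:
  assumes [measurable]: "f \<in> borel_measurable M" "g \<in> borel_measurable M"
  shows "(\<lambda>x. log_mean_slope (f x) (g x)) \<in> borel_measurable M"
proof -
  have [measurable]: "(\<lambda>(p, a). indicator {0..1} a *\<^sub>R (a * (fst p powr (a - 1) * snd p powr (1 - a))))
     \<in> borel_measurable ((borel \<Otimes>\<^sub>M borel) \<Otimes>\<^sub>M (lborel :: real measure))"
    by measurable
  have "(\<lambda>p. log_mean_slope (fst p) (snd p)) \<in> borel_measurable (borel \<Otimes>\<^sub>M borel)"
    unfolding log_mean_slope_def set_lebesgue_integral_def
    by (rule lborel.borel_measurable_lebesgue_integral) measurable
  from measurable_compose[OF _ this, of "\<lambda>x. (f x, g x)" M] show ?thesis by simp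
qed

lemma log_mean_slope_integrable:
  fixes A B :: real
  assumes "0 < A" "0 < B"
  shows "set_integrable lborel {0..1} (\<lambda>a. a * (A powr (a - 1) * B powr (1 - a)))"
  using assms by (intro borel_integrable_atLeastAtMost' continuous_intros) auto

lemma log_mean_slope_swap_integrable:
  fixes A B :: real
  assumes "0 < A" "0 < B"
  shows "set_integrable lborel {0..1} (\<lambda>a. (1 - a) * (A powr a * B powr (- a)))"
  using assms by (intro borel_integrable_atLeastAtMost' continuous_intros) auto

lemma set_integral_reflect_01:
  fixes f :: "real \<Rightarrow> real"
  shows "(LINT a:{0..1}|lborel. f (1 - a)) = (LINT a:{0..1}|lborel. f a)"
proof -
  have "(LINT a:{0..1}|lborel. f a) = (LINT a|lborel. indicator {0..1} (1 + (-1) * a) * f (1 + (-1) * a))"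
    unfolding set_lebesgue_integral_def
    by (subst lborel_integral_real_affine[where c="-1" and t=1]) auto
  also have "\<dots> = (LINT a:{0..1}|lborel. f (1 - a))"
    unfolding set_lebesgue_integral_def
    by (intro Bochner_Integration.integral_cong) (auto simp: indicator_def)
  finally show ?thesis by simp
qed

text \<open>The substitution a -> 1 - a brings the second partial derivative to the same exponents
  as the first, so that both can be compared under one integral.\<close>

lemma log_mean_slope_swap:
  "log_mean_slope B A = (LINT a:{0..1}|lborel. (1 - a) * (A powr a * B powr (- a)))"
  unfolding log_mean_slope_def
  by (subst set_integral_reflect_01[symmetric]) (simp add: mult.commute)

text \<open>The tangent plane at \<open>(A, B)\<close> of the concave 1-homogeneous function \<^const>\<open>log_mean\<close>.\<close>

lemma log_mean_tangent_eq:
  assumes "0 < A" "0 < B"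
  shows "log_mean A B = log_mean_slope A B * A + log_mean_slope B A * B"
proof -
  \<comment> \<open>Euler's identity for a function homogeneous of degree one, under the integral:
    the weights a and 1 - a distribute the integrand over the two partial derivatives.\<close>
  have *: "A powr a * B powr (1 - a)
      = A * (a * (A powr (a - 1) * B powr (1 - a))) + B * ((1 - a) * (A powr a * B powr (- a)))" for a
  proof -
    have "A * A powr (a - 1) = A powr a" "B * B powr (- a) = B powr (1 - a)"
      using assms by (simp_all add: powr_mult_base)
    then have "A * (a * (A powr (a - 1) * B powr (1 - a))) = a * (A powr a * B powr (1 - a))"
      "B * ((1 - a) * (A powr a * B powr (- a))) = (1 - a) * (A powr a * B powr (1 - a))"
      by (metis mult.assoc mult.left_commute)+
    then show ?thesis
      by (metis (no_types) add.commute diff_add_cancel distrib_right mult_1)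
  qed
  show ?thesis
    unfolding log_mean_def log_mean_slope_swap[of B A] unfolding log_mean_slope_def
    apply (subst *)
    apply (subst set_integral_add)
    using log_mean_slope_integrable[OF assms] log_mean_slope_swap_integrable[OF assms]
    by (auto simp: mult.commute)
qed

text \<open>Concavity under the integral: the weighted arithmetic-geometric mean inequality for s /
  A and t / B, multiplied by A^a B^(1-a). On the boundary s = 0 or t = 0 the left-hand side is
  0.\<close>

lemma log_mean_tangent_le:
  assumes "0 < A" "0 < B" "0 \<le> s" "0 \<le> t"
  shows "log_mean s t \<le> log_mean_slope A B * s + log_mean_slope B A * t"
proof (cases "s = 0 \<or> t = 0")
  case True
  then show ?thesis
    using assms log_mean_slope_nonneg[of A B] log_mean_slope_nonneg[of B A] by auto
next
  case False
  then have st: "0 < s" "0 < t" using assms by auto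
  have *: "s powr a * t powr (1 - a)
      \<le> s * (a * (A powr (a - 1) * B powr (1 - a))) + t * ((1 - a) * (A powr a * B powr (- a)))"
    if "0 \<le> a" "a \<le> 1" for a
  proof -
    have "(s / A) powr a * (t / B) powr (1 - a) \<le> a * (s / A) + (1 - a) * (t / B)"
      using that st assms by (intro Youngs_inequality_0) auto
    then have "A powr a * B powr (1 - a) * ((s / A) powr a * (t / B) powr (1 - a))
      \<le> A powr a * B powr (1 - a) * (a * (s / A) + (1 - a) * (t / B))"
      by (intro mult_left_mono) auto
    also have "A powr a * B powr (1 - a) * ((s / A) powr a * (t / B) powr (1 - a)) = s powr a * t powr (1 - a)"
      using st assms by (simp add: powr_divide)
    also have "A powr a * B powr (1 - a) * (a * (s / A) + (1 - a) * (t / B)) =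
       s * (a * (A powr (a - 1) * B powr (1 - a))) + t * ((1 - a) * (A powr a * B powr (- a)))"
      using assms by (simp add: powr_diff powr_minus field_simps)
    finally show ?thesis .
  qed
  have "log_mean s t \<le> (LINT a:{0..1}|lborel. s * (a * (A powr (a - 1) * B powr (1 - a)))
      + t * ((1 - a) * (A powr a * B powr (- a))))"
    unfolding log_mean_def
    by (intro set_integral_mono powr_product_integrable st * set_integral_add
        set_integrable_mult_right log_mean_slope_integrable log_mean_slope_swap_integrable assms)
      auto
  also have "\<dots> = log_mean_slope A B * s + log_mean_slope B A * t"
    unfolding log_mean_slope_swap[of B A] unfolding log_mean_slope_def
    apply (subst set_integral_add)
    using log_mean_slope_integrable[OF assms(1,2)] log_mean_slope_swap_integrable[OF assms(1,2)]
    by (auto simp: mult.commute)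
  finally show ?thesis .
qed

text \<open>The tangent plane at (1, 1): the integrand of \<open>log_mean_slope 1 1\<close> is a, so
  both slopes are at most 1.\<close>

lemma log_mean_le_add:
  assumes "0 \<le> s" "0 \<le> t"
  shows "log_mean s t \<le> s + t"
proof -
  have *: "log_mean_slope 1 1 \<le> 1"
  proof -
    have "log_mean_slope 1 1 \<le> (LINT a:{0..1::real}|lborel. 1)"
      unfolding log_mean_slope_def using log_mean_slope_integrable[of 1 1]
      by (intro set_integral_mono) (auto simp: borel_integrable_atLeastAtMost')
    then show ?thesis by (simp add: set_lebesgue_integral_def)
  qed
  have "log_mean s t \<le> log_mean_slope 1 1 * s + log_mean_slope 1 1 * t"
    using assms by (intro log_mean_tangent_le) auto
  also have "\<dots> \<le> 1 * s + 1 * t"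
    using assms * by (intro add_mono mult_right_mono) auto
  finally show ?thesis by simp
qed

text \<open>The fundamental theorem of calculus for a -> s^a t^(1-a), which runs from t to s and has
  the integrand of the mean times ln s - ln t as derivative. It turns the integrand of the Fisher
  information into (s - t)^2 divided by the mean.\<close>

lemma log_mean_ln_diff:
  assumes "0 < s" "0 < t"
  shows "log_mean s t * (ln s - ln t) = s - t"
proof -
  have "(LINT a|lborel. (s powr a * t powr (1 - a) * (ln s - ln t)) * indicator {0..1} a)
     = s powr 1 * t powr (1 - 1) - s powr 0 * t powr (1 - 0)"
  proof (rule integral_FTC_Icc_real)
    fix x :: real
    show "((\<lambda>a. s powr a * t powr (1 - a)) has_real_derivative s powr x * t powr (1 - x) * (ln s - ln t)) (at x)"
      using assms by (auto intro!: derivative_eq_intros simp: algebra_simps)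
    show "isCont (\<lambda>x. s powr x * t powr (1 - x) * (ln s - ln t)) x"
      using assms by (intro continuous_intros) auto
  qed auto
  then have "(LINT a|lborel. indicator {0..1} a * (s powr a * t powr (1 - a)) * (ln s - ln t)) = s - t"
    using assms by (simp add: mult.commute mult.left_commute)
  then show ?thesis
    by (simp add: log_mean_def set_lebesgue_integral_def)
qed

lemma log_mean_diag:
  assumes "0 < s" shows "log_mean s s = s"
proof -
  have "log_mean s s = (LINT a:{0..1::real}|lborel. s)"
    unfolding log_mean_def using assms
    by (intro set_lebesgue_integral_cong) (simp_all flip: powr_add)
  then show ?thesis by (simp add: set_lebesgue_integral_def)
qed

lemma log_mean_pos:
  assumes "0 < s" "0 < t"
  shows "0 < log_mean s t"
proof (cases "s = t")
  case True
  then show ?thesis using assms by (simp add: log_mean_diag)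
next
  case False
  then have "log_mean s t \<noteq> 0"
    using log_mean_ln_diff[OF assms] by auto
  then show ?thesis using log_mean_nonneg[of s t] by simp
qed

lemma log_mean_scale:
  assumes "0 \<le> c" "0 \<le> s" "0 \<le> t"
  shows "log_mean (c * s) (c * t) = c * log_mean s t"
proof (cases "c = 0")
  case False
  have "log_mean (c * s) (c * t) = (LINT a:{0..1}|lborel. c * (s powr a * t powr (1 - a)))"
    unfolding log_mean_def
  proof (intro set_lebesgue_integral_cong ballI allI impI)
    fix a :: real
    have "(c * s) powr a * (c * t) powr (1 - a) = (c powr a * c powr (1 - a)) * (s powr a * t powr (1 - a))"
      using assms by (simp add: powr_mult)
    also have "c powr a * c powr (1 - a) = c"
      using assms False by (simp flip: powr_add)
    finally show "(c * s) powr a * (c * t) powr (1 - a) = c * (s powr a * t powr (1 - a))" .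
  qed auto
  then show ?thesis by (simp add: log_mean_def)
qed auto

lemma log_mean_mono:
  assumes "0 \<le> s" "0 \<le> t" "s \<le> s'" "t \<le> t'"
  shows "log_mean s t \<le> log_mean s' t'"
proof (cases "s = 0 \<or> t = 0")
  case True
  then show ?thesis by (auto simp: log_mean_nonneg)
next
  case False
  then have "0 < s" "0 < t" using assms by auto
  then show ?thesis
    unfolding log_mean_def using assms
    by (intro set_integral_mono powr_product_integrable mult_mono powr_mono2) auto
qed

subsection \<open>Smooth functions\<close>

text \<open>Smoothness by a coinductive argument: any class of differentiable functions closed under
  the partial derivatives consists of smooth functions. The closure properties below come from
  exhibiting a suitable class.\<close>

lemma smooth_class:
  assumes "f \<in> F"
    and "\<And>g. g \<in> F \<Longrightarrow> g differentiable_on UNIV"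
    and "\<And>g b. g \<in> F \<Longrightarrow> b \<in> Basis \<Longrightarrow> (\<lambda>x. frechet_derivative g (at x) b) \<in> F"
  shows "smooth f"
proof -
  have "partial_deriv bs f \<in> F" if "bs \<in> lists Basis" for bs
    using that by (induction bs) (use assms in auto)
  then show ?thesis
    unfolding smooth_def using assms(2) by blast
qed

lemma smooth_partial_deriv:
  assumes "smooth f" "b \<in> Basis"
  shows "smooth (\<lambda>x. frechet_derivative f (at x) b)"
proof -
  have "partial_deriv bs (\<lambda>x. frechet_derivative f (at x) b) = partial_deriv (bs @ [b]) f" for bs
    by (induction bs) auto
  then show ?thesis using assms unfolding smooth_def by auto
qed

lemma smooth_has_derivative:
  assumes "smooth f"
  shows "(f has_derivative frechet_derivative f (at x)) (at x within S)"
proof -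
  have "partial_deriv [] f differentiable_on UNIV"
    using assms unfolding smooth_def by blast
  then have "f differentiable (at x)"
    by (simp add: differentiable_on_def)
  then show ?thesis
    by (simp add: frechet_derivative_works has_derivative_at_withinI)
qed

lemma smooth_differentiable_on: "smooth f \<Longrightarrow> f differentiable_on UNIV"
  using smooth_has_derivative unfolding differentiable_on_def differentiable_def by blast

lemma smooth_continuous_on: "smooth f \<Longrightarrow> continuous_on S f"
  using smooth_differentiable_on differentiable_imp_continuous_on continuous_on_subset by blast

lemma smooth_measurable: "smooth f \<Longrightarrow> f \<in> borel_measurable borel"
  by (intro borel_measurable_continuous_onI smooth_continuous_on)

lemma frechet_derivative_eqI:
  "(f has_derivative f') (at x) \<Longrightarrow> frechet_derivative f (at x) = f'"
  using frechet_derivative_at by metis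

lemma smooth_lincomb:
  fixes f g :: "'a::euclidean_space \<Rightarrow> real"
  assumes "smooth f" "smooth g"
  shows "smooth (\<lambda>x. c * f x + d * g x)"
proof -
  define F :: "('a \<Rightarrow> real) set" where "F = {u. \<exists>f g. u = (\<lambda>x. c * f x + d * g x) \<and> smooth f \<and> smooth g}"
  have F: "(\<lambda>x. c * f x + d * g x) \<in> F" if "smooth f" "smooth g" for f g
    unfolding F_def using that by (intro CollectI exI[of _ f] exI[of _ g] conjI refl)
  show ?thesis
  proof (rule smooth_class[of _ F])
    show "(\<lambda>x. c * f x + d * g x) \<in> F" by (rule F[OF assms])
    fix u assume "u \<in> F"
    then obtain f g where u: "u = (\<lambda>x. c * f x + d * g x)" "smooth f" "smooth g"
      unfolding F_def by (elim CollectE exE conjE)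
    have D: "(u has_derivative
        (\<lambda>h. c * frechet_derivative f (at x) h + d * frechet_derivative g (at x) h)) (at x)" for x
      unfolding u(1) by (intro has_derivative_add has_derivative_mult_right smooth_has_derivative u)
    show "u differentiable_on UNIV"
      unfolding differentiable_on_def using differentiableI[OF D] by simp
    fix b :: 'a assume b: "b \<in> Basis"
    show "(\<lambda>x. frechet_derivative u (at x) b) \<in> F"
      unfolding frechet_derivative_eqI[OF D] by (intro F smooth_partial_deriv u b)
  qed
qed

lemma smooth_zero: "smooth (\<lambda>x. 0)"
  by (rule smooth_class[of _ "{\<lambda>x. 0}"]) (simp_all add: frechet_derivative_const)

text \<open>Products of two smooth functions are not closed under partial derivatives, but finite
  sums of such products are. This is the class for \<open>smooth_mult\<close>.\<close>

inductive product_sum :: "('a::euclidean_space \<Rightarrow> real) \<Rightarrow> bool" where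
  product_sum_mult: "smooth f \<Longrightarrow> smooth g \<Longrightarrow> product_sum (\<lambda>x. f x * g x)"
| product_sum_add: "product_sum f \<Longrightarrow> product_sum g \<Longrightarrow> product_sum (\<lambda>x. f x + g x)"

lemma product_sum_derivative:
  assumes "product_sum u"
  shows "\<exists>u'. (\<forall>x. (u has_derivative u' x) (at x)) \<and> (\<forall>b\<in>Basis. product_sum (\<lambda>x. u' x b))"
  using assms
proof induction
  case (product_sum_mult f g)
  show ?case
  proof (intro exI conjI allI ballI)
    fix x
    show "((\<lambda>x. f x * g x) has_derivative
      (\<lambda>h. f x * frechet_derivative g (at x) h + frechet_derivative f (at x) h * g x)) (at x)"
      using product_sum_mult by (intro has_derivative_mult smooth_has_derivative)
  next
    fix b :: 'a assume "b \<in> Basis"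
    then show "product_sum (\<lambda>x. f x * frechet_derivative g (at x) b + frechet_derivative f (at x) b * g x)"
      using product_sum_mult
      by (intro product_sum.product_sum_add product_sum.product_sum_mult smooth_partial_deriv)
  qed
next
  case (product_sum_add f g)
  then obtain f' g' where
    *: "\<And>x. (f has_derivative f' x) (at x)" "\<And>b. b\<in>Basis \<Longrightarrow> product_sum (\<lambda>x. f' x b)"
    "\<And>x. (g has_derivative g' x) (at x)" "\<And>b. b\<in>Basis \<Longrightarrow> product_sum (\<lambda>x. g' x b)" by blast
  show ?case
    by (intro exI[of _ "\<lambda>x h. f' x h + g' x h"] conjI allI ballI has_derivative_add
        product_sum.product_sum_add *)
qed

lemma smooth_mult:
  assumes "smooth f" "smooth g"
  shows "smooth (\<lambda>x. f x * g x)"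
proof (rule smooth_class[of _ "Collect product_sum"])
  show "(\<lambda>x. f x * g x) \<in> Collect product_sum"
    using assms by (intro CollectI product_sum.product_sum_mult)
  fix u :: "'a \<Rightarrow> real" assume "u \<in> Collect product_sum"
  then obtain u' where u': "\<And>x. (u has_derivative u' x) (at x)" "\<And>b. b\<in>Basis \<Longrightarrow> product_sum (\<lambda>x. u' x b)"
    using product_sum_derivative by blast
  then show "u differentiable_on UNIV"
    unfolding differentiable_on_def using differentiableI by blast
  fix b :: 'a assume "b \<in> Basis"
  then show "(\<lambda>x. frechet_derivative u (at x) b) \<in> Collect product_sum"
    unfolding frechet_derivative_eqI[OF u'(1)] using u'(2) by blast
qed

section \<open>Functions of time and space, and flat functions of time\<close>

lemma Basis_pair_cases:
  assumes "b \<in> (Basis :: (real \<times> 'a::euclidean_space) set)"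
  obtains "b = (1, 0)" | b' where "b' \<in> Basis" "b = (0, b')"
  using assms by (auto simp: Basis_prod_def)

lemma time_Basis: "(1, 0) \<in> (Basis :: (real \<times> 'a::euclidean_space) set)"
  by (auto simp: Basis_prod_def)

text \<open>The class has to carry a free factor c, because each time derivative brings out a factor
  h. Rescaled time and translated space are the two changes of variables by which a test function is
  transported to the given curve.\<close>

lemma smooth_time_affine:
  fixes \<Phi> :: "real \<times> 'a::euclidean_space \<Rightarrow> real"
  assumes "smooth \<Phi>"
  shows "smooth (\<lambda>p. c * \<Phi> (a + h * fst p, snd p + z))"
proof -
  define F :: "(real \<times> 'a \<Rightarrow> real) set"
    where "F = {\<lambda>p. c * \<Phi> (a + h * fst p, snd p + z) | c \<Phi>. smooth \<Phi>}"
  show ?thesis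
  proof (rule smooth_class[of _ F])
  show "(\<lambda>p. c * \<Phi> (a + h * fst p, snd p + z)) \<in> F"
    unfolding F_def by (intro CollectI exI[of _ c] exI[of _ \<Phi>] conjI refl assms)
  fix u assume "u \<in> F"
  then obtain c \<Phi> where u: "u = (\<lambda>p. c * \<Phi> (a + h * fst p, snd p + z))" "smooth \<Phi>" unfolding F_def by auto
  have D: "(u has_derivative
      (\<lambda>v. c * frechet_derivative \<Phi> (at (a + h * fst p, snd p + z)) (h * fst v, snd v))) (at p)" for p
    unfolding u(1)
  proof (rule has_derivative_mult_right, rule has_derivative_compose[OF _ smooth_has_derivative[OF u(2)]])
    show "((\<lambda>p. (a + h * fst p, snd p + z)) has_derivative (\<lambda>v. (h * fst v, snd v))) (at p)"
      by (auto intro!: derivative_eq_intros)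
  qed
  then show "u differentiable_on UNIV"
    unfolding differentiable_on_def using differentiableI by blast
  fix b :: "real \<times> 'a" assume b: "b \<in> Basis"
  have lin: "linear (frechet_derivative \<Phi> (at q))" for q
    using smooth_has_derivative[OF u(2), of q UNIV] has_derivative_linear by blast
  show "(\<lambda>x. frechet_derivative u (at x) b) \<in> F"
    using b
  proof (cases rule: Basis_pair_cases)
    case 1
    have "(h * fst b, snd b) = h *\<^sub>R (1, 0)" using 1 by auto
    then have "(\<lambda>x. frechet_derivative u (at x) b)
       = (\<lambda>p. (c * h) * frechet_derivative \<Phi> (at (a + h * fst p, snd p + z)) (1, 0))"
      unfolding frechet_derivative_eqI[OF D] by (simp only: linear_scale[OF lin]) (simp add: mult.assoc)
    then show ?thesis
      using smooth_partial_deriv[OF u(2) time_Basis]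
      unfolding F_def by (intro CollectI exI[of _ "c * h"] exI[of _ "\<lambda>q. frechet_derivative \<Phi> (at q) (1, 0)"] conjI)
  next
    case (2 b')
    then have "(\<lambda>x. frechet_derivative u (at x) b)
       = (\<lambda>p. c * frechet_derivative \<Phi> (at (a + h * fst p, snd p + z)) b)"
      unfolding frechet_derivative_eqI[OF D] by simp
    then show ?thesis
      using smooth_partial_deriv[OF u(2) b]
      unfolding F_def by (intro CollectI exI[of _ c] exI[of _ "\<lambda>q. frechet_derivative \<Phi> (at q) b"] conjI)
  qed
qed
qed

lemma smooth_fst:
  fixes g :: "real \<Rightarrow> real"
  assumes "smooth g"
  shows "smooth (\<lambda>p :: real \<times> 'a::euclidean_space. g (a + h * fst p))"
proof -
  define F :: "(real \<times> 'a \<Rightarrow> real) set"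
    where "F = {\<lambda>p. c * g (a + h * fst p) | c g. smooth g}"
  show ?thesis
  proof (rule smooth_class[of _ F])
  have "(\<lambda>p. 1 * g (a + h * fst p)) \<in> F"
    unfolding F_def by (intro CollectI exI[of _ 1] exI[of _ g] conjI refl assms)
  then show "(\<lambda>p. g (a + h * fst p)) \<in> F" by simp
  fix u assume "u \<in> F"
  then obtain c g where u: "u = (\<lambda>p. c * g (a + h * fst p))" "smooth g" unfolding F_def by auto
  have D: "(u has_derivative
      (\<lambda>v. c * frechet_derivative g (at (a + h * fst p)) (h * fst v))) (at p)" for p
    unfolding u(1)
  proof (rule has_derivative_mult_right, rule has_derivative_compose[OF _ smooth_has_derivative[OF u(2)]])
    show "((\<lambda>p. a + h * fst p) has_derivative (\<lambda>v. h * fst v)) (at p)"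
      by (auto intro!: derivative_eq_intros)
  qed
  then show "u differentiable_on UNIV"
    unfolding differentiable_on_def using differentiableI by blast
  fix b :: "real \<times> 'a" assume b: "b \<in> Basis"
  have lin: "linear (frechet_derivative g (at q))" for q
    using smooth_has_derivative[OF u(2), of q UNIV] has_derivative_linear by blast
  have *: "frechet_derivative g (at q) (h * fst b) = (h * fst b) * frechet_derivative g (at q) 1" for q
    using linear_scale[OF lin, of q "h * fst b" 1] by simp
  have "(\<lambda>x. frechet_derivative u (at x) b)
       = (\<lambda>p. (c * (h * fst b)) * frechet_derivative g (at (a + h * fst p)) 1)"
    unfolding frechet_derivative_eqI[OF D] * by (simp only: mult.assoc)
  moreover have "smooth (\<lambda>t. frechet_derivative g (at t) 1)"
    using smooth_partial_deriv[OF u(2), of 1] by simp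
  ultimately show "(\<lambda>x. frechet_derivative u (at x) b) \<in> F"
    unfolding F_def by (intro CollectI exI[of _ "c * (h * fst b)"] exI[of _ "\<lambda>t. frechet_derivative g (at t) 1"] conjI)
qed
qed

text \<open>\<open>exp_bump 1\<close> is the classical transition function exp (-1/x), flat at 0.
  The polynomial in 1/x is there to make the family closed under differentiation.\<close>

definition exp_bump :: "real poly \<Rightarrow> real \<Rightarrow> real"
  where "exp_bump P x = (if 0 < x then poly P (1 / x) * exp (- (1 / x)) else 0)"

lemma poly_mult_exp_tendsto_0: "((\<lambda>y. poly P y * exp (- y)) \<longlongrightarrow> (0::real)) at_top"
proof -
  have "((\<lambda>y. \<Sum>i\<le>degree P. coeff P i * (y ^ i / exp y)) \<longlongrightarrow> (\<Sum>i\<le>degree P. coeff P i * 0)) at_top"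
    by (intro tendsto_intros tendsto_power_div_exp_0)
  then show ?thesis
    by (simp add: poly_altdef exp_minus sum_distrib_right divide_inverse mult.assoc)
qed

text \<open>With u = 1/x, the derivative of P(u) exp(-u) is u^2 (P(u) - P'(u)) exp(-u), which
  explains the new polynomial. Only x = 0 needs a limit.\<close>

lemma exp_bump_has_derivative:
  "(exp_bump P has_real_derivative exp_bump (monom 1 2 * (P - pderiv P)) x) (at x)"
proof -
  consider "0 < x" | "x < 0" | "x = 0" by linarith
  then show ?thesis
  proof cases
    case 1
    have d: "((\<lambda>x. 1 / x) has_real_derivative - ((1 / x)\<^sup>2)) (at x)"
      using 1 by (auto intro!: derivative_eq_intros simp: power2_eq_square)
    have "((\<lambda>x. poly P (1 / x) * exp (- (1 / x))) has_real_derivative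
        poly (pderiv P) (1 / x) * (- ((1 / x)\<^sup>2)) * exp (- (1 / x))
        + exp (- (1 / x)) * (- (- ((1 / x)\<^sup>2))) * poly P (1 / x)) (at x)"
      by (rule DERIV_mult DERIV_chain2[OF poly_DERIV d] DERIV_chain2[OF DERIV_exp] DERIV_minus d)+
    also have "poly (pderiv P) (1 / x) * (- ((1 / x)\<^sup>2)) * exp (- (1 / x))
        + exp (- (1 / x)) * (- (- ((1 / x)\<^sup>2))) * poly P (1 / x) = exp_bump (monom 1 2 * (P - pderiv P)) x"
      using 1 by (simp add: exp_bump_def poly_monom left_diff_distrib right_diff_distrib mult_ac del: power_one_over)
    finally have "((\<lambda>x. poly P (1 / x) * exp (- (1 / x))) has_real_derivative
       exp_bump (monom 1 2 * (P - pderiv P)) x) (at x)" .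
    moreover have "\<forall>\<^sub>F y in nhds x. poly P (1 / y) * exp (- (1 / y)) = exp_bump P y"
      using eventually_nhds_in_open[of "{0<..}" x] 1
      by (auto elim!: eventually_mono simp: exp_bump_def)
    ultimately show ?thesis by (subst (asm) DERIV_cong_ev) auto
  next
    case 2
    have "((\<lambda>x. 0) has_real_derivative exp_bump (monom 1 2 * (P - pderiv P)) x) (at x)"
      using 2 by (simp add: exp_bump_def)
    moreover have "\<forall>\<^sub>F y in nhds x. 0 = exp_bump P y"
      using eventually_nhds_in_open[of "{..<0}" x] 2
      by (auto elim!: eventually_mono simp: exp_bump_def)
    ultimately show ?thesis by (subst (asm) DERIV_cong_ev) auto
  next
    case 3
    \<comment> \<open>\<open>pCons 0 P\<close> is the polynomial X P(X): dividing by x multiplies by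
      the argument 1/x, so the difference quotient at 0 from the right is again a polynomial against
      an exponential.\<close>
    have "((\<lambda>x. poly (pCons 0 P) (1 / x) * exp (- (1 / x))) \<longlongrightarrow> 0) (at_right 0)"
      by (rule filterlim_compose[OF poly_mult_exp_tendsto_0])
        (simp add: filterlim_inverse_at_top_right flip: inverse_eq_divide)
    then have R: "((\<lambda>x. exp_bump P x / x) \<longlongrightarrow> 0) (at_right 0)"
      by (rule Lim_transform_eventually)
        (auto simp: exp_bump_def eventually_at_right_less field_simps intro!: eventually_at_rightI[of 0 1])
    have L: "((\<lambda>x. exp_bump P x / x) \<longlongrightarrow> 0) (at_left 0)"
      by (rule Lim_transform_eventually[OF tendsto_const])
        (auto simp: exp_bump_def intro!: eventually_at_leftI[of "-1" 0])
    have "((\<lambda>x. exp_bump P x / x) \<longlongrightarrow> 0) (at 0)"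
      using L R by (simp add: filterlim_at_split)
    then show ?thesis using 3 by (simp add: has_field_derivative_iff exp_bump_def)
  qed
qed

lemma smooth_exp_bump: "smooth (exp_bump P)"
proof (rule smooth_class[of _ "range exp_bump"])
  show "exp_bump P \<in> range exp_bump" by (rule rangeI)
  fix u :: "real \<Rightarrow> real" assume "u \<in> range exp_bump"
  then obtain P where u: "u = exp_bump P" by (rule rangeE)
  have D: "(u has_derivative (\<lambda>h. exp_bump (monom 1 2 * (P - pderiv P)) x * h)) (at x)" for x
    unfolding u by (rule exp_bump_has_derivative[THEN has_field_derivative_imp_has_derivative])
  show "u differentiable_on UNIV"
    unfolding differentiable_on_def using differentiableI[OF D] by simp
  fix b :: real assume "b \<in> Basis"
  then have "(\<lambda>x. frechet_derivative u (at x) b) = exp_bump (monom 1 2 * (P - pderiv P))"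
    unfolding frechet_derivative_eqI[OF D] by simp
  then show "(\<lambda>x. frechet_derivative u (at x) b) \<in> range exp_bump"
    by (rule range_eqI)
qed

subsection \<open>Smooth functions of compact support\<close>

text \<open>Test functions without the restriction to times in (0, 1). On a piece of a curve a test
  function does not vanish at the ends of the time interval, and after a change of variables its
  support may lie anywhere in time.\<close>

definition smooth_compact :: "('a::euclidean_space \<Rightarrow> real) \<Rightarrow> bool"
  where "smooth_compact \<Phi> \<longleftrightarrow> smooth \<Phi> \<and> bounded {z. \<Phi> z \<noteq> 0}"

lemma smooth_compact_smooth: "smooth_compact \<Phi> \<Longrightarrow> smooth \<Phi>"
  by (simp add: smooth_compact_def)

lemma test_function_smooth_compact: "test_function \<Phi> \<Longrightarrow> smooth_compact \<Phi>"
  by (simp add: test_function_def smooth_compact_def compact_closure)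

lemma smooth_compact_bounded:
  assumes "smooth_compact \<Phi>"
  obtains B where "0 \<le> B" "\<And>z. \<bar>\<Phi> z\<bar> \<le> B"
proof -
  have "compact (closure {z. \<Phi> z \<noteq> 0})"
    using assms by (simp add: smooth_compact_def compact_closure)
  then have "bounded (\<Phi> ` closure {z. \<Phi> z \<noteq> 0})"
    using assms smooth_compact_smooth by (intro compact_imp_bounded compact_continuous_image smooth_continuous_on)
  then obtain B where B: "\<forall>z\<in>closure {z. \<Phi> z \<noteq> 0}. \<bar>\<Phi> z\<bar> \<le> B"
    by (auto simp: bounded_iff)
  have "\<bar>\<Phi> z\<bar> \<le> max B 0" for z
  proof (cases "\<Phi> z = 0")
    case False
    then have "z \<in> closure {z. \<Phi> z \<noteq> 0}" using closure_subset[of "{z. \<Phi> z \<noteq> 0}"] by blast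
    then show ?thesis using B by (auto simp: le_max_iff_disj)
  qed auto
  then show ?thesis by (intro that[of "max B 0"]) auto
qed

lemma smooth_compact_partial_deriv:
  assumes "smooth_compact \<Phi>" "b \<in> Basis"
  shows "smooth_compact (\<lambda>x. frechet_derivative \<Phi> (at x) b)"
proof -
  have "{z. frechet_derivative \<Phi> (at z) b \<noteq> 0} \<subseteq> closure {z. \<Phi> z \<noteq> 0}"
  proof (rule ccontr)
    assume "\<not> ?thesis"
    then obtain z where z: "frechet_derivative \<Phi> (at z) b \<noteq> 0" "z \<in> - closure {z. \<Phi> z \<noteq> 0}" by auto
    have "(\<Phi> has_derivative (\<lambda>h. 0)) (at z)"
    proof (rule has_derivative_transform_within_open[of "\<lambda>_. 0" _ _ UNIV "- closure {z. \<Phi> z \<noteq> 0}"])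
      show "0 = \<Phi> x" if "x \<in> - closure {z. \<Phi> z \<noteq> 0}" for x
        using that closure_subset[of "{z. \<Phi> z \<noteq> 0}"] by auto
    qed (use z in auto)
    from frechet_derivative_eqI[OF this] z(1) show False by simp
  qed
  moreover have "bounded (closure {z. \<Phi> z \<noteq> 0})"
    using assms by (simp add: smooth_compact_def bounded_closure)
  ultimately have "bounded {z. frechet_derivative \<Phi> (at z) b \<noteq> 0}" by (rule bounded_subset[rotated])
  then show ?thesis
    using assms smooth_partial_deriv[of \<Phi> b] by (simp add: smooth_compact_def)
qed

text \<open>Expanding a vector in the basis bounds the operator norm of the derivative by the sum of
  the suprema of the partial derivatives; then the mean value inequality applies.\<close>

lemma smooth_compact_Lipschitz:
  assumes "smooth_compact \<Phi>"
  obtains L where "0 \<le> L" "\<And>z w. \<bar>\<Phi> z - \<Phi> w\<bar> \<le> L * dist z w"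
proof -
  have "\<exists>B. 0 \<le> B \<and> (\<forall>z. \<bar>frechet_derivative \<Phi> (at z) b\<bar> \<le> B)" if "b \<in> Basis" for b
    using smooth_compact_bounded[OF smooth_compact_partial_deriv[OF assms that]] by metis
  then obtain B where B: "\<And>b. b \<in> Basis \<Longrightarrow> 0 \<le> B b"
    "\<And>b z. b \<in> Basis \<Longrightarrow> \<bar>frechet_derivative \<Phi> (at z) b\<bar> \<le> B b" by metis
  have D: "(\<Phi> has_derivative frechet_derivative \<Phi> (at z)) (at z)" for z
    using assms smooth_compact_smooth smooth_has_derivative by blast
  have on: "onorm (frechet_derivative \<Phi> (at z)) \<le> sum B Basis" for z
  proof (rule onorm_le)
    fix v :: 'a
    have "frechet_derivative \<Phi> (at z) v = frechet_derivative \<Phi> (at z) (\<Sum>b\<in>Basis. (v \<bullet> b) *\<^sub>R b)"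
      by (simp add: euclidean_representation)
    also have "\<dots> = (\<Sum>b\<in>Basis. (v \<bullet> b) * frechet_derivative \<Phi> (at z) b)"
      using has_derivative_linear[OF D] by (simp add: linear_sum linear_scale)
    also have "norm \<dots> \<le> (\<Sum>b\<in>Basis. norm v * B b)"
      by (intro sum_norm_le) (auto simp: abs_mult intro!: mult_mono B Basis_le_norm)
    finally show "norm (frechet_derivative \<Phi> (at z) v) \<le> sum B Basis * norm v"
      by (simp add: sum_distrib_left mult.commute)
  qed
  have "\<bar>\<Phi> z - \<Phi> w\<bar> \<le> sum B Basis * dist z w" for z w
    using differentiable_bound[of UNIV \<Phi> "\<lambda>z. frechet_derivative \<Phi> (at z)" "sum B Basis" z w] D on
    by (simp add: dist_norm)
  then show ?thesis using B by (intro that[of "sum B Basis"]) (auto intro!: sum_nonneg)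
qed

text \<open>The Lipschitz bound is used for short jumps and the supremum for long ones. The square
  of \<open>min 1 (norm (y - x))\<close> is what a Levy measure integrates.\<close>

lemma smooth_compact_jump_bound:
  fixes \<Phi> :: "real \<times> 'a::euclidean_space \<Rightarrow> real"
  assumes "smooth_compact \<Phi>"
  obtains L where "0 \<le> L" "\<And>t x y. \<bar>\<Phi> (t, y) - \<Phi> (t, x)\<bar> \<le> L * min 1 (norm (y - x))"
proof -
  obtain L where L: "0 \<le> L" "\<And>z w. \<bar>\<Phi> z - \<Phi> w\<bar> \<le> L * dist z w"
    using smooth_compact_Lipschitz[OF assms] by metis
  obtain B where B: "0 \<le> B" "\<And>z. \<bar>\<Phi> z\<bar> \<le> B"
    using smooth_compact_bounded[OF assms] by metis
  have "\<bar>\<Phi> (t, y) - \<Phi> (t, x)\<bar> \<le> (L + 2 * B) * min 1 (norm (y - x))" for t x y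
  proof (cases "norm (y - x) \<le> 1")
    case True
    have "\<bar>\<Phi> (t, y) - \<Phi> (t, x)\<bar> \<le> L * norm (y - x)"
      using L(2)[of "(t, y)" "(t, x)"] by (simp add: dist_Pair_Pair dist_norm)
    also have "\<dots> \<le> (L + 2 * B) * norm (y - x)" using B by (intro mult_right_mono) auto
    finally show ?thesis using True by simp
  next
    case False
    have "\<bar>\<Phi> (t, y) - \<Phi> (t, x)\<bar> \<le> 2 * B"
      using B(2)[of "(t, y)"] B(2)[of "(t, x)"] by linarith
    then show ?thesis using False L by simp
  qed
  then show ?thesis using that[of "L + 2 * B"] L B by auto
qed

text \<open>Written as a derivative along a basis vector of the product space, so that the closure
  properties of smooth functions apply to it; \<open>deriv_eq_time_deriv\<close> identifies it with
  the derivative in the continuity equations.\<close>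

definition time_deriv :: "(real \<times> 'a::euclidean_space \<Rightarrow> real) \<Rightarrow> real \<times> 'a \<Rightarrow> real"
  where "time_deriv \<Phi> p = frechet_derivative \<Phi> (at p) (1, 0)"

lemma smooth_compact_time_deriv: "smooth_compact \<Phi> \<Longrightarrow> smooth_compact (time_deriv \<Phi>)"
  using smooth_compact_partial_deriv[OF _ time_Basis] by (simp add: time_deriv_def[abs_def])

lemma smooth_time_deriv:
  assumes "smooth \<Phi>"
  shows "((\<lambda>s. \<Phi> (s, x)) has_real_derivative time_deriv \<Phi> (t, x)) (at t within S)"
proof -
  have "((\<lambda>s. \<Phi> (s, x)) has_derivative (\<lambda>h. frechet_derivative \<Phi> (at (t, x)) (h, 0))) (at t within S)"
    by (rule has_derivative_compose[OF _ smooth_has_derivative[OF assms]])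
      (auto intro!: derivative_eq_intros)
  moreover have "frechet_derivative \<Phi> (at (t, x)) (h, 0) = time_deriv \<Phi> (t, x) * h" for h
  proof -
    have "frechet_derivative \<Phi> (at (t, x)) (h *\<^sub>R (1, 0)) = h *\<^sub>R frechet_derivative \<Phi> (at (t, x)) (1, 0)"
      using has_derivative_linear[OF smooth_has_derivative[OF assms]] by (rule linear_scale)
    then show ?thesis by (simp add: time_deriv_def mult.commute)
  qed
  ultimately show ?thesis by (simp add: has_field_derivative_def)
qed

lemma deriv_eq_time_deriv: "smooth \<Phi> \<Longrightarrow> deriv (\<lambda>s. \<Phi> (s, x)) t = time_deriv \<Phi> (t, x)"
  using smooth_time_deriv by (rule DERIV_imp_deriv)

lemma smooth_compact_lincomb:
  assumes "smooth_compact f" "smooth_compact g"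
  shows "smooth_compact (\<lambda>x. c * f x + d * g x)"
proof -
  have "{z. c * f z + d * g z \<noteq> 0} \<subseteq> {z. f z \<noteq> 0} \<union> {z. g z \<noteq> 0}" by auto
  moreover have "bounded ({z. f z \<noteq> 0} \<union> {z. g z \<noteq> 0})"
    using assms by (simp add: smooth_compact_def)
  ultimately have "bounded {z. c * f z + d * g z \<noteq> 0}" by (rule bounded_subset[rotated])
  then show ?thesis using assms smooth_lincomb[of f g c d] by (simp add: smooth_compact_def)
qed

lemma test_function_lincomb:
  assumes "test_function f" "test_function g"
  shows "test_function (\<lambda>x. c * f x + d * g x)"
proof -
  have "closure {z. c * f z + d * g z \<noteq> 0} \<subseteq> closure ({z. f z \<noteq> 0} \<union> {z. g z \<noteq> 0})"
    by (intro closure_mono) auto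
  also have "\<dots> \<subseteq> {0<..<1} \<times> UNIV"
    using assms by (auto simp: test_function_def)
  finally show ?thesis
    using smooth_compact_lincomb[of f g c d] assms test_function_smooth_compact
    unfolding test_function_def by (simp add: smooth_compact_def compact_closure)
qed

lemma test_function_zero: "test_function (\<lambda>z. 0)"
  by (simp add: test_function_def smooth_zero)

lemma time_deriv_lincomb:
  assumes "smooth f" "smooth g"
  shows "time_deriv (\<lambda>x. c * f x + d * g x) p = c * time_deriv f p + d * time_deriv g p"
proof -
  have "((\<lambda>x. c * f x + d * g x) has_derivative
      (\<lambda>h. c * frechet_derivative f (at p) h + d * frechet_derivative g (at p) h)) (at p)"
    by (intro derivative_intros smooth_has_derivative assms)
  from frechet_derivative_eqI[OF this] show ?thesis by (simp add: time_deriv_def)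
qed

lemma smooth_compact_time_affine:
  fixes \<Phi> :: "real \<times> 'a::euclidean_space \<Rightarrow> real"
  assumes "smooth_compact \<Phi>" "h \<noteq> 0"
  shows "smooth_compact (\<lambda>p. c * \<Phi> (a + h * fst p, snd p + z))"
proof -
  have "{p. c * \<Phi> (a + h * fst p, snd p + z) \<noteq> 0}
     \<subseteq> (\<lambda>q. ((fst q - a) / h, snd q - z)) ` closure {p. \<Phi> p \<noteq> 0}"
  proof
    fix p assume "p \<in> {p. c * \<Phi> (a + h * fst p, snd p + z) \<noteq> 0}"
    then show "p \<in> (\<lambda>q. ((fst q - a) / h, snd q - z)) ` closure {p. \<Phi> p \<noteq> 0}"
      using assms(2) closure_subset[of "{p. \<Phi> p \<noteq> 0}"]
      by (intro image_eqI[of _ _ "(a + h * fst p, snd p + z)"]) (auto simp: field_simps)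
  qed
  moreover have "compact ((\<lambda>q. ((fst q - a) / h, snd q - z)) ` closure {p. \<Phi> p \<noteq> 0})"
    using assms by (intro compact_continuous_image continuous_intros)
      (auto simp: smooth_compact_def compact_closure)
  ultimately have "bounded {p. c * \<Phi> (a + h * fst p, snd p + z) \<noteq> 0}"
    using bounded_subset[OF compact_imp_bounded] by blast
  then show ?thesis
    using smooth_time_affine[of \<Phi> c a h z] assms by (simp add: smooth_compact_def)
qed

lemma time_deriv_time_affine:
  fixes \<Phi> :: "real \<times> 'a::euclidean_space \<Rightarrow> real"
  assumes "smooth \<Phi>"
  shows "time_deriv (\<lambda>p. c * \<Phi> (a + h * fst p, snd p + z)) (t, x)
    = c * h * time_deriv \<Phi> (a + h * t, x + z)"
proof -
  have "((\<lambda>s. c * \<Phi> (a + h * s, x + z)) has_real_derivative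
      c * (time_deriv \<Phi> (a + h * t, x + z) * h)) (at t)"
    by (auto intro!: derivative_eq_intros DERIV_chain2[OF smooth_time_deriv[OF assms]])
  moreover have "((\<lambda>s. c * \<Phi> (a + h * s, x + z)) has_real_derivative
      time_deriv (\<lambda>p. c * \<Phi> (a + h * fst p, snd p + z)) (t, x)) (at t)"
    using smooth_time_deriv[OF smooth_time_affine[OF assms, of c a h z], of x t UNIV] by simp
  ultimately show ?thesis using DERIV_unique by fastforce
qed

subsection \<open>Cutoff in time\<close>

text \<open>The first factor vanishes up to time 1/n, the second from time 1 - 1/n on, and the
  product tends to 1 on (0, 1). The arguments have the shape a + h t expected by
  \<open>smooth_fst\<close>.\<close>

abbreviation time_cutoff :: "nat \<Rightarrow> real \<Rightarrow> real"
  where "time_cutoff n t \<equiv> exp_bump 1 (- 1 + real n * t) * exp_bump 1 ((real n - 1) + (- real n) * t)"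

text \<open>The product rule, \<open>exp_bump (monom 1 2)\<close> being the derivative of
  \<open>exp_bump 1\<close>.\<close>

abbreviation time_cutoff_deriv :: "nat \<Rightarrow> real \<Rightarrow> real"
  where "time_cutoff_deriv n t \<equiv>
    real n * exp_bump (monom 1 2) (- 1 + real n * t) * exp_bump 1 ((real n - 1) + (- real n) * t)
    - real n * exp_bump 1 (- 1 + real n * t) * exp_bump (monom 1 2) ((real n - 1) + (- real n) * t)"

lemma exp_bump_1_deriv: "(exp_bump 1 has_real_derivative exp_bump (monom 1 2) x) (at x)"
  using exp_bump_has_derivative[of 1 x] by (simp add: pderiv_1)

lemma time_cutoff_has_derivative:
  "(time_cutoff n has_real_derivative time_cutoff_deriv n t) (at t)"
  by (auto intro!: derivative_eq_intros DERIV_chain2[OF exp_bump_1_deriv] simp: algebra_simps)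

lemma exp_bump_1_bounds: "0 \<le> exp_bump 1 x" "exp_bump 1 x \<le> 1"
  by (auto simp: exp_bump_def)

lemma exp_bump_1_tendsto: "(exp_bump 1 \<longlongrightarrow> 1) at_top"
proof (rule Lim_transform_eventually)
  show "((\<lambda>x::real. exp (- (1 / x))) \<longlongrightarrow> 1) at_top"
    by real_asymp
  show "\<forall>\<^sub>F x in at_top. exp (- (1 / x)) = exp_bump 1 x"
    using eventually_gt_at_top[of 0] by eventually_elim (simp add: exp_bump_def)
qed

lemma exp_bump_measurable [measurable]: "exp_bump P \<in> borel_measurable borel"
  by (rule smooth_measurable[OF smooth_exp_bump])

text \<open>The derivative of a function that increases from 0 to 1 is a probability density.
  Rescaled by n, it is an approximate identity at an end of the time interval.\<close>

lemma exp_bump_deriv_integral: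
  "has_bochner_integral lborel (exp_bump (monom 1 2)) 1"
proof (rule has_bochner_integral_nn_integral)
  have "(\<integral>\<^sup>+ x. ennreal (exp_bump (monom 1 2) x) \<partial>lborel)
      = (\<integral>\<^sup>+ x. ennreal (exp_bump (monom 1 2) x) * indicator {0..} x \<partial>lborel)"
    by (intro nn_integral_cong) (auto simp: exp_bump_def indicator_def)
  also have "\<dots> = ennreal (1 - exp_bump 1 0)"
    by (rule nn_integral_FTC_atLeast[OF exp_bump_measurable exp_bump_1_deriv _ exp_bump_1_tendsto])
      (auto simp: exp_bump_def poly_monom)
  finally show "(\<integral>\<^sup>+ x. ennreal (exp_bump (monom 1 2) x) \<partial>lborel) = ennreal 1"
    by (simp add: exp_bump_def)
  show "exp_bump (monom 1 2) \<in> borel_measurable lborel" by measurable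
qed (auto simp: exp_bump_def poly_monom)

lemma smooth_time_cutoff:
  fixes \<Psi> :: "real \<times> 'a::euclidean_space \<Rightarrow> real"
  assumes "smooth \<Psi>"
  shows "smooth (\<lambda>p. time_cutoff n (fst p) * \<Psi> p)"
  by (intro smooth_mult smooth_fst[OF smooth_exp_bump] assms)

lemma test_function_time_cutoff:
  fixes \<Psi> :: "real \<times> 'a::euclidean_space \<Rightarrow> real"
  assumes "smooth_compact \<Psi>"
  shows "test_function (\<lambda>p. time_cutoff n (fst p) * \<Psi> p)"
proof -
  have *: "1 / real n \<le> t \<and> t \<le> 1 - 1 / real n" if "time_cutoff n t \<noteq> 0" for t
  proof -
    have "0 < - 1 + real n * t" "0 < (real n - 1) + (- real n) * t"
      using that by (simp_all only: exp_bump_def mult_eq_0_iff split: if_splits) simp_all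
    moreover from this have "0 < real n" by linarith
    ultimately show ?thesis by (simp add: field_simps)
  qed
  have "{p. time_cutoff n (fst p) * \<Psi> p \<noteq> 0} \<subseteq> {1 / real n..1 - 1 / real n} \<times> UNIV"
  proof
    fix p assume "p \<in> {p. time_cutoff n (fst p) * \<Psi> p \<noteq> 0}"
    then have "time_cutoff n (fst p) \<noteq> 0" by auto
    from *[OF this] show "p \<in> {1 / real n..1 - 1 / real n} \<times> UNIV"
      by (simp add: mem_Times_iff)
  qed
  then have "closure {p. time_cutoff n (fst p) * \<Psi> p \<noteq> 0} \<subseteq> {1 / real n..1 - 1 / real n} \<times> UNIV"
    by (rule closure_minimal) (intro closed_Times closed_atLeastAtMost closed_UNIV)
  moreover have "{1 / real n..1 - 1 / real n} \<times> (UNIV::'a set) \<subseteq> {0<..<1} \<times> UNIV" if "0 < n"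
  proof -
    have "0 < 1 / real n" using that by simp
    have "{d..1 - d} \<subseteq> {0<..<1}" if "0 < d" for d :: real using that by auto
    then show ?thesis using \<open>0 < 1 / real n\<close> by (intro Sigma_mono) auto
  qed
  \<comment> \<open>For n = 0 the fraction 1 / n is 0 and the closed interval is all of [0, 1]; but
    then the cutoff is identically 0, its first factor being \<open>exp_bump 1 (-1)\<close>.\<close>
  moreover have "{p. time_cutoff n (fst p) * \<Psi> p \<noteq> 0} = {}" if "n = 0"
    using that by (auto simp: exp_bump_def)
  ultimately have "closure {p. time_cutoff n (fst p) * \<Psi> p \<noteq> 0} \<subseteq> {0<..<1} \<times> UNIV"
    by (cases "n = 0") (simp_all only: closure_empty, blast+)
  moreover have "bounded {p. time_cutoff n (fst p) * \<Psi> p \<noteq> 0}"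
    by (rule bounded_subset[of "{p. \<Psi> p \<noteq> 0}"]) (use assms in \<open>auto simp: smooth_compact_def\<close>)
  ultimately show ?thesis
    using smooth_time_cutoff[OF smooth_compact_smooth[OF assms], of n]
    unfolding test_function_def compact_closure by blast
qed

lemma time_deriv_time_cutoff:
  assumes "smooth \<Psi>"
  shows "time_deriv (\<lambda>p. time_cutoff n (fst p) * \<Psi> p) (t, x)
    = time_cutoff_deriv n t * \<Psi> (t, x) + time_cutoff n t * time_deriv \<Psi> (t, x)"
proof -
  from smooth_time_deriv[OF smooth_time_cutoff[OF assms], of n x t UNIV]
  have "((\<lambda>s. time_cutoff n s * \<Psi> (s, x)) has_real_derivative
      time_deriv (\<lambda>p. time_cutoff n (fst p) * \<Psi> p) (t, x)) (at t)" by simp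
  moreover have "((\<lambda>s. time_cutoff n s * \<Psi> (s, x)) has_real_derivative
     time_cutoff_deriv n t * \<Psi> (t, x) + time_cutoff n t * time_deriv \<Psi> (t, x)) (at t)"
    using DERIV_mult[OF time_cutoff_has_derivative smooth_time_deriv[OF assms]]
    by (simp only: add.commute mult.commute)
  ultimately show ?thesis by (rule DERIV_unique)
qed

text \<open>The substitution t = (1 + s) / n fixes the density and moves the dependence on n into
  U((1 + s) / n), which tends to U(0), and into the other factor of the cutoff, which tends to 1.
  The majorant is the density times B.\<close>

lemma exp_bump_concentration:
  fixes U :: "real \<Rightarrow> real"
  assumes U: "continuous_on UNIV U" "\<And>t. \<bar>U t\<bar> \<le> B"
  shows "(\<lambda>n. LINT t|lborel. real n * exp_bump (monom 1 2) (- 1 + real n * t) *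
      exp_bump 1 ((real n - 1) + (- real n) * t) * U t) \<longlonglongrightarrow> U 0"
proof -
  have [measurable]: "U \<in> borel_measurable borel"
    using U(1) by (rule borel_measurable_continuous_onI)
  let ?g = "\<lambda>n s. exp_bump (monom 1 2) s * exp_bump 1 (real n - 2 - s) * U ((1 + s) / real n)"
  have eq: "(LINT t|lborel. real n * exp_bump (monom 1 2) (- 1 + real n * t) *
      exp_bump 1 ((real n - 1) + (- real n) * t) * U t) = (LINT s|lborel. ?g n s)" if "0 < n" for n
  proof -
    have *: "- 1 + real n * (1 / real n + 1 / real n * x) = x"
      "(real n - 1) + (- real n) * (1 / real n + 1 / real n * x) = real n - 2 - x"
      "1 / real n + 1 / real n * x = (1 + x) / real n" for x
      using that by (simp_all add: field_simps)
    have "(LINT t|lborel. real n * exp_bump (monom 1 2) (- 1 + real n * t) *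
        exp_bump 1 ((real n - 1) + (- real n) * t) * U t)
      = \<bar>1 / real n\<bar> *\<^sub>R (LINT x|lborel. real n * exp_bump (monom 1 2) (- 1 + real n * (1 / real n + 1 / real n * x)) *
        exp_bump 1 ((real n - 1) + (- real n) * (1 / real n + 1 / real n * x)) * U (1 / real n + 1 / real n * x))"
      using that by (intro lborel_integral_real_affine) auto
    also have "\<dots> = \<bar>1 / real n\<bar> *\<^sub>R (LINT x|lborel. real n * ?g n x)"
      by (simp only: *(1,2) mult.assoc) (simp only: *(3))
    finally show ?thesis using that by simp
  qed
  have "(\<lambda>n. LINT s|lborel. ?g n s) \<longlonglongrightarrow> (LINT s|lborel. exp_bump (monom 1 2) s * 1 * U 0)"
  proof (rule integral_dominated_convergence[where w="\<lambda>s. exp_bump (monom 1 2) s * B"])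
    show "integrable lborel (\<lambda>s. exp_bump (monom 1 2) s * B)"
      using exp_bump_deriv_integral by (auto simp: has_bochner_integral_iff)
    show "AE s in lborel. norm (?g n s) \<le> exp_bump (monom 1 2) s * B" for n
    proof (rule AE_I2)
      fix s
      have "exp_bump 1 (real n - 2 - s) * \<bar>U ((1 + s) / real n)\<bar> \<le> 1 * B"
        using exp_bump_1_bounds U by (intro mult_mono) auto
      then have "exp_bump (monom 1 2) s * (exp_bump 1 (real n - 2 - s) * \<bar>U ((1 + s) / real n)\<bar>)
         \<le> exp_bump (monom 1 2) s * (1 * B)"
        by (intro mult_left_mono) (auto simp: exp_bump_def poly_monom)
      then show "norm (?g n s) \<le> exp_bump (monom 1 2) s * B"
        using exp_bump_1_bounds(1)[of "real n - 2 - s"]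
        by (auto simp: abs_mult exp_bump_def poly_monom)
    qed
    show "AE s in lborel. (\<lambda>n. ?g n s) \<longlonglongrightarrow> exp_bump (monom 1 2) s * 1 * U 0"
    proof (rule AE_I2)
      fix s
      have "(\<lambda>n. exp_bump 1 (real n - 2 - s)) \<longlonglongrightarrow> 1"
        by (rule filterlim_compose[OF exp_bump_1_tendsto]) real_asymp
      moreover have "(\<lambda>n. (1 + s) / real n) \<longlonglongrightarrow> 0" by real_asymp
      then have "(\<lambda>n. U ((1 + s) / real n)) \<longlonglongrightarrow> U 0"
        using U(1) by (auto intro: continuous_on_tendsto_compose[of UNIV U])
      ultimately show "(\<lambda>n. ?g n s) \<longlonglongrightarrow> exp_bump (monom 1 2) s * 1 * U 0"
        by (intro tendsto_intros)
    qed
  qed auto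
  also have "(LINT s|lborel. exp_bump (monom 1 2) s * 1 * U 0) = U 0"
    using exp_bump_deriv_integral by (auto simp: has_bochner_integral_iff)
  finally show ?thesis
    by (rule Lim_transform_eventually) (use eventually_gt_at_top[of 0] in eventually_elim, rule eq[symmetric])
qed

text \<open>The derivative of the cutoff converges to the difference of the point masses at 0 and 1.
  In this way a continuity equation known only for tests supported in (0, 1) yields boundary
  values.\<close>

lemma time_cutoff_limit:
  fixes u D :: "real \<Rightarrow> real"
  assumes u: "continuous_on {0..1} u" and D: "set_integrable lborel {0..1} D"
  shows "(\<lambda>n. LINT t:{0..1}|lborel. time_cutoff_deriv n t * u t + time_cutoff n t * D t)
    \<longlonglongrightarrow> u 0 - u 1 + (LINT t:{0..1}|lborel. D t)"
proof -
  \<comment> \<open>The extension of u by its boundary values is continuous on the whole line, where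
    the concentration lemma lives.\<close>
  define U where "U t = u (max 0 (min 1 t))" for t
  have cU: "continuous_on UNIV U"
    unfolding U_def by (rule continuous_on_compose2[OF u]) (auto intro!: continuous_intros)
  have [measurable]: "U \<in> borel_measurable borel"
    using cU by (rule borel_measurable_continuous_onI)
  have "bounded (u ` {0..1})"
    using u by (intro compact_imp_bounded compact_continuous_image) auto
  then obtain B where "\<forall>t\<in>{0..1}. \<bar>u t\<bar> \<le> B" by (auto simp: bounded_iff)
  then have B: "\<bar>U t\<bar> \<le> B" for t unfolding U_def by auto
  have cU': "continuous_on UNIV (\<lambda>t. U (1 - t))"
    by (rule continuous_on_compose2[OF cU]) (auto intro!: continuous_intros)
  let ?f = "\<lambda>n t. real n * exp_bump (monom 1 2) (- 1 + real n * t) * exp_bump 1 ((real n - 1) + (- real n) * t)"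
  have lim1: "(\<lambda>n. LINT t|lborel. ?f n t * U t) \<longlonglongrightarrow> U 0"
    by (rule exp_bump_concentration[OF cU B])
  have "(\<lambda>n. LINT t|lborel. ?f n t * U (1 - t)) \<longlonglongrightarrow> U (1 - 0)"
    by (rule exp_bump_concentration[OF cU' B])
  \<comment> \<open>The two terms of the derivative of the cutoff are mirror images of each other
    under t -> 1 - t, so the limit at time 1 follows from the one at time 0.\<close>
  moreover have "(LINT t|lborel. ?f n t * U (1 - t)) = (LINT t|lborel. ?f n (1 - t) * U t)" for n
    by (subst lborel_integral_real_affine[where c="-1" and t=1]) auto
  ultimately have lim2: "(\<lambda>n. LINT t|lborel. ?f n (1 - t) * U t) \<longlonglongrightarrow> U 1" by simp
  have [measurable]: "(\<lambda>t. indicator {0..1} t * D t) \<in> borel_measurable borel"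
    using D unfolding set_integrable_def by auto
  have lim3: "(\<lambda>n. LINT t|lborel. time_cutoff n t * (indicator {0..1} t * D t))
     \<longlonglongrightarrow> (LINT t|lborel. indicator {0..1} t * D t)"
  proof (rule integral_dominated_convergence[where w="\<lambda>t. \<bar>indicator {0..1} t * D t\<bar>"])
    show "integrable lborel (\<lambda>t. \<bar>indicator {0..1} t * D t\<bar>)"
      using D unfolding set_integrable_def by simp
    show "AE t in lborel. norm (time_cutoff n t * (indicator {0..1} t * D t)) \<le> \<bar>indicator {0..1} t * D t\<bar>" for n
    proof (rule AE_I2)
      fix t
      have "time_cutoff n t \<le> 1 * 1" using exp_bump_1_bounds by (intro mult_mono) auto
      then show "norm (time_cutoff n t * (indicator {0..1} t * D t)) \<le> \<bar>indicator {0..1} t * D t\<bar>"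
        using exp_bump_1_bounds by (auto simp: abs_mult intro!: mult_left_le_one_le)
    qed
    have "AE t in lborel. t \<noteq> 0 \<and> t \<noteq> (1::real)"
      by (auto intro!: AE_conjI AE_lborel_singleton)
    then show "AE t in lborel. (\<lambda>n. time_cutoff n t * (indicator {0..1} t * D t)) \<longlonglongrightarrow> indicator {0..1} t * D t"
    proof eventually_elim
      case (elim t)
      show ?case
      proof (cases "t \<in> {0..1}")
        case True
        then have t: "0 < t" "t < 1" using elim by auto
        have "(\<lambda>n. exp_bump 1 (- 1 + real n * t)) \<longlonglongrightarrow> 1"
          using t by (intro filterlim_compose[OF exp_bump_1_tendsto]) real_asymp
        moreover have "(\<lambda>n. exp_bump 1 ((real n - 1) + (- real n) * t)) \<longlonglongrightarrow> 1"
        proof (intro filterlim_compose[OF exp_bump_1_tendsto])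
          have "filterlim (\<lambda>n. real n * (1 - t) - 1) at_top sequentially"
            using t by real_asymp
          then show "filterlim (\<lambda>n. (real n - 1) + (- real n) * t) at_top sequentially"
            by (simp add: algebra_simps)
        qed
        ultimately show ?thesis by (auto intro!: tendsto_eq_intros)
      qed auto
    qed
  qed auto
  have int: "integrable lborel (\<lambda>t. ?f n t * V t)" if [measurable]: "V \<in> borel_measurable borel"
    and V: "\<And>t. \<bar>V t\<bar> \<le> B" for n V
  proof (rule Bochner_Integration.integrable_bound)
    have "integrable lborel (\<lambda>t. exp_bump (monom 1 2) (- 1 + real n * t))" if "n \<noteq> 0"
      using exp_bump_deriv_integral that
      by (subst lborel_integrable_real_affine_iff) (auto simp: has_bochner_integral_iff)
    then show "integrable lborel (\<lambda>t. real n * B * exp_bump (monom 1 2) (- 1 + real n * t))"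
      by (cases "n = 0") auto
    have "0 \<le> B" using B[of 0] by simp
    show "AE t in lborel. norm (?f n t * V t) \<le> norm (real n * B * exp_bump (monom 1 2) (- 1 + real n * t))"
    proof (rule AE_I2)
      fix t
      have "exp_bump 1 ((real n - 1) + (- real n) * t) * \<bar>V t\<bar> \<le> 1 * B"
        using exp_bump_1_bounds V by (intro mult_mono) auto
      then have "\<bar>real n * exp_bump (monom 1 2) (- 1 + real n * t)\<bar> *
         (exp_bump 1 ((real n - 1) + (- real n) * t) * \<bar>V t\<bar>)
         \<le> \<bar>real n * exp_bump (monom 1 2) (- 1 + real n * t)\<bar> * (1 * B)"
        by (rule mult_left_mono) auto
      then show "norm (?f n t * V t) \<le> norm (real n * B * exp_bump (monom 1 2) (- 1 + real n * t))"
        using exp_bump_1_bounds(1) \<open>0 \<le> B\<close> by (simp add: abs_mult mult_ac)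
    qed
  qed auto
  \<comment> \<open>Outside [0, 1] one of the two arguments of the cutoff is at most -1, where all
    functions \<open>exp_bump P\<close> vanish. So the integrals over [0, 1] and over the line
    agree, although u and D are given only on [0, 1].\<close>
  have f0: "?f n t = 0" "?f n (1 - t) = 0" "time_cutoff n t = 0" if "t \<notin> {0..1}" for n t
    using that
  proof -
    have "real n * t \<le> 0 \<or> real n * t \<ge> real n"
      using that by (auto simp: mult_le_cancel_left1 mult_nonneg_nonpos)
    then show "?f n t = 0" "?f n (1 - t) = 0" "time_cutoff n t = 0"
      by (auto simp: exp_bump_def algebra_simps)
  qed
  have int1: "integrable lborel (\<lambda>t. ?f n t * U t)" for n
    using int[of U n] B by simp
  have int2: "integrable lborel (\<lambda>t. ?f n (1 - t) * U t)" for n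
  proof -
    have "integrable lborel (\<lambda>t. ?f n t * U (1 - t))"
      using int[of "\<lambda>t. U (1 - t)" n] B by simp
    from lborel_integrable_real_affine[OF this, of "-1" 1] show ?thesis by simp
  qed
  have int3: "integrable lborel (\<lambda>t. time_cutoff n t * (indicator {0..1} t * D t))" for n
  proof (rule Bochner_Integration.integrable_bound[where f="\<lambda>t. indicator {0..1} t * D t"])
    show "integrable lborel (\<lambda>t. indicator {0..1} t * D t)"
      using D unfolding set_integrable_def by simp
    show "AE t in lborel. norm (time_cutoff n t * (indicator {0..1} t * D t)) \<le> norm (indicator {0..1} t * D t)"
    proof (rule AE_I2)
      fix t
      have "time_cutoff n t \<le> 1 * 1" using exp_bump_1_bounds by (intro mult_mono) auto
      then show "norm (time_cutoff n t * (indicator {0..1} t * D t)) \<le> norm (indicator {0..1} t * D t)"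
        using exp_bump_1_bounds by (auto simp: abs_mult intro!: mult_left_le_one_le)
    qed
  qed auto
  have "(LINT t:{0..1}|lborel. time_cutoff_deriv n t * u t + time_cutoff n t * D t)
     = (LINT t|lborel. ?f n t * U t - ?f n (1 - t) * U t + time_cutoff n t * (indicator {0..1} t * D t))" for n
    unfolding set_lebesgue_integral_def
  proof (rule Bochner_Integration.integral_cong)
    fix t :: real
    have *: "?f n (1 - t) = real n * exp_bump 1 (- 1 + real n * t) * exp_bump (monom 1 2) ((real n - 1) + (- real n) * t)"
      by (simp add: algebra_simps)
    show "indicator {0..1} t *\<^sub>R (time_cutoff_deriv n t * u t + time_cutoff n t * D t) =
       ?f n t * U t - ?f n (1 - t) * U t + time_cutoff n t * (indicator {0..1} t * D t)"
    proof (cases "t \<in> {0..1}")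
      case True
      then have "U t = u t" unfolding U_def by simp
      then show ?thesis unfolding * using True by (simp add: algebra_simps)
    next
      case False
      then have "?f n t * U t - ?f n (1 - t) * U t + time_cutoff n t * (indicator {0..1} t * D t) = 0"
        by (simp only: f0[OF False])
      then show ?thesis using False by simp
    qed
  qed simp
  also have "\<dots> n = (LINT t|lborel. ?f n t * U t) - (LINT t|lborel. ?f n (1 - t) * U t)
     + (LINT t|lborel. time_cutoff n t * (indicator {0..1} t * D t))" for n
    using int1 int2 int3 by simp
  finally have eq: "(LINT t:{0..1}|lborel. time_cutoff_deriv n t * u t + time_cutoff n t * D t)
     = (LINT t|lborel. ?f n t * U t) - (LINT t|lborel. ?f n (1 - t) * U t)
     + (LINT t|lborel. time_cutoff n t * (indicator {0..1} t * D t))" for n .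
  have "(\<lambda>n. (LINT t|lborel. ?f n t * U t) - (LINT t|lborel. ?f n (1 - t) * U t)
     + (LINT t|lborel. time_cutoff n t * (indicator {0..1} t * D t)))
     \<longlonglongrightarrow> U 0 - U 1 + (LINT t|lborel. indicator {0..1} t * D t)"
    by (intro tendsto_intros lim1 lim2 lim3)
  then show ?thesis unfolding eq by (simp add: U_def set_lebesgue_integral_def)
qed

subsection \<open>Riesz representation by minimisation\<close>

lemma weighted_AM_GM:
  fixes a b s :: real
  assumes "0 < s"
  shows "\<bar>a * b\<bar> \<le> s * a\<^sup>2 + b\<^sup>2 / s"
proof -
  define c where "c = \<bar>b\<bar> / s"
  have b: "\<bar>b\<bar> = s * c" using assms by (simp add: c_def)
  then have "b\<^sup>2 = (s * c)\<^sup>2" by (metis power2_abs)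
  then have b2: "b\<^sup>2 / s = s * c\<^sup>2" using assms by (simp add: power2_eq_square)
  have "0 \<le> s * (\<bar>a\<bar> - c)\<^sup>2" using assms by simp
  also have "\<dots> = s * \<bar>a\<bar>\<^sup>2 + s * c\<^sup>2 - 2 * (\<bar>a\<bar> * (s * c))"
    by (simp add: power2_eq_square algebra_simps)
  finally have *: "2 * (\<bar>a\<bar> * \<bar>b\<bar>) \<le> s * a\<^sup>2 + b\<^sup>2 / s" unfolding b b2 by simp
  have half: "p \<le> S" if "2 * p \<le> S" "0 \<le> p" for p S :: real using that by linarith
  show ?thesis unfolding abs_mult by (rule half[OF *]) simp
qed

text \<open>The polynomial is tested at s = - a / (b + 1), where the denominator cannot vanish even
  for b = 0.\<close>

lemma linear_term_zero:
  fixes a b :: real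
  assumes "\<And>s. 0 \<le> 2 * s * a + s\<^sup>2 * b" "0 \<le> b"
  shows "a = 0"
proof -
  define t where "t = a / (b + 1)"
  have a: "a = t * (b + 1)" using assms(2) by (simp add: t_def)
  have "0 \<le> 2 * (- t) * (t * (b + 1)) + (- t)\<^sup>2 * b" using assms(1)[of "- t"] a by simp
  also have "\<dots> = - (t\<^sup>2 * (b + 2))" by (simp add: power2_eq_square algebra_simps)
  finally have "t\<^sup>2 * (b + 2) \<le> 0" by simp
  then have "t = 0" using assms(2) by (auto simp: mult_le_0_iff)
  then show ?thesis using a by simp
qed

lemma integrable_mult_L2:
  fixes u w :: "'z \<Rightarrow> real"
  assumes [measurable]: "u \<in> borel_measurable M" "w \<in> borel_measurable M"
    and "integrable M (\<lambda>z. (u z)\<^sup>2)" "integrable M (\<lambda>z. (w z)\<^sup>2)"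
  shows "integrable M (\<lambda>z. u z * w z)"
proof (rule Bochner_Integration.integrable_bound)
  show "integrable M (\<lambda>z. (u z)\<^sup>2 + (w z)\<^sup>2)" using assms by simp
  have "\<bar>a * b\<bar> \<le> a\<^sup>2 + b\<^sup>2" for a b :: real
  proof -
    have "2 * (\<bar>a\<bar> * \<bar>b\<bar>) \<le> a\<^sup>2 + b\<^sup>2" "0 \<le> \<bar>a\<bar> * \<bar>b\<bar>"
      using sum_squares_bound[of "\<bar>a\<bar>" "\<bar>b\<bar>"] by (simp_all add: mult.assoc)
    then show ?thesis unfolding abs_mult by linarith
  qed
  then show "AE z in M. norm (u z * w z) \<le> norm ((u z)\<^sup>2 + (w z)\<^sup>2)"
    by (auto intro!: AE_I2)
qed simp

lemma integral_square_lincomb: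
  fixes u w :: "'z \<Rightarrow> real"
  assumes [measurable]: "u \<in> borel_measurable M" "w \<in> borel_measurable M"
    and "integrable M (\<lambda>z. (u z)\<^sup>2)" "integrable M (\<lambda>z. (w z)\<^sup>2)"
  shows "integrable M (\<lambda>z. (c * u z + d * w z)\<^sup>2)"
    and "(\<integral>z. (c * u z + d * w z)\<^sup>2 \<partial>M) = c\<^sup>2 * (\<integral>z. (u z)\<^sup>2 \<partial>M) + 2 * c * d * (\<integral>z. u z * w z \<partial>M)
      + d\<^sup>2 * (\<integral>z. (w z)\<^sup>2 \<partial>M)"
proof -
  have eq: "(\<lambda>z. (c * u z + d * w z)\<^sup>2) = (\<lambda>z. c\<^sup>2 * (u z)\<^sup>2 + 2 * c * d * (u z * w z) + d\<^sup>2 * (w z)\<^sup>2)"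
    by (simp add: power2_eq_square algebra_simps)
  note i = integrable_mult_L2[OF assms] assms(3,4)
  show "integrable M (\<lambda>z. (c * u z + d * w z)\<^sup>2)" unfolding eq using i by simp
  show "(\<integral>z. (c * u z + d * w z)\<^sup>2 \<partial>M) = c\<^sup>2 * (\<integral>z. (u z)\<^sup>2 \<partial>M) + 2 * c * d * (\<integral>z. u z * w z \<partial>M)
      + d\<^sup>2 * (\<integral>z. (w z)\<^sup>2 \<partial>M)"
    unfolding eq using i by simp
qed

text \<open>The direct method for F(f) = |D f|^2 - 2 l(f), which \<open>bound\<close> keeps above -
  C: the limit of D along a minimising sequence represents l. The last conclusion is stated for
  every measurable v to which the sequence converges almost everywhere, because the user of the
  lemma has to produce a v of a special form, namely a gradient.\<close>

lemma dual_minimizer: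
  fixes V :: "('b \<Rightarrow> real) set" and D :: "('b \<Rightarrow> real) \<Rightarrow> 'z \<Rightarrow> real" and l :: "('b \<Rightarrow> real) \<Rightarrow> real"
  assumes V0: "(\<lambda>x. 0) \<in> V"
    and V: "\<And>f g c d. f \<in> V \<Longrightarrow> g \<in> V \<Longrightarrow> (\<lambda>x. c * f x + d * g x) \<in> V"
    and Dm: "\<And>f. f \<in> V \<Longrightarrow> D f \<in> borel_measurable M"
    and Dsq: "\<And>f. f \<in> V \<Longrightarrow> integrable M (\<lambda>z. (D f z)\<^sup>2)"
    and Dl: "\<And>f g c d z. f \<in> V \<Longrightarrow> g \<in> V \<Longrightarrow> D (\<lambda>x. c * f x + d * g x) z = c * D f z + d * D g z"
    and ll: "\<And>f g c d. f \<in> V \<Longrightarrow> g \<in> V \<Longrightarrow> l (\<lambda>x. c * f x + d * g x) = c * l f + d * l g"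
    and bound: "\<And>f. f \<in> V \<Longrightarrow> 2 * l f \<le> C + (\<integral>z. (D f z)\<^sup>2 \<partial>M)"
  obtains \<phi> :: "nat \<Rightarrow> 'b \<Rightarrow> real"
  where "\<And>n. \<phi> n \<in> V" "AE z in M. convergent (\<lambda>n. D (\<phi> n) z)"
    "\<And>v. v \<in> borel_measurable M \<Longrightarrow> AE z in M. (\<lambda>n. D (\<phi> n) z) \<longlonglongrightarrow> v z \<Longrightarrow>
      (\<integral>\<^sup>+z. ennreal ((v z)\<^sup>2) \<partial>M) \<le> ennreal C \<and>
      (\<forall>f\<in>V. integrable M (\<lambda>z. v z * D f z) \<and> (\<integral>z. v z * D f z \<partial>M) = l f)"
proof -
  define B where "B f = (\<integral>z. (D f z)\<^sup>2 \<partial>M)" for f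
  define F where "F f = B f - 2 * l f" for f
  define I where "I = Inf (F ` V)"
  \<comment> \<open>With errors 8^(-n), the squared distances still form a convergent series after
    multiplication by 2^n. This gives convergence almost everywhere of the whole sequence, with no
    passage to a subsequence.\<close>
  define \<delta> where "\<delta> n = (1 / 8 :: real) ^ n" for n
  have \<delta>: "0 < \<delta> n" for n by (simp add: \<delta>_def)
  have half: "p \<le> S" if "2 * p \<le> S" "0 \<le> p" for p S :: real using that by linarith
  have bdd: "bdd_below (F ` V)"
  proof (rule bdd_belowI2)
    show "- C \<le> F f" if "f \<in> V" for f using bound[OF that] by (simp add: F_def B_def)
  qed
  have I_le: "I \<le> F f" if "f \<in> V" for f
    unfolding I_def using bdd that by (rule cINF_lower)
  have "\<exists>f\<in>V. F f < I + \<delta> n" for n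
  proof -
    have "Inf (F ` V) < I + \<delta> n" using \<delta>[of n] by (simp add: I_def)
    then show ?thesis using V0 by (subst (asm) cInf_less_iff) (use bdd in auto)
  qed
  then obtain \<phi> where \<phi>: "\<And>n. \<phi> n \<in> V" "\<And>n. F (\<phi> n) < I + \<delta> n" by metis
  note [measurable] = Dm[OF \<phi>(1)]
  have Blin: "B (\<lambda>x. c * f x + d * g x) = c\<^sup>2 * B f + 2 * c * d * (\<integral>z. D f z * D g z \<partial>M) + d\<^sup>2 * B g"
    if "f \<in> V" "g \<in> V" for f g c d
    unfolding B_def Dl[OF that]
    by (intro integral_square_lincomb Dm Dsq that)
  \<comment> \<open>The parallelogram law: the value of F at the midpoint is at least the infimum I,
    so the squared distance of two almost minimisers is at most 2 F(\<phi> m) + 2 F(\<phi> n) - 4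
    I.\<close>
  have Bdiff: "B (\<lambda>x. 1 * \<phi> m x + (-1) * \<phi> n x) \<le> 4 * \<delta> n" if "n \<le> m" for n m
  proof -
    have arith: "Z \<le> 2 * (a - 2 * c) + 2 * (b - 2 * d) - 4 * i"
      if "4 * i \<le> a + 2 * X + b - 4 * c - 4 * d" "Z = a - 2 * X + b" for a b c d i X Z :: real
      using that by (simp add: algebra_simps)
    have "\<delta> m \<le> \<delta> n" unfolding \<delta>_def using that by (intro power_decreasing) auto
    have "I \<le> F (\<lambda>x. 1/2 * \<phi> m x + 1/2 * \<phi> n x)" by (rule I_le[OF V[OF \<phi>(1) \<phi>(1)]])
    then have "4 * I \<le> B (\<phi> m) + 2 * (\<integral>z. D (\<phi> m) z * D (\<phi> n) z \<partial>M) + B (\<phi> n) - 4 * l (\<phi> m) - 4 * l (\<phi> n)"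
      unfolding F_def Blin[OF \<phi>(1) \<phi>(1)] ll[OF \<phi>(1) \<phi>(1)] by (simp add: power2_eq_square field_simps)
    moreover have "B (\<lambda>x. 1 * \<phi> m x + (-1) * \<phi> n x) = B (\<phi> m) - 2 * (\<integral>z. D (\<phi> m) z * D (\<phi> n) z \<partial>M) + B (\<phi> n)"
      unfolding Blin[OF \<phi>(1) \<phi>(1)] by simp
    ultimately have "B (\<lambda>x. 1 * \<phi> m x + (-1) * \<phi> n x) \<le> 2 * F (\<phi> m) + 2 * F (\<phi> n) - 4 * I"
      unfolding F_def by (rule arith)
    also have "\<dots> \<le> 4 * \<delta> n" using \<phi>(2)[of m] \<phi>(2)[of n] \<open>\<delta> m \<le> \<delta> n\<close> by linarith
    finally show ?thesis .
  qed
  have Dd: "D (\<lambda>x. 1 * \<phi> m x + (-1) * \<phi> n x) z = D (\<phi> m) z - D (\<phi> n) z" for m n z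
    unfolding Dl[OF \<phi>(1) \<phi>(1)] by simp
  have nnB: "(\<integral>\<^sup>+z. ennreal ((D f z)\<^sup>2) \<partial>M) = ennreal (B f)" if "f \<in> V" for f
    unfolding B_def by (intro nn_integral_eq_integral Dsq that) auto
  have nnd: "(\<integral>\<^sup>+z. ennreal ((D (\<phi> m) z - D (\<phi> n) z)\<^sup>2) \<partial>M) \<le> ennreal (4 * \<delta> n)" if "n \<le> m" for m n
  proof -
    have "(\<integral>\<^sup>+z. ennreal ((D (\<phi> m) z - D (\<phi> n) z)\<^sup>2) \<partial>M) = ennreal (B (\<lambda>x. 1 * \<phi> m x + (-1) * \<phi> n x))"
      using nnB[OF V[OF \<phi>(1) \<phi>(1), of 1 m "-1" n]] by (simp only: Dd)
    also have "\<dots> \<le> ennreal (4 * \<delta> n)" using Bdiff[OF that] by (rule ennreal_leI)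
    finally show ?thesis .
  qed
  have conv: "AE z in M. convergent (\<lambda>n. D (\<phi> n) z)"
  proof -
    let ?d = "\<lambda>n z. D (\<phi> (Suc n)) z - D (\<phi> n) z"
    have "(\<integral>\<^sup>+z. (\<Sum>n. ennreal (2 ^ n * (?d n z)\<^sup>2)) \<partial>M) = (\<Sum>n. \<integral>\<^sup>+z. ennreal (2 ^ n * (?d n z)\<^sup>2) \<partial>M)"
      by (rule nn_integral_suminf) measurable
    also have "\<dots> \<le> (\<Sum>n. ennreal (4 * (1 / 4) ^ n))"
    proof (intro suminf_le allI)
      fix n
      have "(\<integral>\<^sup>+z. ennreal (2 ^ n * (?d n z)\<^sup>2) \<partial>M) = ennreal (2 ^ n) * (\<integral>\<^sup>+z. ennreal ((?d n z)\<^sup>2) \<partial>M)"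
        by (subst nn_integral_cmult[symmetric]) (auto simp: ennreal_mult)
      also have "\<dots> \<le> ennreal (2 ^ n) * ennreal (4 * \<delta> n)" by (intro mult_left_mono nnd) auto
      also have "\<dots> = ennreal (4 * (1 / 4) ^ n)"
      proof -
        have "(1 / 4 :: real) ^ n = 2 ^ n * (1 / 8) ^ n"
          by (simp flip: power_mult_distrib)
        then show ?thesis by (simp add: \<delta>_def flip: ennreal_mult)
      qed
      finally show "(\<integral>\<^sup>+z. ennreal (2 ^ n * (?d n z)\<^sup>2) \<partial>M) \<le> ennreal (4 * (1 / 4) ^ n)" .
    qed auto
    also have "\<dots> < \<infinity>"
    proof -
      have "summable (\<lambda>n. 4 * (1 / 4 :: real) ^ n)" by (intro summable_mult summable_geometric) auto
      then show ?thesis by (subst suminf_ennreal2) auto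
    qed
    finally have "AE z in M. (\<Sum>n. ennreal (2 ^ n * (?d n z)\<^sup>2)) \<noteq> \<infinity>"
      by (intro nn_integral_noteq_infinite) auto
    then show ?thesis
    proof eventually_elim
      case (elim z)
      then have s1: "summable (\<lambda>n. 2 ^ n * (?d n z)\<^sup>2)"
        by (intro summable_suminf_not_top) auto
      have s2: "summable (\<lambda>n. (1 / 2 :: real) ^ n)" by (intro summable_geometric) auto
      \<comment> \<open>|d| \<le> 2^(-n) + 2^n d^2 turns the summability of the weighted squares
        into absolute summability of the increments.\<close>
      have "summable (\<lambda>n. ?d n z)"
      proof (rule summable_comparison_test)
        show "summable (\<lambda>n. (1 / 2) ^ n + 2 ^ n * (?d n z)\<^sup>2)" using s1 s2 by (rule summable_add[rotated])
        have "norm (?d n z) \<le> (1 / 2) ^ n + 2 ^ n * (?d n z)\<^sup>2" for n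
        proof -
          have "0 \<le> 2 ^ n * (\<bar>?d n z\<bar> - (1 / 2) ^ n)\<^sup>2" by simp
          also have "\<dots> = 2 ^ n * (?d n z)\<^sup>2 - 2 * \<bar>?d n z\<bar> + (1 / 2) ^ n"
            by (simp add: power2_eq_square field_simps)
          finally have "2 * \<bar>?d n z\<bar> \<le> (1 / 2) ^ n + 2 ^ n * (?d n z)\<^sup>2" by simp
          then show ?thesis unfolding real_norm_def by (rule half[OF _ abs_ge_zero])
        qed
        then show "\<exists>N. \<forall>n\<ge>N. norm (?d n z) \<le> (1 / 2) ^ n + 2 ^ n * (?d n z)\<^sup>2" by blast
      qed
      then have "convergent (\<lambda>n. \<Sum>i<n. ?d i z)" by (simp add: summable_iff_convergent)
      then have "convergent (\<lambda>n. D (\<phi> n) z - D (\<phi> 0) z)" 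
        by (subst (asm) sum_lessThan_telescope[of "\<lambda>i. D (\<phi> i) z"])
      then obtain L where "(\<lambda>n. D (\<phi> n) z - D (\<phi> 0) z) \<longlonglongrightarrow> L" by (auto simp: convergent_def)
      then have "(\<lambda>n. D (\<phi> n) z - D (\<phi> 0) z + D (\<phi> 0) z) \<longlonglongrightarrow> L + D (\<phi> 0) z" by (intro tendsto_intros)
      then show ?case by (auto simp: convergent_def)
    qed
  qed
  have lim: "(\<integral>\<^sup>+z. ennreal ((v z)\<^sup>2) \<partial>M) \<le> ennreal C \<and>
      (\<forall>f\<in>V. integrable M (\<lambda>z. v z * D f z) \<and> (\<integral>z. v z * D f z \<partial>M) = l f)"
    if [measurable]: "v \<in> borel_measurable M" and v: "AE z in M. (\<lambda>n. D (\<phi> n) z) \<longlonglongrightarrow> v z" for v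
  proof -
    \<comment> \<open>Fatou's lemma in m, with n fixed, transfers the Cauchy estimate to the limit
      v.\<close>
    have nv: "(\<integral>\<^sup>+z. ennreal ((v z - D (\<phi> n) z)\<^sup>2) \<partial>M) \<le> ennreal (4 * \<delta> n)" for n
    proof -
      have "(\<integral>\<^sup>+z. ennreal ((v z - D (\<phi> n) z)\<^sup>2) \<partial>M)
        = (\<integral>\<^sup>+z. liminf (\<lambda>m. ennreal ((D (\<phi> m) z - D (\<phi> n) z)\<^sup>2)) \<partial>M)"
      proof (rule nn_integral_cong_AE)
        show "AE z in M. ennreal ((v z - D (\<phi> n) z)\<^sup>2) = liminf (\<lambda>m. ennreal ((D (\<phi> m) z - D (\<phi> n) z)\<^sup>2))"
          using v
        proof eventually_elim
          case (elim z)
          then have "(\<lambda>m. ennreal ((D (\<phi> m) z - D (\<phi> n) z)\<^sup>2)) \<longlonglongrightarrow> ennreal ((v z - D (\<phi> n) z)\<^sup>2)"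
            by (intro tendsto_ennrealI tendsto_intros)
          then show ?case by (rule lim_imp_Liminf[OF trivial_limit_sequentially, symmetric])
        qed
      qed
      also have "\<dots> \<le> liminf (\<lambda>m. \<integral>\<^sup>+z. ennreal ((D (\<phi> m) z - D (\<phi> n) z)\<^sup>2) \<partial>M)"
        by (rule nn_integral_liminf) measurable
      also have "\<dots> \<le> liminf (\<lambda>m. ennreal (4 * \<delta> n))"
        by (rule Liminf_mono) (use nnd in \<open>auto simp: eventually_sequentially\<close>)
      finally show ?thesis by (simp add: Liminf_const)
    qed
    have iv: "integrable M (\<lambda>z. (v z - D (\<phi> n) z)\<^sup>2)" for n
      by (rule integrableI_nonneg) (auto intro!: le_less_trans[OF nv])
    have nv': "(\<integral>z. (v z - D (\<phi> n) z)\<^sup>2 \<partial>M) \<le> 4 * \<delta> n" for n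
    proof -
      have "ennreal (\<integral>z. (v z - D (\<phi> n) z)\<^sup>2 \<partial>M) \<le> ennreal (4 * \<delta> n)"
        using nv[of n] iv[of n] by (subst nn_integral_eq_integral[symmetric]) auto
      then show ?thesis using \<delta>[of n] by (simp add: ennreal_le_iff)
    qed
    have v2: "integrable M (\<lambda>z. (v z)\<^sup>2)"
    proof -
      have "integrable M (\<lambda>z. (1 * (v z - D (\<phi> 0) z) + 1 * D (\<phi> 0) z)\<^sup>2)"
        by (intro integral_square_lincomb(1) iv Dsq \<phi>) measurable
      then show ?thesis by simp
    qed
    have ivf: "integrable M (\<lambda>z. v z * D f z)" if "f \<in> V" for f
      by (intro integrable_mult_L2 that v2 Dsq Dm) simp
    \<comment> \<open>The arithmetic-geometric inequality with weight 2^n replaces Cauchy-Schwarz: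
      2^n times 4 8^(-n) and 2^(-n) times |D f|^2 both tend to 0.\<close>
    have conv_f: "(\<lambda>n. \<integral>z. D (\<phi> n) z * D f z \<partial>M) \<longlonglongrightarrow> (\<integral>z. v z * D f z \<partial>M)" if f: "f \<in> V" for f
    proof -
      note [measurable] = Dm[OF f]
      let ?w = "\<lambda>n z. v z - D (\<phi> n) z"
      have i: "integrable M (\<lambda>z. ?w n z * D f z)" for n
        by (intro integrable_mult_L2 f iv Dsq) auto
      have b: "\<bar>\<integral>z. ?w n z * D f z \<partial>M\<bar> \<le> 4 * (1 / 4) ^ n + (1 / 2) ^ n * B f" for n
      proof -
        have "\<bar>\<integral>z. ?w n z * D f z \<partial>M\<bar> \<le> (\<integral>z. 2 ^ n * (?w n z)\<^sup>2 + (1 / 2) ^ n * (D f z)\<^sup>2 \<partial>M)"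
        proof (rule integral_abs_bound[THEN order_trans], rule integral_mono)
          show "integrable M (\<lambda>z. \<bar>?w n z * D f z\<bar>)" using i by simp
          show "integrable M (\<lambda>z. 2 ^ n * (?w n z)\<^sup>2 + (1 / 2) ^ n * (D f z)\<^sup>2)" using iv Dsq[OF f] by simp
          fix z
          show "\<bar>?w n z * D f z\<bar> \<le> 2 ^ n * (?w n z)\<^sup>2 + (1 / 2) ^ n * (D f z)\<^sup>2"
            using weighted_AM_GM[of "2 ^ n" "?w n z" "D f z"] by (simp add: power_one_over)
        qed
        also have "\<dots> = 2 ^ n * (\<integral>z. (?w n z)\<^sup>2 \<partial>M) + (1 / 2) ^ n * B f"
          using iv Dsq[OF f] by (simp add: B_def)
        also have "\<dots> \<le> 2 ^ n * (4 * \<delta> n) + (1 / 2) ^ n * B f"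
          by (intro add_right_mono mult_left_mono nv') auto
        also have "2 ^ n * (4 * \<delta> n) = 4 * (1 / 4) ^ n"
        proof -
          have "(1 / 4 :: real) ^ n = 2 ^ n * (1 / 8) ^ n" by (simp flip: power_mult_distrib)
          then show ?thesis by (simp add: \<delta>_def)
        qed
        finally show ?thesis .
      qed
      have "(\<lambda>n. 4 * (1 / 4) ^ n + (1 / 2) ^ n * B f) \<longlonglongrightarrow> 4 * 0 + 0 * B f"
        by (intro tendsto_add tendsto_mult tendsto_const LIMSEQ_power_zero) auto
      then have lim0: "(\<lambda>n. 4 * (1 / 4) ^ n + (1 / 2) ^ n * B f) \<longlonglongrightarrow> 0" by simp
      have "\<forall>\<^sub>F n in sequentially. norm (\<integral>z. ?w n z * D f z \<partial>M) \<le> 4 * (1 / 4) ^ n + (1 / 2) ^ n * B f"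
        unfolding real_norm_def by (intro always_eventually allI b)
      then have "(\<lambda>n. \<integral>z. ?w n z * D f z \<partial>M) \<longlonglongrightarrow> 0"
        using lim0 by (rule Lim_null_comparison)
      then have "(\<lambda>n. (\<integral>z. v z * D f z \<partial>M) - (\<integral>z. ?w n z * D f z \<partial>M)) \<longlonglongrightarrow> (\<integral>z. v z * D f z \<partial>M) - 0"
        by (rule tendsto_diff[OF tendsto_const])
      moreover have "(\<integral>z. v z * D f z \<partial>M) - (\<integral>z. ?w n z * D f z \<partial>M) = (\<integral>z. D (\<phi> n) z * D f z \<partial>M)" for n
        unfolding Bochner_Integration.integral_diff[OF ivf[OF f] i, symmetric]
        by (simp add: algebra_simps)
      ultimately show ?thesis by simp
    qed
    have vl: "(\<integral>z. v z * D f z \<partial>M) = l f" if f: "f \<in> V" for f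
    proof -
      let ?a = "(\<integral>z. v z * D f z \<partial>M) - l f"
      \<comment> \<open>The first variation at an almost minimiser: moving \<phi> n by s f lowers F
        by at most the error, and letting n tend to infinity leaves a quadratic polynomial in s that
        is nonnegative everywhere.\<close>
      have quad: "0 \<le> 2 * s * ?a + s\<^sup>2 * B f" for s
      proof (rule LIMSEQ_le)
        show "(\<lambda>n. - \<delta> n) \<longlonglongrightarrow> 0"
          using tendsto_minus[OF LIMSEQ_power_zero[of "1 / 8 :: real"]] by (simp add: \<delta>_def)
        show "(\<lambda>n. 2 * s * ((\<integral>z. D (\<phi> n) z * D f z \<partial>M) - l f) + s\<^sup>2 * B f) \<longlonglongrightarrow> 2 * s * ?a + s\<^sup>2 * B f"
          by (intro tendsto_add tendsto_mult tendsto_diff tendsto_const conv_f f)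
        have "- \<delta> n \<le> 2 * s * ((\<integral>z. D (\<phi> n) z * D f z \<partial>M) - l f) + s\<^sup>2 * B f" for n
        proof -
          have "I \<le> F (\<lambda>x. 1 * \<phi> n x + s * f x)" by (rule I_le[OF V[OF \<phi>(1) f]])
          also have "\<dots> = B (\<phi> n) + 2 * s * (\<integral>z. D (\<phi> n) z * D f z \<partial>M) + s\<^sup>2 * B f - 2 * (l (\<phi> n) + s * l f)"
            unfolding F_def Blin[OF \<phi>(1) f] ll[OF \<phi>(1) f] by simp
          finally show ?thesis using \<phi>(2)[of n] unfolding F_def by (simp add: algebra_simps)
        qed
        then show "\<exists>N. \<forall>n\<ge>N. - \<delta> n \<le> 2 * s * ((\<integral>z. D (\<phi> n) z * D f z \<partial>M) - l f) + s\<^sup>2 * B f" by blast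
      qed
      have B0: "0 \<le> B f" by (simp add: B_def)
      have "?a = 0" using quad B0 by (rule linear_term_zero)
      then show ?thesis by simp
    qed
    \<comment> \<open>In |v - D (\<phi> n)|^2 the mixed term is l(\<phi> n), by the representation
      just proved. \<open>bound\<close> at \<phi> n itself then gives |v|^2 \<le> C up to the error;
      the value of the infimum does not enter.\<close>
    have "(\<integral>z. (v z)\<^sup>2 \<partial>M) \<le> C"
    proof (rule LIMSEQ_le_const)
      have "(\<lambda>n. C + 4 * \<delta> n) \<longlonglongrightarrow> C + 4 * 0"
        unfolding \<delta>_def by (intro tendsto_add tendsto_mult tendsto_const LIMSEQ_power_zero) auto
      then show "(\<lambda>n. C + 4 * \<delta> n) \<longlonglongrightarrow> C" by simp
      have "(\<integral>z. (v z)\<^sup>2 \<partial>M) \<le> C + 4 * \<delta> n" for n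
      proof -
        have "(\<integral>z. (1 * v z + (-1) * D (\<phi> n) z)\<^sup>2 \<partial>M)
          = 1\<^sup>2 * (\<integral>z. (v z)\<^sup>2 \<partial>M) + 2 * 1 * (-1) * (\<integral>z. v z * D (\<phi> n) z \<partial>M) + (-1)\<^sup>2 * (\<integral>z. (D (\<phi> n) z)\<^sup>2 \<partial>M)"
          by (rule integral_square_lincomb(2)) (auto intro: v2 Dsq \<phi>)
        moreover have "2 * l (\<phi> n) \<le> C + B (\<phi> n)" using bound[OF \<phi>(1)] by (simp add: B_def)
        ultimately show ?thesis using nv'[of n] by (simp add: vl[OF \<phi>(1)] B_def)
      qed
      then show "\<exists>N. \<forall>n\<ge>N. (\<integral>z. (v z)\<^sup>2 \<partial>M) \<le> C + 4 * \<delta> n" by blast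
    qed
    then have "(\<integral>\<^sup>+z. ennreal ((v z)\<^sup>2) \<partial>M) \<le> ennreal C"
      using v2 by (subst nn_integral_eq_integral) (auto intro: ennreal_leI)
    then show ?thesis using ivf vl by blast
  qed
  show thesis
  proof (rule that[of \<phi>])
    show "\<phi> n \<in> V" for n by (rule \<phi>(1))
    show "AE z in M. convergent (\<lambda>n. D (\<phi> n) z)" by (rule conv)
    show "(\<integral>\<^sup>+z. ennreal ((v z)\<^sup>2) \<partial>M) \<le> ennreal C \<and>
      (\<forall>f\<in>V. integrable M (\<lambda>z. v z * D f z) \<and> (\<integral>z. v z * D f z \<partial>M) = l f)"
      if "v \<in> borel_measurable M" "AE z in M. (\<lambda>n. D (\<phi> n) z) \<longlonglongrightarrow> v z" for v
      using that by (rule lim)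
  qed
qed

subsection \<open>Jump measures of translation kernels\<close>

lemma nn_integral_lborel_shift:
  fixes g :: "'a::euclidean_space \<Rightarrow> ennreal"
  assumes [measurable]: "g \<in> borel_measurable borel"
  shows "(\<integral>\<^sup>+y. g (c + y) \<partial>lborel) = (\<integral>\<^sup>+y. g y \<partial>lborel)"
proof -
  have "(\<integral>\<^sup>+y. g y \<partial>lborel) = (\<integral>\<^sup>+y. g y \<partial>distr lborel borel ((+) c))"
    by (simp add: lborel_distr_plus)
  also have "\<dots> = (\<integral>\<^sup>+y. g (c + y) \<partial>lborel)" by (rule nn_integral_distr) auto
  finally show ?thesis ..
qed

lemma nn_integral_lborel_shift_minus:
  fixes g :: "'a::euclidean_space \<Rightarrow> ennreal"
  assumes [measurable]: "g \<in> borel_measurable borel"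
  shows "(\<integral>\<^sup>+y. g (y - c) \<partial>lborel) = (\<integral>\<^sup>+y. g y \<partial>lborel)"
  using nn_integral_lborel_shift[of g "- c"] by (simp add: add.commute)

lemma open_offdiag: "open (offdiag :: ('a::t2_space \<times> 'a) set)"
proof -
  have eq: "offdiag = - {p :: 'a \<times> 'a. fst p = snd p}" by (auto simp: offdiag_def)
  show ?thesis unfolding eq by (intro open_Compl closed_Collect_eq continuous_intros)
qed

lemma offdiag_borel_measurable [measurable]: "(offdiag :: ('a::t2_space \<times> 'a) set) \<in> sets borel"
  by (rule borel_open[OF open_offdiag])

lemma sets_offdiag_borel_iff:
  "A \<in> sets offdiag_borel \<longleftrightarrow> A \<subseteq> offdiag \<and> A \<in> sets (borel :: ('a::t2_space \<times> 'a) measure)"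
  unfolding offdiag_borel_def by (subst sets_restrict_space_iff) auto

lemma space_offdiag_borel: "space offdiag_borel = offdiag"
  by (simp add: offdiag_borel_def space_restrict_space)

lemma sets_offdiag_borel_Pow: "sets (offdiag_borel :: ('a::t2_space \<times> 'a) measure) \<subseteq> Pow offdiag"
  by (auto simp: sets_offdiag_borel_iff)

lemma sigma_sets_offdiag_borel:
  "sigma_sets offdiag (sets (offdiag_borel :: ('a::t2_space \<times> 'a) measure)) = sets offdiag_borel"
  using sets.sigma_sets_eq[of "offdiag_borel :: ('a \<times> 'a) measure"] by (simp only: space_offdiag_borel)

text \<open>Permits replacing j by a version that is positive and symmetric at every point.\<close>

lemma translation_kernel_cong:
  fixes j j' :: "'a::euclidean_space \<Rightarrow> real"
  assumes [measurable]: "j \<in> borel_measurable borel" "j' \<in> borel_measurable borel"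
    and "AE z in lborel. j z = j' z"
  shows "translation_kernel j = translation_kernel j'"
proof
  fix x :: 'a
  have "AE y in lborel. j (y - x) = j' (y - x)"
  proof -
    have "AE y in distr lborel borel ((+) (- x)). j y = j' y"
      using assms(3) by (simp only: lborel_distr_plus)
    then show ?thesis by (subst (asm) AE_distr_iff) auto
  qed
  then show "translation_kernel j x = translation_kernel j' x"
    unfolding translation_kernel_def by (intro density_cong) auto
qed

lemma sets_pair_lborel:
  fixes \<mu> :: "'a::euclidean_space measure"
  assumes "sets \<mu> = sets borel"
  shows "sets (\<mu> \<Otimes>\<^sub>M lborel) = sets (borel :: ('a \<times> 'a) measure)"
proof -
  have "sets (\<mu> \<Otimes>\<^sub>M lborel) = sets ((borel :: 'a measure) \<Otimes>\<^sub>M (borel :: 'a measure))"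
    by (rule sets_pair_measure_cong[OF assms sets_lborel])
  also have "\<dots> = sets (borel :: ('a \<times> 'a) measure)" by (rule arg_cong[OF borel_prod])
  finally show ?thesis .
qed

locale jump_density =
  fixes j :: "'a::euclidean_space \<Rightarrow> real"
  assumes j_measurable [measurable]: "j \<in> borel_measurable borel"
begin

abbreviation K :: "'a \<Rightarrow> 'a measure" where "K \<equiv> translation_kernel j"

text \<open>\<open>measure_of\<close> returns the intended set function only if that function is
  countably additive. Identifying it with the restriction of a product measure with density settles
  this and makes Fubini available.\<close>

lemma jump_measure_eq:
  fixes \<mu> :: "'a measure"
  assumes \<mu> [measurable_cong]: "sets \<mu> = sets borel"
  shows "jump_measure \<mu> K
    = restrict_space (density (\<mu> \<Otimes>\<^sub>M lborel) (\<lambda>(x, y). ennreal (j (y - x)))) offdiag"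
    (is "_ = restrict_space ?M offdiag")
proof -
  have sb: "sets (\<mu> \<Otimes>\<^sub>M lborel) = sets (borel :: ('a \<times> 'a) measure)"
    using sets_pair_lborel[OF \<mu>] .
  have sets: "sets (restrict_space ?M offdiag) = sets offdiag_borel"
    unfolding offdiag_borel_def by (intro sets_restrict_space_cong) (simp only: sets_density sb)
  have space: "space (restrict_space ?M offdiag) = offdiag"
    using sets_eq_imp_space_eq[OF sets] by (simp add: space_offdiag_borel)
  have "restrict_space ?M offdiag = measure_of offdiag (sets offdiag_borel) (emeasure (restrict_space ?M offdiag))"
    using measure_of_of_measure[of "restrict_space ?M offdiag"] by (simp add: sets space)
  also have "\<dots> = jump_measure \<mu> K"
    unfolding jump_measure_def
  proof (rule measure_of_eq)
    show "sets offdiag_borel \<subseteq> Pow (offdiag :: ('a \<times> 'a) set)"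
      by (rule sets_offdiag_borel_Pow)
    fix A :: "('a \<times> 'a) set" assume "A \<in> sigma_sets offdiag (sets offdiag_borel)"
    then have "A \<in> sets offdiag_borel"
      by (simp only: sigma_sets_offdiag_borel)
    then have A: "A \<subseteq> offdiag" and [measurable]: "A \<in> sets borel"
      by (auto simp: sets_offdiag_borel_iff)
    have [measurable]: "A \<in> sets (borel \<Otimes>\<^sub>M borel)"
      using \<open>A \<in> sets borel\<close> arg_cong[OF borel_prod, of sets] by blast
    have "emeasure (restrict_space ?M offdiag) A = emeasure ?M A"
    proof (rule emeasure_restrict_space)
      have "offdiag \<in> sets ?M" unfolding sets_density sb by (rule offdiag_borel_measurable)
      then show "offdiag \<inter> space ?M \<in> sets ?M" by (rule sets.Int[OF _ sets.top])
    qed (rule A)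
    also have "\<dots> = (\<integral>\<^sup>+p. ennreal (j (snd p - fst p)) * indicator A p \<partial>(\<mu> \<Otimes>\<^sub>M lborel))"
      by (subst emeasure_density) (auto simp: sb case_prod_beta)
    also have "\<dots> = (\<integral>\<^sup>+x. \<integral>\<^sup>+y. ennreal (j (y - x)) * indicator A (x, y) \<partial>lborel \<partial>\<mu>)"
      by (subst lborel.nn_integral_fst[symmetric]) auto
    also have "\<dots> = (\<integral>\<^sup>+x. emeasure (K x) {y. (x, y) \<in> A} \<partial>\<mu>)"
    proof (rule nn_integral_cong)
      fix x assume "x \<in> space \<mu>"
      have [measurable]: "{y. (x, y) \<in> A} \<in> sets borel"
        using measurable_sets[of "Pair x" borel "borel \<Otimes>\<^sub>M borel" A] by (simp add: vimage_def)
      show "(\<integral>\<^sup>+y. ennreal (j (y - x)) * indicator A (x, y) \<partial>lborel) = emeasure (K x) {y. (x, y) \<in> A}"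
        unfolding translation_kernel_def
        by (subst emeasure_density) (auto intro!: nn_integral_cong simp: indicator_def)
    qed
    finally show "emeasure (restrict_space ?M offdiag) A = (\<integral>\<^sup>+x. emeasure (K x) {y. (x, y) \<in> A} \<partial>\<mu>)" .
  qed
  finally show ?thesis ..
qed

lemma sets_jump_measure: "sets (jump_measure \<mu> K) = sets offdiag_borel"
  unfolding jump_measure_def
  by (subst sets_measure_of[OF sets_offdiag_borel_Pow]) (rule sigma_sets_offdiag_borel)

lemma space_jump_measure: "space (jump_measure \<mu> K) = offdiag"
  using sets_eq_imp_space_eq[OF sets_jump_measure] by (simp add: space_offdiag_borel)

lemma measurable_jump_measure:
  assumes "f \<in> borel_measurable borel"
  shows "f \<in> borel_measurable (jump_measure \<mu> K)"
  using measurable_restrict_space1[OF assms, of offdiag]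
  by (simp add: offdiag_borel_def[symmetric] cong: measurable_cong_sets[OF sets_jump_measure refl])

lemma measurable_offdiag_borel:
  fixes M :: "('a \<times> 'a) measure"
  assumes "sets M = sets offdiag_borel" "f \<in> borel_measurable borel"
  shows "f \<in> borel_measurable M"
  using measurable_restrict_space1[OF assms(2), of offdiag]
  by (simp add: offdiag_borel_def[symmetric] cong: measurable_cong_sets[OF assms(1) refl])

lemma nn_integral_jump_measure:
  fixes f :: "'a \<times> 'a \<Rightarrow> ennreal"
  assumes \<mu> [measurable_cong]: "sets \<mu> = sets borel" and f: "f \<in> borel_measurable borel"
  shows "(\<integral>\<^sup>+p. f p \<partial>jump_measure \<mu> K) = (\<integral>\<^sup>+x. \<integral>\<^sup>+y. f (x, y) * ennreal (j (y - x)) \<partial>lborel \<partial>\<mu>)"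
proof -
  have sb: "sets (\<mu> \<Otimes>\<^sub>M lborel) = sets (borel :: ('a \<times> 'a) measure)"
    using sets_pair_lborel[OF \<mu>] .
  have [measurable]: "f \<in> borel_measurable (borel \<Otimes>\<^sub>M borel)" using f by (simp add: borel_prod)
  have [measurable]: "(offdiag :: ('a \<times> 'a) set) \<in> sets (borel \<Otimes>\<^sub>M borel)"
    using offdiag_borel_measurable arg_cong[OF borel_prod, of sets] by blast
  have "(\<integral>\<^sup>+p. f p \<partial>jump_measure \<mu> K)
    = (\<integral>\<^sup>+p. ennreal (j (snd p - fst p)) * (f p * indicator offdiag p) \<partial>(\<mu> \<Otimes>\<^sub>M lborel))"
    unfolding jump_measure_eq[OF \<mu>]
    by (subst nn_integral_restrict_space, simp add: sb, subst nn_integral_density) (auto simp: case_prod_beta)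
  also have "\<dots> = (\<integral>\<^sup>+x. \<integral>\<^sup>+y. ennreal (j (y - x)) * (f (x, y) * indicator offdiag (x, y)) \<partial>lborel \<partial>\<mu>)"
    by (subst lborel.nn_integral_fst[symmetric]) auto
  also have "\<dots> = (\<integral>\<^sup>+x. \<integral>\<^sup>+y. f (x, y) * ennreal (j (y - x)) \<partial>lborel \<partial>\<mu>)"
  proof (rule nn_integral_cong, rule nn_integral_cong_AE)
    fix x
    show "AE y in lborel. ennreal (j (y - x)) * (f (x, y) * indicator offdiag (x, y)) = f (x, y) * ennreal (j (y - x))"
      using AE_lborel_singleton[of x] by eventually_elim (auto simp: offdiag_def mult.commute)
  qed
  finally show ?thesis .
qed

lemma measurable_swap_offdiag:
  fixes M :: "('a \<times> 'a) measure"
  assumes "sets M = sets offdiag_borel"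
  shows "prod.swap \<in> measurable M offdiag_borel"
proof -
  have "prod.swap \<in> measurable (borel :: ('a \<times> 'a) measure) borel"
    by (intro borel_measurable_continuous_onI continuous_on_swap)
  then have "prod.swap \<in> measurable (restrict_space borel offdiag) (restrict_space (borel :: ('a \<times> 'a) measure) offdiag)"
    by (intro measurable_restrict_space3) (auto simp: offdiag_def)
  then show ?thesis
    by (simp add: offdiag_borel_def[symmetric] cong: measurable_cong_sets[OF assms refl])
qed

lemma nn_integral_jump_measure_swap:
  fixes f :: "'a \<times> 'a \<Rightarrow> ennreal"
  assumes "sets \<mu> = sets borel" and f [measurable]: "f \<in> borel_measurable borel"
  shows "(\<integral>\<^sup>+p. f p \<partial>jump_measure_swap \<mu> K) = (\<integral>\<^sup>+x. \<integral>\<^sup>+y. f (y, x) * ennreal (j (y - x)) \<partial>lborel \<partial>\<mu>)"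
proof -
  have "(\<integral>\<^sup>+p. f p \<partial>jump_measure_swap \<mu> K) = (\<integral>\<^sup>+p. f (prod.swap p) \<partial>jump_measure \<mu> K)"
    unfolding jump_measure_swap_def
    by (rule nn_integral_distr[OF measurable_swap_offdiag[OF sets_jump_measure]
          measurable_offdiag_borel[OF sets_distr f]])
  also have "\<dots> = (\<integral>\<^sup>+x. \<integral>\<^sup>+y. f (y, x) * ennreal (j (y - x)) \<partial>lborel \<partial>\<mu>)"
  proof -
    have "(\<lambda>p. f (prod.swap p)) \<in> borel_measurable borel"
      by (rule measurable_compose[OF borel_measurable_continuous_onI[OF continuous_on_swap] f])
    from nn_integral_jump_measure[OF assms(1) this] show ?thesis by simp
  qed
  finally show ?thesis .
qed

text \<open>j takes real values, and a finite density preserves sigma-finiteness. This is what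
  Fubini on time and pairs of points rests on, the total mass being infinite in general.\<close>

lemma sigma_finite_jump_measure: "sigma_finite_measure (jump_measure lborel K)"
proof -
  have eq: "jump_measure lborel K
    = restrict_space (density (lborel \<Otimes>\<^sub>M lborel) (\<lambda>(x, y). ennreal (j (y - x)))) offdiag"
    by (rule jump_measure_eq) simp
  have "sigma_finite_measure (lborel \<Otimes>\<^sub>M (lborel :: 'a measure))"
    unfolding lborel_prod by (rule lborel.sigma_finite_measure_axioms)
  note density_finite = sigma_finite_measure.sigma_finite_iff_density_finite'[OF this]
  have "sigma_finite_measure (density (lborel \<Otimes>\<^sub>M lborel) (\<lambda>(x, y). ennreal (j (y - x))))"
    by (subst density_finite) (auto simp: case_prod_beta)
  then show ?thesis
    unfolding eq by (rule sigma_finite_measure_restrict_space) (simp add: lborel_prod)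
qed

end

text \<open>Positivity and symmetry are required at every point, including 0. The theorem reaches
  this setting by changing its kernel on a null set, which leaves all jump measures as they
  are.\<close>

locale levy_kernel = jump_density +
  assumes j_pos: "\<And>z. 0 < j z"
    and j_sym: "\<And>z. j (- z) = j z"
    and j_levy: "(\<integral>\<^sup>+z. ennreal (min 1 ((norm z)\<^sup>2)) * ennreal (j z) \<partial>lborel) < \<infinity>"
begin

abbreviation Jm :: "('a \<times> 'a) measure" where "Jm \<equiv> jump_measure lborel K"

lemma j_commute: "j (x - y) = j (y - x)"
  using j_sym[of "x - y"] by simp

lemma nn_integral_Jm:
  assumes "f \<in> borel_measurable borel"
  shows "(\<integral>\<^sup>+p. f p \<partial>Jm) = (\<integral>\<^sup>+x. \<integral>\<^sup>+y. f (x, y) * ennreal (j (y - x)) \<partial>lborel \<partial>lborel)"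
  using assms by (intro nn_integral_jump_measure) auto

text \<open>Reversibility of the jump measure in terms of iterated integrals: exchange the order of
  integration and use that j is even.\<close>

lemma nn_integral_Jm_swap:
  assumes [measurable]: "f \<in> borel_measurable (borel \<Otimes>\<^sub>M borel)"
  shows "(\<integral>\<^sup>+x. \<integral>\<^sup>+y. f (x, y) * ennreal (j (y - x)) \<partial>lborel \<partial>lborel)
    = (\<integral>\<^sup>+x. \<integral>\<^sup>+y. f (y, x) * ennreal (j (y - x)) \<partial>lborel \<partial>lborel)"
  by (subst lborel_pair.Fubini') (auto simp: j_commute)

definition levy_mass :: ennreal
  where "levy_mass = (\<integral>\<^sup>+z. ennreal (min 1 ((norm z)\<^sup>2)) * ennreal (j z) \<partial>lborel)"

lemma levy_mass_finite: "levy_mass < \<infinity>"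
  using j_levy by (simp add: levy_mass_def)

lemma levy_mass_shift:
  "(\<integral>\<^sup>+y. ennreal ((min 1 (norm (y - x)))\<^sup>2) * ennreal (j (y - x)) \<partial>lborel) = levy_mass"
proof -
  have "(min 1 r)\<^sup>2 = min 1 (r\<^sup>2)" if "0 \<le> r" for r :: real
  proof (cases "r \<le> 1")
    case True
    then have "r\<^sup>2 \<le> 1" using that by (simp add: power_le_one)
    then show ?thesis using True by (simp add: min_absorb2)
  next
    case False
    then have "1 \<le> r\<^sup>2" by (simp add: one_le_power)
    then show ?thesis using False by (simp add: min_absorb1)
  qed
  then have "levy_mass = (\<integral>\<^sup>+y. ennreal ((min 1 (norm y))\<^sup>2) * ennreal (j y) \<partial>lborel)"
    unfolding levy_mass_def by simp
  also have "\<dots> = (\<integral>\<^sup>+y. ennreal ((min 1 (norm (y - x)))\<^sup>2) * ennreal (j (y - x)) \<partial>lborel)"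
    by (rule nn_integral_lborel_shift_minus[symmetric]) measurable
  finally show ?thesis ..
qed

lemma action'_eq:
  assumes [measurable]: "\<rho> \<in> borel_measurable borel" "f \<in> borel_measurable borel"
  shows "action' lborel K \<rho> f = (\<integral>\<^sup>+x. \<integral>\<^sup>+y. ennreal ((f y - f x)\<^sup>2 * log_mean (\<rho> x) (\<rho> y))
      * ennreal (j (y - x)) \<partial>lborel \<partial>lborel) / 2"
proof -
  have "(\<lambda>(x, y). ennreal ((f y - f x)\<^sup>2 * log_mean (\<rho> x) (\<rho> y))) \<in> borel_measurable borel"
    unfolding borel_prod[symmetric] by measurable
  from nn_integral_Jm[OF this] show ?thesis by (simp add: action'_def)
qed

text \<open>The mean is at most \<rho>(x) + \<rho>(y). Each summand contributes the Levy mass, the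
  first by integrating in y and the second by exchanging x and y.\<close>

lemma log_mean_levy_bound:
  assumes [measurable]: "\<rho> \<in> borel_measurable borel" and "\<And>x. 0 \<le> \<rho> x"
    and "(\<integral>\<^sup>+x. ennreal (\<rho> x) \<partial>lborel) = 1"
  shows "(\<integral>\<^sup>+x. \<integral>\<^sup>+y. ennreal ((min 1 (norm (y - x)))\<^sup>2 * log_mean (\<rho> x) (\<rho> y))
      * ennreal (j (y - x)) \<partial>lborel \<partial>lborel) \<le> 2 * levy_mass"
proof -
  let ?m = "\<lambda>x y :: 'a. ennreal ((min 1 (norm (y - x)))\<^sup>2)"
  have "(\<integral>\<^sup>+x. \<integral>\<^sup>+y. (?m x y * ennreal (\<rho> x)) * ennreal (j (y - x)) \<partial>lborel \<partial>lborel)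
    = (\<integral>\<^sup>+x. ennreal (\<rho> x) * levy_mass \<partial>lborel)"
  proof (rule nn_integral_cong)
    fix x
    have "(\<integral>\<^sup>+y. (?m x y * ennreal (\<rho> x)) * ennreal (j (y - x)) \<partial>lborel)
      = (\<integral>\<^sup>+y. ennreal (\<rho> x) * (?m x y * ennreal (j (y - x))) \<partial>lborel)"
      by (simp only: mult_ac)
    also have "\<dots> = ennreal (\<rho> x) * (\<integral>\<^sup>+y. ?m x y * ennreal (j (y - x)) \<partial>lborel)"
      by (rule nn_integral_cmult) measurable
    finally show "(\<integral>\<^sup>+y. (?m x y * ennreal (\<rho> x)) * ennreal (j (y - x)) \<partial>lborel) = ennreal (\<rho> x) * levy_mass"
      by (simp only: levy_mass_shift)
  qed
  also have "\<dots> = (\<integral>\<^sup>+x. ennreal (\<rho> x) \<partial>lborel) * levy_mass"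
    by (rule nn_integral_multc) measurable
  also have "\<dots> = levy_mass"
    by (simp only: assms mult_1)
  finally have mass: "(\<integral>\<^sup>+x. \<integral>\<^sup>+y. (?m x y * ennreal (\<rho> x)) * ennreal (j (y - x)) \<partial>lborel \<partial>lborel) = levy_mass" .
  have swap: "(\<integral>\<^sup>+x. \<integral>\<^sup>+y. (?m x y * ennreal (\<rho> y)) * ennreal (j (y - x)) \<partial>lborel \<partial>lborel)
    = (\<integral>\<^sup>+x. \<integral>\<^sup>+y. (?m x y * ennreal (\<rho> x)) * ennreal (j (y - x)) \<partial>lborel \<partial>lborel)"
    using nn_integral_Jm_swap[of "\<lambda>(x, y). ?m x y * ennreal (\<rho> y)"] by (simp add: norm_minus_commute)
  have "(\<integral>\<^sup>+x. \<integral>\<^sup>+y. ennreal ((min 1 (norm (y - x)))\<^sup>2 * log_mean (\<rho> x) (\<rho> y))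
      * ennreal (j (y - x)) \<partial>lborel \<partial>lborel)
    \<le> (\<integral>\<^sup>+x. \<integral>\<^sup>+y. (?m x y * ennreal (\<rho> x)) * ennreal (j (y - x))
        + (?m x y * ennreal (\<rho> y)) * ennreal (j (y - x)) \<partial>lborel \<partial>lborel)"
  proof (intro nn_integral_mono)
    fix x y
    have "ennreal ((min 1 (norm (y - x)))\<^sup>2 * log_mean (\<rho> x) (\<rho> y))
      \<le> ennreal ((min 1 (norm (y - x)))\<^sup>2 * (\<rho> x + \<rho> y))"
      by (intro ennreal_leI mult_left_mono log_mean_le_add assms) auto
    also have "\<dots> = ?m x y * ennreal (\<rho> x) + ?m x y * ennreal (\<rho> y)"
      using assms by (simp add: distrib_left flip: ennreal_mult)
    finally show "ennreal ((min 1 (norm (y - x)))\<^sup>2 * log_mean (\<rho> x) (\<rho> y)) * ennreal (j (y - x))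
      \<le> (?m x y * ennreal (\<rho> x)) * ennreal (j (y - x)) + (?m x y * ennreal (\<rho> y)) * ennreal (j (y - x))"
      by (metis distrib_right mult_right_mono zero_le)
  qed
  also have "\<dots> = (\<integral>\<^sup>+x. \<integral>\<^sup>+y. (?m x y * ennreal (\<rho> x)) * ennreal (j (y - x)) \<partial>lborel \<partial>lborel)
    + (\<integral>\<^sup>+x. \<integral>\<^sup>+y. (?m x y * ennreal (\<rho> y)) * ennreal (j (y - x)) \<partial>lborel \<partial>lborel)"
    by (simp add: nn_integral_add)
  also have "\<dots> = levy_mass + levy_mass" unfolding swap mass ..
  finally show ?thesis by (simp only: mult_2)
qed

lemma action'_levy_bound:
  assumes [measurable]: "\<rho> \<in> borel_measurable borel" "f \<in> borel_measurable borel" and "\<And>x. 0 \<le> \<rho> x"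
    and "(\<integral>\<^sup>+x. ennreal (\<rho> x) \<partial>lborel) = 1"
    and f: "\<And>x y. \<bar>f y - f x\<bar> \<le> L * min 1 (norm (y - x))"
  shows "action' lborel K \<rho> f \<le> ennreal (L\<^sup>2) * levy_mass"
proof -
  have "(\<integral>\<^sup>+x. \<integral>\<^sup>+y. ennreal ((f y - f x)\<^sup>2 * log_mean (\<rho> x) (\<rho> y)) * ennreal (j (y - x)) \<partial>lborel \<partial>lborel)
    \<le> (\<integral>\<^sup>+x. \<integral>\<^sup>+y. ennreal (L\<^sup>2) * (ennreal ((min 1 (norm (y - x)))\<^sup>2 * log_mean (\<rho> x) (\<rho> y))
      * ennreal (j (y - x))) \<partial>lborel \<partial>lborel)"
  proof (intro nn_integral_mono)
    fix x y
    have "(f y - f x)\<^sup>2 \<le> (L * min 1 (norm (y - x)))\<^sup>2"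
      using f[of y x] by (metis abs_ge_zero power2_abs power_mono)
    then have "(f y - f x)\<^sup>2 * log_mean (\<rho> x) (\<rho> y) \<le> (L * min 1 (norm (y - x)))\<^sup>2 * log_mean (\<rho> x) (\<rho> y)"
      by (rule mult_right_mono[OF _ log_mean_nonneg])
    then have "ennreal ((f y - f x)\<^sup>2 * log_mean (\<rho> x) (\<rho> y))
      \<le> ennreal (L\<^sup>2) * ennreal ((min 1 (norm (y - x)))\<^sup>2 * log_mean (\<rho> x) (\<rho> y))"
      by (simp add: power_mult_distrib mult.assoc ennreal_leI flip: ennreal_mult')
    then show "ennreal ((f y - f x)\<^sup>2 * log_mean (\<rho> x) (\<rho> y)) * ennreal (j (y - x))
      \<le> ennreal (L\<^sup>2) * (ennreal ((min 1 (norm (y - x)))\<^sup>2 * log_mean (\<rho> x) (\<rho> y)) * ennreal (j (y - x)))"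
      by (metis mult.assoc mult_right_mono zero_le)
  qed
  also have "\<dots> = ennreal (L\<^sup>2) * (\<integral>\<^sup>+x. \<integral>\<^sup>+y. ennreal ((min 1 (norm (y - x)))\<^sup>2 * log_mean (\<rho> x) (\<rho> y))
      * ennreal (j (y - x)) \<partial>lborel \<partial>lborel)"
    by (simp add: nn_integral_cmult)
  also have "\<dots> \<le> ennreal (L\<^sup>2) * (2 * levy_mass)"
    by (intro mult_left_mono log_mean_levy_bound assms) auto
  finally show ?thesis
    unfolding action'_eq[OF assms(1,2)]
    by (simp add: divide_le_posI_ennreal mult_ac)
qed

end

subsection \<open>From a dual estimate to a potential\<close>

lemma sets_borel_prod:
  "sets (borel \<Otimes>\<^sub>M borel) = sets (borel :: ('a::second_countable_topology \<times> 'b::second_countable_topology) measure)"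
  by (rule arg_cong[OF borel_prod])

lemma measurable_borel_prod:
  "(f \<in> borel \<Otimes>\<^sub>M borel \<rightarrow>\<^sub>M N) = (f \<in> (borel :: ('a::second_countable_topology \<times> 'b::second_countable_topology) measure) \<rightarrow>\<^sub>M N)"
  by (rule arg_cong[OF measurable_cong_sets[OF sets_borel_prod refl]])

lemma AE_lborel_ex:
  assumes "AE x in (lborel :: 'a::euclidean_space measure). P x"
  obtains x where "P x"
proof (rule ccontr)
  assume "\<not> thesis"
  then have "\<not> P x" for x using that by blast
  then have "AE x in (lborel :: 'a measure). False" using assms by simp
  then show False by (simp add: AE_iff_measurable[OF _ refl])
qed

section \<open>The space-time measure weighted by the logarithmic mean\<close>

context levy_kernel
begin

lemma measurable_Jm_id: "(\<lambda>p. p) \<in> Jm \<rightarrow>\<^sub>M (borel \<Otimes>\<^sub>M borel)"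
proof -
  have s: "sets Jm = sets (restrict_space borel offdiag)"
    by (simp only: sets_jump_measure offdiag_borel_def)
  have "(\<lambda>p. p) \<in> restrict_space borel offdiag \<rightarrow>\<^sub>M (borel :: ('a \<times> 'a) measure)"
    by (rule measurable_restrict_space1) simp
  then show ?thesis using measurable_cong_sets[OF s sets_borel_prod] by blast
qed

lemma measurable_Jm_fst [measurable]: "fst \<in> Jm \<rightarrow>\<^sub>M borel"
  by (rule measurable_compose[OF measurable_Jm_id measurable_fst])

lemma measurable_Jm_snd [measurable]: "snd \<in> Jm \<rightarrow>\<^sub>M borel"
  by (rule measurable_compose[OF measurable_Jm_id measurable_snd])

text \<open>The half is the one in the action: the squared L2 norm of a gradient in the measure with
  this weight is the time integral of the action, so the dual problem becomes a Hilbert space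
  problem.\<close>

definition weight :: "(real \<Rightarrow> 'a \<Rightarrow> real) \<Rightarrow> real \<times> 'a \<times> 'a \<Rightarrow> real"
  where "weight \<rho> z = indicator {0..1} (fst z)
    * (log_mean (\<rho> (fst z) (fst (snd z))) (\<rho> (fst z) (snd (snd z))) / 2)"

definition weighted_measure :: "(real \<Rightarrow> 'a \<Rightarrow> real) \<Rightarrow> (real \<times> 'a \<times> 'a) measure"
  where "weighted_measure \<rho> = density (lborel \<Otimes>\<^sub>M Jm) (\<lambda>z. ennreal (weight \<rho> z))"

definition gradient :: "(real \<times> 'a \<Rightarrow> real) \<Rightarrow> real \<times> 'a \<times> 'a \<Rightarrow> real"
  where "gradient f z = f (fst z, snd (snd z)) - f (fst z, fst (snd z))"

lemma weight_nonneg: "0 \<le> weight \<rho> z"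
  by (simp add: weight_def log_mean_nonneg)

lemma weight_measurable:
  assumes [measurable]: "(\<lambda>(t, x). \<rho> t x) \<in> borel_measurable (borel \<Otimes>\<^sub>M borel)"
  shows "weight \<rho> \<in> borel_measurable (lborel \<Otimes>\<^sub>M Jm)"
  unfolding weight_def[abs_def] by measurable

lemma gradient_measurable:
  assumes [measurable]: "f \<in> borel_measurable (borel \<Otimes>\<^sub>M borel)"
  shows "gradient f \<in> borel_measurable (lborel \<Otimes>\<^sub>M Jm)"
  unfolding gradient_def[abs_def] by measurable

lemma sets_weighted_measure: "sets (weighted_measure \<rho>) = sets (lborel \<Otimes>\<^sub>M Jm)"
  by (simp only: weighted_measure_def sets_density)

lemma measurable_weighted_measure:
  "f \<in> borel_measurable (lborel \<Otimes>\<^sub>M Jm) \<Longrightarrow> f \<in> borel_measurable (weighted_measure \<rho>)"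
  by (simp only: measurable_cong_sets[OF sets_weighted_measure refl])

lemma nn_integral_weighted_measure:
  assumes \<rho>: "(\<lambda>(t, x). \<rho> t x) \<in> borel_measurable (borel \<Otimes>\<^sub>M borel)"
    and H: "H \<in> borel_measurable (lborel \<Otimes>\<^sub>M Jm)"
  shows "(\<integral>\<^sup>+z. H z \<partial>weighted_measure \<rho>) = (\<integral>\<^sup>+t. \<integral>\<^sup>+p. ennreal (weight \<rho> (t, p)) * H (t, p) \<partial>Jm \<partial>lborel)"
proof -
  note [measurable] = weight_measurable[OF \<rho>] H
  have "(\<integral>\<^sup>+z. H z \<partial>weighted_measure \<rho>) = (\<integral>\<^sup>+z. ennreal (weight \<rho> z) * H z \<partial>(lborel \<Otimes>\<^sub>M Jm))"
    unfolding weighted_measure_def by (rule nn_integral_density) measurable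
  also have "\<dots> = (\<integral>\<^sup>+t. \<integral>\<^sup>+p. ennreal (weight \<rho> (t, p)) * H (t, p) \<partial>Jm \<partial>lborel)"
    by (rule sigma_finite_measure.nn_integral_fst[OF sigma_finite_jump_measure, symmetric]) measurable
  finally show ?thesis .
qed

lemma nn_integral_weighted_gradient:
  fixes \<rho> :: "real \<Rightarrow> 'a \<Rightarrow> real" and f :: "real \<times> 'a \<Rightarrow> real"
  assumes \<rho> [measurable]: "(\<lambda>(t, x). \<rho> t x) \<in> borel_measurable (borel \<Otimes>\<^sub>M borel)"
    and f [measurable]: "f \<in> borel_measurable (borel \<Otimes>\<^sub>M borel)"
  shows "(\<integral>\<^sup>+z. ennreal ((gradient f z)\<^sup>2) \<partial>weighted_measure \<rho>)
    = (\<integral>\<^sup>+t\<in>{0..1}. action' lborel K (\<rho> t) (\<lambda>x. f (t, x)) \<partial>lborel)"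
proof -
  note [measurable] = gradient_measurable[OF f]
  have "(\<integral>\<^sup>+z. ennreal ((gradient f z)\<^sup>2) \<partial>weighted_measure \<rho>)
    = (\<integral>\<^sup>+t. \<integral>\<^sup>+p. ennreal (weight \<rho> (t, p)) * ennreal ((gradient f (t, p))\<^sup>2) \<partial>Jm \<partial>lborel)"
    by (rule nn_integral_weighted_measure[OF \<rho>]) measurable
  also have "\<dots> = (\<integral>\<^sup>+t\<in>{0..1}. action' lborel K (\<rho> t) (\<lambda>x. f (t, x)) \<partial>lborel)"
  proof (rule nn_integral_cong)
    fix t
    have "ennreal (weight \<rho> (t, p)) * ennreal ((gradient f (t, p))\<^sup>2)
      = ennreal ((f (t, snd p) - f (t, fst p))\<^sup>2 * log_mean (\<rho> t (fst p)) (\<rho> t (snd p))) * (indicator {0..1} t / 2)" for p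
    proof (cases "t \<in> {0..1}")
      case True
      have "ennreal (weight \<rho> (t, p)) * ennreal ((gradient f (t, p))\<^sup>2)
        = ennreal (weight \<rho> (t, p) * (gradient f (t, p))\<^sup>2)"
        by (simp add: ennreal_mult weight_nonneg)
      also have "weight \<rho> (t, p) * (gradient f (t, p))\<^sup>2
        = ((f (t, snd p) - f (t, fst p))\<^sup>2 * log_mean (\<rho> t (fst p)) (\<rho> t (snd p))) / 2"
        using True by (simp add: weight_def gradient_def)
      also have "ennreal \<dots> = ennreal ((f (t, snd p) - f (t, fst p))\<^sup>2 * log_mean (\<rho> t (fst p)) (\<rho> t (snd p))) / 2"
        by (rule ennreal_divide_numeral[symmetric]) (simp add: log_mean_nonneg)
      finally show ?thesis using True by (simp add: divide_ennreal_def)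
    next
      case False
      then show ?thesis by (simp add: weight_def)
    qed
    then have "(\<integral>\<^sup>+p. ennreal (weight \<rho> (t, p)) * ennreal ((gradient f (t, p))\<^sup>2) \<partial>Jm)
      = (\<integral>\<^sup>+p. ennreal ((f (t, snd p) - f (t, fst p))\<^sup>2 * log_mean (\<rho> t (fst p)) (\<rho> t (snd p))) * (indicator {0..1} t / 2) \<partial>Jm)"
      by (rule nn_integral_cong)
    also have "\<dots> = (\<integral>\<^sup>+p. ennreal ((f (t, snd p) - f (t, fst p))\<^sup>2 * log_mean (\<rho> t (fst p)) (\<rho> t (snd p))) \<partial>Jm) * (indicator {0..1} t / 2)"
      by (rule nn_integral_multc) measurable
    also have "\<dots> = action' lborel K (\<rho> t) (\<lambda>x. f (t, x)) * indicator {0..1} t"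
      unfolding action'_def case_prod_beta by (simp add: divide_ennreal_def mult_ac)
    finally show "(\<integral>\<^sup>+p. ennreal (weight \<rho> (t, p)) * ennreal ((gradient f (t, p))\<^sup>2) \<partial>Jm)
      = action' lborel K (\<rho> t) (\<lambda>x. f (t, x)) * indicator {0..1} t" .
  qed
  finally show ?thesis .
qed

lemma test_function_measurable:
  assumes "smooth_compact f" shows "f \<in> borel_measurable (borel \<Otimes>\<^sub>M borel)"
  unfolding measurable_borel_prod by (rule smooth_measurable[OF smooth_compact_smooth[OF assms]])

lemma gradient_square_finite:
  fixes \<rho> :: "real \<Rightarrow> 'a \<Rightarrow> real" and f :: "real \<times> 'a \<Rightarrow> real"
  assumes \<rho> [measurable]: "(\<lambda>(t, x). \<rho> t x) \<in> borel_measurable (borel \<Otimes>\<^sub>M borel)"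
    and pos: "\<And>t x. 0 \<le> \<rho> t x" and prob: "\<And>t. (\<integral>\<^sup>+x. ennreal (\<rho> t x) \<partial>lborel) = 1"
    and f: "smooth_compact f"
  shows "(\<integral>\<^sup>+t\<in>{0..1}. action' lborel K (\<rho> t) (\<lambda>x. f (t, x)) \<partial>lborel) < \<infinity>"
proof -
  obtain L where L: "0 \<le> L" "\<And>t x y. \<bar>f (t, y) - f (t, x)\<bar> \<le> L * min 1 (norm (y - x))"
    using smooth_compact_jump_bound[OF f] by blast
  note [measurable] = test_function_measurable[OF f]
  have "(\<integral>\<^sup>+t\<in>{0..1}. action' lborel K (\<rho> t) (\<lambda>x. f (t, x)) \<partial>lborel)
    \<le> (\<integral>\<^sup>+t. (ennreal (L\<^sup>2) * levy_mass) * indicator {0..1::real} t \<partial>lborel)"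
  proof (intro nn_integral_mono mult_right_mono)
    fix t :: real
    show "action' lborel K (\<rho> t) (\<lambda>x. f (t, x)) \<le> ennreal (L\<^sup>2) * levy_mass"
    proof (rule action'_levy_bound)
      show "\<rho> t \<in> borel_measurable borel" by measurable
      show "(\<lambda>x. f (t, x)) \<in> borel_measurable borel" by measurable
    qed (rule pos prob L)+
  qed simp
  also have "\<dots> = ennreal (L\<^sup>2) * levy_mass"
    by (subst nn_integral_cmult) simp_all
  also have "\<dots> < \<infinity>" using levy_mass_finite by (simp add: ennreal_mult_less_top)
  finally show ?thesis .
qed

text \<open>Since j is positive, the jump measure has the same null sets as Lebesgue measure on
  pairs.\<close>

lemma AE_Jm_iff:
  assumes Q: "Measurable.pred (borel \<Otimes>\<^sub>M borel) Q"
  shows "(AE p in Jm. Q p) \<longleftrightarrow> (AE x in lborel. AE y in lborel. Q (x, y))"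
proof -
  note [measurable] = Q
  let ?I = "\<lambda>p. indicator {p. \<not> Q p} p :: ennreal"
  have [measurable]: "?I \<in> borel_measurable (borel \<Otimes>\<^sub>M borel)"
  proof -
    have "?I = (\<lambda>p. if Q p then 0 else 1)" by (auto simp: indicator_def)
    then show ?thesis by simp
  qed
  have b: "?I \<in> borel_measurable borel"
    using \<open>?I \<in> borel_measurable (borel \<Otimes>\<^sub>M borel)\<close> unfolding measurable_borel_prod .
  have "(AE p in Jm. Q p) \<longleftrightarrow> (AE p in Jm. ?I p = 0)"
    by (rule AE_cong) (simp add: indicator_def)
  also have "\<dots> \<longleftrightarrow> (\<integral>\<^sup>+p. ?I p \<partial>Jm) = 0"
    by (rule nn_integral_0_iff_AE[symmetric]) (rule measurable_jump_measure[OF b])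
  also have "\<dots> \<longleftrightarrow> (\<integral>\<^sup>+x. \<integral>\<^sup>+y. ?I (x, y) * ennreal (j (y - x)) \<partial>lborel \<partial>lborel) = 0"
    unfolding nn_integral_Jm[OF b] ..
  also have "\<dots> \<longleftrightarrow> (AE x in lborel. (\<integral>\<^sup>+y. ?I (x, y) * ennreal (j (y - x)) \<partial>lborel) = 0)"
    by (rule nn_integral_0_iff_AE) measurable
  also have "\<dots> \<longleftrightarrow> (AE x in lborel. AE y in lborel. ?I (x, y) * ennreal (j (y - x)) = 0)"
  proof (rule AE_cong)
    fix x
    show "((\<integral>\<^sup>+y. ?I (x, y) * ennreal (j (y - x)) \<partial>lborel) = 0) = (AE y in lborel. ?I (x, y) * ennreal (j (y - x)) = 0)"
      by (rule nn_integral_0_iff_AE) measurable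
  qed
  also have "\<dots> \<longleftrightarrow> (AE x in lborel. AE y in lborel. Q (x, y))"
  proof (rule AE_cong, rule AE_cong)
    fix x y
    have "ennreal (j (y - x)) \<noteq> 0" using j_pos[of "y - x"] by simp
    then show "(?I (x, y) * ennreal (j (y - x)) = 0) = Q (x, y)" by (simp add: indicator_def)
  qed
  finally show ?thesis .
qed

text \<open>For a positive \<rho> the logarithmic mean is positive at every pair, so nothing is lost
  between the weighted measure and Lebesgue measure. This is the reason for working with positive
  curves.\<close>

lemma AE_weighted_measure_iff:
  assumes \<rho> [measurable]: "(\<lambda>(t, x). \<rho> t x) \<in> borel_measurable (borel \<Otimes>\<^sub>M borel)"
    and pos: "\<And>t x. 0 < \<rho> t x"
    and Q: "Measurable.pred (borel \<Otimes>\<^sub>M (borel \<Otimes>\<^sub>M borel)) Q"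
  shows "(AE z in weighted_measure \<rho>. Q z)
    \<longleftrightarrow> (AE t in lborel. t \<in> {0..1} \<longrightarrow> (AE x in lborel. AE y in lborel. Q (t, x, y)))"
proof -
  note [measurable] = Q
  let ?I = "\<lambda>z. if Q z then 0 else 1 :: ennreal"
  have id: "(\<lambda>z. z) \<in> lborel \<Otimes>\<^sub>M Jm \<rightarrow>\<^sub>M borel \<Otimes>\<^sub>M (borel \<Otimes>\<^sub>M borel)"
  proof -
    have "(\<lambda>z. (fst z, snd z)) \<in> lborel \<Otimes>\<^sub>M Jm \<rightarrow>\<^sub>M borel \<Otimes>\<^sub>M (borel \<Otimes>\<^sub>M borel)"
      by (rule measurable_Pair[OF _ measurable_compose[OF measurable_snd measurable_Jm_id]]) measurable
    then show ?thesis by simp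
  qed
  have I: "?I \<in> borel_measurable (borel \<Otimes>\<^sub>M (borel \<Otimes>\<^sub>M borel))" by measurable
  note I' [measurable] = measurable_compose[OF id I]
  note [measurable] = weight_measurable[OF \<rho>]
  have "(AE z in weighted_measure \<rho>. Q z) \<longleftrightarrow> (AE z in weighted_measure \<rho>. ?I z = 0)"
    by (rule AE_cong) simp
  also have "\<dots> \<longleftrightarrow> (\<integral>\<^sup>+z. ?I z \<partial>weighted_measure \<rho>) = 0"
    by (rule nn_integral_0_iff_AE[symmetric]) (rule measurable_weighted_measure[OF I'])
  also have "\<dots> \<longleftrightarrow> (\<integral>\<^sup>+t. \<integral>\<^sup>+p. ennreal (weight \<rho> (t, p)) * ?I (t, p) \<partial>Jm \<partial>lborel) = 0"
    unfolding nn_integral_weighted_measure[OF \<rho> I'] ..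
  also have "\<dots> \<longleftrightarrow> (AE t in lborel. (\<integral>\<^sup>+p. ennreal (weight \<rho> (t, p)) * ?I (t, p) \<partial>Jm) = 0)"
    by (rule nn_integral_0_iff_AE)
      (rule sigma_finite_measure.borel_measurable_nn_integral_fst[OF sigma_finite_jump_measure], measurable)
  also have "\<dots> \<longleftrightarrow> (AE t in lborel. t \<in> {0..1} \<longrightarrow> (AE x in lborel. AE y in lborel. Q (t, x, y)))"
  proof (rule AE_cong)
    fix t :: real
    have [measurable]: "(\<lambda>p. ennreal (weight \<rho> (t, p)) * ?I (t, p)) \<in> borel_measurable Jm"
      by measurable
    have "((\<integral>\<^sup>+p. ennreal (weight \<rho> (t, p)) * ?I (t, p) \<partial>Jm) = 0)
      \<longleftrightarrow> (AE p in Jm. ennreal (weight \<rho> (t, p)) * ?I (t, p) = 0)"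
      by (rule nn_integral_0_iff_AE) measurable
    also have "\<dots> \<longleftrightarrow> (AE p in Jm. t \<in> {0..1} \<longrightarrow> Q (t, p))"
    proof (rule AE_cong)
      fix p
      have "0 < weight \<rho> (t, p)" if "t \<in> {0..1}"
        using that log_mean_pos[OF pos pos, of t "fst p" t "snd p"] by (simp add: weight_def)
      moreover have "weight \<rho> (t, p) = 0" if "t \<notin> {0..1}" using that by (simp add: weight_def)
      ultimately show "(ennreal (weight \<rho> (t, p)) * ?I (t, p) = 0) = (t \<in> {0..1} \<longrightarrow> Q (t, p))"
      proof (cases "t \<in> {0..1}")
        case True
        then have "ennreal (weight \<rho> (t, p)) \<noteq> 0" using \<open>t \<in> {0..1} \<Longrightarrow> 0 < weight \<rho> (t, p)\<close> by (simp add: not_le)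
        then show ?thesis using True by (simp del: atLeastAtMost_iff)
      next
        case False
        then have "weight \<rho> (t, p) = 0" by (rule \<open>t \<notin> {0..1} \<Longrightarrow> weight \<rho> (t, p) = 0\<close>)
        then show ?thesis using False by (simp del: atLeastAtMost_iff)
      qed
    qed
    also have "\<dots> \<longleftrightarrow> (t \<in> {0..1} \<longrightarrow> (AE p in Jm. Q (t, p)))" by (cases "t \<in> {0..1}") simp_all
    also have "(AE p in Jm. Q (t, p)) \<longleftrightarrow> (AE x in lborel. AE y in lborel. Q (t, x, y))"
      by (rule AE_Jm_iff) measurable
    finally show "((\<integral>\<^sup>+p. ennreal (weight \<rho> (t, p)) * ?I (t, p) \<partial>Jm) = 0)
      = (t \<in> {0..1} \<longrightarrow> (AE x in lborel. AE y in lborel. Q (t, x, y)))" .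
  qed
  finally show ?thesis .
qed

text \<open>Fubini for the null set of exceptions: a property of almost every (t, x, y) holds, for a
  suitable x, at almost every (t, y). Getting one point for all times keeps the normalised potential
  jointly measurable.\<close>

lemma AE_exchange_point:
  assumes Q [measurable]: "Measurable.pred (borel \<Otimes>\<^sub>M (borel \<Otimes>\<^sub>M borel)) Q"
    and ae: "AE t in lborel. t \<in> {0..1} \<longrightarrow> (AE x in lborel. AE y in lborel. Q (t, x, y))"
  obtains x\<^sub>0 :: 'a where "AE t in lborel. t \<in> {0..1::real} \<longrightarrow> (AE y in (lborel :: 'a measure). Q (t, x\<^sub>0, y))"
proof -
  let ?I = "\<lambda>t x y. (if Q (t, x, y) then 0 else indicator {0..1} t) :: ennreal"
  have [measurable]: "(\<lambda>(t, x, y). ?I t x y) \<in> borel_measurable (borel \<Otimes>\<^sub>M (borel \<Otimes>\<^sub>M borel))"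
    by measurable
  have "(\<integral>\<^sup>+t. \<integral>\<^sup>+x. \<integral>\<^sup>+y. ?I t x y \<partial>lborel \<partial>lborel \<partial>lborel) = 0"
  proof (subst nn_integral_0_iff_AE, measurable)
    show "AE t in lborel. (\<integral>\<^sup>+x. \<integral>\<^sup>+y. ?I t x y \<partial>lborel \<partial>lborel) = 0"
      using ae
    proof eventually_elim
      case (elim t)
      have "AE x in lborel. (\<integral>\<^sup>+y. ?I t x y \<partial>lborel) = 0"
      proof (cases "t \<in> {0..1}")
        case True
        then have "AE x in lborel. AE y in lborel. Q (t, x, y)" using elim by blast
        then show ?thesis
        proof eventually_elim
          case (elim x)
          then have "AE y in lborel. ?I t x y = 0" by eventually_elim simp
          then show ?case by (subst nn_integral_0_iff_AE) measurable
        qed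
      next
        case False
        then have "?I t x y = 0" for x y by simp
        then show ?thesis by simp
      qed
      then show ?case by (subst nn_integral_0_iff_AE) measurable
    qed
  qed
  moreover have "(\<integral>\<^sup>+x. \<integral>\<^sup>+t. \<integral>\<^sup>+y. ?I t x y \<partial>lborel \<partial>lborel \<partial>lborel) = (\<integral>\<^sup>+t. \<integral>\<^sup>+x. \<integral>\<^sup>+y. ?I t x y \<partial>lborel \<partial>lborel \<partial>lborel)"
    by (rule lborel_pair.Fubini') measurable
  ultimately have "(\<integral>\<^sup>+x. \<integral>\<^sup>+t. \<integral>\<^sup>+y. ?I t x y \<partial>lborel \<partial>lborel \<partial>lborel) = 0" by simp
  then have "AE x in lborel. (\<integral>\<^sup>+t. \<integral>\<^sup>+y. ?I t x y \<partial>lborel \<partial>lborel) = 0"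
    by (subst (asm) nn_integral_0_iff_AE) measurable
  then obtain x\<^sub>0 where "(\<integral>\<^sup>+t. \<integral>\<^sup>+y. ?I t x\<^sub>0 y \<partial>lborel \<partial>lborel) = 0"
    by (rule AE_lborel_ex)
  then have "AE t in lborel. (\<integral>\<^sup>+y. ?I t x\<^sub>0 y \<partial>lborel) = 0"
    by (subst (asm) nn_integral_0_iff_AE) measurable
  then have "AE t in lborel. t \<in> {0..1} \<longrightarrow> (AE y in lborel. Q (t, x\<^sub>0, y))"
  proof eventually_elim
    case (elim t)
    then have ae: "AE y in lborel. ?I t x\<^sub>0 y = 0"
      by (subst (asm) nn_integral_0_iff_AE) measurable
    show ?case
    proof
      assume t: "t \<in> {0..1}"
      show "AE y in lborel. Q (t, x\<^sub>0, y)"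
        using ae by eventually_elim (use t in \<open>simp split: if_splits\<close>)
    qed
  qed
  then show thesis by (rule that)
qed

end

subsection \<open>Interpolation with a smoothed density\<close>

lemma two_mult_le_weighted:
  fixes a b s :: real
  assumes "0 < s"
  shows "2 * (\<bar>a\<bar> * \<bar>b\<bar>) \<le> s * a\<^sup>2 + b\<^sup>2 / s"
proof -
  define c where "c = \<bar>b\<bar> / s"
  have b: "\<bar>b\<bar> = s * c" using assms by (simp add: c_def)
  then have "b\<^sup>2 = (s * c)\<^sup>2" by (metis power2_abs)
  then have b2: "b\<^sup>2 / s = s * c\<^sup>2" using assms by (simp add: power2_eq_square)
  have "0 \<le> s * (\<bar>a\<bar> - c)\<^sup>2" using assms by simp
  also have "\<dots> = s * \<bar>a\<bar>\<^sup>2 + s * c\<^sup>2 - 2 * (\<bar>a\<bar> * (s * c))"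
    by (simp add: power2_eq_square algebra_simps)
  finally show ?thesis unfolding b b2 by simp
qed

text \<open>For a function that is not integrable the Bochner integral is 0, so no integrability has
  to be checked. Many estimates below start from this inequality.\<close>

lemma ennreal_integral_le:
  fixes f :: "'z \<Rightarrow> real"
  shows "ennreal (integral\<^sup>L M f) \<le> (\<integral>\<^sup>+z. ennreal (f z) \<partial>M)"
proof (cases "integrable M f")
  case True
  then have i: "integrable M (\<lambda>z. max 0 (f z))" by simp
  have "integral\<^sup>L M f \<le> (\<integral>z. max 0 (f z) \<partial>M)"
    by (rule integral_mono[OF True i]) simp
  then have "ennreal (integral\<^sup>L M f) \<le> ennreal (\<integral>z. max 0 (f z) \<partial>M)" by (rule ennreal_leI)
  also have "\<dots> = (\<integral>\<^sup>+z. ennreal (max 0 (f z)) \<partial>M)"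
    by (rule nn_integral_eq_integral[OF i, symmetric]) simp
  also have "\<dots> = (\<integral>\<^sup>+z. ennreal (f z) \<partial>M)"
    by (intro nn_integral_cong) (simp add: max_def ennreal_neg)
  finally show ?thesis .
next
  case False
  then show ?thesis by (simp add: not_integrable_integral_eq)
qed

lemma integrable_bounded_density:
  fixes f \<sigma> :: "'z \<Rightarrow> real"
  assumes [measurable]: "f \<in> borel_measurable M" "\<sigma> \<in> borel_measurable M"
    and "\<And>z. \<bar>f z\<bar> \<le> B" "\<And>z. 0 \<le> \<sigma> z" "(\<integral>\<^sup>+z. ennreal (\<sigma> z) \<partial>M) < \<infinity>"
  shows "integrable M (\<lambda>z. f z * \<sigma> z)"
proof (rule Bochner_Integration.integrable_bound)
  have "integrable M \<sigma>" using assms by (intro integrableI_nonneg) auto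
  then show "integrable M (\<lambda>z. B * \<sigma> z)" by simp
  show "AE z in M. norm (f z * \<sigma> z) \<le> norm (B * \<sigma> z)"
  proof (rule AE_I2)
    fix z
    have "\<bar>f z\<bar> * \<sigma> z \<le> B * \<sigma> z" using assms(3,4) by (rule mult_right_mono)
    then show "norm (f z * \<sigma> z) \<le> norm (B * \<sigma> z)"
      using assms(4)[of z] mult_right_mono[OF abs_ge_self[of B] assms(4)[of z]] by (simp add: abs_mult)
  qed
qed measurable

lemma ennreal_set_integral_le:
  "ennreal (LINT t:A|M. f t) \<le> (\<integral>\<^sup>+t\<in>A. ennreal (f t) \<partial>M)"
proof -
  have "ennreal (LINT t:A|M. f t) \<le> (\<integral>\<^sup>+t. ennreal (indicator A t *\<^sub>R f t) \<partial>M)"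
    unfolding set_lebesgue_integral_def by (rule ennreal_integral_le)
  also have "\<dots> = (\<integral>\<^sup>+t\<in>A. ennreal (f t) \<partial>M)"
    by (intro nn_integral_cong) (simp add: indicator_def)
  finally show ?thesis .
qed

context levy_kernel
begin

text \<open>Young's inequality with weight \<theta>(r, s) c separates the gradient of the potential
  from the rate u = (x - y) k at which mass moves along one jump. The remainder g'^2 u^2 /
  (\<theta>(r, s) c) is reduced to the integrand of the Fisher information by k \<le> \<epsilon> c
  and g'^2 \<le> \<open>K\<^sub>0\<close> g; here r and s are values of the interpolated density and
  x and y of the original one.\<close>

lemma interpolation_pointwise:
  fixes a b x y f g g' k \<theta> K\<^sub>0 \<epsilon> :: real
  assumes "0 < x" "0 < y" "0 \<le> f'" "0 < r" "0 < s" "0 \<le> k" "k \<le> \<epsilon> * c" "0 < c" "0 \<le> K\<^sub>0"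
    and g: "0 \<le> g" "g'\<^sup>2 \<le> K\<^sub>0 * g" "g * x \<le> r" "g * y \<le> s"
  shows "g' * (a - b) * (x - y) * k
    \<le> (K\<^sub>0 * \<epsilon>\<^sup>2 * ((y - x) * (ln y - ln x)) / 2 + (b - a)\<^sup>2 * log_mean r s / 2) * c"
proof -
  let ?l = "log_mean x y" and ?R = "log_mean r s"
  have l: "0 < ?l" "0 < ?R" using assms by (auto intro: log_mean_pos)
  \<comment> \<open>Homogeneity and monotonicity of the mean: the interpolated density dominates g
    times the original one.\<close>
  have gl: "g * ?l \<le> ?R"
    using log_mean_scale[of g x y] log_mean_mono[of "g * x" "g * y" r s] assms by simp
  \<comment> \<open>The integrand of the Fisher information is the squared difference divided by the
    mean.\<close>
  have xy: "(y - x) * (ln y - ln x) = (x - y)\<^sup>2 / ?l"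
  proof -
    have "ln x - ln y = (x - y) / ?l"
      using log_mean_ln_diff[of x y] assms l by (simp add: eq_divide_eq mult.commute)
    moreover have "(y - x) * (ln y - ln x) = (x - y) * (ln x - ln y)" by (simp add: algebra_simps)
    ultimately show ?thesis by (simp add: power2_eq_square)
  qed
  define u where "u = (x - y) * k"
  have u2: "u\<^sup>2 \<le> (x - y)\<^sup>2 * (\<epsilon>\<^sup>2 * c\<^sup>2)"
  proof -
    have "k\<^sup>2 \<le> (\<epsilon> * c)\<^sup>2" using assms by (intro power_mono)
    then show ?thesis unfolding u_def power_mult_distrib by (intro mult_left_mono) auto
  qed
  have main: "g'\<^sup>2 * (x - y)\<^sup>2 * ?l \<le> K\<^sub>0 * (x - y)\<^sup>2 * ?R"
  proof -
    have "g'\<^sup>2 * ?l \<le> K\<^sub>0 * g * ?l" using g l by (intro mult_right_mono) auto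
    also have "\<dots> \<le> K\<^sub>0 * ?R" using gl assms by (simp add: mult.assoc mult_left_mono)
    finally have "(x - y)\<^sup>2 * (g'\<^sup>2 * ?l) \<le> (x - y)\<^sup>2 * (K\<^sub>0 * ?R)" by (intro mult_left_mono) auto
    then show ?thesis by (simp add: mult_ac)
  qed
  have e1: "(g' * u)\<^sup>2 / (?R * c) \<le> K\<^sub>0 * \<epsilon>\<^sup>2 * ((x - y)\<^sup>2 / ?l) * c"
  proof -
    have "(g' * u)\<^sup>2 \<le> g'\<^sup>2 * ((x - y)\<^sup>2 * (\<epsilon>\<^sup>2 * c\<^sup>2))"
      unfolding power_mult_distrib by (rule mult_left_mono[OF u2]) simp
    then have "(g' * u)\<^sup>2 * ?l \<le> g'\<^sup>2 * ((x - y)\<^sup>2 * (\<epsilon>\<^sup>2 * c\<^sup>2)) * ?l"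
      using l by (intro mult_right_mono) auto
    also have "\<dots> = (g'\<^sup>2 * (x - y)\<^sup>2 * ?l) * (\<epsilon>\<^sup>2 * c\<^sup>2)" by (simp add: mult_ac)
    also have "\<dots> \<le> (K\<^sub>0 * (x - y)\<^sup>2 * ?R) * (\<epsilon>\<^sup>2 * c\<^sup>2)"
      by (rule mult_right_mono[OF main]) simp
    finally have "(g' * u)\<^sup>2 * ?l \<le> K\<^sub>0 * \<epsilon>\<^sup>2 * (x - y)\<^sup>2 * c * (?R * c)"
      by (simp add: power2_eq_square mult_ac)
    then show ?thesis using l \<open>0 < c\<close> by (simp add: field_simps)
  qed
  have "2 * ((a - b) * (g' * u)) \<le> (a - b)\<^sup>2 * (?R * c) + (g' * u)\<^sup>2 / (?R * c)"
  proof -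
    have "0 < ?R * c" using l \<open>0 < c\<close> by simp
    from two_mult_le_weighted[OF this, of "a - b" "g' * u"]
    have "2 * \<bar>(a - b) * (g' * u)\<bar> \<le> (a - b)\<^sup>2 * (?R * c) + (g' * u)\<^sup>2 / (?R * c)"
      by (simp add: abs_mult mult.commute)
    then show ?thesis by linarith
  qed
  then have "2 * ((a - b) * (g' * u)) \<le> (a - b)\<^sup>2 * (?R * c) + K\<^sub>0 * \<epsilon>\<^sup>2 * ((x - y)\<^sup>2 / ?l) * c"
    using e1 by simp
  then show ?thesis
    unfolding xy u_def by (simp add: power2_commute[of b a] algebra_simps)
qed

text \<open>For an even probability density k, the difference between \<sigma> and its convolution,
  paired with f, is a Dirichlet form with jump density k. This displays the effect of the
  convolution as a flow along jumps, to be compared with j.\<close>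

lemma smoothing_symmetrised:
  fixes \<sigma> k f :: "'a \<Rightarrow> real"
  assumes [measurable]: "\<sigma> \<in> borel_measurable borel" "k \<in> borel_measurable borel" "f \<in> borel_measurable borel"
    and nn: "\<And>x. 0 \<le> \<sigma> x" "\<And>x. 0 \<le> k x" and sym: "\<And>x. k (- x) = k x" and B: "\<And>x. \<bar>f x\<bar> \<le> B"
    and s1: "(\<integral>\<^sup>+x. ennreal (\<sigma> x) \<partial>lborel) = 1" and k1: "(\<integral>\<^sup>+x. ennreal (k x) \<partial>lborel) = 1"
  defines "\<tau> \<equiv> \<lambda>x. LINT y|lborel. \<sigma> y * k (x - y)"
  shows "integrable (lborel \<Otimes>\<^sub>M lborel) (\<lambda>p. (f (fst p) - f (snd p)) * (\<sigma> (fst p) - \<sigma> (snd p)) * k (snd p - fst p))"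
    and "(LINT p|(lborel \<Otimes>\<^sub>M lborel). (f (fst p) - f (snd p)) * (\<sigma> (fst p) - \<sigma> (snd p)) * k (snd p - fst p))
      = 2 * ((LINT x|lborel. f x * \<sigma> x) - (LINT x|lborel. f x * \<tau> x))"
proof -
  have kc: "k (x - y) = k (y - x)" for x y using sym[of "y - x"] by simp
  have k1x: "(LINT y|lborel. k (y - x)) = 1" for x
  proof (rule integral_eq_nn_integral[THEN trans])
    have "(\<integral>\<^sup>+y. ennreal (k (y - x)) \<partial>lborel) = 1"
      using nn_integral_lborel_shift_minus[of "\<lambda>y. ennreal (k y)" x] k1 by simp
    then show "enn2real (\<integral>\<^sup>+y. ennreal (k (y - x)) \<partial>lborel) = 1" by simp
  qed (use nn in auto)
  have k1y: "(LINT x|lborel. k (y - x)) = 1" for y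
    using k1x[of y] by (simp only: kc[of y])
  let ?N = "lborel \<Otimes>\<^sub>M lborel :: ('a \<times> 'a) measure"
  have fin: "(\<integral>\<^sup>+p. ennreal (\<sigma> (fst p) * k (snd p - fst p)) \<partial>?N) = 1"
  proof -
    have "(\<integral>\<^sup>+p. ennreal (\<sigma> (fst p) * k (snd p - fst p)) \<partial>?N)
      = (\<integral>\<^sup>+x. \<integral>\<^sup>+y. ennreal (\<sigma> x) * ennreal (k (y - x)) \<partial>lborel \<partial>lborel)"
      by (subst lborel.nn_integral_fst[symmetric]) (simp_all add: ennreal_mult nn)
    also have "\<dots> = (\<integral>\<^sup>+x. ennreal (\<sigma> x) * (\<integral>\<^sup>+y. ennreal (k (y - x)) \<partial>lborel) \<partial>lborel)"
      by (intro nn_integral_cong nn_integral_cmult) measurable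
    also have "\<dots> = 1"
      using nn_integral_lborel_shift_minus[of "\<lambda>y. ennreal (k y)"] k1 s1 by simp
    finally show ?thesis .
  qed
  have fin': "(\<integral>\<^sup>+p. ennreal (\<sigma> (snd p) * k (snd p - fst p)) \<partial>?N) = 1"
  proof -
    have "(\<integral>\<^sup>+p. ennreal (\<sigma> (snd p) * k (snd p - fst p)) \<partial>?N)
      = (\<integral>\<^sup>+y. \<integral>\<^sup>+x. ennreal (\<sigma> y * k (y - x)) \<partial>lborel \<partial>lborel)"
      by (subst lborel_pair.nn_integral_snd[symmetric]) simp_all
    also have "\<dots> = (\<integral>\<^sup>+x. \<integral>\<^sup>+y. ennreal (\<sigma> x * k (y - x)) \<partial>lborel \<partial>lborel)" by (simp only: kc)
    also have "\<dots> = (\<integral>\<^sup>+p. ennreal (\<sigma> (fst p) * k (snd p - fst p)) \<partial>?N)"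
      by (subst lborel.nn_integral_fst[symmetric]) simp_all
    finally show ?thesis using fin by simp
  qed
  have i1: "integrable ?N (\<lambda>p. h p * (\<sigma> (fst p) * k (snd p - fst p)))"
    and i2: "integrable ?N (\<lambda>p. h p * (\<sigma> (snd p) * k (snd p - fst p)))"
    if [measurable]: "h \<in> borel_measurable ?N" and "\<And>p. \<bar>h p\<bar> \<le> B" for h
    using that fin fin' nn by (auto intro!: integrable_bounded_density[where B=B])
  have fm: "(\<lambda>p. f (fst p)) \<in> borel_measurable ?N" "(\<lambda>p. f (snd p)) \<in> borel_measurable ?N" by measurable
  note a = i1[OF fm(1) B] i1[OF fm(2) B] i2[OF fm(1) B] i2[OF fm(2) B]
  have eq: "(\<lambda>p. (f (fst p) - f (snd p)) * (\<sigma> (fst p) - \<sigma> (snd p)) * k (snd p - fst p))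
    = (\<lambda>p. f (fst p) * (\<sigma> (fst p) * k (snd p - fst p)) - f (snd p) * (\<sigma> (fst p) * k (snd p - fst p))
      - f (fst p) * (\<sigma> (snd p) * k (snd p - fst p)) + f (snd p) * (\<sigma> (snd p) * k (snd p - fst p)))"
    by (simp add: algebra_simps)
  show "integrable ?N (\<lambda>p. (f (fst p) - f (snd p)) * (\<sigma> (fst p) - \<sigma> (snd p)) * k (snd p - fst p))"
    unfolding eq by (intro Bochner_Integration.integrable_add Bochner_Integration.integrable_diff a)
  \<comment> \<open>In the four products, a free variable is integrated out: if f and \<sigma> sit
    at the same point, k contributes its mass 1, otherwise it forms the convolution.\<close>
  have v1: "(LINT p|?N. f (fst p) * (\<sigma> (fst p) * k (snd p - fst p))) = (LINT x|lborel. f x * \<sigma> x)"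
    using lborel_pair.integral_fst'[OF a(1)] by (simp add: k1x)
  have v2: "(LINT p|?N. f (snd p) * (\<sigma> (fst p) * k (snd p - fst p))) = (LINT x|lborel. f x * \<tau> x)"
  proof -
    have "integrable ?N (\<lambda>(x, y). f y * (\<sigma> x * k (y - x)))" using a(2) by (simp only: case_prod_beta')
    from lborel_pair.integral_snd[OF this] show ?thesis by (simp add: case_prod_beta' \<tau>_def)
  qed
  have v3: "(LINT p|?N. f (fst p) * (\<sigma> (snd p) * k (snd p - fst p))) = (LINT x|lborel. f x * \<tau> x)"
    using lborel_pair.integral_fst'[OF a(3)] by (simp add: \<tau>_def kc)
  have v4: "(LINT p|?N. f (snd p) * (\<sigma> (snd p) * k (snd p - fst p))) = (LINT x|lborel. f x * \<sigma> x)"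
  proof -
    have "integrable ?N (\<lambda>(x, y). f y * (\<sigma> y * k (y - x)))" using a(4) by (simp only: case_prod_beta')
    from lborel_pair.integral_snd[OF this] show ?thesis by (simp add: case_prod_beta' k1y)
  qed
  show "(LINT p|?N. (f (fst p) - f (snd p)) * (\<sigma> (fst p) - \<sigma> (snd p)) * k (snd p - fst p))
      = 2 * ((LINT x|lborel. f x * \<sigma> x) - (LINT x|lborel. f x * \<tau> x))"
    unfolding eq using a by (simp add: v1 v2 v3 v4)
qed

end

subsection \<open>Weakly continuous curves\<close>

lemma weakly_continuous_curve_prob:
  assumes "weakly_continuous_curve \<mu>" "t \<in> {0..1}"
  shows "prob_space (\<mu> t)" "sets (\<mu> t) = sets borel"
  using assms unfolding weakly_continuous_curve_def space_prob_algebra by auto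

text \<open>Continues a curve on [0, 1] by its end values, so that measurability and continuity can
  be stated on the whole line. Before and after the middle piece, the glued curve uses these frozen
  values.\<close>

definition clamp01 :: "real \<Rightarrow> real" where "clamp01 t = max 0 (min 1 t)"

lemma clamp01_in: "clamp01 t \<in> {0..1}"
  by (simp add: clamp01_def)

lemma clamp01_bounds [simp]: "0 \<le> clamp01 t" "clamp01 t \<le> 1"
  by (simp_all add: clamp01_def)

lemma clamp01_id: "t \<in> {0..1} \<Longrightarrow> clamp01 t = t"
  by (simp add: clamp01_def)

lemma clamp01_continuous: "continuous_on S clamp01"
  unfolding clamp01_def[abs_def] by (intro continuous_intros)

lemma clamp01_measurable [measurable]: "clamp01 \<in> borel_measurable borel"
  by (rule borel_measurable_continuous_onI[OF clamp01_continuous])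

lemma weakly_continuous_curve_integral:
  fixes f :: "'a::topological_space \<Rightarrow> real"
  assumes "weakly_continuous_curve \<mu>" "continuous_on UNIV f" "bounded (range f)"
  shows "continuous_on UNIV (\<lambda>t. LINT x|\<mu> (clamp01 t). f x)"
proof -
  have "continuous_on {0..1} (\<lambda>t. LINT x|\<mu> t. f x)"
    using assms unfolding weakly_continuous_curve_def by blast
  then show ?thesis
    by (rule continuous_on_compose2[OF _ clamp01_continuous]) (auto simp: clamp01_in image_subset_iff)
qed

text \<open>The open sets generate the Borel sets and are stable under intersection, and the
  indicator of an open U is the increasing limit of the bounded continuous functions min 1 (n d(x,
  -U)). Hence the mass of U is a limit of continuous functions of time.\<close>

lemma weakly_continuous_curve_measurable:
  fixes \<mu> :: "real \<Rightarrow> 'a::metric_space measure"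
  assumes \<mu>: "weakly_continuous_curve \<mu>"
  shows "(\<lambda>t. \<mu> (clamp01 t)) \<in> borel \<rightarrow>\<^sub>M prob_algebra borel"
proof (rule measurable_prob_algebra_generated)
  show "sets (borel :: 'a measure) = sigma_sets UNIV {S. open S}" by (rule sets_borel)
  show "Int_stable {S :: 'a set. open S}" by (auto simp: Int_stable_def)
  show "prob_space (\<mu> (clamp01 t))" "sets (\<mu> (clamp01 t)) = sets borel" for t
    using weakly_continuous_curve_prob[OF \<mu> clamp01_in] by auto
  fix U :: "'a set" assume "U \<in> {S. open S}"
  then have U: "open U" by simp
  show "(\<lambda>t. emeasure (\<mu> (clamp01 t)) U) \<in> borel_measurable borel"
  \<comment> \<open>\<open>infdist\<close> to the empty set is 0, so the approximating functions
    would vanish for the full space.\<close>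
  proof (cases "U = UNIV")
    case True
    have "emeasure (\<mu> (clamp01 t)) UNIV = 1" for t
      using prob_space.emeasure_space_1[OF weakly_continuous_curve_prob(1)[OF \<mu> clamp01_in]]
        sets_eq_imp_space_eq[OF weakly_continuous_curve_prob(2)[OF \<mu> clamp01_in]] by simp
    then show ?thesis using True by simp
  next
    case False
    define f where "f n x = min 1 (real n * infdist x (- U))" for n x
    have fc: "continuous_on UNIV (f n)" for n
      unfolding f_def by (intro continuous_intros)
    have fb: "0 \<le> f n x" "f n x \<le> 1" for n x
      by (simp_all add: f_def infdist_nonneg)
    have fl: "(\<lambda>n. f n x) \<longlonglongrightarrow> indicator U x" for x
    proof (cases "x \<in> U")
      case True
      have "0 < infdist x (- U)"
        using True U False infdist_pos_not_in_closed[of "- U" x] by auto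
      then obtain N where N: "1 \<le> real N * infdist x (- U)"
        using reals_Archimedean3[of "infdist x (- U)"] less_imp_le by blast
      have "f n x = 1" if "N \<le> n" for n
      proof -
        have "real N * infdist x (- U) \<le> real n * infdist x (- U)"
          using that by (intro mult_right_mono) (auto simp: infdist_nonneg)
        then show ?thesis using N by (simp add: f_def)
      qed
      then have "\<forall>\<^sub>F n in sequentially. f n x = 1" by (auto simp: eventually_sequentially)
      then show ?thesis using True by (simp add: tendsto_eventually)
    next
      case False
      then have "f n x = 0" for n by (simp add: f_def)
      then show ?thesis using False by simp
    qed
    have m: "(\<lambda>t. LINT x|\<mu> (clamp01 t). f n x) \<in> borel_measurable borel" for n
    proof (rule borel_measurable_continuous_onI, rule weakly_continuous_curve_integral[OF \<mu> fc])
      show "bounded (range (f n))" using fb by (auto intro!: boundedI[of _ 1])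
    qed
    have lim: "(\<lambda>n. LINT x|\<mu> (clamp01 t). f n x) \<longlonglongrightarrow> measure (\<mu> (clamp01 t)) U" for t
    proof -
      interpret P: prob_space "\<mu> (clamp01 t)" by (rule weakly_continuous_curve_prob[OF \<mu> clamp01_in])
      note s = weakly_continuous_curve_prob(2)[OF \<mu> clamp01_in, of t]
      have Us: "U \<in> sets (\<mu> (clamp01 t))" unfolding s by (rule borel_open[OF U])
      have "(\<lambda>n. LINT x|\<mu> (clamp01 t). f n x) \<longlonglongrightarrow> (LINT x|\<mu> (clamp01 t). indicator U x)"
      proof (rule integral_dominated_convergence[where w="\<lambda>_. 1"])
        show "f n \<in> borel_measurable (\<mu> (clamp01 t))" for n
          using borel_measurable_continuous_onI[OF fc] measurable_cong_sets[OF s refl] by blast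
        show "(indicator U :: 'a \<Rightarrow> real) \<in> borel_measurable (\<mu> (clamp01 t))"
          using Us by simp
      qed (use fb fl in auto)
      then show ?thesis using Us sets.sets_into_space[OF Us] by (simp add: Int_absorb2)
    qed
    have "(\<lambda>t. measure (\<mu> (clamp01 t)) U) \<in> borel_measurable borel"
      by (rule borel_measurable_LIMSEQ_real[OF lim m])
    moreover have "emeasure (\<mu> (clamp01 t)) U = ennreal (measure (\<mu> (clamp01 t)) U)" for t
    proof -
      interpret P: prob_space "\<mu> (clamp01 t)" by (rule weakly_continuous_curve_prob[OF \<mu> clamp01_in])
      show ?thesis by (rule P.emeasure_eq_measure)
    qed
    ultimately show ?thesis by simp
  qed
qed simp

text \<open>Weak continuity speaks of a fixed function. The change of the function with time is
  uniformly small in x by the Lipschitz bound, and the measures have mass 1.\<close>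

lemma weakly_continuous_curve_smooth:
  fixes \<Phi> :: "real \<times> 'a::euclidean_space \<Rightarrow> real"
  assumes \<mu>: "weakly_continuous_curve \<mu>" and \<Phi>: "smooth_compact \<Phi>"
  shows "continuous_on {0..1} (\<lambda>t. LINT x|\<mu> t. \<Phi> (t, x))"
proof -
  obtain L where L: "0 \<le> L" "\<And>z w. \<bar>\<Phi> z - \<Phi> w\<bar> \<le> L * dist z w"
    using smooth_compact_Lipschitz[OF \<Phi>] by blast
  obtain B where B: "\<And>z. \<bar>\<Phi> z\<bar> \<le> B" using smooth_compact_bounded[OF \<Phi>] by blast
  have c: "continuous_on UNIV (\<lambda>x. \<Phi> (s, x))" for s
    by (rule continuous_on_compose2[OF smooth_continuous_on[OF smooth_compact_smooth[OF \<Phi>]]])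
      (auto intro!: continuous_intros)
  have i: "integrable (\<mu> t) (\<lambda>x. \<Phi> (s, x))" if "t \<in> {0..1}" for s t
  proof -
    interpret P: prob_space "\<mu> t" by (rule weakly_continuous_curve_prob[OF \<mu> that])
    show ?thesis
    proof (rule P.integrable_const_bound)
      show "AE x in \<mu> t. norm (\<Phi> (s, x)) \<le> B" using B by simp
      show "(\<lambda>x. \<Phi> (s, x)) \<in> borel_measurable (\<mu> t)"
        using borel_measurable_continuous_onI[OF c]
          measurable_cong_sets[OF weakly_continuous_curve_prob(2)[OF \<mu> that] refl] by blast
    qed
  qed
  show ?thesis
    unfolding continuous_on_def
  proof
    fix s :: real assume s: "s \<in> {0..1}"
    have "continuous_on {0..1} (\<lambda>t. LINT x|\<mu> t. \<Phi> (s, x))"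
    proof -
      have "bounded (range (\<lambda>x. \<Phi> (s, x)))" using B by (intro boundedI[of _ B]) auto
      then show ?thesis using \<mu> c[of s] unfolding weakly_continuous_curve_def by blast
    qed
    then have l1: "((\<lambda>t. LINT x|\<mu> t. \<Phi> (s, x)) \<longlongrightarrow> (LINT x|\<mu> s. \<Phi> (s, x))) (at s within {0..1})"
      using s unfolding continuous_on_def by blast
    have l2: "((\<lambda>t. (LINT x|\<mu> t. \<Phi> (t, x)) - (LINT x|\<mu> t. \<Phi> (s, x))) \<longlongrightarrow> 0) (at s within {0..1})"
    proof (rule Lim_null_comparison)
      show "\<forall>\<^sub>F t in at s within {0..1}. norm ((LINT x|\<mu> t. \<Phi> (t, x)) - (LINT x|\<mu> t. \<Phi> (s, x))) \<le> L * dist t s"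
        unfolding eventually_at_filter
      proof (intro always_eventually allI impI)
        fix t :: real assume t: "t \<in> {0..1}"
        interpret P: prob_space "\<mu> t" by (rule weakly_continuous_curve_prob[OF \<mu> t])
        have "(LINT x|\<mu> t. \<Phi> (t, x)) - (LINT x|\<mu> t. \<Phi> (s, x)) = (LINT x|\<mu> t. \<Phi> (t, x) - \<Phi> (s, x))"
          by (rule Bochner_Integration.integral_diff[OF i[OF t] i[OF t], symmetric])
        also have "norm \<dots> \<le> (LINT x|\<mu> t. norm (\<Phi> (t, x) - \<Phi> (s, x)))"
          by (rule integral_norm_bound)
        also have "\<dots> \<le> (LINT x|\<mu> t. L * dist t s)"
        proof (rule integral_mono)
          show "integrable (\<mu> t) (\<lambda>x. norm (\<Phi> (t, x) - \<Phi> (s, x)))"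
            by (intro integrable_norm Bochner_Integration.integrable_diff i t)
          show "norm (\<Phi> (t, x) - \<Phi> (s, x)) \<le> L * dist t s" for x
            using L(2)[of "(t, x)" "(s, x)"] by (simp add: dist_Pair_Pair)
        qed simp
        also have "\<dots> = L * dist t s" by (simp add: P.prob_space)
        finally show "norm ((LINT x|\<mu> t. \<Phi> (t, x)) - (LINT x|\<mu> t. \<Phi> (s, x))) \<le> L * dist t s"
          by simp
      qed
      have "((\<lambda>t. L * dist t s) \<longlongrightarrow> L * dist s s) (at s within {0..1})"
        by (intro tendsto_mult tendsto_const tendsto_dist tendsto_ident_at)
      then show "((\<lambda>t. L * dist t s) \<longlongrightarrow> 0) (at s within {0..1})" by simp
    qed
    from tendsto_add[OF l2 l1]
    show "((\<lambda>t. LINT x|\<mu> t. \<Phi> (t, x)) \<longlongrightarrow> (LINT x|\<mu> s. \<Phi> (s, x))) (at s within {0..1})"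
      by (simp only: diff_add_cancel add_0_left)
  qed
qed

subsection \<open>Duality for the action\<close>

lemma ennreal_add_le: "ennreal (a + b) \<le> ennreal a + ennreal b"
proof -
  have "ennreal (a + b) \<le> ennreal (max 0 a + max 0 b)" by (rule ennreal_leI) simp
  also have "\<dots> = ennreal (max 0 a) + ennreal (max 0 b)" by (rule ennreal_plus) auto
  also have "\<dots> = ennreal a + ennreal b" by (simp add: max_def ennreal_neg)
  finally show ?thesis .
qed

text \<open>The Legendre inequality w f \<le> w^2 / (2 \<theta>) + \<theta> f^2 / 2, followed by the
  linear majorant of \<theta>. The left-hand side is split into the two parts of w because a signed
  measure is a pair of measures. If \<theta> = 0, the action density is infinite unless w =
  0.\<close>

lemma action_density_duality:
  assumes "0 \<le> s" "0 \<le> t" and \<theta>: "log_mean s t \<le> a * s + b * t" and "0 \<le> a" "0 \<le> b"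
  shows "ennreal w * ennreal f + ennreal (- w) * ennreal (- f)
    \<le> action_density w s t + (ennreal (a * f\<^sup>2) * ennreal s + ennreal (b * f\<^sup>2) * ennreal t) / 2"
proof -
  let ?\<theta> = "log_mean s t"
  have l: "ennreal w * ennreal f + ennreal (- w) * ennreal (- f) \<le> ennreal \<bar>w * f\<bar>"
  proof (cases "0 \<le> w")
    case True
    then have "ennreal w * ennreal f = ennreal (w * f)" by (simp add: ennreal_mult')
    then show ?thesis using True by (simp add: ennreal_neg ennreal_leI)
  next
    case False
    then have "ennreal (- w) * ennreal (- f) = ennreal ((- w) * (- f))"
      by (intro ennreal_mult'[symmetric]) simp
    then show ?thesis using False by (simp add: ennreal_neg ennreal_leI)
  qed
  show ?thesis
  proof (cases "?\<theta> = 0")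
    case True
    then show ?thesis using l by (cases "w = 0") (auto simp: action_density_def)
  next
    case False
    then have p: "0 < ?\<theta>" using log_mean_nonneg[of s t] by simp
    have "\<bar>w * f\<bar> \<le> w\<^sup>2 / (2 * ?\<theta>) + ?\<theta> * f\<^sup>2 / 2"
    proof -
      have "2 * (\<bar>w\<bar> * \<bar>f\<bar>) \<le> ?\<theta> * f\<^sup>2 + w\<^sup>2 / ?\<theta>"
        using two_mult_le_weighted[OF p, of f w] by (simp add: mult.commute)
      then show ?thesis unfolding abs_mult using p by (simp add: field_simps)
    qed
    also have "\<dots> \<le> w\<^sup>2 / (2 * ?\<theta>) + (a * s + b * t) * f\<^sup>2 / 2"
      using \<theta> by (intro add_left_mono divide_right_mono mult_right_mono) auto
    finally have "ennreal \<bar>w * f\<bar> \<le> ennreal (w\<^sup>2 / (2 * ?\<theta>) + (a * s + b * t) * f\<^sup>2 / 2)"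
      by (rule ennreal_leI)
    also have "\<dots> = ennreal (w\<^sup>2 / (2 * ?\<theta>)) + ennreal ((a * s + b * t) * f\<^sup>2 / 2)"
      using p assms by (intro ennreal_plus) auto
    also have "ennreal ((a * s + b * t) * f\<^sup>2 / 2) = (ennreal (a * f\<^sup>2) * ennreal s + ennreal (b * f\<^sup>2) * ennreal t) / 2"
      using assms by (simp add: algebra_simps flip: ennreal_mult ennreal_plus ennreal_divide_numeral)
    finally show ?thesis using l p by (simp add: action_density_def)
  qed
qed

context jump_density
begin

text \<open>A majorant linear in both densities integrates to expressions in
  \<open>jump_measure\<close> and \<open>jump_measure_swap\<close> alone, so the reference measure
  \<sigma> disappears from the error term. The bound can therefore be proved for each representation
  separately and passes to the infimum in the action.\<close>

lemma action_tangent_bound: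
  fixes f :: "'a \<times> 'a \<Rightarrow> real" and \<mu> :: "'a measure"
  assumes \<mu>: "sets \<mu> = sets borel"
    and f: "f \<in> borel_measurable borel" and a: "a \<in> borel_measurable borel" and b: "b \<in> borel_measurable borel"
    and ab: "\<And>p. 0 \<le> a p" "\<And>p. 0 \<le> b p"
    and tangent: "\<And>p s t. 0 \<le> s \<Longrightarrow> 0 \<le> t \<Longrightarrow> log_mean s t \<le> a p * s + b p * t"
  shows "ennreal (signed_integral N f) \<le> action K \<mu> N
    + ((\<integral>\<^sup>+p. ennreal (a p * (f p)\<^sup>2) \<partial>jump_measure \<mu> K)
      + (\<integral>\<^sup>+p. ennreal (b p * (f p)\<^sup>2) \<partial>jump_measure_swap \<mu> K)) / 2"
    (is "_ \<le> _ + ?X")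
\<comment> \<open>The error term is moved to the left by truncated subtraction, leaving the infimum
  alone on the right. This is reversible only when the term is finite.\<close>
proof (cases "?X = \<top>")
  case True
  then show ?thesis by simp
next
  case False
  have "ennreal (signed_integral N f) - ?X \<le> action K \<mu> N"
    unfolding action_def
  proof (rule Inf_greatest)
    fix A assume "A \<in> {(\<integral>\<^sup>+ p. action_density (w p) (\<rho>\<^sub>1 p) (\<rho>\<^sub>2 p) \<partial>\<sigma>) | \<sigma> w \<rho>\<^sub>1 \<rho>\<^sub>2.
      radon_offdiag \<sigma> \<and>
      w \<in> borel_measurable \<sigma> \<and> \<rho>\<^sub>1 \<in> borel_measurable \<sigma> \<and> \<rho>\<^sub>2 \<in> borel_measurable \<sigma> \<and>
      (\<forall>p. 0 \<le> \<rho>\<^sub>1 p \<and> 0 \<le> \<rho>\<^sub>2 p) \<and>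
      jump_measure \<mu> K = density \<sigma> (\<lambda>p. ennreal (\<rho>\<^sub>1 p)) \<and>
      jump_measure_swap \<mu> K = density \<sigma> (\<lambda>p. ennreal (\<rho>\<^sub>2 p)) \<and>
      N = signed_density \<sigma> w}"
    then obtain \<sigma> w \<rho>\<^sub>1 \<rho>\<^sub>2 where A: "A = (\<integral>\<^sup>+ p. action_density (w p) (\<rho>\<^sub>1 p) (\<rho>\<^sub>2 p) \<partial>\<sigma>)"
      and \<sigma>: "radon_offdiag \<sigma>" and [measurable]: "w \<in> borel_measurable \<sigma>" "\<rho>\<^sub>1 \<in> borel_measurable \<sigma>" "\<rho>\<^sub>2 \<in> borel_measurable \<sigma>"
      and nn: "\<And>p. 0 \<le> \<rho>\<^sub>1 p" "\<And>p. 0 \<le> \<rho>\<^sub>2 p"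
      and J1: "jump_measure \<mu> K = density \<sigma> (\<lambda>p. ennreal (\<rho>\<^sub>1 p))"
      and J2: "jump_measure_swap \<mu> K = density \<sigma> (\<lambda>p. ennreal (\<rho>\<^sub>2 p))"
      and N: "N = signed_density \<sigma> w"
      by (elim CollectE exE conjE) blast
    have s: "sets \<sigma> = sets offdiag_borel" using \<sigma> by (simp add: radon_offdiag_def)
    note [measurable] = measurable_offdiag_borel[OF s f] measurable_offdiag_borel[OF s a] measurable_offdiag_borel[OF s b]
    let ?u = "\<lambda>p. ennreal (a p * (f p)\<^sup>2) * ennreal (\<rho>\<^sub>1 p)" and ?v = "\<lambda>p. ennreal (b p * (f p)\<^sup>2) * ennreal (\<rho>\<^sub>2 p)"
    have "(\<integral>\<^sup>+p. (?u p + ?v p) / 2 \<partial>\<sigma>) = (\<integral>\<^sup>+p. ?u p + ?v p \<partial>\<sigma>) / 2"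
      by (rule nn_integral_divide) measurable
    moreover have "(\<integral>\<^sup>+p. ?u p + ?v p \<partial>\<sigma>) = (\<integral>\<^sup>+p. ?u p \<partial>\<sigma>) + (\<integral>\<^sup>+p. ?v p \<partial>\<sigma>)"
      by (rule nn_integral_add) measurable
    moreover have "(\<integral>\<^sup>+p. ?u p \<partial>\<sigma>) = (\<integral>\<^sup>+p. ennreal (a p * (f p)\<^sup>2) \<partial>jump_measure \<mu> K)"
      unfolding J1 by (subst nn_integral_density) (measurable, simp only: mult.commute)
    moreover have "(\<integral>\<^sup>+p. ?v p \<partial>\<sigma>) = (\<integral>\<^sup>+p. ennreal (b p * (f p)\<^sup>2) \<partial>jump_measure_swap \<mu> K)"
      unfolding J2 by (subst nn_integral_density) (measurable, simp only: mult.commute)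
    ultimately have X: "(\<integral>\<^sup>+p. (?u p + ?v p) / 2 \<partial>\<sigma>) = ?X" by (simp only:)
    have "signed_integral N f = (LINT p|density \<sigma> (\<lambda>p. ennreal (w p)). f p) - (LINT p|density \<sigma> (\<lambda>p. ennreal (- w p)). f p)"
      by (simp add: signed_integral_def N signed_density_def)
    also have "\<dots> = (LINT p|density \<sigma> (\<lambda>p. ennreal (w p)). f p) + (LINT p|density \<sigma> (\<lambda>p. ennreal (- w p)). - f p)"
      by simp
    also have "ennreal \<dots> \<le> ennreal (LINT p|density \<sigma> (\<lambda>p. ennreal (w p)). f p) + ennreal (LINT p|density \<sigma> (\<lambda>p. ennreal (- w p)). - f p)"
      by (rule ennreal_add_le)
    also have "\<dots> \<le> (\<integral>\<^sup>+p. ennreal (f p) \<partial>density \<sigma> (\<lambda>p. ennreal (w p))) + (\<integral>\<^sup>+p. ennreal (- f p) \<partial>density \<sigma> (\<lambda>p. ennreal (- w p)))"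
      by (intro add_mono ennreal_integral_le)
    also have "\<dots> = (\<integral>\<^sup>+p. ennreal (w p) * ennreal (f p) \<partial>\<sigma>) + (\<integral>\<^sup>+p. ennreal (- w p) * ennreal (- f p) \<partial>\<sigma>)"
      by (subst (1 2) nn_integral_density) measurable
    also have "\<dots> = (\<integral>\<^sup>+p. ennreal (w p) * ennreal (f p) + ennreal (- w p) * ennreal (- f p) \<partial>\<sigma>)"
      by (rule nn_integral_add[symmetric]) measurable
    also have "\<dots> \<le> (\<integral>\<^sup>+p. action_density (w p) (\<rho>\<^sub>1 p) (\<rho>\<^sub>2 p)
      + (ennreal (a p * (f p)\<^sup>2) * ennreal (\<rho>\<^sub>1 p) + ennreal (b p * (f p)\<^sup>2) * ennreal (\<rho>\<^sub>2 p)) / 2 \<partial>\<sigma>)"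
      by (intro nn_integral_mono action_density_duality nn ab tangent)
    also have "\<dots> = A + (\<integral>\<^sup>+p. (?u p + ?v p) / 2 \<partial>\<sigma>)"
      unfolding A by (rule nn_integral_add) (unfold action_density_def, measurable)
    also have "\<dots> = A + ?X" by (simp only: X)
    finally have "ennreal (signed_integral N f) \<le> ?X + A" by (simp only: add.commute)
    then show "ennreal (signed_integral N f) - ?X \<le> A"
      unfolding ennreal_minus_le_iff using False by blast
  qed
  then have "ennreal (signed_integral N f) \<le> ?X + action K \<mu> N"
    unfolding ennreal_minus_le_iff by blast
  then show ?thesis by (simp only: add.commute)
qed

end

section \<open>The limiting potential and its flux\<close>

context levy_kernel
begin

lemma set_integrable_density_curve:
  fixes \<rho> :: "real \<Rightarrow> 'a \<Rightarrow> real" and F :: "real \<times> 'a \<Rightarrow> real"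
  assumes \<rho> [measurable]: "(\<lambda>(t, x). \<rho> t x) \<in> borel_measurable (borel \<Otimes>\<^sub>M borel)"
    and pos: "\<And>t x. 0 \<le> \<rho> t x" and prob: "\<And>t. (\<integral>\<^sup>+x. ennreal (\<rho> t x) \<partial>lborel) = 1"
    and F [measurable]: "F \<in> borel_measurable (borel \<Otimes>\<^sub>M borel)" and B: "\<And>z. \<bar>F z\<bar> \<le> B"
  shows "integrable lborel (\<lambda>x. F (t, x) * \<rho> t x)"
    and "set_integrable lborel {a..b} (\<lambda>t. LINT x|lborel. F (t, x) * \<rho> t x)"
proof -
  have i: "integrable lborel (\<lambda>x. F (t, x) * \<rho> t x)" for t
    by (rule integrable_bounded_density[where B=B]) (measurable, simp_all add: B pos prob)
  then show "integrable lborel (\<lambda>x. F (t, x) * \<rho> t x)" .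
  have one: "(LINT x|lborel. \<rho> t x) = 1" "integrable lborel (\<rho> t)" for t
  proof -
    show "(LINT x|lborel. \<rho> t x) = 1"
      by (subst integral_eq_nn_integral) (measurable, simp_all add: pos prob)
    then show "integrable lborel (\<rho> t)" using not_integrable_integral_eq by fastforce
  qed
  have m: "(\<lambda>t. LINT x|lborel. F (t, x) * \<rho> t x) \<in> borel_measurable borel"
    by (rule lborel.borel_measurable_lebesgue_integral) measurable
  have b: "\<bar>LINT x|lborel. F (t, x) * \<rho> t x\<bar> \<le> B" for t
  proof -
    have "\<bar>LINT x|lborel. F (t, x) * \<rho> t x\<bar> \<le> (LINT x|lborel. \<bar>F (t, x) * \<rho> t x\<bar>)"
      by (rule integral_abs_bound)
    also have "\<dots> \<le> (LINT x|lborel. B * \<rho> t x)"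
    proof (rule integral_mono)
      show "integrable lborel (\<lambda>x. \<bar>F (t, x) * \<rho> t x\<bar>)" using i by (rule integrable_abs)
      show "integrable lborel (\<lambda>x. B * \<rho> t x)" using one(2) by (rule integrable_mult_right)
      show "\<bar>F (t, x) * \<rho> t x\<bar> \<le> B * \<rho> t x" for x
        unfolding abs_mult using mult_right_mono[OF B pos] pos[of t x] by simp
    qed
    also have "\<dots> = B" by (simp add: one)
    finally show ?thesis .
  qed
  show "set_integrable lborel {a..b} (\<lambda>t. LINT x|lborel. F (t, x) * \<rho> t x)"
    unfolding set_integrable_def
  proof (rule Bochner_Integration.integrable_bound)
    have "integrable lborel (indicator {a..b} :: real \<Rightarrow> real)"
      by (rule integrable_real_indicator) (simp_all add: emeasure_lborel_Icc_eq)
    then show "integrable lborel (\<lambda>t. indicator {a..b} t *\<^sub>R B)" by simp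
    show "AE t in lborel. norm (indicator {a..b} t *\<^sub>R (LINT x|lborel. F (t, x) * \<rho> t x)) \<le> norm (indicator {a..b} t *\<^sub>R B)"
      using b by (intro AE_I2) (auto simp: indicator_def intro: order_trans[OF _ abs_ge_self])
  qed (use m in measurable)
qed

text \<open>The minimisation lemma for test functions, with the gradient as operator and minus the
  pairing with the time derivative as functional. What it leaves open is that the limit is a
  gradient, and this is where positivity of \<rho> and of j is used.\<close>

lemma realize_potential:
  fixes \<rho> :: "real \<Rightarrow> 'a \<Rightarrow> real"
  assumes \<rho> [measurable]: "(\<lambda>(t, x). \<rho> t x) \<in> borel_measurable (borel \<Otimes>\<^sub>M borel)"
    and pos: "\<And>t x. 0 < \<rho> t x" and prob: "\<And>t. (\<integral>\<^sup>+x. ennreal (\<rho> t x) \<partial>lborel) = 1"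
    and C: "0 \<le> C"
    and bound: "\<And>\<phi>. test_function \<phi> \<Longrightarrow>
      ennreal (- 2 * (LINT t:{0..1}|lborel. LINT x|lborel. time_deriv \<phi> (t, x) * \<rho> t x))
      \<le> ennreal C + (\<integral>\<^sup>+t\<in>{0..1}. action' lborel K (\<rho> t) (\<lambda>x. \<phi> (t, x)) \<partial>lborel)"
  obtains \<psi> :: "real \<times> 'a \<Rightarrow> real"
  where "\<psi> \<in> borel_measurable (borel \<Otimes>\<^sub>M borel)"
    and "(\<integral>\<^sup>+t\<in>{0..1}. action' lborel K (\<rho> t) (\<lambda>x. \<psi> (t, x)) \<partial>lborel) \<le> ennreal C"
    and "\<And>\<phi>. test_function \<phi> \<Longrightarrow> integrable (weighted_measure \<rho>) (\<lambda>z. gradient \<psi> z * gradient \<phi> z)"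
    and "\<And>\<phi>. test_function \<phi> \<Longrightarrow> (LINT z|weighted_measure \<rho>. gradient \<psi> z * gradient \<phi> z)
      = - (LINT t:{0..1}|lborel. LINT x|lborel. time_deriv \<phi> (t, x) * \<rho> t x)"
proof -
  have nn: "0 \<le> \<rho> t x" for t x using pos[of t x] by simp
  define l where "l \<phi> = - (LINT t:{0..1}|lborel. LINT x|lborel. time_deriv \<phi> (t, x) * \<rho> t x)" for \<phi>
  have tm: "\<phi> \<in> borel_measurable (borel \<Otimes>\<^sub>M borel)" if "test_function \<phi>" for \<phi> :: "real \<times> 'a \<Rightarrow> real"
    by (rule test_function_measurable[OF test_function_smooth_compact[OF that]])
  have fin: "(\<integral>\<^sup>+z. ennreal ((gradient \<phi> z)\<^sup>2) \<partial>weighted_measure \<rho>) < \<infinity>" if "test_function \<phi>" for \<phi>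
    unfolding nn_integral_weighted_gradient[OF \<rho> tm[OF that]]
    by (rule gradient_square_finite[OF \<rho> nn prob test_function_smooth_compact[OF that]])
  have Dm: "gradient \<phi> \<in> borel_measurable (weighted_measure \<rho>)" if "test_function \<phi>" for \<phi>
    by (rule measurable_weighted_measure[OF gradient_measurable[OF tm[OF that]]])
  have Dsq: "integrable (weighted_measure \<rho>) (\<lambda>z. (gradient \<phi> z)\<^sup>2)" if "test_function \<phi>" for \<phi>
    using fin[OF that] Dm[OF that] by (intro integrableI_nonneg) (simp_all add: borel_measurable_power)
  have ll: "l (\<lambda>z. c * f z + d * g z) = c * l f + d * l g" if f: "test_function f" and g: "test_function g" for f g c d
  proof -
    note sf = test_function_smooth_compact[OF f] and sg = test_function_smooth_compact[OF g]
    note tf = smooth_compact_time_deriv[OF sf] and tg = smooth_compact_time_deriv[OF sg]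
    obtain Bf where Bf: "\<And>z. \<bar>time_deriv f z\<bar> \<le> Bf" using smooth_compact_bounded[OF tf] by blast
    obtain Bg where Bg: "\<And>z. \<bar>time_deriv g z\<bar> \<le> Bg" using smooth_compact_bounded[OF tg] by blast
    note If = set_integrable_density_curve[OF \<rho> nn prob test_function_measurable[OF tf] Bf]
    note Ig = set_integrable_density_curve[OF \<rho> nn prob test_function_measurable[OF tg] Bg]
    have "(LINT x|lborel. time_deriv (\<lambda>z. c * f z + d * g z) (t, x) * \<rho> t x)
      = c * (LINT x|lborel. time_deriv f (t, x) * \<rho> t x) + d * (LINT x|lborel. time_deriv g (t, x) * \<rho> t x)" for t
    proof -
      have "time_deriv (\<lambda>z. c * f z + d * g z) (t, x) * \<rho> t x
        = c * (time_deriv f (t, x) * \<rho> t x) + d * (time_deriv g (t, x) * \<rho> t x)" for x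
        by (simp add: time_deriv_lincomb[OF smooth_compact_smooth[OF sf] smooth_compact_smooth[OF sg]] algebra_simps)
      then show ?thesis using If(1)[of t] Ig(1)[of t] by simp
    qed
    then show ?thesis
      unfolding l_def using If(2)[of 0 1] Ig(2)[of 0 1]
      by (simp add: set_integral_add(2) set_integrable_mult_right)
  qed
  have bnd: "2 * l \<phi> \<le> C + (LINT z|weighted_measure \<rho>. (gradient \<phi> z)\<^sup>2)" if \<phi>: "test_function \<phi>" for \<phi>
  proof -
    have "ennreal (2 * l \<phi>) \<le> ennreal C + (\<integral>\<^sup>+z. ennreal ((gradient \<phi> z)\<^sup>2) \<partial>weighted_measure \<rho>)"
      using bound[OF \<phi>] unfolding nn_integral_weighted_gradient[OF \<rho> tm[OF \<phi>]] l_def by simp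
    also have "(\<integral>\<^sup>+z. ennreal ((gradient \<phi> z)\<^sup>2) \<partial>weighted_measure \<rho>) = ennreal (LINT z|weighted_measure \<rho>. (gradient \<phi> z)\<^sup>2)"
      by (rule nn_integral_eq_integral[OF Dsq[OF \<phi>]]) simp
    also have "ennreal C + \<dots> = ennreal (C + (LINT z|weighted_measure \<rho>. (gradient \<phi> z)\<^sup>2))"
      by (rule ennreal_plus[symmetric]) (simp_all add: C)
    finally show ?thesis
      by (subst (asm) ennreal_le_iff) (simp_all add: C)
  qed
  let ?V = "Collect test_function :: (real \<times> 'a \<Rightarrow> real) set"
  have p0: "(\<lambda>x. 0) \<in> ?V" using test_function_zero by simp
  have p1: "(\<lambda>x. c * f x + d * g x) \<in> ?V" if "f \<in> ?V" "g \<in> ?V" for f g c d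
    using that test_function_lincomb by simp
  have p2: "gradient f \<in> borel_measurable (weighted_measure \<rho>)" if "f \<in> ?V" for f using that Dm by simp
  have p3: "integrable (weighted_measure \<rho>) (\<lambda>z. (gradient f z)\<^sup>2)" if "f \<in> ?V" for f using that Dsq by simp
  have p4: "gradient (\<lambda>x. c * f x + d * g x) z = c * gradient f z + d * gradient g z"
    if "f \<in> ?V" "g \<in> ?V" for f g c d z
    by (simp add: gradient_def algebra_simps)
  have p5: "l (\<lambda>x. c * f x + d * g x) = c * l f + d * l g" if "f \<in> ?V" "g \<in> ?V" for f g c d
    using that ll by simp
  have p6: "2 * l f \<le> C + (\<integral>z. (gradient f z)\<^sup>2 \<partial>weighted_measure \<rho>)" if "f \<in> ?V" for f
    using that bnd by simp
  obtain \<phi> where \<phi>: "\<And>n. \<phi> n \<in> Collect test_function"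
    and conv: "AE z in weighted_measure \<rho>. convergent (\<lambda>n. gradient (\<phi> n) z)"
    and lim: "\<And>v. v \<in> borel_measurable (weighted_measure \<rho>) \<Longrightarrow> AE z in weighted_measure \<rho>. (\<lambda>n. gradient (\<phi> n) z) \<longlonglongrightarrow> v z \<Longrightarrow>
      (\<integral>\<^sup>+z. ennreal ((v z)\<^sup>2) \<partial>weighted_measure \<rho>) \<le> ennreal C \<and>
      (\<forall>f\<in>Collect test_function. integrable (weighted_measure \<rho>) (\<lambda>z. v z * gradient f z) \<and> (\<integral>z. v z * gradient f z \<partial>weighted_measure \<rho>) = l f)"
    by (rule dual_minimizer[where V="?V" and D=gradient and M="weighted_measure \<rho>" and l=l and C=C, OF p0 p1 p2 p3 p4 p5 p6])
      (assumption+, rule that)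
  have \<phi>t: "test_function (\<phi> n)" for n using \<phi> by simp
  note [measurable] = tm[OF \<phi>t]
  \<comment> \<open>The Cauchy property rather than convergence, as its set is visibly measurable;
    on the real line the two coincide.\<close>
  let ?Q = "\<lambda>z. Cauchy (\<lambda>n. gradient (\<phi> n) z)"
  have Q [measurable]: "Measurable.pred (borel \<Otimes>\<^sub>M (borel \<Otimes>\<^sub>M borel)) ?Q"
    unfolding pred_def by (rule sets_Collect_Cauchy) (unfold gradient_def[abs_def], measurable)
  have "AE z in weighted_measure \<rho>. ?Q z"
    using conv by eventually_elim (simp add: Cauchy_convergent_iff)
  then have "AE t in lborel. t \<in> {0..1} \<longrightarrow> (AE x in lborel. AE y in lborel. ?Q (t, x, y))"
    unfolding AE_weighted_measure_iff[OF \<rho> pos Q] .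
  then obtain x\<^sub>0 where x0: "AE t in lborel. t \<in> {0..1} \<longrightarrow> (AE y in lborel. ?Q (t, x\<^sub>0, y))"
    using AE_exchange_point[OF Q] by blast
  \<comment> \<open>Only differences of the \<phi> n converge, so each is normalised to vanish at
    the base point \<open>x\<^sub>0\<close> at every time. Measurability is that of a pointwise
    limit, whatever value \<open>lim\<close> takes where there is no convergence.\<close>
  define \<psi> where "\<psi> z = lim (\<lambda>n. \<phi> n z - \<phi> n (fst z, x\<^sub>0))" for z
  have \<psi>m [measurable]: "\<psi> \<in> borel_measurable (borel \<Otimes>\<^sub>M borel)"
    unfolding \<psi>_def[abs_def] by (rule borel_measurable_lim_metric) measurable
  \<comment> \<open>The gradient at (x, y) is the difference of the gradients at
    (\<open>x\<^sub>0\<close>, y) and (\<open>x\<^sub>0\<close>, x), so convergence is asked for at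
    these two pairs.\<close>
  let ?Q2 = "\<lambda>z. ?Q (fst z, x\<^sub>0, fst (snd z)) \<and> ?Q (fst z, x\<^sub>0, snd (snd z))"
  have Q2: "Measurable.pred (borel \<Otimes>\<^sub>M (borel \<Otimes>\<^sub>M borel)) ?Q2" by measurable
  have "AE z in weighted_measure \<rho>. ?Q2 z"
    unfolding AE_weighted_measure_iff[OF \<rho> pos Q2]
    using x0
  proof eventually_elim
    case (elim t)
    show ?case
    proof
      assume "t \<in> {0..1}"
      then have ae: "AE y in lborel. ?Q (t, x\<^sub>0, y)" using elim by blast
      show "AE x in lborel. AE y in lborel. ?Q2 (t, x, y)"
        using ae
      proof eventually_elim
        case (elim x)
        show ?case using ae by eventually_elim (use elim in simp)
      qed
    qed
  qed
  then have "AE z in weighted_measure \<rho>. (\<lambda>n. gradient (\<phi> n) z) \<longlonglongrightarrow> gradient \<psi> z"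
  proof eventually_elim
    case (elim z)
    have c: "(\<lambda>n. \<phi> n (fst z, y) - \<phi> n (fst z, x\<^sub>0)) \<longlonglongrightarrow> \<psi> (fst z, y)" if "?Q (fst z, x\<^sub>0, y)" for y
      using that unfolding \<psi>_def gradient_def by (simp add: Cauchy_convergent_iff convergent_LIMSEQ_iff)
    have "(\<lambda>n. (\<phi> n (fst z, snd (snd z)) - \<phi> n (fst z, x\<^sub>0)) - (\<phi> n (fst z, fst (snd z)) - \<phi> n (fst z, x\<^sub>0)))
      \<longlonglongrightarrow> \<psi> (fst z, snd (snd z)) - \<psi> (fst z, fst (snd z))"
      by (rule tendsto_diff[OF c c]) (use elim in blast)+
    then show ?case by (simp add: gradient_def)
  qed
  from lim[OF measurable_weighted_measure[OF gradient_measurable[OF \<psi>m]] this]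
  have res: "(\<integral>\<^sup>+z. ennreal ((gradient \<psi> z)\<^sup>2) \<partial>weighted_measure \<rho>) \<le> ennreal C"
    "\<And>f. test_function f \<Longrightarrow> integrable (weighted_measure \<rho>) (\<lambda>z. gradient \<psi> z * gradient f z)"
    "\<And>f. test_function f \<Longrightarrow> (\<integral>z. gradient \<psi> z * gradient f z \<partial>weighted_measure \<rho>) = l f"
    by simp_all
  show thesis
    by (rule that[OF \<psi>m]) (use res in \<open>simp_all only: nn_integral_weighted_gradient[OF \<rho> \<psi>m] l_def\<close>)
qed

text \<open>Rewrites integrability and value of an L2 pairing as the two conditions in
  \<open>CE'\<close>: the first conclusion is the finiteness of the flux integral, the second its
  value, with the half coming from the weight.\<close>

lemma weighted_integral_flux:
  fixes \<rho> :: "real \<Rightarrow> 'a \<Rightarrow> real" and \<psi> \<phi> :: "real \<times> 'a \<Rightarrow> real"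
  assumes \<rho> [measurable]: "(\<lambda>(t, x). \<rho> t x) \<in> borel_measurable (borel \<Otimes>\<^sub>M borel)"
    and \<psi>: "\<psi> \<in> borel_measurable (borel \<Otimes>\<^sub>M borel)" and \<phi>: "\<phi> \<in> borel_measurable (borel \<Otimes>\<^sub>M borel)"
    and i: "integrable (weighted_measure \<rho>) (\<lambda>z. gradient \<psi> z * gradient \<phi> z)"
  shows "(\<integral>\<^sup>+ t\<in>{0..1}. (\<integral>\<^sup>+ (x, y). ennreal (\<bar>(\<phi> (t, y) - \<phi> (t, x)) * (\<psi> (t, y) - \<psi> (t, x))\<bar> *
         log_mean (\<rho> t x) (\<rho> t y)) \<partial>Jm) \<partial>lborel) < \<infinity>"
    and "(LINT z|weighted_measure \<rho>. gradient \<psi> z * gradient \<phi> z)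
      = 1 / 2 * (LINT t:{0..1}|lborel. LINT (x, y)|Jm.
        (\<phi> (t, y) - \<phi> (t, x)) * (\<psi> (t, y) - \<psi> (t, x)) * log_mean (\<rho> t x) (\<rho> t y))"
proof -
  note [measurable] = gradient_measurable[OF \<psi>] gradient_measurable[OF \<phi>] weight_measurable[OF \<rho>] \<psi> \<phi>
  let ?G = "\<lambda>z. gradient \<psi> z * gradient \<phi> z"
  let ?q = "\<lambda>t p. (\<phi> (t, snd p) - \<phi> (t, fst p)) * (\<psi> (t, snd p) - \<psi> (t, fst p))"
  let ?\<theta> = "\<lambda>t p. log_mean (\<rho> t (fst p)) (\<rho> t (snd p))"
  have wG: "weight \<rho> (t, p) * ?G (t, p) = indicator {0..1} t * (1 / 2 * (?q t p * ?\<theta> t p))" for t p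
    by (simp add: weight_def gradient_def)
  have "(\<integral>\<^sup>+z. ennreal (norm (?G z)) \<partial>weighted_measure \<rho>) < \<infinity>"
    using i by (simp add: integrable_iff_bounded)
  also have "(\<integral>\<^sup>+z. ennreal (norm (?G z)) \<partial>weighted_measure \<rho>)
    = (\<integral>\<^sup>+t. \<integral>\<^sup>+p. ennreal (weight \<rho> (t, p)) * ennreal (norm (?G (t, p))) \<partial>Jm \<partial>lborel)"
    by (rule nn_integral_weighted_measure[OF \<rho>]) measurable
  also have "\<dots> = (\<integral>\<^sup>+t. ennreal (1 / 2) * ((\<integral>\<^sup>+p. ennreal (\<bar>?q t p\<bar> * ?\<theta> t p) \<partial>Jm) * indicator {0..1} t) \<partial>lborel)"
  proof (rule nn_integral_cong)
    fix t
    have "ennreal (weight \<rho> (t, p)) * ennreal (norm (?G (t, p)))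
      = (ennreal (1 / 2) * indicator {0..1} t) * ennreal (\<bar>?q t p\<bar> * ?\<theta> t p)" for p
    proof -
      have "ennreal (weight \<rho> (t, p)) * ennreal (norm (?G (t, p))) = ennreal \<bar>weight \<rho> (t, p) * ?G (t, p)\<bar>"
        by (simp add: abs_mult weight_nonneg ennreal_mult)
      also have "\<bar>weight \<rho> (t, p) * ?G (t, p)\<bar> = indicator {0..1} t * (1 / 2 * (\<bar>?q t p\<bar> * ?\<theta> t p))"
        unfolding wG by (simp add: abs_mult log_mean_nonneg indicator_def)
      also have "ennreal \<dots> = (ennreal (1 / 2) * indicator {0..1} t) * ennreal (\<bar>?q t p\<bar> * ?\<theta> t p)"
      proof (cases "t \<in> {0..1}")
        case True
        have "ennreal (1 / 2 * (\<bar>?q t p\<bar> * ?\<theta> t p)) = ennreal (1 / 2) * ennreal (\<bar>?q t p\<bar> * ?\<theta> t p)"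
          by (rule ennreal_mult) (simp_all add: log_mean_nonneg)
        then show ?thesis using True by simp
      qed simp
      finally show ?thesis .
    qed
    then have "(\<integral>\<^sup>+p. ennreal (weight \<rho> (t, p)) * ennreal (norm (?G (t, p))) \<partial>Jm)
      = (\<integral>\<^sup>+p. (ennreal (1 / 2) * indicator {0..1} t) * ennreal (\<bar>?q t p\<bar> * ?\<theta> t p) \<partial>Jm)"
      by (rule nn_integral_cong)
    also have "\<dots> = (ennreal (1 / 2) * indicator {0..1} t) * (\<integral>\<^sup>+p. ennreal (\<bar>?q t p\<bar> * ?\<theta> t p) \<partial>Jm)"
      by (rule nn_integral_cmult) measurable
    finally show "(\<integral>\<^sup>+p. ennreal (weight \<rho> (t, p)) * ennreal (norm (?G (t, p))) \<partial>Jm)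
      = ennreal (1 / 2) * ((\<integral>\<^sup>+p. ennreal (\<bar>?q t p\<bar> * ?\<theta> t p) \<partial>Jm) * indicator {0..1} t)"
      by (simp only: mult_ac)
  qed
  also have "\<dots> = ennreal (1 / 2) * (\<integral>\<^sup>+t\<in>{0..1}. (\<integral>\<^sup>+p. ennreal (\<bar>?q t p\<bar> * ?\<theta> t p) \<partial>Jm) \<partial>lborel)"
  proof (rule nn_integral_cmult)
    have [measurable]: "(\<lambda>t. \<integral>\<^sup>+p. ennreal (\<bar>?q t p\<bar> * ?\<theta> t p) \<partial>Jm) \<in> borel_measurable lborel"
      by (rule sigma_finite_measure.borel_measurable_nn_integral[OF sigma_finite_jump_measure]) measurable
    show "(\<lambda>t. (\<integral>\<^sup>+p. ennreal (\<bar>?q t p\<bar> * ?\<theta> t p) \<partial>Jm) * indicator {0..1} t) \<in> borel_measurable lborel"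
      by measurable
  qed
  finally have "ennreal (1 / 2) * (\<integral>\<^sup>+t\<in>{0..1}. (\<integral>\<^sup>+p. ennreal (\<bar>?q t p\<bar> * ?\<theta> t p) \<partial>Jm) \<partial>lborel) < \<infinity>" .
  then have "(\<integral>\<^sup>+t\<in>{0..1}. (\<integral>\<^sup>+p. ennreal (\<bar>?q t p\<bar> * ?\<theta> t p) \<partial>Jm) \<partial>lborel) < \<infinity>"
    by (auto simp: ennreal_mult_less_top)
  then show "(\<integral>\<^sup>+ t\<in>{0..1}. (\<integral>\<^sup>+ (x, y). ennreal (\<bar>(\<phi> (t, y) - \<phi> (t, x)) * (\<psi> (t, y) - \<psi> (t, x))\<bar> *
         log_mean (\<rho> t x) (\<rho> t y)) \<partial>Jm) \<partial>lborel) < \<infinity>"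
    by (simp only: case_prod_beta')
  have ip: "integrable (lborel \<Otimes>\<^sub>M Jm) (\<lambda>z. weight \<rho> z * ?G z)"
  proof -
    have "integrable (lborel \<Otimes>\<^sub>M Jm) (\<lambda>z. weight \<rho> z *\<^sub>R ?G z)"
      using i unfolding weighted_measure_def
      by (subst (asm) integrable_density) (measurable, simp_all add: weight_nonneg)
    then show ?thesis by simp
  qed
  interpret P: pair_sigma_finite "lborel :: real measure" Jm
    by (rule pair_sigma_finite.intro[OF lborel.sigma_finite_measure_axioms sigma_finite_jump_measure])
  have "(LINT z|weighted_measure \<rho>. ?G z) = (LINT z|(lborel \<Otimes>\<^sub>M Jm). weight \<rho> z *\<^sub>R ?G z)"
    unfolding weighted_measure_def
    by (rule integral_density) (measurable, simp_all add: weight_nonneg)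
  also have "\<dots> = (LINT t|lborel. LINT p|Jm. weight \<rho> (t, p) * ?G (t, p))"
    using P.integral_fst'[OF ip] by simp
  also have "\<dots> = (LINT t|lborel. 1 / 2 * (indicator {0..1} t *\<^sub>R (LINT p|Jm. ?q t p * ?\<theta> t p)))"
    by (simp only: wG) simp
  also have "\<dots> = 1 / 2 * (LINT t:{0..1}|lborel. LINT p|Jm. ?q t p * ?\<theta> t p)"
    unfolding set_lebesgue_integral_def by (rule integral_mult_right_zero)
  finally show "(LINT z|weighted_measure \<rho>. gradient \<psi> z * gradient \<phi> z)
      = 1 / 2 * (LINT t:{0..1}|lborel. LINT (x, y)|Jm.
        (\<phi> (t, y) - \<phi> (t, x)) * (\<psi> (t, y) - \<psi> (t, x)) * log_mean (\<rho> t x) (\<rho> t y))"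
    by (simp only: case_prod_beta')
qed

end

subsection \<open>The continuity equation with smooth test functions\<close>

text \<open>The time derivative of \<Phi> is itself Lipschitz, so the Taylor remainder is at most L
  (s - t)^2 uniformly in x and survives integration against a probability density.\<close>

lemma density_time_derivative:
  fixes \<sigma> :: "'a::euclidean_space \<Rightarrow> real"
  assumes [measurable]: "\<sigma> \<in> borel_measurable borel" and nn: "\<And>x. 0 \<le> \<sigma> x"
    and s1: "(\<integral>\<^sup>+x. ennreal (\<sigma> x) \<partial>lborel) = 1" and \<Phi>: "smooth_compact \<Phi>"
  shows "((\<lambda>t. LINT x|lborel. \<Phi> (t, x) * \<sigma> x) has_real_derivative (LINT x|lborel. time_deriv \<Phi> (t, x) * \<sigma> x)) (at t)"
proof -
  note t\<Phi> = smooth_compact_time_deriv[OF \<Phi>]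
  obtain L where L: "0 \<le> L" "\<And>z w. \<bar>time_deriv \<Phi> z - time_deriv \<Phi> w\<bar> \<le> L * dist z w"
    using smooth_compact_Lipschitz[OF t\<Phi>] by blast
  have i: "integrable lborel (\<lambda>x. F (t, x) * \<sigma> x)" if F: "smooth_compact F" for F :: "real \<times> 'a \<Rightarrow> real" and t
  proof -
    obtain B where B: "\<And>z. \<bar>F z\<bar> \<le> B" using smooth_compact_bounded[OF F] by blast
    have "(\<lambda>x. F (t, x)) \<in> borel_measurable borel"
      by (rule borel_measurable_continuous_onI,
          rule continuous_on_compose2[OF smooth_continuous_on[OF smooth_compact_smooth[OF F], of UNIV]])
        (auto intro!: continuous_intros)
    then show ?thesis
      by (intro integrable_bounded_density[where B=B]) (simp_all add: B nn s1)
  qed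
  have si: "integrable lborel \<sigma>" "(LINT x|lborel. \<sigma> x) = 1"
  proof -
    show "integrable lborel \<sigma>" using nn s1 by (intro integrableI_nonneg) auto
    show "(LINT x|lborel. \<sigma> x) = 1" using nn s1 by (subst integral_eq_nn_integral) auto
  qed
  have taylor: "\<bar>\<Phi> (s, x) - \<Phi> (t, x) - (s - t) * time_deriv \<Phi> (t, x)\<bar> \<le> L * \<bar>s - t\<bar> * \<bar>s - t\<bar>" for s x
  proof -
    have "norm ((\<Phi> (s, x) - s * time_deriv \<Phi> (t, x)) - (\<Phi> (t, x) - t * time_deriv \<Phi> (t, x)))
      \<le> (L * \<bar>s - t\<bar>) * norm (s - t)"
    proof (rule field_differentiable_bound[where S="closed_segment s t"])
      fix r assume r: "r \<in> closed_segment s t"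
      show "((\<lambda>r. \<Phi> (r, x) - r * time_deriv \<Phi> (t, x)) has_field_derivative (time_deriv \<Phi> (r, x) - time_deriv \<Phi> (t, x)))
        (at r within closed_segment s t)"
        by (rule derivative_eq_intros smooth_time_deriv[OF smooth_compact_smooth[OF \<Phi>]] refl)+ simp
      have "\<bar>r - t\<bar> \<le> \<bar>s - t\<bar>" using r by (auto simp: closed_segment_eq_real_ivl split: if_splits)
      then have "L * \<bar>r - t\<bar> \<le> L * \<bar>s - t\<bar>" using L(1) by (rule mult_left_mono)
      then show "norm (time_deriv \<Phi> (r, x) - time_deriv \<Phi> (t, x)) \<le> L * \<bar>s - t\<bar>"
        using L(2)[of "(r, x)" "(t, x)"] by (simp add: dist_Pair_Pair dist_real_def)
    qed auto
    then show ?thesis by (simp add: algebra_simps)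
  qed
  let ?u = "\<lambda>t. LINT x|lborel. \<Phi> (t, x) * \<sigma> x" and ?d = "LINT x|lborel. time_deriv \<Phi> (t, x) * \<sigma> x"
  have est: "\<bar>(?u s - ?u t) / (s - t) - ?d\<bar> \<le> L * \<bar>s - t\<bar>" if "s \<noteq> t" for s
  proof -
    have eq: "?u s - ?u t - (s - t) * ?d = (LINT x|lborel. (\<Phi> (s, x) - \<Phi> (t, x) - (s - t) * time_deriv \<Phi> (t, x)) * \<sigma> x)"
    proof -
      have "(\<lambda>x. (\<Phi> (s, x) - \<Phi> (t, x) - (s - t) * time_deriv \<Phi> (t, x)) * \<sigma> x)
        = (\<lambda>x. \<Phi> (s, x) * \<sigma> x - \<Phi> (t, x) * \<sigma> x - (s - t) * (time_deriv \<Phi> (t, x) * \<sigma> x))"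
        by (simp add: left_diff_distrib mult.assoc)
      moreover have "(LINT x|lborel. \<Phi> (s, x) * \<sigma> x - \<Phi> (t, x) * \<sigma> x - (s - t) * (time_deriv \<Phi> (t, x) * \<sigma> x))
        = ?u s - ?u t - (s - t) * ?d"
      proof -
        note i1 = Bochner_Integration.integrable_diff[OF i[OF \<Phi>, of s] i[OF \<Phi>, of t]]
        have i2: "integrable lborel (\<lambda>x. (s - t) * (time_deriv \<Phi> (t, x) * \<sigma> x))"
          by (rule integrable_mult_right) (rule i[OF t\<Phi>])
        show ?thesis
          unfolding Bochner_Integration.integral_diff[OF i1 i2]
            Bochner_Integration.integral_diff[OF i[OF \<Phi>, of s] i[OF \<Phi>, of t]] integral_mult_right_zero ..
      qed
      ultimately show ?thesis by (simp only:)
    qed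
    have "\<bar>?u s - ?u t - (s - t) * ?d\<bar> \<le> (LINT x|lborel. \<bar>(\<Phi> (s, x) - \<Phi> (t, x) - (s - t) * time_deriv \<Phi> (t, x)) * \<sigma> x\<bar>)"
      unfolding eq by (rule integral_abs_bound)
    also have "\<dots> \<le> (LINT x|lborel. (L * \<bar>s - t\<bar> * \<bar>s - t\<bar>) * \<sigma> x)"
    proof (rule integral_mono')
      show "integrable lborel (\<lambda>x. (L * \<bar>s - t\<bar> * \<bar>s - t\<bar>) * \<sigma> x)" using si by simp
      show "\<bar>(\<Phi> (s, x) - \<Phi> (t, x) - (s - t) * time_deriv \<Phi> (t, x)) * \<sigma> x\<bar> \<le> (L * \<bar>s - t\<bar> * \<bar>s - t\<bar>) * \<sigma> x" for x
        unfolding abs_mult using mult_right_mono[OF taylor nn] nn[of x] by simp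
      show "0 \<le> (L * \<bar>s - t\<bar> * \<bar>s - t\<bar>) * \<sigma> x" for x using L(1) nn by simp
    qed
    also have "\<dots> = L * \<bar>s - t\<bar> * \<bar>s - t\<bar>" using si by simp
    finally have le: "\<bar>?u s - ?u t - (s - t) * ?d\<bar> \<le> L * \<bar>s - t\<bar> * \<bar>s - t\<bar>" .
    have gen: "\<bar>A / r - d\<bar> \<le> c" if "r \<noteq> 0" "\<bar>A - r * d\<bar> \<le> c * \<bar>r\<bar>" for A r d c :: real
    proof -
      have "A / r - d = (A - r * d) / r" using that by (simp add: diff_divide_distrib)
      then show ?thesis using that by (simp add: abs_divide divide_le_eq)
    qed
    show ?thesis by (rule gen[OF _ le]) (use that in simp)
  qed
  have "((\<lambda>s. (?u s - ?u t) / (s - t) - ?d) \<longlongrightarrow> 0) (at t)"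
  proof (rule Lim_null_comparison)
    show "\<forall>\<^sub>F s in at t. norm ((?u s - ?u t) / (s - t) - ?d) \<le> L * \<bar>s - t\<bar>"
      unfolding eventually_at_filter using est by simp
    have "((\<lambda>s. L * \<bar>s - t\<bar>) \<longlongrightarrow> L * \<bar>t - t\<bar>) (at t)"
      by (intro tendsto_mult tendsto_const tendsto_rabs tendsto_diff tendsto_ident_at)
    then show "((\<lambda>s. L * \<bar>s - t\<bar>) \<longlongrightarrow> 0) (at t)" by simp
  qed
  then have "((\<lambda>s. (?u s - ?u t) / (s - t)) \<longlongrightarrow> ?d) (at t)" by (rule LIM_zero_cancel)
  then show ?thesis unfolding has_field_derivative_iff .
qed

lemma set_integral_le_nonmeasurable:
  fixes S :: "real \<Rightarrow> real"
  assumes [measurable]: "X \<in> borel_measurable lborel"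
    and le: "\<And>t. t \<in> {0..1} \<Longrightarrow> ennreal (S t) \<le> A t + X t"
  shows "ennreal (LINT t:{0..1}|lborel. S t) \<le> (\<integral>\<^sup>+t\<in>{0..1}. A t \<partial>lborel) + (\<integral>\<^sup>+t\<in>{0..1}. X t \<partial>lborel)"
proof (cases "set_integrable lborel {0..1} S")
  case False
  then have "(LINT t:{0..1}|lborel. S t) = 0"
    unfolding set_integrable_def set_lebesgue_integral_def by (rule not_integrable_integral_eq)
  then show ?thesis by simp
next
  case True
  then have "(\<lambda>t. indicator {0..1} t *\<^sub>R S t) \<in> borel_measurable lborel"
    unfolding set_integrable_def by (rule borel_measurable_integrable)
  then have [measurable]: "(\<lambda>t. ennreal (indicator {0..1} t *\<^sub>R S t)) \<in> borel_measurable lborel"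
    by measurable
  let ?s = "\<lambda>t. ennreal (indicator {0..1} t *\<^sub>R S t)" and ?X = "\<lambda>t. X t * indicator {0..1} t"
  have "ennreal (LINT t:{0..1}|lborel. S t) \<le> (\<integral>\<^sup>+t. ?s t \<partial>lborel)"
    unfolding set_lebesgue_integral_def by (rule ennreal_integral_le)
  also have "\<dots> \<le> (\<integral>\<^sup>+t. (?s t - ?X t) + ?X t \<partial>lborel)"
  proof (rule nn_integral_mono)
    fix t show "?s t \<le> (?s t - ?X t) + ?X t"
      by (metis add.commute ennreal_minus_le_iff order_refl)
  qed
  also have "\<dots> = (\<integral>\<^sup>+t. ?s t - ?X t \<partial>lborel) + (\<integral>\<^sup>+t. ?X t \<partial>lborel)"
    by (rule nn_integral_add) measurable
  also have "\<dots> \<le> (\<integral>\<^sup>+t\<in>{0..1}. A t \<partial>lborel) + (\<integral>\<^sup>+t. ?X t \<partial>lborel)"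
  proof (intro add_right_mono nn_integral_mono)
    fix t :: real
    show "?s t - ?X t \<le> A t * indicator {0..1} t"
    proof (cases "t \<in> {0..1}")
      case True
      then show ?thesis
        using le[of t] unfolding ennreal_minus_le_iff by (simp add: add.commute)
    qed simp
  qed
  finally show ?thesis .
qed

context levy_kernel
begin

text \<open>The continuity equation is tested with \<Psi> times the time cutoff, and the limit of
  the cutoffs produces the boundary values. The coefficients a of the linear majorant are left free:
  they will be slopes of tangent planes at the values of another density. The second slope is a with
  x and y exchanged, which makes the two error terms equal and cancels the factor 1/2.\<close>

lemma CE_dual_estimate:
  fixes \<Psi> :: "real \<times> 'a \<Rightarrow> real" and a :: "real \<Rightarrow> 'a \<Rightarrow> 'a \<Rightarrow> real"
  assumes CE: "(\<mu>, N) \<in> CE \<mu>\<^sub>0 \<mu>\<^sub>1"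
    and a [measurable]: "(\<lambda>(t, x, y). a t x y) \<in> borel_measurable (borel \<Otimes>\<^sub>M (borel \<Otimes>\<^sub>M borel))"
    and a0: "\<And>t x y. 0 \<le> a t x y"
    and tangent: "\<And>t x y r s. 0 \<le> r \<Longrightarrow> 0 \<le> s \<Longrightarrow> log_mean r s \<le> a t x y * r + a t y x * s"
    and \<Psi>: "smooth_compact \<Psi>"
  shows "ennreal (2 * ((LINT x|\<mu> 1. \<Psi> (1, x)) - (LINT x|\<mu> 0. \<Psi> (0, x))
      - (LINT t:{0..1}|lborel. LINT x|\<mu> t. time_deriv \<Psi> (t, x))))
    \<le> (\<integral>\<^sup>+t\<in>{0..1}. action K (\<mu> t) (N t) \<partial>lborel)
      + (\<integral>\<^sup>+t\<in>{0..1}. (\<integral>\<^sup>+x. \<integral>\<^sup>+y. ennreal (a t x y * (\<Psi> (t, y) - \<Psi> (t, x))\<^sup>2) * ennreal (j (y - x)) \<partial>lborel \<partial>\<mu> (clamp01 t)) \<partial>lborel)"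
    (is "_ \<le> ?A + (\<integral>\<^sup>+t\<in>{0..1}. ?X t \<partial>lborel)")
proof -
  have wc: "weakly_continuous_curve \<mu>"
    and ce: "\<And>\<phi>. test_function \<phi> \<Longrightarrow>
      (LINT t:{0..1}|lborel. LINT x|\<mu> t. deriv (\<lambda>s. \<phi> (s, x)) t) +
      1 / 2 * (LINT t:{0..1}|lborel. signed_integral (N t) (\<lambda>(x, y). \<phi> (t, y) - \<phi> (t, x))) = 0"
    using CE unfolding CE_def by blast+
  note [measurable] = test_function_measurable[OF \<Psi>]
  note t\<Psi> = smooth_compact_time_deriv[OF \<Psi>]
  have \<mu>m: "(\<lambda>t. \<mu> (clamp01 t)) \<in> borel \<rightarrow>\<^sub>M subprob_algebra borel"
    using measurable_prob_algebraD[OF weakly_continuous_curve_measurable[OF wc]] .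
  have am' [measurable (raw)]: "(\<lambda>z. a (f z) (g z) (h z)) \<in> borel_measurable Q"
    if "f \<in> borel_measurable Q" "g \<in> Q \<rightarrow>\<^sub>M borel" "h \<in> Q \<rightarrow>\<^sub>M borel" for f g h Q
    using measurable_compose[OF measurable_Pair[OF that(1) measurable_Pair[OF that(2,3)]] a] by simp
  have Xb: "?X \<in> borel_measurable borel"
  proof (rule nn_integral_measurable_subprob_algebra2[OF _ \<mu>m])
    show "(\<lambda>(t, x). \<integral>\<^sup>+y. ennreal (a t x y * (\<Psi> (t, y) - \<Psi> (t, x))\<^sup>2) * ennreal (j (y - x)) \<partial>lborel)
      \<in> borel_measurable (borel \<Otimes>\<^sub>M borel)"
      unfolding case_prod_beta'
      by (rule lborel.borel_measurable_nn_integral) (unfold case_prod_beta', measurable)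
  qed
  have X: "?X \<in> borel_measurable lborel" using Xb by simp
  define u where "u t = (LINT x|\<mu> t. \<Psi> (t, x))" for t
  define D where "D t = (LINT x|\<mu> t. time_deriv \<Psi> (t, x))" for t
  have uc: "continuous_on {0..1} u" unfolding u_def by (rule weakly_continuous_curve_smooth[OF wc \<Psi>])
  have Dc: "continuous_on {0..1} D" unfolding D_def by (rule weakly_continuous_curve_smooth[OF wc t\<Psi>])
  have Di: "set_integrable lborel {0..1} D" by (rule borel_integrable_atLeastAtMost'[OF Dc])
  have int: "integrable (\<mu> t) (\<lambda>x. F (t, x))" if t: "t \<in> {0..1}" and F: "smooth_compact F" for t and F :: "real \<times> 'a \<Rightarrow> real"
  proof -
    interpret P: prob_space "\<mu> t" by (rule weakly_continuous_curve_prob[OF wc t])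
    obtain B where B: "\<And>z. \<bar>F z\<bar> \<le> B" using smooth_compact_bounded[OF F] by blast
    note [measurable] = test_function_measurable[OF F]
    have "(\<lambda>x. F (t, x)) \<in> borel_measurable borel" by measurable
    then have m: "(\<lambda>x. F (t, x)) \<in> borel_measurable (\<mu> t)"
      using measurable_cong_sets[OF weakly_continuous_curve_prob(2)[OF wc t] refl] by blast
    show ?thesis by (rule P.integrable_const_bound[where B=B]) (simp_all add: B m)
  qed
  have bound: "ennreal (- 2 * (LINT t:{0..1}|lborel. time_cutoff_deriv n t * u t + time_cutoff n t * D t))
    \<le> ?A + (\<integral>\<^sup>+t\<in>{0..1}. ?X t \<partial>lborel)" for n
  proof -
    define \<phi> where "\<phi> p = time_cutoff n (fst p) * \<Psi> p" for p
    have \<phi>: "test_function \<phi>" unfolding \<phi>_def[abs_def] by (rule test_function_time_cutoff[OF \<Psi>])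
    have "(LINT t:{0..1}|lborel. LINT x|\<mu> t. deriv (\<lambda>s. \<phi> (s, x)) t)
      = (LINT t:{0..1}|lborel. time_cutoff_deriv n t * u t + time_cutoff n t * D t)"
    proof (rule set_lebesgue_integral_cong)
      show "\<forall>t. t \<in> {0..1} \<longrightarrow> (LINT x|\<mu> t. deriv (\<lambda>s. \<phi> (s, x)) t) = time_cutoff_deriv n t * u t + time_cutoff n t * D t"
      proof (intro allI impI)
        fix t :: real assume t: "t \<in> {0..1}"
        have "deriv (\<lambda>s. \<phi> (s, x)) t = time_cutoff_deriv n t * \<Psi> (t, x) + time_cutoff n t * time_deriv \<Psi> (t, x)" for x
          unfolding deriv_eq_time_deriv[OF smooth_compact_smooth[OF test_function_smooth_compact[OF \<phi>]]]
          unfolding \<phi>_def[abs_def] by (rule time_deriv_time_cutoff[OF smooth_compact_smooth[OF \<Psi>]])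
        then have "(LINT x|\<mu> t. deriv (\<lambda>s. \<phi> (s, x)) t)
          = (LINT x|\<mu> t. time_cutoff_deriv n t * \<Psi> (t, x) + time_cutoff n t * time_deriv \<Psi> (t, x))" by (simp only:)
        also have "\<dots> = (LINT x|\<mu> t. time_cutoff_deriv n t * \<Psi> (t, x)) + (LINT x|\<mu> t. time_cutoff n t * time_deriv \<Psi> (t, x))"
          by (rule Bochner_Integration.integral_add) (intro integrable_mult_right int t \<Psi> t\<Psi>)+
        also have "\<dots> = time_cutoff_deriv n t * u t + time_cutoff n t * D t"
          unfolding u_def D_def by (simp only: integral_mult_right_zero)
        finally show "(LINT x|\<mu> t. deriv (\<lambda>s. \<phi> (s, x)) t) = time_cutoff_deriv n t * u t + time_cutoff n t * D t" .
      qed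
    qed simp
    then have eq: "- 2 * (LINT t:{0..1}|lborel. time_cutoff_deriv n t * u t + time_cutoff n t * D t)
      = (LINT t:{0..1}|lborel. signed_integral (N t) (\<lambda>(x, y). \<phi> (t, y) - \<phi> (t, x)))"
      using ce[OF \<phi>] by simp
    show ?thesis
      unfolding eq
    proof (rule set_integral_le_nonmeasurable[OF X])
      fix t :: real assume t: "t \<in> {0..1}"
      let ?f = "\<lambda>p. \<phi> (t, snd p) - \<phi> (t, fst p)"
      have s: "sets (\<mu> t) = sets borel" by (rule weakly_continuous_curve_prob[OF wc t])
      note [measurable] = test_function_measurable[OF test_function_smooth_compact[OF \<phi>]]
      have fm: "?f \<in> borel_measurable borel" unfolding measurable_borel_prod[symmetric] by measurable
      have am: "(\<lambda>p. a t (fst p) (snd p)) \<in> borel_measurable borel"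
        "(\<lambda>p. a t (snd p) (fst p)) \<in> borel_measurable borel"
        unfolding measurable_borel_prod[symmetric] by measurable
      \<comment> \<open>The cutoff lies between 0 and 1 and does not depend on x, so it only
        decreases squared differences. The bound is therefore uniform in n.\<close>
      have sq: "ennreal (a t x y * (\<phi> (t, y) - \<phi> (t, x))\<^sup>2) * ennreal (j (y - x))
        \<le> ennreal (a t x y * (\<Psi> (t, y) - \<Psi> (t, x))\<^sup>2) * ennreal (j (y - x))" for x y
      proof (intro mult_right_mono ennreal_leI mult_left_mono a0)
        have c: "0 \<le> time_cutoff n t" "time_cutoff n t \<le> 1"
          using exp_bump_1_bounds by (simp_all add: mult_le_one)
        have "(\<phi> (t, y) - \<phi> (t, x))\<^sup>2 = (time_cutoff n t)\<^sup>2 * (\<Psi> (t, y) - \<Psi> (t, x))\<^sup>2"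
          unfolding \<phi>_def fst_conv by (simp only: right_diff_distrib[symmetric] power_mult_distrib)
        also have "\<dots> \<le> 1 * (\<Psi> (t, y) - \<Psi> (t, x))\<^sup>2"
          using c by (intro mult_right_mono power_le_one) auto
        finally show "(\<phi> (t, y) - \<phi> (t, x))\<^sup>2 \<le> (\<Psi> (t, y) - \<Psi> (t, x))\<^sup>2" by simp
      qed simp
      have X1: "(\<integral>\<^sup>+p. ennreal (a t (fst p) (snd p) * (?f p)\<^sup>2) \<partial>jump_measure (\<mu> t) K) \<le> ?X t"
      proof -
        have "(\<lambda>p. ennreal (a t (fst p) (snd p) * (?f p)\<^sup>2)) \<in> borel_measurable borel"
          using fm am by measurable
        then have "(\<integral>\<^sup>+p. ennreal (a t (fst p) (snd p) * (?f p)\<^sup>2) \<partial>jump_measure (\<mu> t) K)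
          = (\<integral>\<^sup>+x. \<integral>\<^sup>+y. ennreal (a t x y * (\<phi> (t, y) - \<phi> (t, x))\<^sup>2) * ennreal (j (y - x)) \<partial>lborel \<partial>\<mu> t)"
          by (subst nn_integral_jump_measure[OF s]) (assumption, unfold fst_conv snd_conv, rule refl)
        also have "\<dots> \<le> ?X t"
          unfolding clamp01_id[OF t] by (intro nn_integral_mono sq)
        finally show ?thesis .
      qed
      \<comment> \<open>Integrating against the swapped measure exchanges x and y, which restores
        the first slope.\<close>
      have X2: "(\<integral>\<^sup>+p. ennreal (a t (snd p) (fst p) * (?f p)\<^sup>2) \<partial>jump_measure_swap (\<mu> t) K) \<le> ?X t"
      proof -
        have "(\<lambda>p. ennreal (a t (snd p) (fst p) * (?f p)\<^sup>2)) \<in> borel_measurable borel"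
          using fm am by measurable
        then have "(\<integral>\<^sup>+p. ennreal (a t (snd p) (fst p) * (?f p)\<^sup>2) \<partial>jump_measure_swap (\<mu> t) K)
          = (\<integral>\<^sup>+x. \<integral>\<^sup>+y. ennreal (a t x y * (\<phi> (t, x) - \<phi> (t, y))\<^sup>2) * ennreal (j (y - x)) \<partial>lborel \<partial>\<mu> t)"
          by (subst nn_integral_jump_measure_swap[OF s]) (assumption, unfold fst_conv snd_conv, rule refl)
        also have "\<dots> \<le> ?X t"
          unfolding clamp01_id[OF t]
        proof (intro nn_integral_mono)
          fix x y
          show "ennreal (a t x y * (\<phi> (t, x) - \<phi> (t, y))\<^sup>2) * ennreal (j (y - x))
            \<le> ennreal (a t x y * (\<Psi> (t, y) - \<Psi> (t, x))\<^sup>2) * ennreal (j (y - x))"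
            using sq[of x y] power2_commute[of "\<phi> (t, x)" "\<phi> (t, y)"] by metis
        qed
        finally show ?thesis .
      qed
      have "ennreal (signed_integral (N t) ?f) \<le> action K (\<mu> t) (N t)
        + ((\<integral>\<^sup>+p. ennreal (a t (fst p) (snd p) * (?f p)\<^sup>2) \<partial>jump_measure (\<mu> t) K)
          + (\<integral>\<^sup>+p. ennreal (a t (snd p) (fst p) * (?f p)\<^sup>2) \<partial>jump_measure_swap (\<mu> t) K)) / 2"
        by (rule action_tangent_bound[OF s fm am a0 a0 tangent])
      also have "\<dots> \<le> action K (\<mu> t) (N t) + (?X t + ?X t) / 2"
        by (intro add_left_mono divide_right_mono_ennreal add_mono X1 X2)
      also have "(?X t + ?X t) / 2 = ?X t"
      proof -
        have "(2 * X) / 2 = X * (2 / 2)" for X :: ennreal by (simp only: divide_ennreal_def mult_ac)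
        moreover have "2 / 2 = (1 :: ennreal)" by (rule ennreal_divide_self) auto
        ultimately show ?thesis unfolding mult_2[symmetric] by (simp only: mult_1_right)
      qed
      finally show "ennreal (signed_integral (N t) (\<lambda>(x, y). \<phi> (t, y) - \<phi> (t, x))) \<le> action K (\<mu> t) (N t) + ?X t"
        by (simp only: case_prod_beta')
    qed
  qed
  have "(\<lambda>n. ennreal (- 2 * (LINT t:{0..1}|lborel. time_cutoff_deriv n t * u t + time_cutoff n t * D t)))
    \<longlonglongrightarrow> ennreal (- 2 * (u 0 - u 1 + (LINT t:{0..1}|lborel. D t)))"
    by (rule tendsto_ennrealI[OF tendsto_mult[OF tendsto_const time_cutoff_limit[OF uc Di]]])
  then have "ennreal (- 2 * (u 0 - u 1 + (LINT t:{0..1}|lborel. D t))) \<le> ?A + (\<integral>\<^sup>+t\<in>{0..1}. ?X t \<partial>lborel)"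
    by (rule LIMSEQ_le_const2) (rule exI, rule allI, rule impI, rule bound)
  moreover have "- 2 * (u 0 - u 1 + (LINT t:{0..1}|lborel. D t)) = 2 * (u 1 - u 0 - (LINT t:{0..1}|lborel. D t))"
    by simp
  ultimately show ?thesis unfolding u_def D_def by (simp only:)
qed

end

subsection \<open>The interpolation segments\<close>

context levy_kernel
begin

lemma action'_measurable:
  fixes \<rho> :: "real \<Rightarrow> 'a \<Rightarrow> real" and f :: "real \<times> 'a \<Rightarrow> real"
  assumes \<rho> [measurable]: "(\<lambda>(t, x). \<rho> t x) \<in> borel_measurable (borel \<Otimes>\<^sub>M borel)"
    and f [measurable]: "f \<in> borel_measurable (borel \<Otimes>\<^sub>M borel)"
  shows "(\<lambda>t. action' lborel K (\<rho> t) (\<lambda>x. f (t, x))) \<in> borel_measurable borel"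
proof -
  have "action' lborel K (\<rho> t) (\<lambda>x. f (t, x)) = (\<integral>\<^sup>+x. \<integral>\<^sup>+y. ennreal ((f (t, y) - f (t, x))\<^sup>2 * log_mean (\<rho> t x) (\<rho> t y))
      * ennreal (j (y - x)) \<partial>lborel \<partial>lborel) / 2" for t
    by (rule action'_eq) measurable
  then show ?thesis by simp
qed

text \<open>g' (\<sigma> - \<tau>) is the time derivative of the interpolation. Its pairing with f
  is symmetrised into an integral over jumps with density k, to which the pointwise estimate
  applies; integration in space yields the Fisher information and the action.\<close>

lemma interpolation_time_slice:
  fixes \<sigma> k f :: "'a \<Rightarrow> real"
  assumes \<sigma> [measurable]: "\<sigma> \<in> borel_measurable borel" and k [measurable]: "k \<in> borel_measurable borel"
    and f [measurable]: "f \<in> borel_measurable borel"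
    and \<sigma>0: "\<And>x. 0 < \<sigma> x" and k0: "\<And>x. 0 \<le> k x" and sym: "\<And>x. k (- x) = k x" and B: "\<And>x. \<bar>f x\<bar> \<le> B"
    and s1: "(\<integral>\<^sup>+x. ennreal (\<sigma> x) \<partial>lborel) = 1" and k1: "(\<integral>\<^sup>+x. ennreal (k x) \<partial>lborel) = 1"
    and kj: "\<And>x. k x \<le> \<epsilon> * j x"
    and \<tau> [measurable]: "\<tau> \<in> borel_measurable borel" and \<tau>0: "\<And>x. 0 < \<tau> x"
    and \<tau>_def: "\<And>x. \<tau> x = (LINT y|lborel. \<sigma> y * k (x - y))"
    and g: "0 \<le> g" "g \<le> 1" "g'\<^sup>2 \<le> K\<^sub>0 * g" "0 \<le> K\<^sub>0"
  shows "ennreal (2 * (g' * ((LINT x|lborel. f x * \<sigma> x) - (LINT x|lborel. f x * \<tau> x))))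
    \<le> ennreal (K\<^sub>0 * \<epsilon>\<^sup>2) * ((\<integral>\<^sup>+(x, y). ennreal ((\<sigma> y - \<sigma> x) * (ln (\<sigma> y) - ln (\<sigma> x))) \<partial>Jm) / 2)
      + action' lborel K (\<lambda>x. g * \<sigma> x + (1 - g) * \<tau> x) f"
proof -
  let ?\<rho> = "\<lambda>x. g * \<sigma> x + (1 - g) * \<tau> x"
  let ?G = "\<lambda>p. (f (fst p) - f (snd p)) * (\<sigma> (fst p) - \<sigma> (snd p)) * k (snd p - fst p)"
  let ?H = "\<lambda>x y. (\<sigma> y - \<sigma> x) * (ln (\<sigma> y) - ln (\<sigma> x))"
  let ?E = "\<lambda>x y. (f y - f x)\<^sup>2 * log_mean (?\<rho> x) (?\<rho> y)"
  let ?A = "ennreal (K\<^sub>0 * \<epsilon>\<^sup>2)"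
  let ?N = "lborel \<Otimes>\<^sub>M lborel :: ('a \<times> 'a) measure"
  have \<rho>0: "0 < ?\<rho> x" for x
  proof (cases "g = 0")
    case False
    then have "0 < g * \<sigma> x" using g \<sigma>0[of x] by simp
    moreover have "0 \<le> (1 - g) * \<tau> x" using g \<tau>0[of x] by simp
    ultimately show ?thesis by linarith
  qed (use \<tau>0 in simp)
  have H0: "0 \<le> ?H x y" for x y
    using \<sigma>0[of x] \<sigma>0[of y] by (cases "\<sigma> x \<le> \<sigma> y") (auto simp: mult_nonneg_nonneg mult_nonpos_nonpos)
  have nn: "0 \<le> \<sigma> x" for x using \<sigma>0[of x] by simp
  note sy = smoothing_symmetrised[OF \<sigma> k f nn k0 sym B s1 k1, folded \<tau>_def]
  have "2 * (g' * ((LINT x|lborel. f x * \<sigma> x) - (LINT x|lborel. f x * \<tau> x))) = (LINT p|?N. g' * ?G p)"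
    using sy(2) by simp
  also have "ennreal \<dots> \<le> (\<integral>\<^sup>+p. ennreal (g' * ?G p) \<partial>?N)" by (rule ennreal_integral_le)
  also have "\<dots> = (\<integral>\<^sup>+x. \<integral>\<^sup>+y. ennreal (g' * ?G (x, y)) \<partial>lborel \<partial>lborel)"
    by (rule lborel.nn_integral_fst[symmetric]) measurable
  also have "\<dots> \<le> (\<integral>\<^sup>+x. \<integral>\<^sup>+y. (?A * (ennreal (?H x y) * ennreal (j (y - x))) + ennreal (?E x y) * ennreal (j (y - x))) / 2 \<partial>lborel \<partial>lborel)"
  proof (intro nn_integral_mono)
    fix x y
    let ?c = "j (y - x)"
    have nnc: "0 \<le> ?c" using j_pos[of "y - x"] by simp
    have nnE: "0 \<le> ?E x y" by (simp add: log_mean_nonneg)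
    have nnA: "0 \<le> K\<^sub>0 * \<epsilon>\<^sup>2" using g by simp
    have "g' * ?G (x, y) = g' * (f x - f y) * (\<sigma> x - \<sigma> y) * k (y - x)" by simp
    also have "\<dots> \<le> (K\<^sub>0 * \<epsilon>\<^sup>2 * ?H x y / 2 + (f y - f x)\<^sup>2 * log_mean (?\<rho> x) (?\<rho> y) / 2) * ?c"
    proof (rule interpolation_pointwise[where g=g and f'=0])
      show "g * \<sigma> x \<le> ?\<rho> x" "g * \<sigma> y \<le> ?\<rho> y" using g \<tau>0[of x] \<tau>0[of y] by simp_all
    qed (use \<sigma>0 \<rho>0 k0 kj j_pos g in auto)
    also have "\<dots> = (K\<^sub>0 * \<epsilon>\<^sup>2 * (?H x y * ?c) + ?E x y * ?c) / 2"
      by (simp only: add_divide_distrib[symmetric] times_divide_eq_left distrib_right mult.assoc)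
    finally have "ennreal (g' * ?G (x, y)) \<le> ennreal ((K\<^sub>0 * \<epsilon>\<^sup>2 * (?H x y * ?c) + ?E x y * ?c) / 2)"
      by (rule ennreal_leI)
    also have "\<dots> = ennreal (K\<^sub>0 * \<epsilon>\<^sup>2 * (?H x y * ?c) + ?E x y * ?c) / 2"
    proof (rule ennreal_divide_numeral[symmetric])
      show "0 \<le> K\<^sub>0 * \<epsilon>\<^sup>2 * (?H x y * ?c) + ?E x y * ?c"
        by (intro add_nonneg_nonneg mult_nonneg_nonneg nnA nnE nnc H0)
    qed
    also have "ennreal (K\<^sub>0 * \<epsilon>\<^sup>2 * (?H x y * ?c) + ?E x y * ?c) = ?A * (ennreal (?H x y) * ennreal ?c) + ennreal (?E x y) * ennreal ?c"
    proof -
      note nn = mult_nonneg_nonneg[OF H0 nnc] mult_nonneg_nonneg[OF nnE nnc] nnA nnc nnE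
      have "ennreal (K\<^sub>0 * \<epsilon>\<^sup>2 * (?H x y * ?c) + ?E x y * ?c) = ennreal (K\<^sub>0 * \<epsilon>\<^sup>2 * (?H x y * ?c)) + ennreal (?E x y * ?c)"
        by (rule ennreal_plus) (intro mult_nonneg_nonneg[OF nn(3) nn(1)] nn(2))+
      also have "ennreal (K\<^sub>0 * \<epsilon>\<^sup>2 * (?H x y * ?c)) = ?A * ennreal (?H x y * ?c)" by (rule ennreal_mult[OF nn(3) nn(1)])
      also have "ennreal (?H x y * ?c) = ennreal (?H x y) * ennreal ?c" by (rule ennreal_mult[OF H0 nn(4)])
      also have "ennreal (?E x y * ?c) = ennreal (?E x y) * ennreal ?c" by (rule ennreal_mult[OF nn(5) nn(4)])
      finally show ?thesis .
    qed
    finally show "ennreal (g' * ?G (x, y)) \<le> (?A * (ennreal (?H x y) * ennreal ?c) + ennreal (?E x y) * ennreal ?c) / 2" .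
  qed
  also have "\<dots> = (?A * (\<integral>\<^sup>+x. \<integral>\<^sup>+y. ennreal (?H x y) * ennreal (j (y - x)) \<partial>lborel \<partial>lborel)
      + (\<integral>\<^sup>+x. \<integral>\<^sup>+y. ennreal (?E x y) * ennreal (j (y - x)) \<partial>lborel \<partial>lborel)) / 2"
    by (simp add: nn_integral_divide nn_integral_add nn_integral_cmult)
  also have "\<dots> = ?A * ((\<integral>\<^sup>+x. \<integral>\<^sup>+y. ennreal (?H x y) * ennreal (j (y - x)) \<partial>lborel \<partial>lborel) / 2)
      + (\<integral>\<^sup>+x. \<integral>\<^sup>+y. ennreal (?E x y) * ennreal (j (y - x)) \<partial>lborel \<partial>lborel) / 2"
    by (simp only: add_divide_distrib_ennreal ennreal_times_divide)
  also have "(\<integral>\<^sup>+x. \<integral>\<^sup>+y. ennreal (?E x y) * ennreal (j (y - x)) \<partial>lborel \<partial>lborel) / 2 = action' lborel K ?\<rho> f"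
    by (rule action'_eq[symmetric]) measurable
  also have "(\<integral>\<^sup>+x. \<integral>\<^sup>+y. ennreal (?H x y) * ennreal (j (y - x)) \<partial>lborel \<partial>lborel) = (\<integral>\<^sup>+(x, y). ennreal (?H x y) \<partial>Jm)"
  proof -
    have "(\<lambda>(x, y). ennreal (?H x y)) \<in> borel_measurable borel"
      unfolding measurable_borel_prod[symmetric] by measurable
    from nn_integral_Jm[OF this] show ?thesis by simp
  qed
  finally show ?thesis .
qed

text \<open>With P and Q the pairings of \<Phi> with \<sigma> and \<tau>, the product rule for g P +
  (1 - g) Q leaves exactly the integral of g' (P - Q) on the left-hand side. The weight g is a
  square centred at c, the time at which the segment meets the convolution \<tau>; integrating the
  constant cost over the segment gives the factor e - s.\<close>

lemma interpolation_segment: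
  fixes \<sigma> k :: "'a \<Rightarrow> real"
  assumes \<sigma> [measurable]: "\<sigma> \<in> borel_measurable borel" and k [measurable]: "k \<in> borel_measurable borel"
    and \<sigma>0: "\<And>x. 0 < \<sigma> x" and k0: "\<And>x. 0 \<le> k x" and sym: "\<And>x. k (- x) = k x"
    and s1: "(\<integral>\<^sup>+x. ennreal (\<sigma> x) \<partial>lborel) = 1" and k1: "(\<integral>\<^sup>+x. ennreal (k x) \<partial>lborel) = 1"
    and kj: "\<And>x. k x \<le> \<epsilon> * j x"
    and \<tau> [measurable]: "\<tau> \<in> borel_measurable borel" and \<tau>0: "\<And>x. 0 < \<tau> x"
    and \<tau>_def: "\<And>x. \<tau> x = (LINT y|lborel. \<sigma> y * k (x - y))" and t1: "(\<integral>\<^sup>+x. ennreal (\<tau> x) \<partial>lborel) = 1"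
    and g: "\<And>t. t \<in> {s..e} \<Longrightarrow> g t \<le> 1" and g_def: "\<And>t. g t = ((t - c) / a)\<^sup>2" and a: "a \<noteq> 0"
    and se: "s \<le> e"
    and \<Phi>: "smooth_compact \<Phi>"
    and R: "\<And>t x. R t x = g t * \<sigma> x + (1 - g t) * \<tau> x"
  shows "ennreal (2 * ((LINT x|lborel. \<Phi> (e, x) * R e x) - (LINT x|lborel. \<Phi> (s, x) * R s x)
      - (LINT t:{s..e}|lborel. LINT x|lborel. time_deriv \<Phi> (t, x) * R t x)))
    \<le> ennreal (4 / a\<^sup>2 * \<epsilon>\<^sup>2) * ((\<integral>\<^sup>+(x, y). ennreal ((\<sigma> y - \<sigma> x) * (ln (\<sigma> y) - ln (\<sigma> x))) \<partial>Jm) / 2) * ennreal (e - s)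
      + (\<integral>\<^sup>+t\<in>{s..e}. action' lborel K (R t) (\<lambda>x. \<Phi> (t, x)) \<partial>lborel)"
    (is "_ \<le> ?A * ?F * _ + _")
proof -
  note t\<Phi> = smooth_compact_time_deriv[OF \<Phi>]
  have nn: "0 \<le> \<sigma> x" "0 \<le> \<tau> x" for x using \<sigma>0[of x] \<tau>0[of x] by simp_all
  define g' where "g' t = 2 * (t - c) / a\<^sup>2" for t
  have g': "(g has_real_derivative g' t) (at t)" for t
  proof -
    have "((\<lambda>t. ((t - c) / a)\<^sup>2) has_real_derivative g' t) (at t)"
      using a by (auto intro!: derivative_eq_intros simp: g'_def power2_eq_square)
    moreover have "g = (\<lambda>t. ((t - c) / a)\<^sup>2)" using g_def by auto
    ultimately show ?thesis by simp
  qed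
  \<comment> \<open>An equality: 4 / a^2 is the constant value of g'^2 / g for this quadratic
    weight.\<close>
  have g'sq: "(g' t)\<^sup>2 \<le> 4 / a\<^sup>2 * g t" for t
  proof -
    have "(g' t)\<^sup>2 = 4 * (t - c)\<^sup>2 / (a\<^sup>2 * a\<^sup>2)"
      by (simp only: g'_def power_divide power_mult_distrib power2_eq_square[of "a\<^sup>2"]) simp
    moreover have "4 / a\<^sup>2 * g t = 4 * (t - c)\<^sup>2 / (a\<^sup>2 * a\<^sup>2)"
      by (simp only: g_def power_divide times_divide_times_eq)
    ultimately show ?thesis by simp
  qed
  define P where "P t = (LINT x|lborel. \<Phi> (t, x) * \<sigma> x)" for t
  define Q where "Q t = (LINT x|lborel. \<Phi> (t, x) * \<tau> x)" for t
  define P' where "P' t = (LINT x|lborel. time_deriv \<Phi> (t, x) * \<sigma> x)" for t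
  define Q' where "Q' t = (LINT x|lborel. time_deriv \<Phi> (t, x) * \<tau> x)" for t
  have dP: "(P has_real_derivative P' t) (at t)" for t
    unfolding P_def P'_def by (rule density_time_derivative[OF \<sigma> nn(1) s1 \<Phi>])
  have dQ: "(Q has_real_derivative Q' t) (at t)" for t
    unfolding Q_def Q'_def by (rule density_time_derivative[OF \<tau> nn(2) t1 \<Phi>])
  have cP': "isCont P' t" for t
    unfolding P'_def by (rule DERIV_isCont[OF density_time_derivative[OF \<sigma> nn(1) s1 t\<Phi>]])
  have cQ': "isCont Q' t" for t
    unfolding Q'_def by (rule DERIV_isCont[OF density_time_derivative[OF \<tau> nn(2) t1 t\<Phi>]])
  have cg': "isCont g' t" for t unfolding g'_def[abs_def] using a by (intro continuous_intros) auto
  have cg: "isCont g t" "isCont P t" "isCont Q t" for t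
    using g' dP dQ DERIV_isCont by blast+
  have FR: "(LINT x|lborel. F (t, x) * R t x) = g t * (LINT x|lborel. F (t, x) * \<sigma> x) + (1 - g t) * (LINT x|lborel. F (t, x) * \<tau> x)"
    if F: "smooth_compact F" for F :: "real \<times> 'a \<Rightarrow> real" and t
  proof -
    obtain B where B: "\<And>z. \<bar>F z\<bar> \<le> B" using smooth_compact_bounded[OF F] by blast
    note [measurable] = test_function_measurable[OF F]
    have m: "(\<lambda>x. F (t, x)) \<in> borel_measurable lborel" by measurable
    have i: "integrable lborel (\<lambda>x. F (t, x) * \<sigma> x)" "integrable lborel (\<lambda>x. F (t, x) * \<tau> x)"
      by (rule integrable_bounded_density[OF m _ B]; simp add: nn s1 t1)+
    have "(\<lambda>x. F (t, x) * R t x) = (\<lambda>x. g t * (F (t, x) * \<sigma> x) + (1 - g t) * (F (t, x) * \<tau> x))"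
      unfolding R by (simp add: algebra_simps)
    then show ?thesis using i by simp
  qed
  define h1 where "h1 t = g' t * (P t - Q t)" for t
  define h2 where "h2 t = g t * P' t + (1 - g t) * Q' t" for t
  have c1: "isCont h1 t" and c2: "isCont h2 t" for t
    unfolding h1_def[abs_def] h2_def[abs_def] by (intro continuous_intros cg cg' cP' cQ')+
  have i12: "set_integrable lborel {s..e} h1" "set_integrable lborel {s..e} h2"
    by (rule borel_integrable_atLeastAtMost', rule continuous_at_imp_continuous_on, use c1 c2 in blast)+
  have "(LINT t|lborel. (h1 t + h2 t) * indicator {s..e} t) = (g e * P e + (1 - g e) * Q e) - (g s * P s + (1 - g s) * Q s)"
  proof (rule integral_FTC_Icc_real[OF se])
    show "((\<lambda>t. g t * P t + (1 - g t) * Q t) has_real_derivative h1 t + h2 t) (at t)" for t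
      unfolding h1_def h2_def
      by (rule derivative_eq_intros g' dP dQ refl)+ (simp add: algebra_simps)
    show "isCont (\<lambda>t. h1 t + h2 t) t" for t by (intro continuous_intros c1 c2)
  qed
  then have "(LINT t:{s..e}|lborel. h1 t + h2 t) = (g e * P e + (1 - g e) * Q e) - (g s * P s + (1 - g s) * Q s)"
    unfolding set_lebesgue_integral_def by (simp add: mult.commute)
  then have ftc: "(LINT t:{s..e}|lborel. h1 t) = (g e * P e + (1 - g e) * Q e) - (g s * P s + (1 - g s) * Q s) - (LINT t:{s..e}|lborel. h2 t)"
    using set_integral_add(2)[OF i12] by simp
  have lhs: "2 * ((LINT x|lborel. \<Phi> (e, x) * R e x) - (LINT x|lborel. \<Phi> (s, x) * R s x)
      - (LINT t:{s..e}|lborel. LINT x|lborel. time_deriv \<Phi> (t, x) * R t x)) = (LINT t:{s..e}|lborel. 2 * h1 t)"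
    unfolding FR[OF \<Phi>] FR[OF t\<Phi>] set_integral_mult_right ftc
    unfolding P_def Q_def P'_def Q'_def h2_def ..
  obtain B where B: "\<And>z. \<bar>\<Phi> z\<bar> \<le> B" using smooth_compact_bounded[OF \<Phi>] by blast
  note [measurable] = test_function_measurable[OF \<Phi>]
  have gm [measurable]: "g \<in> borel_measurable borel"
    using cg(1) by (intro borel_measurable_continuous_onI continuous_at_imp_continuous_on) blast
  have Rm: "(\<lambda>(t, x). R t x) \<in> borel_measurable (borel \<Otimes>\<^sub>M borel)"
    unfolding R by measurable
  have am: "(\<lambda>t. action' lborel K (R t) (\<lambda>x. \<Phi> (t, x))) \<in> borel_measurable borel"
    by (rule action'_measurable[OF Rm]) measurable
  have "ennreal (LINT t:{s..e}|lborel. 2 * h1 t) \<le> (\<integral>\<^sup>+t\<in>{s..e}. ennreal (2 * h1 t) \<partial>lborel)"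
    by (rule ennreal_set_integral_le)
  also have "\<dots> \<le> (\<integral>\<^sup>+t. ?A * ?F * indicator {s..e} t + action' lborel K (R t) (\<lambda>x. \<Phi> (t, x)) * indicator {s..e} t \<partial>lborel)"
  proof (rule nn_integral_mono)
    fix t
    show "ennreal (2 * h1 t) * indicator {s..e} t \<le> ?A * ?F * indicator {s..e} t + action' lborel K (R t) (\<lambda>x. \<Phi> (t, x)) * indicator {s..e} t"
    proof (cases "t \<in> {s..e}")
      case True
      have m: "(\<lambda>x. \<Phi> (t, x)) \<in> borel_measurable borel" by measurable
      have "ennreal (2 * (g' t * ((LINT x|lborel. \<Phi> (t, x) * \<sigma> x) - (LINT x|lborel. \<Phi> (t, x) * \<tau> x))))
        \<le> ?A * ?F + action' lborel K (\<lambda>x. g t * \<sigma> x + (1 - g t) * \<tau> x) (\<lambda>x. \<Phi> (t, x))"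
      proof (rule interpolation_time_slice[OF \<sigma> k m \<sigma>0 k0 sym B s1 k1 kj \<tau> \<tau>0 \<tau>_def _ g[OF True] g'sq])
        show "0 \<le> g t" unfolding g_def by simp
        show "0 \<le> 4 / a\<^sup>2" by simp
      qed
      then show ?thesis using True unfolding h1_def P_def Q_def R by simp
    qed simp
  qed
  also have "\<dots> = (\<integral>\<^sup>+t. ?A * ?F * indicator {s..e} t \<partial>lborel) + (\<integral>\<^sup>+t\<in>{s..e}. action' lborel K (R t) (\<lambda>x. \<Phi> (t, x)) \<partial>lborel)"
    by (rule nn_integral_add) (use am in measurable)
  also have "(\<integral>\<^sup>+t. ?A * ?F * indicator {s..e} t \<partial>lborel) = ?A * ?F * ennreal (e - s)"
    using se by (subst nn_integral_cmult) simp_all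
  finally show ?thesis unfolding lhs .
qed

end

subsection \<open>Smoothing of a weakly continuous curve\<close>

context jump_density
begin

text \<open>Tonelli and the translation of z by x. Averaging the translates of H with weight k
  amounts to integrating H against the density of the convolution of \<mu> with k.\<close>

lemma convolution_nn_integral:
  fixes k :: "'a \<Rightarrow> real" and \<mu> :: "'a measure"
  assumes k [measurable]: "k \<in> borel_measurable borel" and H [measurable]: "H \<in> borel_measurable borel"
    and \<mu>: "prob_space \<mu>" and s [measurable_cong]: "sets \<mu> = sets borel"
  shows "(\<integral>\<^sup>+z. ennreal (k z) * (\<integral>\<^sup>+x. H (x + z) \<partial>\<mu>) \<partial>lborel)
    = (\<integral>\<^sup>+x. (\<integral>\<^sup>+y. ennreal (k (x - y)) \<partial>\<mu>) * H x \<partial>lborel)"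
proof -
  interpret \<mu>: prob_space \<mu> by (rule \<mu>)
  interpret P: pair_sigma_finite \<mu> "lborel :: 'a measure"
    by (rule pair_sigma_finite.intro[OF \<mu>.sigma_finite_measure_axioms lborel.sigma_finite_measure_axioms])
  have "(\<integral>\<^sup>+z. ennreal (k z) * (\<integral>\<^sup>+x. H (x + z) \<partial>\<mu>) \<partial>lborel) = (\<integral>\<^sup>+z. \<integral>\<^sup>+x. ennreal (k z) * H (x + z) \<partial>\<mu> \<partial>lborel)"
    by (intro nn_integral_cong nn_integral_cmult[symmetric]) measurable
  also have "\<dots> = (\<integral>\<^sup>+x. \<integral>\<^sup>+z. ennreal (k z) * H (x + z) \<partial>lborel \<partial>\<mu>)"
    by (rule P.Fubini') measurable
  also have "\<dots> = (\<integral>\<^sup>+x. \<integral>\<^sup>+z. ennreal (k (z - x)) * H z \<partial>lborel \<partial>\<mu>)"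
  proof (rule nn_integral_cong)
    fix x
    have "(\<integral>\<^sup>+z. ennreal (k ((x + z) - x)) * H (x + z) \<partial>lborel) = (\<integral>\<^sup>+z. ennreal (k (z - x)) * H z \<partial>lborel)"
      by (rule nn_integral_lborel_shift) measurable
    then show "(\<integral>\<^sup>+z. ennreal (k z) * H (x + z) \<partial>lborel) = (\<integral>\<^sup>+z. ennreal (k (z - x)) * H z \<partial>lborel)" by simp
  qed
  also have "\<dots> = (\<integral>\<^sup>+z. \<integral>\<^sup>+x. ennreal (k (z - x)) * H z \<partial>\<mu> \<partial>lborel)"
    by (rule P.Fubini'[symmetric]) measurable
  also have "\<dots> = (\<integral>\<^sup>+z. (\<integral>\<^sup>+x. ennreal (k (z - x)) \<partial>\<mu>) * H z \<partial>lborel)"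
    by (intro nn_integral_cong nn_integral_multc) measurable
  finally show ?thesis .
qed

end

text \<open>The bound B makes k integrable against every probability measure, and strict positivity
  of k makes the convolution positive at every point, whatever the measure is.\<close>

locale smoothed_curve =
  fixes \<mu> :: "real \<Rightarrow> 'a::euclidean_space measure" and k :: "'a \<Rightarrow> real" and B :: real
  assumes wc: "weakly_continuous_curve \<mu>"
    and km [measurable]: "k \<in> borel_measurable borel"
    and k0: "\<And>x. 0 < k x" and kB: "\<And>x. k x \<le> B"
    and k1: "(\<integral>\<^sup>+x. ennreal (k x) \<partial>lborel) = 1"
begin

abbreviation \<nu> :: "real \<Rightarrow> 'a measure" where "\<nu> t \<equiv> \<mu> (clamp01 t)"

definition smoothed :: "real \<Rightarrow> 'a \<Rightarrow> real" where "smoothed t x = (LINT y|\<nu> t. k (x - y))"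

lemma \<nu>_prob: "prob_space (\<nu> t)" and \<nu>_sets: "sets (\<nu> t) = sets borel"
  by (rule weakly_continuous_curve_prob[OF wc clamp01_in])+

lemma \<nu>_measurable: "\<nu> \<in> borel \<rightarrow>\<^sub>M subprob_algebra borel"
  using measurable_prob_algebraD[OF weakly_continuous_curve_measurable[OF wc]] .

lemma measurable_\<nu>: "f \<in> borel_measurable borel \<Longrightarrow> f \<in> borel_measurable (\<nu> t)"
  by (simp only: measurable_cong_sets[OF \<nu>_sets refl])

lemma smoothed_integrable: "integrable (\<nu> t) (\<lambda>y. k (x - y))"
proof -
  interpret P: prob_space "\<nu> t" by (rule \<nu>_prob)
  have "(\<lambda>y. k (x - y)) \<in> borel_measurable borel" by measurable
  from measurable_\<nu>[OF this] show ?thesis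
    using k0 kB by (intro P.integrable_const_bound[where B=B]) (auto simp: less_imp_le)
qed

lemma smoothed_nn: "ennreal (smoothed t x) = (\<integral>\<^sup>+y. ennreal (k (x - y)) \<partial>\<nu> t)"
  unfolding smoothed_def
  by (rule nn_integral_eq_integral[OF smoothed_integrable, symmetric]) (simp add: k0 less_imp_le)

lemma smoothed_nonneg: "0 \<le> smoothed t x"
  unfolding smoothed_def by (rule integral_nonneg_AE) (simp add: k0 less_imp_le)

lemma smoothed_pos: "0 < smoothed t x"
proof (rule ccontr)
  assume "\<not> 0 < smoothed t x"
  then have "smoothed t x = 0" using smoothed_nonneg[of t x] by simp
  then have "(\<integral>\<^sup>+y. ennreal (k (x - y)) \<partial>\<nu> t) = 0" using smoothed_nn[of t x] by simp
  moreover have "(\<lambda>y. ennreal (k (x - y))) \<in> borel_measurable (\<nu> t)" by (rule measurable_\<nu>) measurable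
  ultimately have "AE y in \<nu> t. ennreal (k (x - y)) = 0" by (simp add: nn_integral_0_iff_AE)
  moreover have "ennreal (k (x - y)) \<noteq> 0" for y using k0[of "x - y"] by (simp add: not_le)
  ultimately have "AE y in \<nu> t. False" by simp
  then show False using prob_space.AE_False[OF \<nu>_prob] by blast
qed

lemma smoothed_measurable: "(\<lambda>(t, x). smoothed t x) \<in> borel_measurable (borel \<Otimes>\<^sub>M borel)"
proof -
  have \<nu>m: "(\<lambda>p. \<nu> (fst p)) \<in> borel \<Otimes>\<^sub>M borel \<rightarrow>\<^sub>M subprob_algebra borel"
    by (rule measurable_compose[OF measurable_fst \<nu>_measurable])
  have "(\<lambda>p. (\<integral>\<^sup>+y. ennreal (k (snd p - y)) \<partial>\<nu> (fst p))) \<in> borel_measurable (borel \<Otimes>\<^sub>M borel)"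
    by (rule nn_integral_measurable_subprob_algebra2[OF _ \<nu>m]) measurable
  then have "(\<lambda>p. enn2real (\<integral>\<^sup>+y. ennreal (k (snd p - y)) \<partial>\<nu> (fst p))) \<in> borel_measurable (borel \<Otimes>\<^sub>M borel)"
    by (rule measurable_compose) measurable
  moreover have "enn2real (\<integral>\<^sup>+y. ennreal (k (snd p - y)) \<partial>\<nu> (fst p)) = smoothed (fst p) (snd p)" for p
    unfolding smoothed_nn[symmetric] using smoothed_nonneg by simp
  ultimately show ?thesis by (simp add: case_prod_beta')
qed

lemma smoothed_measurable': "smoothed t \<in> borel_measurable borel"
proof -
  note [measurable] = smoothed_measurable
  show ?thesis by measurable
qed

lemma smoothed_convolution_nn:
  assumes H: "H \<in> borel_measurable borel"
  shows "(\<integral>\<^sup>+z. ennreal (k z) * (\<integral>\<^sup>+x. H (x + z) \<partial>\<nu> t) \<partial>lborel) = (\<integral>\<^sup>+x. ennreal (smoothed t x) * H x \<partial>lborel)"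
  unfolding smoothed_nn
  by (rule jump_density.convolution_nn_integral[OF jump_density.intro[OF km] km H \<nu>_prob \<nu>_sets])

lemma smoothed_prob: "(\<integral>\<^sup>+x. ennreal (smoothed t x) \<partial>lborel) = 1"
proof -
  have "(\<integral>\<^sup>+z. ennreal (k z) * (\<integral>\<^sup>+x. 1 \<partial>\<nu> t) \<partial>lborel) = (\<integral>\<^sup>+x. ennreal (smoothed t x) * 1 \<partial>lborel)"
    by (rule smoothed_convolution_nn) simp
  moreover have "(\<integral>\<^sup>+x. 1 \<partial>\<nu> t) = 1"
    using prob_space.emeasure_space_1[OF \<nu>_prob[of t]] by simp
  ultimately show ?thesis using k1 by simp
qed

lemma bounded_average:
  fixes f :: "'a \<Rightarrow> real"
  assumes f [measurable]: "f \<in> borel_measurable borel" and C: "\<And>x. \<bar>f x\<bar> \<le> C"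
  shows "integrable (\<nu> t) (\<lambda>x. f (x + z))" and "\<bar>LINT x|\<nu> t. f (x + z)\<bar> \<le> C"
proof -
  interpret P: prob_space "\<nu> t" by (rule \<nu>_prob)
  have "(\<lambda>x. f (x + z)) \<in> borel_measurable borel" by measurable
  from measurable_\<nu>[OF this] show i: "integrable (\<nu> t) (\<lambda>x. f (x + z))"
    using C by (intro P.integrable_const_bound[where B=C]) auto
  have "\<bar>LINT x|\<nu> t. f (x + z)\<bar> \<le> (LINT x|\<nu> t. \<bar>f (x + z)\<bar>)" by (rule integral_abs_bound)
  also have "\<dots> \<le> (LINT x|\<nu> t. C)" using i C by (intro integral_mono) auto
  finally show "\<bar>LINT x|\<nu> t. f (x + z)\<bar> \<le> C" by (simp add: P.prob_space)
qed

text \<open>The identity for nonnegative functions is applied to f + C; the constant contributes C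
  on both sides because k and the convolution have mass 1.\<close>

lemma smoothed_convolution:
  fixes f :: "'a \<Rightarrow> real"
  assumes f [measurable]: "f \<in> borel_measurable borel" and C: "\<And>x. \<bar>f x\<bar> \<le> C"
  shows "integrable lborel (\<lambda>z. k z * (LINT x|\<nu> t. f (x + z)))"
    and "(LINT z|lborel. k z * (LINT x|\<nu> t. f (x + z))) = (LINT x|lborel. f x * smoothed t x)"
proof -
  interpret P: prob_space "\<nu> t" by (rule \<nu>_prob)
  have fC: "0 \<le> f x + C" for x using C[of x] by linarith
  let ?u = "\<lambda>z. LINT x|\<nu> t. f (x + z)"
  have k1i: "integrable lborel k" "(LINT x|lborel. k x) = 1"
    using k1 k0 by (auto intro!: integrableI_nonneg integral_eq_nn_integral[THEN trans] simp: less_imp_le)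
  have s1i: "integrable lborel (smoothed t)" "(LINT x|lborel. smoothed t x) = 1"
    using smoothed_prob[of t] smoothed_nonneg smoothed_measurable'
    by (auto intro!: integrableI_nonneg integral_eq_nn_integral[THEN trans])
  have eu: "ennreal (?u z + C) = (\<integral>\<^sup>+x. ennreal (f (x + z) + C) \<partial>\<nu> t)" for z
  proof -
    have i: "integrable (\<nu> t) (\<lambda>x. f (x + z) + C)" using bounded_average(1)[OF f C] by simp
    have "(\<integral>\<^sup>+x. ennreal (f (x + z) + C) \<partial>\<nu> t) = ennreal (LINT x|\<nu> t. f (x + z) + C)"
      by (rule nn_integral_eq_integral[OF i]) (simp add: fC)
    also have "(LINT x|\<nu> t. f (x + z) + C) = ?u z + C"
      using bounded_average(1)[OF f C] by (simp add: P.prob_space)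
    finally show ?thesis by simp
  qed
  have um: "?u \<in> borel_measurable borel"
  proof -
    have "(\<lambda>z. \<integral>\<^sup>+x. ennreal (f (x + z) + C) \<partial>\<nu> t) \<in> borel_measurable borel"
    proof -
      have "(\<lambda>z :: 'a. \<nu> t) \<in> borel \<rightarrow>\<^sub>M subprob_algebra borel"
        by (rule measurable_const) (use measurable_space[OF \<nu>_measurable, of t] in simp)
      then show ?thesis
        by (rule nn_integral_measurable_subprob_algebra2[rotated]) measurable
    qed
    then have "(\<lambda>z. enn2real (\<integral>\<^sup>+x. ennreal (f (x + z) + C) \<partial>\<nu> t) - C) \<in> borel_measurable borel"
      by measurable
    moreover have "enn2real (\<integral>\<^sup>+x. ennreal (f (x + z) + C) \<partial>\<nu> t) - C = ?u z" for z
      unfolding eu[symmetric] using bounded_average(2)[OF f C, of t z] by simp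
    ultimately show ?thesis by simp
  qed
  have ub: "\<bar>?u z\<bar> \<le> C" for z by (rule bounded_average(2)[OF f C])
  show iu: "integrable lborel (\<lambda>z. k z * ?u z)"
  proof (rule Bochner_Integration.integrable_bound)
    show "integrable lborel (\<lambda>z. C * k z)" using k1i by simp
    show "(\<lambda>z. k z * ?u z) \<in> borel_measurable lborel" using um by measurable
    have "\<bar>k z * ?u z\<bar> \<le> \<bar>C * k z\<bar>" for z
      using mult_left_mono[OF ub[of z], of "k z"] k0[of z] ub[of z] by (simp add: abs_mult mult.commute)
    then show "AE z in lborel. norm (k z * ?u z) \<le> norm (C * k z)" by simp
  qed
  have ifs: "integrable lborel (\<lambda>x. f x * smoothed t x)"
    by (rule integrable_bounded_density[where B=C])
      (use smoothed_measurable' smoothed_prob smoothed_nonneg C in auto)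
  have "(\<integral>\<^sup>+z. ennreal (k z) * (\<integral>\<^sup>+x. ennreal (f (x + z) + C) \<partial>\<nu> t) \<partial>lborel)
    = (\<integral>\<^sup>+x. ennreal (smoothed t x) * ennreal (f x + C) \<partial>lborel)"
    by (rule smoothed_convolution_nn) measurable
  then have "(\<integral>\<^sup>+z. ennreal (k z * (?u z + C)) \<partial>lborel) = (\<integral>\<^sup>+x. ennreal ((f x + C) * smoothed t x) \<partial>lborel)"
    unfolding eu[symmetric] using k0 fC smoothed_nonneg ub
    by (simp add: ennreal_mult'' ennreal_mult' less_imp_le mult.commute)
  moreover have "(\<integral>\<^sup>+z. ennreal (k z * (?u z + C)) \<partial>lborel) = ennreal (LINT z|lborel. k z * (?u z + C))"
  proof (rule nn_integral_eq_integral)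
    show "integrable lborel (\<lambda>z. k z * (?u z + C))" using iu k1i by (simp add: distrib_left)
    have "0 \<le> ?u z + C" for z using ub[of z] by linarith
    then show "AE z in lborel. 0 \<le> k z * (?u z + C)" using k0 by (simp add: less_imp_le)
  qed
  moreover have "(\<integral>\<^sup>+x. ennreal ((f x + C) * smoothed t x) \<partial>lborel) = ennreal (LINT x|lborel. (f x + C) * smoothed t x)"
  proof (rule nn_integral_eq_integral)
    show "integrable lborel (\<lambda>x. (f x + C) * smoothed t x)" using ifs s1i by (simp add: distrib_right)
    show "AE x in lborel. 0 \<le> (f x + C) * smoothed t x" using fC smoothed_nonneg by simp
  qed
  moreover have "0 \<le> (LINT z|lborel. k z * (?u z + C))" "0 \<le> (LINT x|lborel. (f x + C) * smoothed t x)"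
  proof -
    have "0 \<le> ?u z + C" for z using ub[of z] by linarith
    then show "0 \<le> (LINT z|lborel. k z * (?u z + C))" using k0 by (intro integral_nonneg_AE) (simp add: less_imp_le)
    show "0 \<le> (LINT x|lborel. (f x + C) * smoothed t x)"
      using fC smoothed_nonneg by (intro integral_nonneg_AE) simp
  qed
  ultimately have "(LINT z|lborel. k z * (?u z + C)) = (LINT x|lborel. (f x + C) * smoothed t x)" by simp
  moreover have "(LINT z|lborel. k z * (?u z + C)) = (LINT z|lborel. k z * ?u z) + C"
    using iu k1i by (simp add: distrib_left)
  moreover have "(LINT x|lborel. (f x + C) * smoothed t x) = (LINT x|lborel. f x * smoothed t x) + C"
    using ifs s1i by (simp add: distrib_right)
  ultimately show "(LINT z|lborel. k z * ?u z) = (LINT x|lborel. f x * smoothed t x)" by simp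
qed

end

subsection \<open>Signed fluxes with a density\<close>

context levy_kernel
begin

lemma flux_square_bound:
  fixes \<theta> a d m :: real
  assumes "0 \<le> \<theta>" "0 \<le> m"
  shows "m * (\<bar>d\<bar> * \<theta>) \<le> m\<^sup>2 * \<theta> + d\<^sup>2 * \<theta>"
proof -
  have "2 * (m * \<bar>d\<bar>) \<le> m\<^sup>2 + d\<^sup>2" using sum_squares_bound[of m "\<bar>d\<bar>"] by (simp add: mult.assoc)
  moreover have "0 \<le> m * \<bar>d\<bar>" using assms by simp
  ultimately have "m * \<bar>d\<bar> \<le> m\<^sup>2 + d\<^sup>2" by linarith
  from mult_right_mono[OF this assms(1)] show ?thesis by (simp add: distrib_right mult.assoc)
qed

text \<open>Since m |d| \<le> m^2 + d^2, the flux weighted by m = min 1 |x - y| is controlled by the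
  Levy mass and the action. Finite action thus implies the integrability demanded of fluxes in
  \<open>CE\<close>.\<close>

lemma flux_integrable:
  fixes \<rho> \<psi> :: "'a \<Rightarrow> real"
  assumes \<rho> [measurable]: "\<rho> \<in> borel_measurable borel" and \<rho>0: "\<And>x. 0 \<le> \<rho> x"
    and \<rho>1: "(\<integral>\<^sup>+x. ennreal (\<rho> x) \<partial>lborel) = 1"
    and \<psi> [measurable]: "\<psi> \<in> borel_measurable borel"
  shows "(\<integral>\<^sup>+p. ennreal (min 1 (norm (snd p - fst p)) * (\<bar>\<psi> (snd p) - \<psi> (fst p)\<bar> * log_mean (\<rho> (fst p)) (\<rho> (snd p)))) \<partial>Jm)
    \<le> 2 * levy_mass + 2 * action' lborel K \<rho> \<psi>"
proof -
  let ?\<theta> = "\<lambda>x y. log_mean (\<rho> x) (\<rho> y)" and ?m = "\<lambda>x y :: 'a. min 1 (norm (y - x))"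
  have "(\<integral>\<^sup>+p. ennreal (?m (fst p) (snd p) * (\<bar>\<psi> (snd p) - \<psi> (fst p)\<bar> * ?\<theta> (fst p) (snd p))) \<partial>Jm)
    = (\<integral>\<^sup>+x. \<integral>\<^sup>+y. ennreal (?m x y * (\<bar>\<psi> y - \<psi> x\<bar> * ?\<theta> x y)) * ennreal (j (y - x)) \<partial>lborel \<partial>lborel)"
  proof -
    have "(\<lambda>p. ennreal (?m (fst p) (snd p) * (\<bar>\<psi> (snd p) - \<psi> (fst p)\<bar> * ?\<theta> (fst p) (snd p)))) \<in> borel_measurable borel"
      unfolding measurable_borel_prod[symmetric] by measurable
    from nn_integral_Jm[OF this] show ?thesis unfolding fst_conv snd_conv .
  qed
  also have "\<dots> \<le> (\<integral>\<^sup>+x. \<integral>\<^sup>+y. ennreal ((?m x y)\<^sup>2 * ?\<theta> x y) * ennreal (j (y - x))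
      + ennreal ((\<psi> y - \<psi> x)\<^sup>2 * ?\<theta> x y) * ennreal (j (y - x)) \<partial>lborel \<partial>lborel)"
  proof (intro nn_integral_mono)
    fix x y
    have "ennreal (?m x y * (\<bar>\<psi> y - \<psi> x\<bar> * ?\<theta> x y)) \<le> ennreal ((?m x y)\<^sup>2 * ?\<theta> x y + (\<psi> y - \<psi> x)\<^sup>2 * ?\<theta> x y)"
      by (intro ennreal_leI flux_square_bound log_mean_nonneg) simp
    also have "\<dots> = ennreal ((?m x y)\<^sup>2 * ?\<theta> x y) + ennreal ((\<psi> y - \<psi> x)\<^sup>2 * ?\<theta> x y)"
      by (rule ennreal_plus) (simp_all add: log_mean_nonneg)
    finally show "ennreal (?m x y * (\<bar>\<psi> y - \<psi> x\<bar> * ?\<theta> x y)) * ennreal (j (y - x))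
      \<le> ennreal ((?m x y)\<^sup>2 * ?\<theta> x y) * ennreal (j (y - x)) + ennreal ((\<psi> y - \<psi> x)\<^sup>2 * ?\<theta> x y) * ennreal (j (y - x))"
      unfolding distrib_right[symmetric] by (rule mult_right_mono) simp
  qed
  also have "\<dots> = (\<integral>\<^sup>+x. \<integral>\<^sup>+y. ennreal ((?m x y)\<^sup>2 * ?\<theta> x y) * ennreal (j (y - x)) \<partial>lborel \<partial>lborel)
      + (\<integral>\<^sup>+x. \<integral>\<^sup>+y. ennreal ((\<psi> y - \<psi> x)\<^sup>2 * ?\<theta> x y) * ennreal (j (y - x)) \<partial>lborel \<partial>lborel)"
    by (simp add: nn_integral_add)
  also have "\<dots> \<le> 2 * levy_mass + 2 * action' lborel K \<rho> \<psi>"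
  proof (rule add_mono)
    show "(\<integral>\<^sup>+x. \<integral>\<^sup>+y. ennreal ((?m x y)\<^sup>2 * ?\<theta> x y) * ennreal (j (y - x)) \<partial>lborel \<partial>lborel) \<le> 2 * levy_mass"
      by (rule log_mean_levy_bound[OF \<rho> \<rho>0 \<rho>1])
    have "2 * (X / 2) = X" for X :: ennreal
    proof -
      have "2 * (X / 2) = X * (2 / 2)" by (simp only: divide_ennreal_def mult_ac)
      moreover have "2 / 2 = (1 :: ennreal)" by (rule ennreal_divide_self) auto
      ultimately show ?thesis by (simp only: mult_1_right)
    qed
    then show "(\<integral>\<^sup>+x. \<integral>\<^sup>+y. ennreal ((\<psi> y - \<psi> x)\<^sup>2 * ?\<theta> x y) * ennreal (j (y - x)) \<partial>lborel \<partial>lborel) \<le> 2 * action' lborel K \<rho> \<psi>"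
      unfolding action'_eq[OF \<rho> \<psi>] by simp
  qed
  finally show ?thesis .
qed

text \<open>On a compact set off the diagonal the distance of the two coordinates attains a positive
  minimum, so there the weight min 1 |x - y| is bounded below.\<close>

lemma radon_Jm_density:
  fixes W :: "'a \<times> 'a \<Rightarrow> real"
  assumes W: "W \<in> borel_measurable borel"
    and fin: "(\<integral>\<^sup>+p. ennreal (min 1 (norm (snd p - fst p)) * \<bar>W p\<bar>) \<partial>Jm) < \<infinity>"
  shows "radon_offdiag (density Jm (\<lambda>p. ennreal (W p)))"
proof -
  note Wm = measurable_jump_measure[OF W, of lborel]
  have "emeasure (density Jm (\<lambda>p. ennreal (W p))) S < \<infinity>" if S: "compact S" "S \<subseteq> offdiag" for S
  proof (cases "S = {}")
    case False
    have "continuous_on S (\<lambda>p. norm (snd p - fst p))" by (intro continuous_intros)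
    then obtain q where q: "q \<in> S" "\<And>p. p \<in> S \<Longrightarrow> norm (snd q - fst q) \<le> norm (snd p - fst p)"
      using continuous_attains_inf[OF S(1) False] by blast
    define \<delta> where "\<delta> = min 1 (norm (snd q - fst q))"
    have "snd q \<noteq> fst q" using q(1) S(2) by (auto simp: offdiag_def)
    then have \<delta>: "0 < \<delta>" by (simp add: \<delta>_def)
    have Sm: "S \<in> sets Jm"
      unfolding sets_jump_measure sets_offdiag_borel_iff using S borel_compact by blast
    have mm: "(\<lambda>p. ennreal (min 1 (norm (snd p - fst p)) * \<bar>W p\<bar>)) \<in> borel_measurable Jm"
    proof -
      have "(\<lambda>p :: 'a \<times> 'a. min 1 (norm (snd p - fst p))) \<in> borel_measurable Jm" by measurable
      then show ?thesis
        by (intro measurable_compose[OF _ measurable_ennreal] borel_measurable_times borel_measurable_abs Wm)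
    qed
    have "emeasure (density Jm (\<lambda>p. ennreal (W p))) S = (\<integral>\<^sup>+p. ennreal (W p) * indicator S p \<partial>Jm)"
      by (rule emeasure_density[OF measurable_compose[OF Wm measurable_ennreal] Sm])
    also have "\<dots> \<le> (\<integral>\<^sup>+p. ennreal (1 / \<delta>) * ennreal (min 1 (norm (snd p - fst p)) * \<bar>W p\<bar>) \<partial>Jm)"
    proof (rule nn_integral_mono)
      fix p
      show "ennreal (W p) * indicator S p \<le> ennreal (1 / \<delta>) * ennreal (min 1 (norm (snd p - fst p)) * \<bar>W p\<bar>)"
      proof (cases "p \<in> S")
        case True
        have "\<delta> \<le> min 1 (norm (snd p - fst p))" using q(2)[OF True] by (simp add: \<delta>_def)
        then have "\<delta> * \<bar>W p\<bar> \<le> min 1 (norm (snd p - fst p)) * \<bar>W p\<bar>" by (rule mult_right_mono) simp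
        then have "W p \<le> 1 / \<delta> * (min 1 (norm (snd p - fst p)) * \<bar>W p\<bar>)"
        proof -
          have "\<delta> * W p \<le> \<delta> * \<bar>W p\<bar>" using \<delta> by (intro mult_left_mono) auto
          also have "\<dots> \<le> min 1 (norm (snd p - fst p)) * \<bar>W p\<bar>" by fact
          finally show ?thesis using \<delta> by (simp add: le_divide_eq mult.commute)
        qed
        then have "ennreal (W p) \<le> ennreal (1 / \<delta> * (min 1 (norm (snd p - fst p)) * \<bar>W p\<bar>))" by (rule ennreal_leI)
        also have "\<dots> = ennreal (1 / \<delta>) * ennreal (min 1 (norm (snd p - fst p)) * \<bar>W p\<bar>)"
          using \<delta> by (intro ennreal_mult) auto
        finally show ?thesis using True by simp
      qed simp
    qed
    also have "\<dots> = ennreal (1 / \<delta>) * (\<integral>\<^sup>+p. ennreal (min 1 (norm (snd p - fst p)) * \<bar>W p\<bar>) \<partial>Jm)"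
      by (rule nn_integral_cmult[OF mm])
    also have "\<dots> < \<infinity>" using fin by (simp add: ennreal_mult_less_top)
    finally show ?thesis .
  qed simp
  then show ?thesis
    unfolding radon_offdiag_def by (simp add: sets_jump_measure)
qed

text \<open>The Hahn set is {W < 0}: the positive part gives it no mass and the negative part lives
  on it, so \<open>signed_density\<close> is a Jordan decomposition.\<close>

lemma signed_radon_density:
  fixes W :: "'a \<times> 'a \<Rightarrow> real"
  assumes W: "W \<in> borel_measurable borel"
    and fin: "(\<integral>\<^sup>+p. ennreal (min 1 (norm (snd p - fst p)) * \<bar>W p\<bar>) \<partial>Jm) < \<infinity>"
  shows "signed_radon_offdiag (signed_density Jm W)"
proof -
  have m: "(\<lambda>p. - W p) \<in> borel_measurable borel" using W by measurable
  note Wm = measurable_jump_measure[OF W, of lborel]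
  let ?A = "{p \<in> space Jm. W p < 0}"
  have A: "?A \<in> sets Jm" by (rule borel_measurable_less[OF Wm borel_measurable_const])
  have B: "offdiag - ?A \<in> sets Jm"
    using sets.Diff[OF sets.top[of Jm] A] by (simp add: space_jump_measure)
  have "emeasure (density Jm (\<lambda>p. ennreal (W p))) ?A = (\<integral>\<^sup>+p. ennreal (W p) * indicator ?A p \<partial>Jm)"
    by (rule emeasure_density[OF measurable_compose[OF Wm measurable_ennreal] A])
  also have "\<dots> = (\<integral>\<^sup>+p. 0 \<partial>Jm)"
    by (intro nn_integral_cong) (auto simp: indicator_def ennreal_neg)
  finally have 1: "emeasure (density Jm (\<lambda>p. ennreal (W p))) ?A = 0" by simp
  have "emeasure (density Jm (\<lambda>p. ennreal (- W p))) (offdiag - ?A) = (\<integral>\<^sup>+p. ennreal (- W p) * indicator (offdiag - ?A) p \<partial>Jm)"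
    by (rule emeasure_density[OF measurable_compose[OF borel_measurable_uminus[OF Wm] measurable_ennreal] B])
  also have "\<dots> = (\<integral>\<^sup>+p. 0 \<partial>Jm)"
    by (intro nn_integral_cong) (auto simp: indicator_def ennreal_neg space_jump_measure)
  finally have 2: "emeasure (density Jm (\<lambda>p. ennreal (- W p))) (offdiag - ?A) = 0" by simp
  have f': "(\<integral>\<^sup>+p. ennreal (min 1 (norm (snd p - fst p)) * \<bar>- W p\<bar>) \<partial>Jm) < \<infinity>" using fin by simp
  have "?A \<in> sets offdiag_borel" using A by (simp only: sets_jump_measure)
  then show ?thesis
    unfolding signed_radon_offdiag_def signed_density_def fst_conv snd_conv
    using radon_Jm_density[OF W fin] radon_Jm_density[OF m f'] 1 2 by blast
qed

lemma signed_integral_density: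
  fixes W f :: "'a \<times> 'a \<Rightarrow> real"
  assumes W: "W \<in> borel_measurable borel" and f: "f \<in> borel_measurable borel"
    and i: "integrable Jm (\<lambda>p. f p * W p)"
  shows "signed_integral (signed_density Jm W) f = (LINT p|Jm. f p * W p)"
proof -
  note Wm [measurable] = measurable_jump_measure[OF W, of lborel]
  note fm [measurable] = measurable_jump_measure[OF f, of lborel]
  have pos: "integral\<^sup>L (density Jm (\<lambda>p. ennreal (V p))) f = (LINT p|Jm. max 0 (V p) * f p)"
    if [measurable]: "V \<in> borel_measurable Jm" for V
  proof -
    have "density Jm (\<lambda>p. ennreal (V p)) = density Jm (\<lambda>p. ennreal (max 0 (V p)))"
    proof (rule density_cong)
      show "(\<lambda>p. ennreal (V p)) \<in> borel_measurable Jm" by (rule measurable_compose[OF that measurable_ennreal])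
      have "(\<lambda>p. max 0 (V p)) \<in> borel_measurable Jm"
        by (intro borel_measurable_max borel_measurable_const that)
      then show "(\<lambda>p. ennreal (max 0 (V p))) \<in> borel_measurable Jm"
        by (rule measurable_compose[OF _ measurable_ennreal])
    qed (simp add: max_def ennreal_neg)
    then have "integral\<^sup>L (density Jm (\<lambda>p. ennreal (V p))) f = integral\<^sup>L (density Jm (\<lambda>p. ennreal (max 0 (V p)))) f"
      by (simp only:)
    also have "\<dots> = (LINT p|Jm. max 0 (V p) *\<^sub>R f p)"
    proof (rule integral_density[OF fm])
      show "(\<lambda>p. max 0 (V p)) \<in> borel_measurable Jm"
        by (intro borel_measurable_max borel_measurable_const that)
    qed simp
    finally show ?thesis by simp
  qed
  have ip: "integrable Jm (\<lambda>p. max 0 (V p) * f p)" if [measurable]: "V \<in> borel_measurable Jm"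
    and "\<And>p. \<bar>V p\<bar> = \<bar>W p\<bar>" for V
  proof (rule Bochner_Integration.integrable_bound[OF i])
    have "\<bar>max 0 (V p)\<bar> * \<bar>f p\<bar> \<le> \<bar>f p\<bar> * \<bar>W p\<bar>" for p
    proof -
      have "\<bar>max 0 (V p)\<bar> \<le> \<bar>V p\<bar>" by (simp add: max_def)
      then have "\<bar>max 0 (V p)\<bar> * \<bar>f p\<bar> \<le> \<bar>W p\<bar> * \<bar>f p\<bar>"
        unfolding that(2)[of p] by (rule mult_right_mono) simp
      then show ?thesis by (simp only: mult.commute)
    qed
    then show "AE p in Jm. norm (max 0 (V p) * f p) \<le> norm (f p * W p)" by (simp add: abs_mult)
    show "(\<lambda>p. max 0 (V p) * f p) \<in> borel_measurable Jm"
      by (intro borel_measurable_times borel_measurable_max borel_measurable_const that(1) fm)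
  qed
  have "signed_integral (signed_density Jm W) f = (LINT p|Jm. max 0 (W p) * f p) - (LINT p|Jm. max 0 (- W p) * f p)"
    unfolding signed_integral_def signed_density_def fst_conv snd_conv pos[OF Wm] pos[OF borel_measurable_uminus[OF Wm]] ..
  also have "\<dots> = (LINT p|Jm. max 0 (W p) * f p - max 0 (- W p) * f p)"
    by (rule Bochner_Integration.integral_diff[symmetric]) (rule ip[OF Wm], simp, rule ip[OF borel_measurable_uminus[OF Wm]], simp)
  also have "\<dots> = (LINT p|Jm. f p * W p)"
    by (rule Bochner_Integration.integral_cong[OF refl]) (simp add: max_def)
  finally show ?thesis .
qed

end

section \<open>The action as an integral over tangent slopes\<close>

context levy_kernel
begin

text \<open>At its own point of contact the tangent plane is exact, and exchanging x and y
  identifies the contributions of the two slopes. The left-hand side is the form that the error term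
  of the dual estimate takes after averaging over translates.\<close>

lemma tangent_energy:
  fixes \<rho> f :: "'a \<Rightarrow> real"
  assumes \<rho> [measurable]: "\<rho> \<in> borel_measurable borel" and pos: "\<And>x. 0 < \<rho> x"
    and f [measurable]: "f \<in> borel_measurable borel"
  shows "(\<integral>\<^sup>+x. ennreal (\<rho> x) * (\<integral>\<^sup>+y. ennreal (log_mean_slope (\<rho> x) (\<rho> y) * (f y - f x)\<^sup>2) * ennreal (j (y - x)) \<partial>lborel) \<partial>lborel)
    = action' lborel K \<rho> f"
proof -
  let ?l = "\<lambda>x y. log_mean_slope (\<rho> x) (\<rho> y)" and ?d = "\<lambda>x y. (f y - f x)\<^sup>2"
  let ?F = "\<lambda>x y. ennreal (?l x y * \<rho> x * ?d x y)"
  have nn: "0 \<le> \<rho> x" for x using pos[of x] by simp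
  let ?Z = "\<integral>\<^sup>+x. \<integral>\<^sup>+y. ?F x y * ennreal (j (y - x)) \<partial>lborel \<partial>lborel"
  have Z: "(\<integral>\<^sup>+x. ennreal (\<rho> x) * (\<integral>\<^sup>+y. ennreal (?l x y * ?d x y) * ennreal (j (y - x)) \<partial>lborel) \<partial>lborel) = ?Z"
  proof (rule nn_integral_cong)
    fix x
    have "ennreal (\<rho> x) * (\<integral>\<^sup>+y. ennreal (?l x y * ?d x y) * ennreal (j (y - x)) \<partial>lborel)
      = (\<integral>\<^sup>+y. ennreal (\<rho> x) * (ennreal (?l x y * ?d x y) * ennreal (j (y - x))) \<partial>lborel)"
      by (rule nn_integral_cmult[symmetric]) measurable
    also have "\<dots> = (\<integral>\<^sup>+y. ?F x y * ennreal (j (y - x)) \<partial>lborel)"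
    proof (rule nn_integral_cong)
      fix y
      have "?F x y = ennreal (\<rho> x * (?l x y * ?d x y))" by (simp only: mult_ac)
      also have "\<dots> = ennreal (\<rho> x) * ennreal (?l x y * ?d x y)" by (rule ennreal_mult'[OF nn])
      finally show "ennreal (\<rho> x) * (ennreal (?l x y * ?d x y) * ennreal (j (y - x))) = ?F x y * ennreal (j (y - x))"
        by (simp only: mult.assoc)
    qed
    finally show "ennreal (\<rho> x) * (\<integral>\<^sup>+y. ennreal (?l x y * ?d x y) * ennreal (j (y - x)) \<partial>lborel)
      = (\<integral>\<^sup>+y. ?F x y * ennreal (j (y - x)) \<partial>lborel)" .
  qed
  have swap: "?Z = (\<integral>\<^sup>+x. \<integral>\<^sup>+y. ?F y x * ennreal (j (y - x)) \<partial>lborel \<partial>lborel)"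
    using nn_integral_Jm_swap[of "\<lambda>(x, y). ?F x y"] by simp
  have "?Z + ?Z = (\<integral>\<^sup>+x. \<integral>\<^sup>+y. ?F x y * ennreal (j (y - x)) \<partial>lborel \<partial>lborel) + (\<integral>\<^sup>+x. \<integral>\<^sup>+y. ?F y x * ennreal (j (y - x)) \<partial>lborel \<partial>lborel)"
    by (simp only: swap[symmetric])
  also have "\<dots> = (\<integral>\<^sup>+x. \<integral>\<^sup>+y. ?F x y * ennreal (j (y - x)) + ?F y x * ennreal (j (y - x)) \<partial>lborel \<partial>lborel)"
    by (simp add: nn_integral_add)
  also have "\<dots> = (\<integral>\<^sup>+x. \<integral>\<^sup>+y. ennreal (?d x y * log_mean (\<rho> x) (\<rho> y)) * ennreal (j (y - x)) \<partial>lborel \<partial>lborel)"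
  proof (intro nn_integral_cong)
    fix x y
    have "?d x y * log_mean (\<rho> x) (\<rho> y) = ?l x y * \<rho> x * ?d x y + ?l y x * \<rho> y * ?d y x"
      unfolding log_mean_tangent_eq[OF pos pos] power2_commute[of "f x" "f y"] by (simp add: algebra_simps)
    then have "ennreal (?d x y * log_mean (\<rho> x) (\<rho> y)) = ?F x y + ?F y x"
      by (simp add: log_mean_slope_nonneg nn)
    then show "?F x y * ennreal (j (y - x)) + ?F y x * ennreal (j (y - x)) = ennreal (?d x y * log_mean (\<rho> x) (\<rho> y)) * ennreal (j (y - x))"
      by (simp only: distrib_right)
  qed
  finally have "?Z + ?Z = (\<integral>\<^sup>+x. \<integral>\<^sup>+y. ennreal (?d x y * log_mean (\<rho> x) (\<rho> y)) * ennreal (j (y - x)) \<partial>lborel \<partial>lborel)" .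
  then have "action' lborel K \<rho> f = (?Z + ?Z) / 2" unfolding action'_eq[OF \<rho> f] by (simp only:)
  also have "\<dots> = ?Z"
  proof -
    have "(2 * X) / 2 = X * (2 / 2)" for X :: ennreal by (simp only: divide_ennreal_def mult_ac)
    moreover have "2 / 2 = (1 :: ennreal)" by (rule ennreal_divide_self) auto
    ultimately show ?thesis unfolding mult_2[symmetric] by (simp only: mult_1_right)
  qed
  finally show ?thesis unfolding Z ..
qed

end

section \<open>Averages over translates along the curve\<close>

context smoothed_curve
begin

lemma clamp01_01 [simp]: "clamp01 0 = 0" "clamp01 1 = 1"
  by (simp_all add: clamp01_def)

text \<open>Adding the bound C reduces the claim to nonnegative integrals against a measurable
  family of measures.\<close>

lemma average_measurable:
  fixes f :: "real \<times> 'a \<Rightarrow> real"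
  assumes f [measurable]: "f \<in> borel_measurable (borel \<Otimes>\<^sub>M borel)" and C: "\<And>p. \<bar>f p\<bar> \<le> C"
  shows "(\<lambda>(t, z). LINT x|\<nu> t. f (t, x + z)) \<in> borel_measurable (borel \<Otimes>\<^sub>M borel)"
proof -
  have \<nu>m: "(\<lambda>p. \<nu> (fst p)) \<in> borel \<Otimes>\<^sub>M borel \<rightarrow>\<^sub>M subprob_algebra borel"
    by (rule measurable_compose[OF measurable_fst \<nu>_measurable])
  have "(\<lambda>p. (\<integral>\<^sup>+x. ennreal (f (fst p, x + snd p) + C) \<partial>\<nu> (fst p))) \<in> borel_measurable (borel \<Otimes>\<^sub>M borel)"
    by (rule nn_integral_measurable_subprob_algebra2[OF _ \<nu>m]) measurable
  then have m: "(\<lambda>p. enn2real (\<integral>\<^sup>+x. ennreal (f (fst p, x + snd p) + C) \<partial>\<nu> (fst p)) - C) \<in> borel_measurable (borel \<Otimes>\<^sub>M borel)"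
    by measurable
  have "enn2real (\<integral>\<^sup>+x. ennreal (f (t, x + z) + C) \<partial>\<nu> t) - C = (LINT x|\<nu> t. f (t, x + z))" for t z
  proof -
    interpret P: prob_space "\<nu> t" by (rule \<nu>_prob)
    have fm: "(\<lambda>x. f (t, x)) \<in> borel_measurable borel" by measurable
    have i: "integrable (\<nu> t) (\<lambda>x. f (t, x + z))" by (rule bounded_average(1)[OF fm C])
    have "0 \<le> f (t, x + z) + C" for x using C[of "(t, x + z)"] by linarith
    then have "(\<integral>\<^sup>+x. ennreal (f (t, x + z) + C) \<partial>\<nu> t) = ennreal (LINT x|\<nu> t. f (t, x + z) + C)"
      using i by (intro nn_integral_eq_integral) auto
    also have "(LINT x|\<nu> t. f (t, x + z) + C) = (LINT x|\<nu> t. f (t, x + z)) + C"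
      using i by (simp add: P.prob_space)
    finally show ?thesis using bounded_average(2)[OF fm C, of t z] by simp
  qed
  then show ?thesis using m by (simp add: case_prod_beta')
qed

lemma smoothed_convolution_time:
  fixes f :: "real \<times> 'a \<Rightarrow> real"
  assumes f [measurable]: "f \<in> borel_measurable (borel \<Otimes>\<^sub>M borel)" and C: "\<And>p. \<bar>f p\<bar> \<le> C"
  shows "integrable lborel (\<lambda>z. k z * (LINT t:{0..1}|lborel. LINT x|\<nu> t. f (t, x + z)))"
    and "(LINT z|lborel. k z * (LINT t:{0..1}|lborel. LINT x|\<nu> t. f (t, x + z)))
      = (LINT t:{0..1}|lborel. LINT x|lborel. f (t, x) * smoothed t x)"
proof -
  have fm: "(\<lambda>x. f (t, x)) \<in> borel_measurable borel" for t by measurable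
  have Cb: "\<bar>f (t, x)\<bar> \<le> C" for t x by (rule C)
  note [measurable] = average_measurable[OF f C]
  have U: "\<bar>LINT x|\<nu> t. f (t, x + z)\<bar> \<le> C" for t z by (rule bounded_average(2)[OF fm Cb])
  let ?G = "\<lambda>t z. indicator {0..1} t * (k z * (LINT x|\<nu> t. f (t, x + z)))"
  have i: "integrable (lborel \<Otimes>\<^sub>M lborel) (\<lambda>(t, z). ?G t z)"
  proof (rule Bochner_Integration.integrable_bound)
    have "(\<integral>\<^sup>+p. ennreal (C * (indicator {0..1::real} (fst p) * k (snd p))) \<partial>(lborel \<Otimes>\<^sub>M lborel))
      = (\<integral>\<^sup>+t. \<integral>\<^sup>+z. ennreal (C * (indicator {0..1::real} t * k z)) \<partial>lborel \<partial>lborel)"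
      by (subst lborel.nn_integral_fst[symmetric]) simp_all
    also have "\<dots> = (\<integral>\<^sup>+t. ennreal C * indicator {0..1::real} t \<partial>lborel)"
    proof (rule nn_integral_cong)
      fix t :: real
      have "0 \<le> C" using order_trans[OF abs_ge_zero C] .
      then have "(\<integral>\<^sup>+z. ennreal (C * (indicator {0..1} t * k z)) \<partial>lborel) = (\<integral>\<^sup>+z. (ennreal C * indicator {0..1} t) * ennreal (k z) \<partial>lborel)"
        using k0 by (intro nn_integral_cong) (simp add: indicator_def ennreal_mult less_imp_le)
      also have "\<dots> = (ennreal C * indicator {0..1} t) * (\<integral>\<^sup>+z. ennreal (k z) \<partial>lborel)"
        by (rule nn_integral_cmult) measurable
      finally show "(\<integral>\<^sup>+z. ennreal (C * (indicator {0..1} t * k z)) \<partial>lborel) = ennreal C * indicator {0..1} t"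
        by (simp only: k1 mult_1_right)
    qed
    also have "\<dots> < \<infinity>" by (subst nn_integral_cmult) simp_all
    finally have fin: "(\<integral>\<^sup>+p. ennreal (C * (indicator {0..1::real} (fst p) * k (snd p))) \<partial>(lborel \<Otimes>\<^sub>M lborel)) < \<infinity>" .
    have C0: "0 \<le> C" using order_trans[OF abs_ge_zero C] .
    show "integrable (lborel \<Otimes>\<^sub>M lborel) (\<lambda>p. C * (indicator {0..1::real} (fst p) * k (snd p)))"
    proof (rule integrableI_nonneg[OF _ _ fin])
      show "(\<lambda>p. C * (indicator {0..1::real} (fst p) * k (snd p))) \<in> borel_measurable (lborel \<Otimes>\<^sub>M lborel)" by measurable
      have "0 \<le> C * (indicator {0..1::real} (fst p) * k (snd p))" for p
        using C0 k0[of "snd p"] by (intro mult_nonneg_nonneg) (simp_all add: less_imp_le)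
      then show "AE p in lborel \<Otimes>\<^sub>M lborel. 0 \<le> C * (indicator {0..1::real} (fst p) * k (snd p))" by simp
    qed
    have "\<bar>?G t z\<bar> \<le> C * (indicator {0..1} t * k z)" for t z
    proof -
      have "k z * \<bar>LINT x|\<nu> t. f (t, x + z)\<bar> \<le> k z * C" using U k0[of z] by (intro mult_left_mono) auto
      then show ?thesis using k0[of z] by (simp add: abs_mult indicator_def mult.commute)
    qed
    then show "AE p in lborel \<Otimes>\<^sub>M lborel. norm (case p of (t, z) \<Rightarrow> ?G t z) \<le> norm (C * (indicator {0..1::real} (fst p) * k (snd p)))"
      by (auto intro!: AE_I2 order_trans[OF _ abs_ge_self])
  qed measurable
  have eq: "k z * (LINT t:{0..1}|lborel. LINT x|\<nu> t. f (t, x + z)) = (LINT t|lborel. ?G t z)" for z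
    unfolding set_lebesgue_integral_def integral_mult_right_zero[symmetric]
    by (simp add: mult_ac)
  show "integrable lborel (\<lambda>z. k z * (LINT t:{0..1}|lborel. LINT x|\<nu> t. f (t, x + z)))"
    unfolding eq using lborel_pair.integrable_snd[OF i] by simp
  have "(LINT z|lborel. k z * (LINT t:{0..1}|lborel. LINT x|\<nu> t. f (t, x + z))) = (LINT z|lborel. LINT t|lborel. ?G t z)"
    unfolding eq ..
  also have "\<dots> = (LINT t|lborel. LINT z|lborel. ?G t z)"
    by (rule lborel_pair.Fubini_integral[OF i])
  also have "\<dots> = (LINT t:{0..1}|lborel. LINT x|lborel. f (t, x) * smoothed t x)"
    unfolding set_lebesgue_integral_def
    by (rule Bochner_Integration.integral_cong[OF refl]) (simp add: smoothed_convolution(2)[OF fm Cb])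
  finally show "(LINT z|lborel. k z * (LINT t:{0..1}|lborel. LINT x|\<nu> t. f (t, x + z)))
      = (LINT t:{0..1}|lborel. LINT x|lborel. f (t, x) * smoothed t x)" .
qed

text \<open>For each translate z, the average is continuous in time by weak continuity of the given
  curve; dominated convergence in z with majorant C k finishes.\<close>

lemma smoothed_weakly_continuous:
  fixes f :: "'a \<Rightarrow> real"
  assumes f: "continuous_on UNIV f" and C: "\<And>x. \<bar>f x\<bar> \<le> C"
  shows "continuous_on UNIV (\<lambda>t. LINT x|lborel. f x * smoothed t x)"
proof -
  have fm: "f \<in> borel_measurable borel" by (rule borel_measurable_continuous_onI[OF f])
  have k1i: "integrable lborel k"
    using k1 k0 by (intro integrableI_nonneg) (auto simp: less_imp_le)
  have "continuous_on UNIV (\<lambda>t. LINT z|lborel. k z * (LINT x|\<nu> t. f (x + z)))"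
    unfolding continuous_on_sequentially
  proof (intro allI ballI impI, elim conjE)
    fix s :: "nat \<Rightarrow> real" and t assume s: "s \<longlonglongrightarrow> t"
    show "((\<lambda>t. LINT z|lborel. k z * (LINT x|\<nu> t. f (x + z))) \<circ> s) \<longlonglongrightarrow> (LINT z|lborel. k z * (LINT x|\<nu> t. f (x + z)))"
      unfolding comp_def
    proof (rule integral_dominated_convergence[where w="\<lambda>z. C * k z"])
      show "(\<lambda>z. k z * (LINT x|\<nu> r. f (x + z))) \<in> borel_measurable lborel" for r
        using smoothed_convolution(1)[OF fm C] by (rule borel_measurable_integrable)
      then show "(\<lambda>z. k z * (LINT x|\<nu> (s n). f (x + z))) \<in> borel_measurable lborel" for n .
      show "integrable lborel (\<lambda>z. C * k z)" using k1i by simp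
      show "AE z in lborel. norm (k z * (LINT x|\<nu> (s n). f (x + z))) \<le> C * k z" for n
      proof (rule AE_I2)
        fix z
        have "k z * \<bar>LINT x|\<nu> (s n). f (x + z)\<bar> \<le> k z * C"
          using bounded_average(2)[OF fm C] k0[of z] by (intro mult_left_mono) auto
        then show "norm (k z * (LINT x|\<nu> (s n). f (x + z))) \<le> C * k z"
          using k0[of z] by (simp add: abs_mult mult.commute)
      qed
      show "AE z in lborel. (\<lambda>n. k z * (LINT x|\<nu> (s n). f (x + z))) \<longlonglongrightarrow> k z * (LINT x|\<nu> t. f (x + z))"
      proof (rule AE_I2)
        fix z
        have "continuous_on UNIV (\<lambda>x. f (x + z))"
          by (rule continuous_on_compose2[OF f]) (auto intro!: continuous_intros)
        moreover have "bounded (range (\<lambda>x. f (x + z)))" using C by (intro boundedI[of _ C]) auto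
        ultimately have "continuous_on UNIV (\<lambda>t. LINT x|\<nu> t. f (x + z))"
          by (rule weakly_continuous_curve_integral[OF wc])
        then have "(\<lambda>n. LINT x|\<nu> (s n). f (x + z)) \<longlonglongrightarrow> (LINT x|\<nu> t. f (x + z))"
          using s by (rule continuous_on_tendsto_compose) auto
        then show "(\<lambda>n. k z * (LINT x|\<nu> (s n). f (x + z))) \<longlonglongrightarrow> k z * (LINT x|\<nu> t. f (x + z))"
          by (rule tendsto_mult_left)
      qed
    qed
  qed
  then show ?thesis unfolding smoothed_convolution(2)[OF fm C] .
qed

end

subsection \<open>Infinite jump activity\<close>

text \<open>Shifting by half a period \<pi> / (n + 1) in direction b changes the sign of the
  exponential, so twice the integral is at most the L1 distance of p and its shift. For a continuous
  density this distance tends to 0 by Scheffe's lemma, all shifts having the same mass.\<close>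

lemma riemann_lebesgue_sequence:
  fixes p :: "'a::euclidean_space \<Rightarrow> real"
  assumes c: "continuous_on UNIV p" and p0: "\<And>x. 0 \<le> p x" and p1: "(\<integral>\<^sup>+x. ennreal (p x) \<partial>lborel) = 1"
    and b: "b \<in> Basis"
  shows "(\<lambda>n. LINT x|lborel. iexp (((real (Suc n)) *\<^sub>R b) \<bullet> x) * complex_of_real (p x)) \<longlonglongrightarrow> 0"
proof -
  have pm [measurable]: "p \<in> borel_measurable borel" by (rule borel_measurable_continuous_onI[OF c])
  define h where "h n = (pi / real (Suc n)) *\<^sub>R b" for n
  let ?e = "\<lambda>n x. iexp (((real (Suc n)) *\<^sub>R b) \<bullet> x)"
  have pi: "integrable lborel p" using p0 p1 by (intro integrableI_nonneg) auto
  have p1': "(LINT x|lborel. p x) = 1" using p0 p1 by (subst integral_eq_nn_integral) auto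
  have [measurable]: "?e n \<in> borel_measurable borel" for n
    by (intro borel_measurable_continuous_onI continuous_intros)
  have en: "norm (?e n x) = 1" for n x by simp
  have ie: "integrable lborel (\<lambda>x. ?e n x * complex_of_real (q x))"
    if [measurable]: "q \<in> borel_measurable borel" and "integrable lborel q" for q n
    by (rule Bochner_Integration.integrable_bound[OF that(2)]) (measurable, simp add: norm_mult)
  have pn: "(\<lambda>x. p (x + h n)) \<in> borel_measurable borel" for n by measurable
  have shift: "integrable lborel (\<lambda>x. p (x + h n))" "(LINT x|lborel. p (x + h n)) = 1"
    "(\<integral>\<^sup>+x. ennreal (p (x + h n)) \<partial>lborel) = 1" for n
  proof -
    show nn1: "(\<integral>\<^sup>+x. ennreal (p (x + h n)) \<partial>lborel) = 1"
      using nn_integral_lborel_shift[of "\<lambda>x. ennreal (p x)" "h n"] p1 by (simp add: add.commute)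
    then show "integrable lborel (\<lambda>x. p (x + h n))" using p0 by (intro integrableI_nonneg) auto
    show "(LINT x|lborel. p (x + h n)) = 1" using p0 nn1 by (subst integral_eq_nn_integral) auto
  qed
  have est: "norm (LINT x|lborel. ?e n x * complex_of_real (p x)) \<le> (LINT x|lborel. \<bar>p (x + h n) - p x\<bar>)" for n
  proof -
    have eh: "?e n (h n + x) = - ?e n x" for x
    proof -
      have "((real (Suc n)) *\<^sub>R b) \<bullet> (h n + x) = pi + ((real (Suc n)) *\<^sub>R b) \<bullet> x"
        using b by (simp add: h_def inner_add_right del: of_nat_Suc)
      then show ?thesis by (simp add: distrib_left exp_add del: of_nat_Suc)
    qed
    have "(LINT x|lborel. ?e n x * complex_of_real (p x)) = (LINT x|distr lborel borel ((+) (h n)). ?e n x * complex_of_real (p x))"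
      by (simp only: lborel_distr_plus)
    also have "\<dots> = (LINT x|lborel. ?e n (h n + x) * complex_of_real (p (h n + x)))"
      by (rule integral_distr) measurable
    also have "\<dots> = - (LINT x|lborel. ?e n x * complex_of_real (p (x + h n)))"
      unfolding eh by (simp add: add.commute)
    finally have m: "(LINT x|lborel. ?e n x * complex_of_real (p x)) = - (LINT x|lborel. ?e n x * complex_of_real (p (x + h n)))" .
    have "2 * (LINT x|lborel. ?e n x * complex_of_real (p x))
      = (LINT x|lborel. ?e n x * complex_of_real (p x)) - (LINT x|lborel. ?e n x * complex_of_real (p (x + h n)))"
      using m by simp
    also have "\<dots> = (LINT x|lborel. ?e n x * complex_of_real (p x) - ?e n x * complex_of_real (p (x + h n)))"
      by (rule Bochner_Integration.integral_diff[OF ie[OF pm pi] ie[OF pn shift(1)], symmetric])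
    finally have eq2: "2 * (LINT x|lborel. ?e n x * complex_of_real (p x))
      = (LINT x|lborel. ?e n x * complex_of_real (p x) - ?e n x * complex_of_real (p (x + h n)))" .
    have "2 * norm (LINT x|lborel. ?e n x * complex_of_real (p x))
      = norm (2 * (LINT x|lborel. ?e n x * complex_of_real (p x)))"
      by (simp only: norm_mult norm_numeral)
    also have "\<dots> = norm (LINT x|lborel. ?e n x * complex_of_real (p x) - ?e n x * complex_of_real (p (x + h n)))"
      unfolding eq2 ..
    also have "\<dots> \<le> (LINT x|lborel. norm (?e n x * complex_of_real (p x) - ?e n x * complex_of_real (p (x + h n))))"
      by (rule integral_norm_bound)
    also have "\<dots> = (LINT x|lborel. \<bar>p (x + h n) - p x\<bar>)"
    proof (rule Bochner_Integration.integral_cong[OF refl])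
      fix x
      have "?e n x * complex_of_real (p x) - ?e n x * complex_of_real (p (x + h n)) = ?e n x * complex_of_real (p x - p (x + h n))"
        by (simp add: right_diff_distrib)
      then show "norm (?e n x * complex_of_real (p x) - ?e n x * complex_of_real (p (x + h n))) = \<bar>p (x + h n) - p x\<bar>"
        by (simp only: norm_mult en norm_of_real abs_minus_commute mult_1_left)
    qed
    finally show ?thesis using norm_ge_zero[of "LINT x|lborel. ?e n x * complex_of_real (p x)"] by linarith
  qed
  have hl: "h \<longlonglongrightarrow> 0"
  proof -
    have "(\<lambda>n. (pi / real (Suc n)) *\<^sub>R b) \<longlonglongrightarrow> 0 *\<^sub>R b"
      by (intro tendsto_scaleR tendsto_const) real_asymp
    then show ?thesis by (simp add: h_def[abs_def])
  qed
  have pt: "(\<lambda>n. p (x + h n)) \<longlonglongrightarrow> p x" for x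
  proof -
    have "(\<lambda>n. x + h n) \<longlonglongrightarrow> x + 0" by (intro tendsto_add tendsto_const hl)
    then show ?thesis using continuous_on_tendsto_compose[OF c, of "\<lambda>n. x + h n" x] by simp
  qed
  have "(\<lambda>n. \<integral>\<^sup>+x. norm (p (x + h n) - p x) \<partial>lborel) \<longlonglongrightarrow> 0"
  proof (rule Scheffe_lemma2)
    show "(\<lambda>x. p (x + h n)) \<in> borel_measurable lborel" for n by measurable
    show "integrable lborel p" by (rule pi)
    show "AE x in lborel. (\<lambda>n. p (x + h n)) \<longlonglongrightarrow> p x" using pt by simp
    show "(\<integral>\<^sup>+x. norm (p (x + h n)) \<partial>lborel) \<le> (\<integral>\<^sup>+x. norm (p x) \<partial>lborel)" for n
      using shift(3)[of n] p1 p0 by simp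
  qed
  moreover have "(\<integral>\<^sup>+x. norm (p (x + h n) - p x) \<partial>lborel) = ennreal (LINT x|lborel. \<bar>p (x + h n) - p x\<bar>)" for n
    using shift(1) pi by (subst nn_integral_eq_integral) auto
  ultimately have "(\<lambda>n. ennreal (LINT x|lborel. \<bar>p (x + h n) - p x\<bar>)) \<longlonglongrightarrow> ennreal 0" by simp
  then have "(\<lambda>n. LINT x|lborel. \<bar>p (x + h n) - p x\<bar>) \<longlonglongrightarrow> 0"
    by (subst (asm) tendsto_ennreal_iff) (auto intro!: integral_nonneg_AE)
  then show ?thesis
    by (rule Lim_null_comparison[rotated]) (use est in simp)
qed

text \<open>The compensator is purely imaginary, so the real part of the integrand is cos - 1 \<ge>
  -2. If the integrand is not integrable, the exponent has the default value 0 and the bound holds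
  as well.\<close>

lemma levy_exponent_Re_bound:
  fixes \<nu> :: "'a::euclidean_space measure"
  assumes "finite_measure \<nu>"
  shows "- 2 * measure \<nu> (space \<nu>) \<le> Re (levy_exponent \<nu> \<xi>)"
proof -
  interpret finite_measure \<nu> by fact
  let ?f = "\<lambda>y. iexp (y \<bullet> \<xi>) - 1 - \<i> * complex_of_real (y \<bullet> \<xi>) * indicator (cball 0 1) y"
  show ?thesis
  proof (cases "integrable \<nu> ?f")
    case False
    then show ?thesis unfolding levy_exponent_def by (simp add: not_integrable_integral_eq measure_nonneg)
  next
    case True
    have re: "Re (?f y) = cos (y \<bullet> \<xi>) - 1" for y
      by (simp add: Re_exp indicator_def)
    have "(LINT y|\<nu>. - 2) \<le> (LINT y|\<nu>. Re (?f y))"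
    proof (rule integral_mono)
      show "integrable \<nu> (\<lambda>y. Re (?f y))" using True by (rule integrable_Re)
      show "- 2 \<le> Re (?f y)" for y unfolding re using cos_ge_minus_one[of "y \<bullet> \<xi>"] by linarith
    qed simp
    also have "(LINT y|\<nu>. Re (?f y)) = Re (levy_exponent \<nu> \<xi>)"
      unfolding levy_exponent_def by (rule integral_Re[OF True])
    finally show ?thesis by (simp add: mult.commute)
  qed
qed

lemma regularity_infinite_activity:
  fixes \<nu> :: "'a::euclidean_space measure"
  assumes R: "regularity_assumption \<nu> M X"
  shows "emeasure \<nu> (space \<nu>) = \<infinity>"
proof (rule ccontr)
  assume "emeasure \<nu> (space \<nu>) \<noteq> \<infinity>"
  then have fin: "finite_measure \<nu>" by (intro finite_measureI) auto
  obtain p where p: "\<And>t. 0 < t \<Longrightarrow> distributed M lborel (X t) (\<lambda>x. ennreal (p t x))" "\<And>t x. 0 < t \<Longrightarrow> 0 < p t x"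
    and sm: "\<And>t. 0 < t \<Longrightarrow> smooth (p t)"
  proof -
    from R obtain q where q: "\<forall>t>0. distributed M lborel (X t) (\<lambda>x. ennreal (q t x)) \<and> (\<forall>x. 0 < q t x)"
      "rapidly_decreasing_loc_unif q"
      unfolding regularity_assumption_def by (elim conjE exE)
    then have "\<forall>t>0. smooth (q t)" unfolding rapidly_decreasing_loc_unif_def by (elim conjE)
    with q show ?thesis by (intro that[of q]) simp_all
  qed
  have char: "(LINT \<omega>|M. iexp (\<xi> \<bullet> X 1 \<omega>)) = exp (complex_of_real 1 * levy_exponent \<nu> \<xi>)" for \<xi>
  proof -
    from R have "\<forall>t\<ge>0. \<forall>\<xi>. (LINT \<omega>|M. iexp (\<xi> \<bullet> X t \<omega>)) = exp (complex_of_real t * levy_exponent \<nu> \<xi>)"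
      unfolding regularity_assumption_def by (elim conjE)
    then show ?thesis using zero_le_one by blast
  qed
  have M: "prob_space M" using R unfolding regularity_assumption_def levy_process_def by (elim conjE)
  interpret prob_space M by (rule M)
  have d: "distributed M lborel (X 1) (\<lambda>x. ennreal (p 1 x))" and pp: "0 \<le> p 1 x" for x
    using p(1)[of 1] p(2)[of 1 x] by simp_all
  have pm: "p 1 \<in> borel_measurable borel" using sm[of 1] smooth_measurable by simp
  have Xm: "X 1 \<in> measurable M lborel" using d by (rule distributed_measurable)
  have p1: "(\<integral>\<^sup>+x. ennreal (p 1 x) \<partial>lborel) = 1"
  proof -
    have "prob_space (distr M lborel (X 1))" by (rule prob_space_distr[OF Xm])
    then have "prob_space (density lborel (\<lambda>x. ennreal (p 1 x)))"
      using distributed_distr_eq_density[OF d] by simp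
    then have "emeasure (density lborel (\<lambda>x. ennreal (p 1 x))) UNIV = 1"
      using prob_space.emeasure_space_1 by fastforce
    then show ?thesis using pm by (subst (asm) emeasure_density) simp_all
  qed
  obtain b :: 'a where b: "b \<in> Basis" using nonempty_Basis by blast
  \<comment> \<open>Smoothness of the density of X at time 1 provides the continuity asked for by
    the Riemann-Lebesgue argument; the frequencies run to infinity along one coordinate
    axis.\<close>
  have "(\<lambda>n. LINT x|lborel. iexp (((real (Suc n)) *\<^sub>R b) \<bullet> x) * complex_of_real (p 1 x)) \<longlonglongrightarrow> 0"
    by (rule riemann_lebesgue_sequence[OF smooth_continuous_on[OF sm] pp p1 b]) simp
  moreover have "(LINT x|lborel. iexp (\<xi> \<bullet> x) * complex_of_real (p 1 x)) = exp (levy_exponent \<nu> \<xi>)" for \<xi>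
  proof -
    have [measurable]: "(\<lambda>x. iexp (\<xi> \<bullet> x)) \<in> borel_measurable borel"
      by (intro borel_measurable_continuous_onI continuous_intros)
    have gm: "(\<lambda>x. iexp (\<xi> \<bullet> x)) \<in> borel_measurable lborel" by simp
    have "(LINT x|lborel. p 1 x *\<^sub>R iexp (\<xi> \<bullet> x)) = (LINT x|density lborel (\<lambda>x. ennreal (p 1 x)). iexp (\<xi> \<bullet> x))"
      by (rule integral_density[OF gm, symmetric]) (use pm pp in simp_all)
    also have "\<dots> = (LINT x|distr M lborel (X 1). iexp (\<xi> \<bullet> x))"
      by (simp only: distributed_distr_eq_density[OF d])
    also have "\<dots> = (LINT \<omega>|M. iexp (\<xi> \<bullet> X 1 \<omega>))" by (rule integral_distr[OF Xm gm])
    finally have "(LINT x|lborel. p 1 x *\<^sub>R iexp (\<xi> \<bullet> x)) = (LINT \<omega>|M. iexp (\<xi> \<bullet> X 1 \<omega>))" .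
    then show ?thesis using char[of \<xi>] by (simp add: scaleR_conv_of_real mult.commute)
  qed
  ultimately have "(\<lambda>n. exp (levy_exponent \<nu> ((real (Suc n)) *\<^sub>R b))) \<longlonglongrightarrow> 0" by (simp only:)
  then have "(\<lambda>n. norm (exp (levy_exponent \<nu> ((real (Suc n)) *\<^sub>R b)))) \<longlonglongrightarrow> 0" by (rule tendsto_norm_zero)
  moreover have "exp (- 2 * measure \<nu> (space \<nu>)) \<le> norm (exp (levy_exponent \<nu> \<xi>))" for \<xi>
    using levy_exponent_Re_bound[OF fin, of \<xi>] by simp
  ultimately have "exp (- 2 * measure \<nu> (space \<nu>)) \<le> 0"
    by (intro LIMSEQ_le_const) auto
  then show False by (simp add: not_le[symmetric])
qed

section \<open>A probability density below a small multiple of the jump density\<close>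

context levy_kernel
begin

text \<open>\<kappa> n is j damped near the origin by w n and cut at height n + 1. The damping makes
  it integrable by the Levy condition; since \<kappa> n increases to j, its mass exceeds 1 /
  \<epsilon> for some n, and dividing by this mass gives a density below \<epsilon> j.\<close>

lemma smoothing_kernel_exists:
  assumes inf: "(\<integral>\<^sup>+z. ennreal (j z) \<partial>lborel) = \<infinity>" and \<epsilon>: "0 < \<epsilon>"
  obtains k :: "'a \<Rightarrow> real" and B where "k \<in> borel_measurable borel" "\<And>x. 0 < k x" "\<And>x. k x \<le> B"
    "\<And>x. k (- x) = k x" "\<And>x. k x \<le> \<epsilon> * j x" "(\<integral>\<^sup>+x. ennreal (k x) \<partial>lborel) = 1"
proof -
  \<comment> \<open>The value 1 at the origin keeps \<kappa> positive there; the other branch would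
    give 0.\<close>
  define w where "w n z = (if z = 0 then 1 else min 1 (real (Suc n) * (norm z)\<^sup>2))" for n and z :: 'a
  define \<kappa> where "\<kappa> n z = min (j z * w n z) (real (Suc n))" for n z
  have w: "0 < w n z" "w n z \<le> 1" for n z by (auto simp: w_def)
  have wm: "w n \<in> borel_measurable borel" for n unfolding w_def[abs_def] by measurable
  have \<kappa>m [measurable]: "\<kappa> n \<in> borel_measurable borel" for n
    unfolding \<kappa>_def[abs_def] using wm[of n] by measurable
  have \<kappa>0: "0 < \<kappa> n z" for n z using w(1)[of n z] j_pos[of z] by (simp add: \<kappa>_def)
  have \<kappa>j: "\<kappa> n z \<le> j z" for n z
    using mult_left_mono[OF w(2)[of n z], of "j z"] j_pos[of z] by (simp add: \<kappa>_def min_le_iff_disj)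
  have \<kappa>s: "\<kappa> n (- z) = \<kappa> n z" for n z by (simp add: \<kappa>_def w_def j_sym)
  define \<Lambda> where "\<Lambda> n = (\<integral>\<^sup>+z. ennreal (\<kappa> n z) \<partial>lborel)" for n
  have \<Lambda>fin: "\<Lambda> n < \<infinity>" for n
  proof -
    have "\<Lambda> n \<le> (\<integral>\<^sup>+z. ennreal (real (Suc n)) * (ennreal (min 1 ((norm z)\<^sup>2)) * ennreal (j z)) \<partial>lborel)"
      unfolding \<Lambda>_def
    proof (rule nn_integral_mono_AE)
      show "AE z in lborel. ennreal (\<kappa> n z) \<le> ennreal (real (Suc n)) * (ennreal (min 1 ((norm z)\<^sup>2)) * ennreal (j z))"
        using AE_lborel_singleton[of 0]
      proof eventually_elim
        case (elim z)
        have "min 1 (real (Suc n) * r) \<le> real (Suc n) * min 1 r" if "0 \<le> r" for r :: real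
        proof -
          have N: "1 \<le> real (Suc n)" by simp
          show ?thesis
          proof (cases "r \<le> 1")
            case True
            then show ?thesis by (simp add: min_absorb2 del: of_nat_Suc)
          next
            case False
            then have "min 1 r = 1" by simp
            then show ?thesis using N by (simp add: min.coboundedI1 del: of_nat_Suc)
          qed
        qed
        then have "w n z \<le> real (Suc n) * min 1 ((norm z)\<^sup>2)" using elim by (simp add: w_def)
        then have "j z * w n z \<le> j z * (real (Suc n) * min 1 ((norm z)\<^sup>2))"
          using j_pos[of z] by (intro mult_left_mono) auto
        then have "\<kappa> n z \<le> real (Suc n) * (min 1 ((norm z)\<^sup>2) * j z)" by (simp add: \<kappa>_def min_le_iff_disj mult_ac)
        then have "ennreal (\<kappa> n z) \<le> ennreal (real (Suc n) * (min 1 ((norm z)\<^sup>2) * j z))" by (rule ennreal_leI)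
        also have "\<dots> = ennreal (real (Suc n)) * (ennreal (min 1 ((norm z)\<^sup>2)) * ennreal (j z))"
          using j_pos[of z] by (simp add: ennreal_mult' ennreal_mult'' less_imp_le del: of_nat_Suc)
        finally show ?case .
      qed
    qed
    also have "\<dots> = ennreal (real (Suc n)) * levy_mass"
      unfolding levy_mass_def by (rule nn_integral_cmult) measurable
    also have "\<dots> < \<infinity>" using levy_mass_finite by (simp add: ennreal_mult_less_top del: of_nat_Suc)
    finally show ?thesis .
  qed
  have "incseq (\<lambda>n z. ennreal (\<kappa> n z))"
  proof (rule incseq_SucI, rule le_funI, rule ennreal_leI)
    fix n and z :: 'a
    have "real (Suc n) * (norm z)\<^sup>2 \<le> real (Suc (Suc n)) * (norm z)\<^sup>2" by (intro mult_right_mono) auto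
    then have "w n z \<le> w (Suc n) z"
      unfolding w_def by (simp add: min_le_iff_disj min.coboundedI2 del: of_nat_Suc)
    then have "j z * w n z \<le> j z * w (Suc n) z" using j_pos[of z] by (intro mult_left_mono) auto
    then show "\<kappa> n z \<le> \<kappa> (Suc n) z" unfolding \<kappa>_def by (intro min.mono) auto
  qed
  then have "(\<integral>\<^sup>+z. (SUP n. ennreal (\<kappa> n z)) \<partial>lborel) = (SUP n. \<Lambda> n)"
    unfolding \<Lambda>_def by (rule nn_integral_monotone_convergence_SUP) measurable
  moreover have "(\<integral>\<^sup>+z. ennreal (j z) \<partial>lborel) \<le> (\<integral>\<^sup>+z. (SUP n. ennreal (\<kappa> n z)) \<partial>lborel)"
  proof (rule nn_integral_mono)
    fix z
    have "\<exists>n. \<kappa> n z = j z"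
    proof -
      obtain n1 where n1: "j z \<le> real n1" using real_arch_simple by blast
      obtain n2 where n2: "z \<noteq> 0 \<Longrightarrow> 1 \<le> real n2 * (norm z)\<^sup>2"
      proof (cases "z = 0")
        case False
        then obtain n2 where "1 < real n2 * (norm z)\<^sup>2" using reals_Archimedean3[of "(norm z)\<^sup>2"] by auto
        then show ?thesis using that[of n2] by simp
      qed (use that in blast)
      let ?n = "max n1 n2"
      have "w ?n z = 1"
      proof (cases "z = 0")
        case False
        have "real n2 * (norm z)\<^sup>2 \<le> real (Suc ?n) * (norm z)\<^sup>2" by (intro mult_right_mono) auto
        with n2[OF False] have "1 \<le> real (Suc ?n) * (norm z)\<^sup>2" by (rule order_trans)
        then show ?thesis using False by (simp add: w_def min_absorb1 del: of_nat_Suc)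
      qed (simp add: w_def)
      moreover have "j z \<le> real (Suc ?n)" using n1 by simp
      ultimately have "\<kappa> ?n z = j z" by (simp add: \<kappa>_def del: of_nat_Suc)
      then show ?thesis by blast
    qed
    then obtain n where "\<kappa> n z = j z" by blast
    then show "ennreal (j z) \<le> (SUP n. ennreal (\<kappa> n z))"
      by (intro SUP_upper2[of n]) simp_all
  qed
  ultimately have "(SUP n. \<Lambda> n) = \<infinity>" using inf by (simp add: top_unique)
  then have "ennreal (1 / \<epsilon>) < (SUP n. \<Lambda> n)" by (simp only: infinity_ennreal_def ennreal_less_top)
  then obtain n where n: "ennreal (1 / \<epsilon>) < \<Lambda> n" unfolding less_SUP_iff by blast
  obtain l where l: "\<Lambda> n = ennreal l" "0 \<le> l" using \<Lambda>fin[of n] by (cases "\<Lambda> n") auto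
  have l\<epsilon>: "1 / \<epsilon> < l" using n l \<epsilon> by (simp add: ennreal_less_iff)
  then have l0: "0 < l" using \<epsilon> by (smt (verit) divide_pos_pos)
  define k where "k z = \<kappa> n z / l" for z
  show thesis
  proof (rule that[of k "real (Suc n) / l"])
    show "k \<in> borel_measurable borel" unfolding k_def[abs_def] by measurable
    show "0 < k x" for x using \<kappa>0 l0 by (simp add: k_def)
    show "k x \<le> real (Suc n) / l" for x
      using l0 by (auto simp: k_def \<kappa>_def intro!: divide_right_mono)
    show "k (- x) = k x" for x by (simp add: k_def \<kappa>s)
    show "k x \<le> \<epsilon> * j x" for x
    proof -
      have "k x \<le> j x / l" unfolding k_def using \<kappa>j l0 by (intro divide_right_mono) auto
      also have "j x / l = j x * (1 / l)" by simp
      also have "\<dots> \<le> j x * \<epsilon>"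
        using l\<epsilon> l0 \<epsilon> j_pos[of x] by (intro mult_left_mono) (auto simp: field_simps)
      finally show ?thesis by (simp add: mult.commute)
    qed
    have "(\<integral>\<^sup>+x. ennreal (k x) \<partial>lborel) = (\<integral>\<^sup>+x. ennreal (\<kappa> n x) / ennreal l \<partial>lborel)"
      unfolding k_def using \<kappa>0 l0 by (intro nn_integral_cong) (simp add: divide_ennreal less_imp_le)
    also have "\<dots> = \<Lambda> n / ennreal l" unfolding \<Lambda>_def by (rule nn_integral_divide) measurable
    also have "\<dots> = 1" unfolding l using l0 by (simp add: ennreal_divide_self)
    finally show "(\<integral>\<^sup>+x. ennreal (k x) \<partial>lborel) = 1" .
  qed
qed

end

subsection \<open>The smoothed segment\<close>

lemma ennreal_rescale_le:
  assumes h: "0 < h" and le: "ennreal (h * Y) \<le> C + ennreal h * E"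
  shows "ennreal Y \<le> C / ennreal h + E"
proof -
  have hh: "ennreal h \<noteq> 0" "ennreal h \<noteq> \<top>" using h by simp_all
  have cancel: "(ennreal h * X) / ennreal h = X" for X
  proof -
    have "(ennreal h * X) / ennreal h = X * (ennreal h / ennreal h)" by (simp only: divide_ennreal_def mult_ac)
    then show ?thesis using ennreal_divide_self[OF hh(1)] hh by (simp add: top.not_eq_extremum)
  qed
  have "ennreal Y = ennreal (h * Y) / ennreal h"
    using h by (simp only: ennreal_mult'[OF less_imp_le[OF h]] cancel)
  also have "\<dots> \<le> (C + ennreal h * E) / ennreal h" by (rule divide_right_mono_ennreal[OF le])
  also have "\<dots> = C / ennreal h + E" by (simp only: add_divide_distrib_ennreal cancel)
  finally show ?thesis .
qed

lemma set_integral_rescale: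
  fixes f :: "real \<Rightarrow> real"
  assumes h: "0 < h"
  shows "h * (LINT s:{0..1}|lborel. f (c + h * s)) = (LINT t:{c..c + h}|lborel. f t)"
proof -
  have "indicator {c..c + h} (c + h * s) = (indicator {0..1} s :: real)" for s
    using h by (auto simp: indicator_def zero_le_mult_iff mult_le_cancel_left1)
  then show ?thesis
    unfolding set_lebesgue_integral_def
    by (subst (2) lborel_integral_real_affine[where c=h and t=c]) (use h in simp_all)
qed

lemma set_nn_integral_rescale:
  fixes f :: "real \<Rightarrow> ennreal"
  assumes h: "0 < h" and f [measurable]: "f \<in> borel_measurable borel"
  shows "ennreal h * (\<integral>\<^sup>+s\<in>{0..1}. f (c + h * s) \<partial>lborel) = (\<integral>\<^sup>+t\<in>{c..c + h}. f t \<partial>lborel)"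
proof -
  have i: "indicator {c..c + h} (c + h * s) = (indicator {0..1} s :: ennreal)" for s
    using h by (auto simp: indicator_def zero_le_mult_iff mult_le_cancel_left1)
  have "(\<integral>\<^sup>+t\<in>{c..c + h}. f t \<partial>lborel) = ennreal \<bar>h\<bar> * (\<integral>\<^sup>+s. f (c + h * s) * indicator {c..c + h} (c + h * s) \<partial>lborel)"
    by (rule nn_integral_real_affine) (measurable, use h in simp)
  then show ?thesis unfolding i using h by simp
qed

context levy_kernel
begin

text \<open>The given curve is tested with \<Phi> shifted by z, and the estimates are averaged over
  z with weight k. Shifting the test function is dual to shifting the curve, so the left-hand side
  becomes the pairing with the convolution r. Running the curve in time h instead of 1 multiplies
  its cost by 1 / h.\<close>

lemma CE_segment:
  fixes \<Phi> :: "real \<times> 'a \<Rightarrow> real" and k :: "'a \<Rightarrow> real"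
  assumes CE: "(\<mu>, N) \<in> CE \<mu>\<^sub>0 \<mu>\<^sub>1"
    and km: "k \<in> borel_measurable borel" and k0: "\<And>x. 0 < k x" and kB: "\<And>x. k x \<le> B"
    and k1: "(\<integral>\<^sup>+x. ennreal (k x) \<partial>lborel) = 1"
    and h: "0 < h" and \<Phi>: "smooth_compact \<Phi>"
  defines "r \<equiv> smoothed_curve.smoothed \<mu> k"
  shows "ennreal (2 * ((LINT x|lborel. \<Phi> (c + h, x) * r 1 x) - (LINT x|lborel. \<Phi> (c, x) * r 0 x)
      - (LINT t:{c..c + h}|lborel. LINT x|lborel. time_deriv \<Phi> (t, x) * r ((t - c) / h) x)))
    \<le> (\<integral>\<^sup>+t\<in>{0..1}. action K (\<mu> t) (N t) \<partial>lborel) / ennreal h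
      + (\<integral>\<^sup>+t\<in>{c..c + h}. action' lborel K (r ((t - c) / h)) (\<lambda>x. \<Phi> (t, x)) \<partial>lborel)"
proof -
  have wc: "weakly_continuous_curve \<mu>" using CE unfolding CE_def by blast
  interpret S: smoothed_curve \<mu> k B
    by (rule smoothed_curve.intro[OF wc km k0 kB k1])
  let ?A = "\<integral>\<^sup>+t\<in>{0..1}. action K (\<mu> t) (N t) \<partial>lborel"
  note [measurable] = km test_function_measurable[OF \<Phi>]
  have r: "r = S.smoothed" by (simp add: r_def)
  note rm [measurable] = S.smoothed_measurable[folded r]
  note rm' = S.smoothed_measurable'[folded r]
  have r0: "0 < r t x" for t x unfolding r by (rule S.smoothed_pos)
  note t\<Phi> = smooth_compact_time_deriv[OF \<Phi>]
  note [measurable] = test_function_measurable[OF t\<Phi>]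
  obtain B1 where B1: "\<And>p. \<bar>\<Phi> p\<bar> \<le> B1" using smooth_compact_bounded[OF \<Phi>] by blast
  obtain B2 where B2: "\<And>p. \<bar>time_deriv \<Phi> p\<bar> \<le> B2" using smooth_compact_bounded[OF t\<Phi>] by blast
  define F where "F p = time_deriv \<Phi> (c + h * fst p, snd p)" for p
  have Fm: "F \<in> borel_measurable (borel \<Otimes>\<^sub>M borel)" unfolding F_def[abs_def] by measurable
  have FB: "\<bar>F p\<bar> \<le> B2" for p unfolding F_def by (rule B2)
  have \<Phi>m: "(\<lambda>x. \<Phi> (t, x)) \<in> borel_measurable borel" for t by measurable
  have \<Phi>B: "\<bar>\<Phi> (t, x)\<bar> \<le> B1" for t x by (rule B1)
  define u where "u t s z = (LINT x|S.\<nu> t. \<Phi> (s, x + z))" for t s z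
  define V where "V z = (LINT t:{0..1}|lborel. LINT x|S.\<nu> t. F (t, x + z))" for z
  define L where "L z = h * u 1 (c + h) z - h * u 0 c z - h * h * V z" for z
  define H where "H t x = (\<integral>\<^sup>+y. ennreal (log_mean_slope (r t x) (r t y) * (h * \<Phi> (c + h * t, y) - h * \<Phi> (c + h * t, x))\<^sup>2) * ennreal (j (y - x)) \<partial>lborel)" for t x
  have Hm [measurable]: "(\<lambda>(t, x). H t x) \<in> borel_measurable (borel \<Otimes>\<^sub>M borel)"
    unfolding H_def by measurable
  let ?X = "\<lambda>z. \<integral>\<^sup>+t\<in>{0..1}. (\<integral>\<^sup>+x. H t (x + z) \<partial>S.\<nu> t) \<partial>lborel"
  have est: "ennreal (2 * L z) \<le> ?A + ?X z" for z
  proof -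
    \<comment> \<open>The prefactor h is the one that leaves coefficient 1 in front of the action of
      \<Phi>: the quadratic term gets h^2, of which one h goes into the change of time and the other
      is divided out together with the h on the left.\<close>
    define \<Psi> where "\<Psi> p = h * \<Phi> (c + h * fst p, snd p + z)" for p
    have \<Psi>: "smooth_compact \<Psi>" unfolding \<Psi>_def[abs_def] by (rule smooth_compact_time_affine[OF \<Phi>]) (use h in simp)
    \<comment> \<open>Tangent slopes at the values of the convolution, not of the given curve, which
      may have no density. Shifted by z like the test function, they depend on x and z only through
      x + z after integration in y, so the average over z reproduces r.\<close>
    define a where "a t x y = log_mean_slope (r t (x + z)) (r t (y + z))" for t x y
    have am: "(\<lambda>(t, x, y). a t x y) \<in> borel_measurable (borel \<Otimes>\<^sub>M (borel \<Otimes>\<^sub>M borel))"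
      unfolding a_def by measurable
    have "ennreal (2 * ((LINT x|\<mu> 1. \<Psi> (1, x)) - (LINT x|\<mu> 0. \<Psi> (0, x)) - (LINT t:{0..1}|lborel. LINT x|\<mu> t. time_deriv \<Psi> (t, x))))
      \<le> ?A + (\<integral>\<^sup>+t\<in>{0..1}. (\<integral>\<^sup>+x. \<integral>\<^sup>+y. ennreal (a t x y * (\<Psi> (t, y) - \<Psi> (t, x))\<^sup>2) * ennreal (j (y - x)) \<partial>lborel \<partial>S.\<nu> t) \<partial>lborel)"
      by (rule CE_dual_estimate[OF CE am _ _ \<Psi>])
        (unfold a_def, rule log_mean_slope_nonneg, rule log_mean_tangent_le[OF r0 r0])
    moreover have "(LINT x|\<mu> 1. \<Psi> (1, x)) = h * u 1 (c + h) z" "(LINT x|\<mu> 0. \<Psi> (0, x)) = h * u 0 c z"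
      by (simp_all add: \<Psi>_def u_def)
    moreover have "(LINT t:{0..1}|lborel. LINT x|\<mu> t. time_deriv \<Psi> (t, x)) = h * h * V z"
    proof -
      have "(LINT t:{0..1}|lborel. LINT x|\<mu> t. time_deriv \<Psi> (t, x)) = (LINT t:{0..1}|lborel. h * h * (LINT x|S.\<nu> t. F (t, x + z)))"
      proof (rule set_lebesgue_integral_cong)
        show "\<forall>t. t \<in> {0..1} \<longrightarrow> (LINT x|\<mu> t. time_deriv \<Psi> (t, x)) = h * h * (LINT x|S.\<nu> t. F (t, x + z))"
        proof (intro allI impI)
          fix t :: real assume "t \<in> {0..1}"
          then show "(LINT x|\<mu> t. time_deriv \<Psi> (t, x)) = h * h * (LINT x|S.\<nu> t. F (t, x + z))"
            unfolding \<Psi>_def[abs_def] time_deriv_time_affine[OF smooth_compact_smooth[OF \<Phi>]] F_def fst_conv snd_conv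
            by (simp only: clamp01_id integral_mult_right_zero)
        qed
      qed simp
      then show ?thesis unfolding V_def by (simp only: set_integral_mult_right)
    qed
    \<comment> \<open>Translating y by z leaves y - x unchanged: this is where the translation
      invariance of the kernel is used.\<close>
    moreover have "(\<integral>\<^sup>+y. ennreal (a t x y * (\<Psi> (t, y) - \<Psi> (t, x))\<^sup>2) * ennreal (j (y - x)) \<partial>lborel) = H t (x + z)" for t x
    proof -
      let ?G = "\<lambda>y. ennreal (log_mean_slope (r t (x + z)) (r t y) * (h * \<Phi> (c + h * t, y) - h * \<Phi> (c + h * t, x + z))\<^sup>2) * ennreal (j (y - (x + z)))"
      have "(\<integral>\<^sup>+y. ?G (z + y) \<partial>lborel) = (\<integral>\<^sup>+y. ?G y \<partial>lborel)"
        by (rule nn_integral_lborel_shift) measurable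
      moreover have "?G (z + y) = ennreal (a t x y * (\<Psi> (t, y) - \<Psi> (t, x))\<^sup>2) * ennreal (j (y - x))" for y
      proof -
        have "z + y - (x + z) = y - x" "z + y = y + z" by (simp_all add: algebra_simps)
        then show ?thesis by (simp only: a_def \<Psi>_def fst_conv snd_conv)
      qed
      ultimately show ?thesis unfolding H_def by simp
    qed
    ultimately show ?thesis unfolding L_def by (simp only:)
  qed
  have ku1: "integrable lborel (\<lambda>z. k z * u t s z)" "(LINT z|lborel. k z * u t s z) = (LINT x|lborel. \<Phi> (s, x) * r t x)" for t s
    unfolding u_def r by (rule S.smoothed_convolution[OF \<Phi>m \<Phi>B])+
  have kV: "integrable lborel (\<lambda>z. k z * V z)" "(LINT z|lborel. k z * V z) = (LINT t:{0..1}|lborel. LINT x|lborel. F (t, x) * r t x)"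
    unfolding V_def r by (rule S.smoothed_convolution_time[OF Fm FB])+
  have kL: "(LINT z|lborel. k z * (2 * L z))
    = 2 * (h * (LINT x|lborel. \<Phi> (c + h, x) * r 1 x) - h * (LINT x|lborel. \<Phi> (c, x) * r 0 x)
      - h * h * (LINT t:{0..1}|lborel. LINT x|lborel. F (t, x) * r t x))"
  proof -
    have "k z * (2 * L z) = 2 * (h * (k z * u 1 (c + h) z) - h * (k z * u 0 c z) - h * h * (k z * V z))" for z
      unfolding L_def by (simp add: algebra_simps)
    then have "(LINT z|lborel. k z * (2 * L z)) = (LINT z|lborel. 2 * (h * (k z * u 1 (c + h) z) - h * (k z * u 0 c z) - h * h * (k z * V z)))"
      by (simp only:)
    also have "\<dots> = 2 * (h * (LINT z|lborel. k z * u 1 (c + h) z) - h * (LINT z|lborel. k z * u 0 c z) - h * h * (LINT z|lborel. k z * V z))"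
      using ku1(1)[of 1 "c + h"] ku1(1)[of 0 c] kV(1) by simp
    finally show ?thesis by (simp only: ku1(2) kV(2))
  qed
  have Xm: "(\<lambda>(z, t). (\<integral>\<^sup>+x. H t (x + z) \<partial>S.\<nu> t) * indicator {0..1} t) \<in> borel_measurable (borel \<Otimes>\<^sub>M borel)"
  proof -
    have \<nu>m: "(\<lambda>p. S.\<nu> (snd p)) \<in> borel \<Otimes>\<^sub>M borel \<rightarrow>\<^sub>M subprob_algebra borel"
      by (rule measurable_compose[OF measurable_snd S.\<nu>_measurable])
    have "(\<lambda>p. \<integral>\<^sup>+x. H (snd p) (x + fst p) \<partial>S.\<nu> (snd p)) \<in> borel_measurable (borel \<Otimes>\<^sub>M (borel :: real measure))"
      by (rule nn_integral_measurable_subprob_algebra2[OF _ \<nu>m]) measurable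
    then have "(\<lambda>p. (\<integral>\<^sup>+x. H (snd p) (x + fst p) \<partial>S.\<nu> (snd p)) * indicator {0..1} (snd p)) \<in> borel_measurable (borel \<Otimes>\<^sub>M (borel :: real measure))"
      by (rule borel_measurable_times_ennreal) measurable
    then show ?thesis by (simp only: case_prod_beta')
  qed
  have Xm' [measurable]: "?X \<in> borel_measurable borel"
    by (rule lborel.borel_measurable_nn_integral) (use Xm in simp)
  have "ennreal (LINT z|lborel. k z * (2 * L z)) \<le> (\<integral>\<^sup>+z. ennreal (k z * (2 * L z)) \<partial>lborel)"
    by (rule ennreal_integral_le)
  also have "\<dots> \<le> (\<integral>\<^sup>+z. ?A * ennreal (k z) + ennreal (k z) * ?X z \<partial>lborel)"
  proof (rule nn_integral_mono)
    fix z
    have "ennreal (k z * (2 * L z)) = ennreal (k z) * ennreal (2 * L z)"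
      by (rule ennreal_mult'[OF less_imp_le[OF k0]])
    also have "\<dots> \<le> ennreal (k z) * (?A + ?X z)" by (rule mult_left_mono[OF est]) simp
    finally show "ennreal (k z * (2 * L z)) \<le> ?A * ennreal (k z) + ennreal (k z) * ?X z"
      by (simp only: distrib_left mult.commute)
  qed
  also have "\<dots> = (\<integral>\<^sup>+z. ?A * ennreal (k z) \<partial>lborel) + (\<integral>\<^sup>+z. ennreal (k z) * ?X z \<partial>lborel)"
    by (rule nn_integral_add) measurable
  also have "\<dots> = ?A + ennreal (h * h) * (\<integral>\<^sup>+t\<in>{0..1}. action' lborel K (r t) (\<lambda>x. \<Phi> (c + h * t, x)) \<partial>lborel)"
  proof (rule arg_cong2[where f="(+)"])
    have "(\<integral>\<^sup>+z. ?A * ennreal (k z) \<partial>lborel) = ?A * (\<integral>\<^sup>+z. ennreal (k z) \<partial>lborel)"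
      by (rule nn_integral_cmult) measurable
    then show "(\<integral>\<^sup>+z. ?A * ennreal (k z) \<partial>lborel) = ?A" by (simp only: k1 mult_1_right)
    have "(\<integral>\<^sup>+z. ennreal (k z) * ?X z \<partial>lborel)
      = (\<integral>\<^sup>+z. \<integral>\<^sup>+t. ennreal (k z) * ((\<integral>\<^sup>+x. H t (x + z) \<partial>S.\<nu> t) * indicator {0..1} t) \<partial>lborel \<partial>lborel)"
    proof (rule nn_integral_cong, rule nn_integral_cmult[symmetric])
      fix z
      show "(\<lambda>t. (\<integral>\<^sup>+x. H t (x + z) \<partial>S.\<nu> t) * indicator {0..1} t) \<in> borel_measurable lborel"
        using measurable_compose[OF measurable_Pair1'[of z borel borel] Xm] by simp
    qed
    also have "\<dots> = (\<integral>\<^sup>+t. \<integral>\<^sup>+z. ennreal (k z) * ((\<integral>\<^sup>+x. H t (x + z) \<partial>S.\<nu> t) * indicator {0..1} t) \<partial>lborel \<partial>lborel)"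
    proof (rule lborel_pair.Fubini'[symmetric])
      have "(\<lambda>p. ennreal (k (fst p)) * (case p of (z, t) \<Rightarrow> (\<integral>\<^sup>+x. H t (x + z) \<partial>S.\<nu> t) * indicator {0..1} t)) \<in> borel_measurable (borel \<Otimes>\<^sub>M borel)"
        by (rule borel_measurable_times_ennreal[OF _ Xm]) measurable
      then show "(\<lambda>(z, t). ennreal (k z) * ((\<integral>\<^sup>+x. H t (x + z) \<partial>S.\<nu> t) * indicator {0..1} t)) \<in> borel_measurable (lborel \<Otimes>\<^sub>M lborel)"
        by (simp add: case_prod_beta')
    qed
    also have "\<dots> = (\<integral>\<^sup>+t. ennreal (h * h) * (action' lborel K (r t) (\<lambda>x. \<Phi> (c + h * t, x)) * indicator {0..1} t) \<partial>lborel)"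
    proof (rule nn_integral_cong)
      fix t :: real
      have Hm': "H t \<in> borel_measurable borel" by measurable
      have "(\<lambda>z. \<integral>\<^sup>+x. H t (x + z) \<partial>S.\<nu> t) \<in> borel_measurable borel"
      proof (rule nn_integral_measurable_subprob_algebra2[where N=borel])
        have "(\<lambda>p :: 'a \<times> 'a. snd p + fst p) \<in> borel \<Otimes>\<^sub>M borel \<rightarrow>\<^sub>M borel" by measurable
        from measurable_compose[OF this Hm'] show "(\<lambda>(z, x). H t (x + z)) \<in> borel_measurable (borel \<Otimes>\<^sub>M borel)"
          by (simp only: case_prod_beta')
        have "S.\<nu> t \<in> space (subprob_algebra borel)" by (rule measurable_space[OF S.\<nu>_measurable]) simp
        then show "(\<lambda>z :: 'a. S.\<nu> t) \<in> borel \<rightarrow>\<^sub>M subprob_algebra borel" by (rule measurable_const)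
      qed
      then have m: "(\<lambda>z. ennreal (k z) * (\<integral>\<^sup>+x. H t (x + z) \<partial>S.\<nu> t)) \<in> borel_measurable lborel" by measurable
      have "(\<integral>\<^sup>+z. ennreal (k z) * ((\<integral>\<^sup>+x. H t (x + z) \<partial>S.\<nu> t) * indicator {0..1} t) \<partial>lborel)
        = (\<integral>\<^sup>+z. ennreal (k z) * (\<integral>\<^sup>+x. H t (x + z) \<partial>S.\<nu> t) \<partial>lborel) * indicator {0..1} t"
        unfolding mult.assoc[symmetric] by (rule nn_integral_multc[OF m])
      also have "(\<integral>\<^sup>+z. ennreal (k z) * (\<integral>\<^sup>+x. H t (x + z) \<partial>S.\<nu> t) \<partial>lborel) = (\<integral>\<^sup>+x. ennreal (r t x) * H t x \<partial>lborel)"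
        unfolding r by (rule S.smoothed_convolution_nn[OF Hm'])
      also have "\<dots> = action' lborel K (r t) (\<lambda>x. h * \<Phi> (c + h * t, x))"
        unfolding H_def by (rule tangent_energy[OF rm' r0]) measurable
      also have "\<dots> = ennreal (h * h) * action' lborel K (r t) (\<lambda>x. \<Phi> (c + h * t, x))"
      proof -
        have e: "ennreal ((h * y - h * x)\<^sup>2 * l) = ennreal (h * h) * ennreal ((y - x)\<^sup>2 * l)" for x y l
          by (subst ennreal_mult'[symmetric]) (simp_all add: power2_eq_square algebra_simps)
        have m: "(\<lambda>p. ennreal ((\<Phi> (c + h * t, snd p) - \<Phi> (c + h * t, fst p))\<^sup>2 * log_mean (r t (fst p)) (r t (snd p)))) \<in> borel_measurable Jm"
          by measurable
        show ?thesis
          unfolding action'_def case_prod_beta' e nn_integral_cmult[OF m] ennreal_times_divide ..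
      qed
      finally show "(\<integral>\<^sup>+z. ennreal (k z) * ((\<integral>\<^sup>+x. H t (x + z) \<partial>S.\<nu> t) * indicator {0..1} t) \<partial>lborel)
        = ennreal (h * h) * (action' lborel K (r t) (\<lambda>x. \<Phi> (c + h * t, x)) * indicator {0..1} t)"
        by (simp only: mult.assoc)
    qed
    also have "\<dots> = ennreal (h * h) * (\<integral>\<^sup>+t\<in>{0..1}. action' lborel K (r t) (\<lambda>x. \<Phi> (c + h * t, x)) \<partial>lborel)"
    proof (rule nn_integral_cmult)
      define G where "G p = \<Phi> (c + h * fst p, snd p)" for p
      have "G \<in> borel_measurable (borel \<Otimes>\<^sub>M borel)" unfolding G_def[abs_def] by measurable
      from action'_measurable[OF rm this]
      show "(\<lambda>t. action' lborel K (r t) (\<lambda>x. \<Phi> (c + h * t, x)) * indicator {0..1} t) \<in> borel_measurable lborel"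
        unfolding G_def by simp
    qed
    finally show "(\<integral>\<^sup>+z. ennreal (k z) * ?X z \<partial>lborel)
      = ennreal (h * h) * (\<integral>\<^sup>+t\<in>{0..1}. action' lborel K (r t) (\<lambda>x. \<Phi> (c + h * t, x)) \<partial>lborel)" .
  qed
  finally have main: "ennreal (LINT z|lborel. k z * (2 * L z))
    \<le> ?A + ennreal (h * h) * (\<integral>\<^sup>+t\<in>{0..1}. action' lborel K (r t) (\<lambda>x. \<Phi> (c + h * t, x)) \<partial>lborel)" .
  have hs: "(c + h * s - c) / h = s" for s using h by simp
  have T: "h * (LINT t:{0..1}|lborel. LINT x|lborel. F (t, x) * r t x)
    = (LINT t:{c..c + h}|lborel. LINT x|lborel. time_deriv \<Phi> (t, x) * r ((t - c) / h) x)"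
    unfolding set_integral_rescale[OF h, symmetric] hs F_def fst_conv snd_conv ..
  have rs: "(\<lambda>(t, x). r ((t - c) / h) x) \<in> borel_measurable (borel \<Otimes>\<^sub>M borel)" by measurable
  have E: "ennreal h * (\<integral>\<^sup>+t\<in>{0..1}. action' lborel K (r t) (\<lambda>x. \<Phi> (c + h * t, x)) \<partial>lborel)
    = (\<integral>\<^sup>+t\<in>{c..c + h}. action' lborel K (r ((t - c) / h)) (\<lambda>x. \<Phi> (t, x)) \<partial>lborel)"
    unfolding set_nn_integral_rescale[OF h action'_measurable[OF rs test_function_measurable[OF \<Phi>]], symmetric] hs ..
  have eqL: "(LINT z|lborel. k z * (2 * L z)) = h * (2 * ((LINT x|lborel. \<Phi> (c + h, x) * r 1 x) - (LINT x|lborel. \<Phi> (c, x) * r 0 x)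
      - (LINT t:{c..c + h}|lborel. LINT x|lborel. time_deriv \<Phi> (t, x) * r ((t - c) / h) x)))"
    unfolding kL T[symmetric] by (simp add: algebra_simps)
  have "ennreal (h * h) = ennreal h * ennreal h" using h by (simp add: ennreal_mult)
  then have "ennreal (h * (2 * ((LINT x|lborel. \<Phi> (c + h, x) * r 1 x) - (LINT x|lborel. \<Phi> (c, x) * r 0 x)
      - (LINT t:{c..c + h}|lborel. LINT x|lborel. time_deriv \<Phi> (t, x) * r ((t - c) / h) x))))
    \<le> ?A + ennreal h * (\<integral>\<^sup>+t\<in>{c..c + h}. action' lborel K (r ((t - c) / h)) (\<lambda>x. \<Phi> (t, x)) \<partial>lborel)"
    using main unfolding eqL E[symmetric] by (simp only: mult.assoc)
  then show ?thesis by (rule ennreal_rescale_le[OF h])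
qed

end

subsection \<open>Gluing the segments\<close>

lemma set_integral_split:
  fixes f :: "real \<Rightarrow> real"
  assumes "a \<le> b" "b \<le> c" and i: "set_integrable lborel {a..c} f"
  shows "(LINT t:{a..c}|lborel. f t) = (LINT t:{a..b}|lborel. f t) + (LINT t:{b..c}|lborel. f t)"
proof -
  have U: "{a..c} = {a..b} \<union> {b..c}" using assms by auto
  show ?thesis unfolding U
  proof (rule set_integral_Un_AE)
    show "AE t in lborel. \<not> (t \<in> {a..b} \<and> t \<in> {b..c})"
      using AE_lborel_singleton[of b] by eventually_elim auto
    show "set_integrable lborel {a..b} f" "set_integrable lborel {b..c} f"
      using assms(1,2) by (auto intro: set_integrable_subset[OF i])
  qed simp_all
qed

lemma set_nn_integral_split:
  fixes f :: "real \<Rightarrow> ennreal"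
  assumes "a \<le> b" "b \<le> c" and [measurable]: "f \<in> borel_measurable borel"
  shows "(\<integral>\<^sup>+t\<in>{a..c}. f t \<partial>lborel) = (\<integral>\<^sup>+t\<in>{a..b}. f t \<partial>lborel) + (\<integral>\<^sup>+t\<in>{b..c}. f t \<partial>lborel)"
proof -
  have "(\<integral>\<^sup>+t\<in>{a..c}. f t \<partial>lborel) = (\<integral>\<^sup>+t. f t * indicator {a..b} t + f t * indicator {b..c} t \<partial>lborel)"
  proof (rule nn_integral_cong_AE)
    show "AE t in lborel. f t * indicator {a..c} t = f t * indicator {a..b} t + f t * indicator {b..c} t"
      using AE_lborel_singleton[of b] by eventually_elim (use assms(1,2) in \<open>auto simp: indicator_def\<close>)
  qed
  then show ?thesis by (simp add: nn_integral_add)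
qed

lemma ennreal_add3_le:
  assumes "ennreal x \<le> A + E" "ennreal y \<le> B + F" "ennreal z \<le> C + G" and le: "A + (B + C) \<le> D"
  shows "ennreal (x + (y + z)) \<le> D + (E + (F + G))"
proof -
  have "ennreal (x + (y + z)) \<le> ennreal x + ennreal (y + z)" by (rule ennreal_add_le)
  also have "\<dots> \<le> ennreal x + (ennreal y + ennreal z)" by (rule add_left_mono[OF ennreal_add_le])
  also have "\<dots> \<le> (A + E) + ((B + F) + (C + G))" by (intro add_mono assms)
  also have "\<dots> = (A + (B + C)) + (E + (F + G))" by (simp only: add_ac)
  also have "\<dots> \<le> D + (E + (F + G))" by (rule add_right_mono[OF le])
  finally show ?thesis .
qed

text \<open>c / (1 - 2 a) is the cost of the middle piece. Each end piece costs (4 / a^2)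
  \<epsilon>^2 times its Fisher information times its length a. The length a is chosen first, so
  that 1 / (1 - 2 a) \<le> 1 + 4 a makes the speed-up cost at most \<delta> / 2, and then \<epsilon>
  for this a. The summands c + 1 and F + 1 avoid division by 0.\<close>

lemma gluing_parameters:
  fixes c \<delta> F :: real
  assumes "0 \<le> c" "0 < \<delta>" "0 \<le> F"
  obtains a \<epsilon> where "0 < a" "a \<le> 1 / 4" "0 < \<epsilon>" "c / (1 - 2 * a) + 4 * \<epsilon>\<^sup>2 * F / a \<le> c + \<delta>"
proof -
  define a where "a = min (1 / 4) (\<delta> / (8 * (c + 1)))"
  define \<epsilon> where "\<epsilon> = min 1 (\<delta> * a / (8 * (F + 1)))"
  have a: "0 < a" "a \<le> 1 / 4" unfolding a_def by (use assms in simp) (rule min.cobounded1)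
  have e: "0 < \<epsilon>" "\<epsilon> \<le> 1" using assms a by (auto simp: \<epsilon>_def)
  have "1 \<le> (1 + 4 * a) * (1 - 2 * a)"
  proof -
    have "8 * a * a \<le> 2 * a" using a mult_right_mono[of "a" "1/4" "8 * a"] by (simp add: mult_ac)
    then show ?thesis by (simp add: algebra_simps)
  qed
  then have "c * 1 \<le> c * ((1 + 4 * a) * (1 - 2 * a))" using assms(1) by (rule mult_left_mono)
  then have 1: "c / (1 - 2 * a) \<le> c * (1 + 4 * a)"
    using a by (simp add: pos_divide_le_eq mult.assoc)
  have "a \<le> \<delta> / (8 * (c + 1))" by (simp add: a_def)
  then have "a * (8 * (c + 1)) \<le> \<delta>" using assms(1) by (simp add: pos_le_divide_eq)
  moreover have "4 * (c * a) \<le> 4 * (a * (c + 1))" using a by (simp add: algebra_simps)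
  ultimately have 2: "4 * (c * a) \<le> \<delta> / 2" by linarith
  have "\<epsilon> \<le> \<delta> * a / (8 * (F + 1))" by (simp add: \<epsilon>_def)
  then have "\<epsilon> * (8 * (F + 1)) \<le> \<delta> * a" using assms(3) by (simp add: pos_le_divide_eq)
  moreover have "\<epsilon> * F \<le> \<epsilon> * (F + 1)" using e by simp
  ultimately have 3: "8 * (\<epsilon> * F) \<le> \<delta> * a" by linarith
  have "\<epsilon>\<^sup>2 * F \<le> \<epsilon> * F"
    using e mult_right_mono[of \<epsilon> 1 \<epsilon>] assms(3) by (intro mult_right_mono) (auto simp: power2_eq_square)
  moreover have "0 \<le> \<delta> * a" using a assms(2) by simp
  ultimately have "4 * (\<epsilon>\<^sup>2 * F) \<le> (\<delta> * a) / 2" using 3 by linarith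
  then have "4 * \<epsilon>\<^sup>2 * F \<le> \<delta> / 2 * a" by (simp add: mult.assoc)
  then have "4 * \<epsilon>\<^sup>2 * F / a \<le> \<delta> / 2" using a(1) by (simp add: pos_divide_le_eq)
  moreover have "c * (1 + 4 * a) = c + 4 * (c * a)" by (simp add: algebra_simps)
  ultimately have "c / (1 - 2 * a) + 4 * \<epsilon>\<^sup>2 * F / a \<le> c + \<delta>" using 1 2 by linarith
  with a e show ?thesis using that by blast
qed

lemma clamp01_le0: "t \<le> 0 \<Longrightarrow> clamp01 t = 0" and clamp01_ge1: "1 \<le> t \<Longrightarrow> clamp01 t = 1"
  by (simp_all add: clamp01_def)

text \<open>For a \<le> 1/4 the initial and final pieces do not overlap, so one of the two weights
  vanishes at each time and the remaining weight 1 - G0 - G1 is nonnegative.\<close>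

lemma glued_weights:
  fixes a t :: real
  assumes a: "0 < a" "a \<le> 1 / 4"
  defines "G0 \<equiv> (clamp01 ((a - t) / a))\<^sup>2" and "G1 \<equiv> (clamp01 ((t - (1 - a)) / a))\<^sup>2"
  shows "0 \<le> G0" "0 \<le> G1" "0 \<le> 1 - G0 - G1" "G0 = 0 \<or> G1 = 0"
proof -
  show z: "G0 = 0 \<or> G1 = 0"
  proof (cases "a \<le> t")
    case True
    then have "(a - t) / a \<le> 0" using a by (simp add: divide_le_0_iff)
    then show ?thesis by (simp add: G0_def clamp01_le0)
  next
    case False
    then have "(t - (1 - a)) / a \<le> 0" using a by (simp add: divide_le_0_iff)
    then show ?thesis by (simp add: G1_def clamp01_le0)
  qed
  show "0 \<le> G0" "0 \<le> G1" by (simp_all add: G0_def G1_def)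
  have "G0 \<le> 1" "G1 \<le> 1" unfolding G0_def G1_def by (simp_all add: power_le_one)
  then show "0 \<le> 1 - G0 - G1" using z by auto
qed

lemma test_function_boundary:
  assumes "test_function \<phi>"
  shows "\<phi> (0, x) = 0" "\<phi> (1, x) = 0"
  using assms closure_subset[of "{z. \<phi> z \<noteq> 0}"] unfolding test_function_def by auto

section \<open>The glued curve and its potential\<close>

context levy_kernel
begin

text \<open>\<sigma>0 and \<sigma>1 are the positive densities supplied by the Fisher information,
  \<rho>0 and \<rho>1 the prescribed versions of the same end measures, which may vanish on null
  sets. The curve is built from the former, and the latter are inserted at the end times
  only.\<close>

lemma CE_approximation:
  fixes \<sigma>0 \<sigma>1 \<rho>0 \<rho>1 :: "'a \<Rightarrow> real"
  assumes inf: "(\<integral>\<^sup>+z. ennreal (j z) \<partial>lborel) = \<infinity>"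
    and s0m [measurable]: "\<sigma>0 \<in> borel_measurable borel" and s0: "\<And>x. 0 < \<sigma>0 x"
    and s1m [measurable]: "\<sigma>1 \<in> borel_measurable borel" and s1: "\<And>x. 0 < \<sigma>1 x"
    and F0: "(\<integral>\<^sup>+(x, y). ennreal ((\<sigma>0 y - \<sigma>0 x) * (ln (\<sigma>0 y) - ln (\<sigma>0 x))) \<partial>Jm) / 2 < \<infinity>"
    and F1: "(\<integral>\<^sup>+(x, y). ennreal ((\<sigma>1 y - \<sigma>1 x) * (ln (\<sigma>1 y) - ln (\<sigma>1 x))) \<partial>Jm) / 2 < \<infinity>"
    and CE: "(\<mu>, N) \<in> CE (density lborel (\<lambda>x. ennreal (\<sigma>0 x))) (density lborel (\<lambda>x. ennreal (\<sigma>1 x)))"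
    and fin: "(\<integral>\<^sup>+t\<in>{0..1}. action K (\<mu> t) (N t) \<partial>lborel) < \<infinity>" and \<delta>: "0 < \<delta>"
    and r0m [measurable]: "\<rho>0 \<in> borel_measurable borel" and r0: "\<And>x. 0 \<le> \<rho>0 x"
    and r1m [measurable]: "\<rho>1 \<in> borel_measurable borel" and r1: "\<And>x. 0 \<le> \<rho>1 x"
    and eq0: "density lborel (\<lambda>x. ennreal (\<rho>0 x)) = density lborel (\<lambda>x. ennreal (\<sigma>0 x))"
    and eq1: "density lborel (\<lambda>x. ennreal (\<rho>1 x)) = density lborel (\<lambda>x. ennreal (\<sigma>1 x))"
  obtains \<rho> \<psi> where "(\<rho>, \<psi>) \<in> CE' lborel K \<rho>0 \<rho>1"
    "(\<integral>\<^sup>+t\<in>{0..1}. action' lborel K (\<rho> t) (\<psi> t) \<partial>lborel) \<le> (\<integral>\<^sup>+t\<in>{0..1}. action K (\<mu> t) (N t) \<partial>lborel) + ennreal \<delta>"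
proof -
  have wc: "weakly_continuous_curve \<mu>" and m0: "\<mu> 0 = density lborel (\<lambda>x. ennreal (\<sigma>0 x))"
    and m1: "\<mu> 1 = density lborel (\<lambda>x. ennreal (\<sigma>1 x))" using CE unfolding CE_def by blast+
  let ?I = "\<lambda>\<sigma>. (\<integral>\<^sup>+(x, y). ennreal ((\<sigma> y - \<sigma> x) * (ln (\<sigma> y) - ln (\<sigma> x))) \<partial>Jm) / 2"
  let ?A = "\<integral>\<^sup>+t\<in>{0..1}. action K (\<mu> t) (N t) \<partial>lborel"
  obtain c where c: "?A = ennreal c" "0 \<le> c" using fin by (cases ?A) auto
  obtain f0 where f0: "?I \<sigma>0 = ennreal f0" "0 \<le> f0" using F0 by (cases "?I \<sigma>0") auto
  obtain f1 where f1: "?I \<sigma>1 = ennreal f1" "0 \<le> f1" using F1 by (cases "?I \<sigma>1") auto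
  obtain a \<epsilon> where a: "0 < a" "a \<le> 1 / 4" and \<epsilon>: "0 < \<epsilon>"
    and tot: "c / (1 - 2 * a) + 4 * \<epsilon>\<^sup>2 * (f0 + f1) / a \<le> c + \<delta>"
    using gluing_parameters[OF c(2) \<delta>, of "f0 + f1"] f0(2) f1(2) by auto
  obtain k B where k [measurable]: "k \<in> borel_measurable borel" and k0: "\<And>x. 0 < k x" and kB: "\<And>x. k x \<le> B"
    and ks: "\<And>x. k (- x) = k x" and kj: "\<And>x. k x \<le> \<epsilon> * j x" and k1: "(\<integral>\<^sup>+x. ennreal (k x) \<partial>lborel) = 1"
    using smoothing_kernel_exists[OF inf \<epsilon>] by metis
  have k0': "0 \<le> k x" for x using k0[of x] by simp
  interpret S: smoothed_curve \<mu> k B by (rule smoothed_curve.intro[OF wc k k0 kB k1])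
  define h where "h = 1 - 2 * a"
  have h: "0 < h" using a by (simp add: h_def)
  let ?r = "S.smoothed"
  note rm [measurable] = S.smoothed_measurable
  define G0 where "G0 t = (clamp01 ((a - t) / a))\<^sup>2" for t
  define G1 where "G1 t = (clamp01 ((t - (1 - a)) / a))\<^sup>2" for t
  note Gw = glued_weights[OF a, folded G0_def G1_def]
  \<comment> \<open>One formula for all times, so that measurability and weak continuity need no
    gluing. Clamping freezes the middle curve at its end values during the end pieces, where it is
    the convolution of \<sigma>0 or \<sigma>1 with k.\<close>
  define R where "R t x = G0 t * \<sigma>0 x + G1 t * \<sigma>1 x + (1 - G0 t - G1 t) * ?r ((t - a) / h) x" for t x
  have G0m [measurable]: "G0 \<in> borel_measurable borel" unfolding G0_def[abs_def] by measurable
  have G1m [measurable]: "G1 \<in> borel_measurable borel" unfolding G1_def[abs_def] by measurable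
  have Rm [measurable]: "(\<lambda>(t, x). R t x) \<in> borel_measurable (borel \<Otimes>\<^sub>M borel)"
    unfolding R_def by measurable
  have Rm': "R t \<in> borel_measurable borel" for t by measurable
  have rp: "0 < ?r t x" for t x by (rule S.smoothed_pos)
  have Rpos: "0 < R t x" for t x
  proof -
    have "0 \<le> G0 t * \<sigma>0 x" "0 \<le> G1 t * \<sigma>1 x" "0 \<le> (1 - G0 t - G1 t) * ?r ((t - a) / h) x"
      using Gw[of t] s0[of x] s1[of x] rp[of "(t - a) / h" x] by (auto intro!: mult_nonneg_nonneg)
    moreover have "0 < G0 t * \<sigma>0 x \<or> 0 < G1 t * \<sigma>1 x \<or> 0 < (1 - G0 t - G1 t) * ?r ((t - a) / h) x"
    proof (cases "G0 t = 0 \<and> G1 t = 0")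
      case True then show ?thesis using rp by simp
    next
      case False
      then have "0 < G0 t \<or> 0 < G1 t" using Gw(1,2)[of t] by linarith
      then show ?thesis using s0[of x] s1[of x] by auto
    qed
    ultimately show ?thesis unfolding R_def by linarith
  qed
  have Rnn: "0 \<le> R t x" for t x using Rpos[of t x] by simp
  have P0: "prob_space (density lborel (\<lambda>x. ennreal (\<sigma>0 x)))" and P1: "prob_space (density lborel (\<lambda>x. ennreal (\<sigma>1 x)))"
    using S.\<nu>_prob[of 0] S.\<nu>_prob[of 1] by (simp_all add: m0 m1)
  have density_1: "(\<integral>\<^sup>+x. ennreal (\<sigma> x) \<partial>lborel) = 1"
    if "prob_space (density lborel (\<lambda>x. ennreal (\<sigma> x)))" "\<sigma> \<in> borel_measurable borel" for \<sigma> :: "'a \<Rightarrow> real"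
    using prob_space.emeasure_space_1[OF that(1)] that(2) by (simp add: emeasure_density)
  note s01 = density_1[OF P0 s0m] and s11 = density_1[OF P1 s1m]
  have R1: "(\<integral>\<^sup>+x. ennreal (R t x) \<partial>lborel) = 1" for t
  proof -
    note G = Gw(1-3)[of t]
    have "(\<integral>\<^sup>+x. ennreal (R t x) \<partial>lborel)
      = (\<integral>\<^sup>+x. ennreal (G0 t) * ennreal (\<sigma>0 x) + (ennreal (G1 t) * ennreal (\<sigma>1 x) + ennreal (1 - G0 t - G1 t) * ennreal (?r ((t - a) / h) x)) \<partial>lborel)"
    proof (rule nn_integral_cong)
      fix x
      have nn: "0 \<le> \<sigma>0 x" "0 \<le> \<sigma>1 x" "0 \<le> ?r ((t - a) / h) x" using s0[of x] s1[of x] rp[of "(t - a) / h" x] by simp_all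
      note p = mult_nonneg_nonneg[OF G(1) nn(1)] mult_nonneg_nonneg[OF G(2) nn(2)] mult_nonneg_nonneg[OF G(3) nn(3)]
      show "ennreal (R t x) = ennreal (G0 t) * ennreal (\<sigma>0 x) + (ennreal (G1 t) * ennreal (\<sigma>1 x) + ennreal (1 - G0 t - G1 t) * ennreal (?r ((t - a) / h) x))"
        unfolding R_def ennreal_mult[OF G(1) nn(1), symmetric] ennreal_mult[OF G(2) nn(2), symmetric] ennreal_mult[OF G(3) nn(3), symmetric]
        by (simp only: add.assoc ennreal_plus[OF p(1) add_nonneg_nonneg[OF p(2,3)]] ennreal_plus[OF p(2,3)])
    qed
    also have "\<dots> = ennreal (G0 t) * 1 + (ennreal (G1 t) * 1 + ennreal (1 - G0 t - G1 t) * 1)"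
      using S.smoothed_measurable'[of "(t - a) / h"]
      by (simp add: nn_integral_add nn_integral_cmult s01 s11 S.smoothed_prob)
    also have "\<dots> = ennreal (G0 t + (G1 t + (1 - G0 t - G1 t)))"
      by (simp only: mult_1_right ennreal_plus[OF G(1) add_nonneg_nonneg[OF G(2,3)]] ennreal_plus[OF G(2,3)])
    finally show ?thesis by simp
  qed
  have R_left: "R t x = ((t - a) / a)\<^sup>2 * \<sigma>0 x + (1 - ((t - a) / a)\<^sup>2) * ?r 0 x" if "t \<in> {0..a}" for t x
  proof -
    have "(a - t) / a \<in> {0..1}" using that a by auto
    moreover have "((a - t) / a)\<^sup>2 = ((t - a) / a)\<^sup>2" by (simp add: power_divide power2_commute)
    ultimately have "G0 t = ((t - a) / a)\<^sup>2" by (simp add: G0_def clamp01_id)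
    moreover have "(t - (1 - a)) / a \<le> 0" using that a by (simp add: divide_le_0_iff)
    then have "G1 t = 0" by (simp add: G1_def clamp01_le0)
    moreover have "(t - a) / h \<le> 0" using that h by (simp add: divide_le_0_iff)
    then have "?r ((t - a) / h) x = ?r 0 x" by (simp add: S.smoothed_def clamp01_le0)
    ultimately show ?thesis unfolding R_def by simp
  qed
  have R_right: "R t x = ((t - (1 - a)) / a)\<^sup>2 * \<sigma>1 x + (1 - ((t - (1 - a)) / a)\<^sup>2) * ?r 1 x" if "t \<in> {1 - a..1}" for t x
  proof -
    have "(t - (1 - a)) / a \<in> {0..1}" using that a by auto
    then have "G1 t = ((t - (1 - a)) / a)\<^sup>2" by (simp add: G1_def clamp01_id)
    moreover have "(a - t) / a \<le> 0" using that a by (simp add: divide_le_0_iff)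
    then have "G0 t = 0" by (simp add: G0_def clamp01_le0)
    moreover have "1 \<le> (t - a) / h" using that h by (simp add: pos_le_divide_eq) (simp add: h_def)
    then have "?r ((t - a) / h) x = ?r 1 x" by (simp add: S.smoothed_def clamp01_ge1)
    ultimately show ?thesis unfolding R_def by simp
  qed
  have R_mid: "R t x = ?r ((t - a) / h) x" if "t \<in> {a..1 - a}" for t x
  proof -
    have "(a - t) / a \<le> 0" "(t - (1 - a)) / a \<le> 0" using that a by (simp_all add: divide_le_0_iff)
    then show ?thesis by (simp add: R_def G0_def G1_def clamp01_le0)
  qed
  have Rends: "R 0 x = \<sigma>0 x" "R 1 x = \<sigma>1 x" for x
    using R_left[of 0 x] R_right[of 1 x] a by (simp_all add: power_divide)
  have tau: "?r t x = (LINT y|lborel. \<sigma> y * k (x - y))"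
    if "S.\<nu> t = density lborel (\<lambda>x. ennreal (\<sigma> x))" "\<sigma> \<in> borel_measurable borel" "\<And>x. 0 < \<sigma> x" for t x \<sigma>
  proof -
    have "(\<lambda>y. k (x - y)) \<in> borel_measurable lborel" by measurable
    then have "?r t x = (LINT y|lborel. \<sigma> y *\<^sub>R k (x - y))"
      unfolding S.smoothed_def that(1) by (rule integral_density) (use that(2,3) in \<open>simp_all add: less_imp_le\<close>)
    then show ?thesis by simp
  qed
  have wcR: "weakly_continuous_curve (\<lambda>t. density lborel (\<lambda>x. ennreal (R t x)))"
    unfolding weakly_continuous_curve_def
  proof (intro conjI ballI allI impI)
    fix t :: real
    have "prob_space (density lborel (\<lambda>x. ennreal (R t x)))"
      using Rm'[of t] by (intro prob_spaceI) (simp add: emeasure_density R1)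
    then show "density lborel (\<lambda>x. ennreal (R t x)) \<in> space (prob_algebra borel)"
      by (simp add: space_prob_algebra)
  next
    fix f :: "'a \<Rightarrow> real" assume f: "continuous_on UNIV f \<and> bounded (range f)"
    then have fm [measurable]: "f \<in> borel_measurable borel" by (intro borel_measurable_continuous_onI) simp
    obtain C where "\<And>y. y \<in> range f \<Longrightarrow> norm y \<le> C" using f unfolding bounded_iff by blast
    then have C: "\<bar>f x\<bar> \<le> C" for x by auto
    have sm: "S.smoothed t \<in> borel_measurable borel" for t by (rule S.smoothed_measurable')
    have i: "integrable lborel (\<lambda>x. f x * u x)"
      if u [measurable]: "u \<in> borel_measurable borel" and u0: "\<And>x. 0 < u x" and u1: "(\<integral>\<^sup>+x. ennreal (u x) \<partial>lborel) = 1" for u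
      by (rule integrable_bounded_density) (use u u0 u1 C in \<open>auto simp: less_imp_le\<close>)
    have I0: "integrable lborel (\<lambda>x. f x * \<sigma>0 x)" by (rule i[OF s0m s0 s01])
    have I1: "integrable lborel (\<lambda>x. f x * \<sigma>1 x)" by (rule i[OF s1m s1 s11])
    have Ir: "integrable lborel (\<lambda>x. f x * ?r t x)" for t by (rule i[OF sm rp S.smoothed_prob])
    have "(LINT x|density lborel (\<lambda>x. ennreal (R t x)). f x) = G0 t * (LINT x|lborel. f x * \<sigma>0 x) + G1 t * (LINT x|lborel. f x * \<sigma>1 x)
      + (1 - G0 t - G1 t) * (LINT x|lborel. f x * ?r ((t - a) / h) x)" for t
    proof -
      have "(LINT x|density lborel (\<lambda>x. ennreal (R t x)). f x) = (LINT x|lborel. R t x *\<^sub>R f x)"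
        by (rule integral_density) (use Rm'[of t] Rnn in simp_all)
      also have "\<dots> = (LINT x|lborel. G0 t * (f x * \<sigma>0 x) + G1 t * (f x * \<sigma>1 x) + (1 - G0 t - G1 t) * (f x * ?r ((t - a) / h) x))"
        by (rule Bochner_Integration.integral_cong[OF refl]) (simp add: R_def algebra_simps)
      also have "\<dots> = G0 t * (LINT x|lborel. f x * \<sigma>0 x) + G1 t * (LINT x|lborel. f x * \<sigma>1 x)
        + (1 - G0 t - G1 t) * (LINT x|lborel. f x * ?r ((t - a) / h) x)"
        using I0 I1 Ir[of "(t - a) / h"] by simp
      finally show ?thesis .
    qed
    moreover have "continuous_on {0..1} (\<lambda>t. LINT x|lborel. f x * ?r ((t - a) / h) x)"
      by (rule continuous_on_compose2[OF S.smoothed_weakly_continuous[OF conjunct1[OF f] C]])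
        (use h in \<open>auto intro!: continuous_intros\<close>)
    moreover have "continuous_on {0..1} G0" "continuous_on {0..1} G1"
      unfolding G0_def[abs_def] G1_def[abs_def] using a
      by (auto intro!: continuous_intros continuous_on_compose2[OF clamp01_continuous[of UNIV]])
    ultimately show "continuous_on {0..1} (\<lambda>t. LINT x|density lborel (\<lambda>x. ennreal (R t x)). f x)"
      by (simp only:) (intro continuous_intros)
  qed
  have bound: "ennreal (- 2 * (LINT t:{0..1}|lborel. LINT x|lborel. time_deriv \<phi> (t, x) * R t x))
      \<le> ennreal (c + \<delta>) + (\<integral>\<^sup>+t\<in>{0..1}. action' lborel K (R t) (\<lambda>x. \<phi> (t, x)) \<partial>lborel)"
    if \<phi>: "test_function \<phi>" for \<phi>
  proof -
    have \<Phi>: "smooth_compact \<phi>" by (rule test_function_smooth_compact[OF \<phi>])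
    note \<phi>m [measurable] = test_function_measurable[OF \<Phi>] test_function_measurable[OF smooth_compact_time_deriv[OF \<Phi>]]
    obtain B2 where B2: "\<And>p. \<bar>time_deriv \<phi> p\<bar> \<le> B2" using smooth_compact_bounded[OF smooth_compact_time_deriv[OF \<Phi>]] by blast
    let ?D = "\<lambda>t. LINT x|lborel. time_deriv \<phi> (t, x) * R t x"
    let ?E = "\<lambda>t. action' lborel K (R t) (\<lambda>x. \<phi> (t, x))"
    let ?L = "\<lambda>t. LINT x|lborel. \<phi> (t, x) * R t x"
    have Di: "set_integrable lborel {s..e} ?D" for s e
      by (rule set_integrable_density_curve(2)[OF Rm Rnn R1 \<phi>m(2) B2])
    have Em: "?E \<in> borel_measurable borel" by (rule action'_measurable[OF Rm \<phi>m(1)])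
    \<comment> \<open>Transfers an estimate for the explicit form Q of the curve on one time
      interval to R, with which Q agrees there, end points included.\<close>
    have seg: "ennreal (2 * (?L e - ?L s - (LINT t:{s..e}|lborel. ?D t))) \<le> C + (\<integral>\<^sup>+t\<in>{s..e}. ?E t \<partial>lborel)"
      if le: "s \<le> e" and RQ: "\<And>t x. t \<in> {s..e} \<Longrightarrow> R t x = Q t x"
        and est: "ennreal (2 * ((LINT x|lborel. \<phi> (e, x) * Q e x) - (LINT x|lborel. \<phi> (s, x) * Q s x)
          - (LINT t:{s..e}|lborel. LINT x|lborel. time_deriv \<phi> (t, x) * Q t x)))
          \<le> C + (\<integral>\<^sup>+t\<in>{s..e}. action' lborel K (Q t) (\<lambda>x. \<phi> (t, x)) \<partial>lborel)" for s e Q C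
    proof -
      have Rt: "t \<in> {s..e} \<Longrightarrow> R t = Q t" for t using RQ by (simp add: fun_eq_iff)
      have "(LINT t:{s..e}|lborel. ?D t) = (LINT t:{s..e}|lborel. LINT x|lborel. time_deriv \<phi> (t, x) * Q t x)"
        by (rule set_lebesgue_integral_cong) (simp_all add: Rt)
      moreover have "(\<integral>\<^sup>+t\<in>{s..e}. ?E t \<partial>lborel) = (\<integral>\<^sup>+t\<in>{s..e}. action' lborel K (Q t) (\<lambda>x. \<phi> (t, x)) \<partial>lborel)"
        by (rule nn_integral_cong) (simp add: Rt indicator_def)
      ultimately show ?thesis using est Rt[of s] Rt[of e] le by simp
    qed
    have left: "ennreal (2 * (?L a - ?L 0 - (LINT t:{0..a}|lborel. ?D t)))
      \<le> ennreal (4 / a\<^sup>2 * \<epsilon>\<^sup>2) * ?I \<sigma>0 * ennreal (a - 0) + (\<integral>\<^sup>+t\<in>{0..a}. ?E t \<partial>lborel)"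
    proof (rule seg[OF _ R_left])
      show "ennreal (2 * ((LINT x|lborel. \<phi> (a, x) * (((a - a) / a)\<^sup>2 * \<sigma>0 x + (1 - ((a - a) / a)\<^sup>2) * ?r 0 x))
          - (LINT x|lborel. \<phi> (0, x) * (((0 - a) / a)\<^sup>2 * \<sigma>0 x + (1 - ((0 - a) / a)\<^sup>2) * ?r 0 x))
          - (LINT t:{0..a}|lborel. LINT x|lborel. time_deriv \<phi> (t, x) * (((t - a) / a)\<^sup>2 * \<sigma>0 x + (1 - ((t - a) / a)\<^sup>2) * ?r 0 x))))
        \<le> ennreal (4 / a\<^sup>2 * \<epsilon>\<^sup>2) * ?I \<sigma>0 * ennreal (a - 0)
          + (\<integral>\<^sup>+t\<in>{0..a}. action' lborel K (\<lambda>x. ((t - a) / a)\<^sup>2 * \<sigma>0 x + (1 - ((t - a) / a)\<^sup>2) * ?r 0 x) (\<lambda>x. \<phi> (t, x)) \<partial>lborel)"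
      proof (rule interpolation_segment[OF s0m k s0 k0' ks s01 k1 kj S.smoothed_measurable' rp _ S.smoothed_prob _ refl _ _ \<Phi> refl])
        show "?r 0 x = (LINT y|lborel. \<sigma>0 y * k (x - y))" for x by (rule tau[OF _ s0m s0]) (simp add: m0)
        show "((t - a) / a)\<^sup>2 \<le> 1" if "t \<in> {0..a}" for t
          unfolding abs_square_le_1 using that a by (simp add: abs_le_iff field_simps)
      qed (use a in simp_all)
    qed (use a in simp_all)
    have right: "ennreal (2 * (?L 1 - ?L (1 - a) - (LINT t:{1 - a..1}|lborel. ?D t)))
      \<le> ennreal (4 / a\<^sup>2 * \<epsilon>\<^sup>2) * ?I \<sigma>1 * ennreal (1 - (1 - a)) + (\<integral>\<^sup>+t\<in>{1 - a..1}. ?E t \<partial>lborel)"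
    proof (rule seg[OF _ R_right])
      show "ennreal (2 * ((LINT x|lborel. \<phi> (1, x) * (((1 - (1 - a)) / a)\<^sup>2 * \<sigma>1 x + (1 - ((1 - (1 - a)) / a)\<^sup>2) * ?r 1 x))
          - (LINT x|lborel. \<phi> (1 - a, x) * (((1 - a - (1 - a)) / a)\<^sup>2 * \<sigma>1 x + (1 - ((1 - a - (1 - a)) / a)\<^sup>2) * ?r 1 x))
          - (LINT t:{1 - a..1}|lborel. LINT x|lborel. time_deriv \<phi> (t, x) * (((t - (1 - a)) / a)\<^sup>2 * \<sigma>1 x + (1 - ((t - (1 - a)) / a)\<^sup>2) * ?r 1 x))))
        \<le> ennreal (4 / a\<^sup>2 * \<epsilon>\<^sup>2) * ?I \<sigma>1 * ennreal (1 - (1 - a))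
          + (\<integral>\<^sup>+t\<in>{1 - a..1}. action' lborel K (\<lambda>x. ((t - (1 - a)) / a)\<^sup>2 * \<sigma>1 x + (1 - ((t - (1 - a)) / a)\<^sup>2) * ?r 1 x) (\<lambda>x. \<phi> (t, x)) \<partial>lborel)"
      proof (rule interpolation_segment[OF s1m k s1 k0' ks s11 k1 kj S.smoothed_measurable' rp _ S.smoothed_prob _ refl _ _ \<Phi> refl])
        show "?r 1 x = (LINT y|lborel. \<sigma>1 y * k (x - y))" for x by (rule tau[OF _ s1m s1]) (simp add: m1)
        show "((t - (1 - a)) / a)\<^sup>2 \<le> 1" if "t \<in> {1 - a..1}" for t
          unfolding abs_square_le_1 using that a by (simp add: abs_le_iff field_simps)
      qed (use a in simp_all)
    qed (use a in simp_all)
    have ah: "a + h = 1 - a" by (simp add: h_def)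
    have mid: "ennreal (2 * (?L (1 - a) - ?L a - (LINT t:{a..1 - a}|lborel. ?D t)))
      \<le> ?A / ennreal h + (\<integral>\<^sup>+t\<in>{a..1 - a}. ?E t \<partial>lborel)"
    proof (rule seg[OF _ R_mid])
      have "(1 - a - a) / h = 1" "(a - a) / h = 0" using h by (simp_all add: h_def)
      then show "ennreal (2 * ((LINT x|lborel. \<phi> (1 - a, x) * ?r ((1 - a - a) / h) x) - (LINT x|lborel. \<phi> (a, x) * ?r ((a - a) / h) x)
          - (LINT t:{a..1 - a}|lborel. LINT x|lborel. time_deriv \<phi> (t, x) * ?r ((t - a) / h) x)))
        \<le> ?A / ennreal h + (\<integral>\<^sup>+t\<in>{a..1 - a}. action' lborel K (?r ((t - a) / h)) (\<lambda>x. \<phi> (t, x)) \<partial>lborel)"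
        using CE_segment[OF CE k k0 kB k1 h \<Phi>, of a] unfolding ah by (simp only:)
    qed (use a in simp_all)
    \<comment> \<open>The test function vanishes at the times 0 and 1; the boundary terms at a and 1
      - a occur with both signs and cancel in the sum of the three estimates.\<close>
    have L01: "?L 0 = 0" "?L 1 = 0" using test_function_boundary[OF \<phi>] by simp_all
    let ?Da = "LINT t:{0..a}|lborel. ?D t" and ?Db = "LINT t:{a..1 - a}|lborel. ?D t" and ?Dc = "LINT t:{1 - a..1}|lborel. ?D t"
    let ?Ea = "\<integral>\<^sup>+t\<in>{0..a}. ?E t \<partial>lborel" and ?Eb = "\<integral>\<^sup>+t\<in>{a..1 - a}. ?E t \<partial>lborel" and ?Ec = "\<integral>\<^sup>+t\<in>{1 - a..1}. ?E t \<partial>lborel"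
    have D: "(LINT t:{0..1}|lborel. ?D t) = ?Da + (?Db + ?Dc)"
    proof -
      have "(LINT t:{0..1}|lborel. ?D t) = ?Da + (LINT t:{a..1}|lborel. ?D t)"
        by (rule set_integral_split[OF _ _ Di]) (use a in simp_all)
      moreover have "(LINT t:{a..1}|lborel. ?D t) = ?Db + ?Dc"
        by (rule set_integral_split[OF _ _ Di]) (use a in simp_all)
      ultimately show ?thesis by simp
    qed
    have E: "(\<integral>\<^sup>+t\<in>{0..1}. ?E t \<partial>lborel) = ?Ea + (?Eb + ?Ec)"
    proof -
      have "(\<integral>\<^sup>+t\<in>{0..1}. ?E t \<partial>lborel) = ?Ea + (\<integral>\<^sup>+t\<in>{a..1}. ?E t \<partial>lborel)"
        by (rule set_nn_integral_split[OF _ _ Em]) (use a in simp_all)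
      moreover have "(\<integral>\<^sup>+t\<in>{a..1}. ?E t \<partial>lborel) = ?Eb + ?Ec"
        by (rule set_nn_integral_split[OF _ _ Em]) (use a in simp_all)
      ultimately show ?thesis by simp
    qed
    have costs: "ennreal (4 / a\<^sup>2 * \<epsilon>\<^sup>2) * ?I \<sigma>0 * ennreal (a - 0) + (?A / ennreal h + ennreal (4 / a\<^sup>2 * \<epsilon>\<^sup>2) * ?I \<sigma>1 * ennreal (1 - (1 - a))) \<le> ennreal (c + \<delta>)"
    proof -
      have cost: "ennreal (4 / a\<^sup>2 * \<epsilon>\<^sup>2) * ennreal f * ennreal a = ennreal (4 * \<epsilon>\<^sup>2 * f / a)" if "0 \<le> f" for f
      proof -
        have "4 / a\<^sup>2 * \<epsilon>\<^sup>2 * f * a = 4 * \<epsilon>\<^sup>2 * f / a" using a by (simp add: power2_eq_square)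
        then show ?thesis using that a by (simp add: ennreal_mult[symmetric])
      qed
      have Ah: "?A / ennreal h = ennreal (c / h)" unfolding c(1) by (rule divide_ennreal[OF c(2) h])
      have n: "0 \<le> 4 * \<epsilon>\<^sup>2 * f0 / a" "0 \<le> 4 * \<epsilon>\<^sup>2 * f1 / a" "0 \<le> c / h" using f0 f1 a c h by simp_all
      have a': "1 - (1 - a) = a" "a - 0 = a" by simp_all
      have "ennreal (4 / a\<^sup>2 * \<epsilon>\<^sup>2) * ?I \<sigma>0 * ennreal (a - 0) + (?A / ennreal h + ennreal (4 / a\<^sup>2 * \<epsilon>\<^sup>2) * ?I \<sigma>1 * ennreal (1 - (1 - a)))
        = ennreal (4 * \<epsilon>\<^sup>2 * f0 / a + (c / h + 4 * \<epsilon>\<^sup>2 * f1 / a))"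
        unfolding f0(1) f1(1) a' cost[OF f0(2)] cost[OF f1(2)] Ah
        by (simp only: ennreal_plus[OF n(1) add_nonneg_nonneg[OF n(3,2)]] ennreal_plus[OF n(3,2)])
      moreover have "4 * \<epsilon>\<^sup>2 * f0 / a + (c / h + 4 * \<epsilon>\<^sup>2 * f1 / a) \<le> c + \<delta>"
        using tot by (simp add: h_def add_divide_distrib distrib_left)
      ultimately show ?thesis by (simp only: ennreal_leI)
    qed
    have telescope: "- 2 * (p + (q + r)) = 2 * (u - 0 - p) + (2 * (v - u - q) + 2 * (0 - v - r))" for p q r u v :: real
      by (simp add: algebra_simps)
    have sum: "- 2 * (LINT t:{0..1}|lborel. ?D t)
      = 2 * (?L a - ?L 0 - ?Da) + (2 * (?L (1 - a) - ?L a - ?Db) + 2 * (?L 1 - ?L (1 - a) - ?Dc))"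
      unfolding D L01 by (rule telescope)
    show ?thesis unfolding sum E by (rule ennreal_add3_le[OF left mid right costs])
  qed
  have c\<delta>: "0 \<le> c + \<delta>" using c \<delta> by simp
  obtain \<psi> :: "real \<times> 'a \<Rightarrow> real" where \<psi> [measurable]: "\<psi> \<in> borel_measurable (borel \<Otimes>\<^sub>M borel)"
    and \<psi>E: "(\<integral>\<^sup>+t\<in>{0..1}. action' lborel K (R t) (\<lambda>x. \<psi> (t, x)) \<partial>lborel) \<le> ennreal (c + \<delta>)"
    and \<psi>i: "\<And>\<phi>. test_function \<phi> \<Longrightarrow> integrable (weighted_measure R) (\<lambda>z. gradient \<psi> z * gradient \<phi> z)"
    and \<psi>e: "\<And>\<phi>. test_function \<phi> \<Longrightarrow> (LINT z|weighted_measure R. gradient \<psi> z * gradient \<phi> z)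
      = - (LINT t:{0..1}|lborel. LINT x|lborel. time_deriv \<phi> (t, x) * R t x)"
  proof (rule realize_potential[OF Rm Rpos R1 c\<delta> bound])
    fix \<psi> :: "real \<times> 'a \<Rightarrow> real"
    assume p1: "\<psi> \<in> borel_measurable (borel \<Otimes>\<^sub>M borel)"
      and p2: "(\<integral>\<^sup>+t\<in>{0..1}. action' lborel K (R t) (\<lambda>x. \<psi> (t, x)) \<partial>lborel) \<le> ennreal (c + \<delta>)"
      and p3: "\<And>\<phi>. test_function \<phi> \<Longrightarrow> integrable (weighted_measure R) (\<lambda>z. gradient \<psi> z * gradient \<phi> z)"
      and p4: "\<And>\<phi>. test_function \<phi> \<Longrightarrow> (LINT z|weighted_measure R. gradient \<psi> z * gradient \<phi> z)
        = - (LINT t:{0..1}|lborel. LINT x|lborel. time_deriv \<phi> (t, x) * R t x)"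
    show thesis by (rule that[OF p1 p2 p3 p4])
  qed
  \<comment> \<open>R has the right end measures but possibly not the prescribed density functions.
    Changing it at two times affects no time integral, and as measures the two curves are the
    same.\<close>
  define \<rho> where "\<rho> t = (if t = 0 then \<rho>0 else if t = 1 then \<rho>1 else R t)" for t
  have \<rho>R: "\<rho> t = R t" if "t \<notin> {0, 1}" for t using that by (simp add: \<rho>_def)
  have \<rho>m [measurable]: "(\<lambda>(t, x). \<rho> t x) \<in> borel_measurable (borel \<Otimes>\<^sub>M borel)"
  proof -
    have "(\<lambda>(t, x). if t = 0 then \<rho>0 x else if t = 1 then \<rho>1 x else R t x) \<in> borel_measurable (borel \<Otimes>\<^sub>M borel)" by measurable
    moreover have "(\<lambda>(t, x). if t = 0 then \<rho>0 x else if t = 1 then \<rho>1 x else R t x) = (\<lambda>(t, x). \<rho> t x)"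
      by (auto simp: \<rho>_def fun_eq_iff)
    ultimately show ?thesis by simp
  qed
  have \<rho>d: "density lborel (\<lambda>x. ennreal (\<rho> t x)) = density lborel (\<lambda>x. ennreal (R t x))" for t
    by (simp add: \<rho>_def eq0 eq1 Rends)
  have \<rho>t: "\<rho> t \<in> borel_measurable borel" and \<rho>0: "0 \<le> \<rho> t x" for t x
    using r0 r1 Rnn Rm'[of t] by (simp_all add: \<rho>_def)
  have \<rho>1: "(\<integral>\<^sup>+x. ennreal (\<rho> t x) \<partial>lborel) = 1" for t
  proof -
    have "emeasure (density lborel (\<lambda>x. ennreal (\<rho> t x))) UNIV = emeasure (density lborel (\<lambda>x. ennreal (R t x))) UNIV"
      by (simp only: \<rho>d)
    then show ?thesis using \<rho>t[of t] Rm'[of t] R1[of t] by (simp add: emeasure_density)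
  qed
  have disc: "integral\<^sup>L lborel F = integral\<^sup>L lborel G" if "\<And>t. t \<notin> {0, 1} \<Longrightarrow> F t = G t" for F G :: "real \<Rightarrow> real"
    by (rule integral_discrete_difference[where X="{0, 1}"]) (use that in auto)
  have disc_nn: "integral\<^sup>N lborel F = integral\<^sup>N lborel G" if "\<And>t. t \<notin> {0, 1} \<Longrightarrow> F t = G t" for F G :: "real \<Rightarrow> ennreal"
  proof (rule nn_integral_cong_AE)
    show "AE t in lborel. F t = G t"
      using AE_lborel_singleton[of 0] AE_lborel_singleton[of 1] by eventually_elim (use that in auto)
  qed
  have inCE: "(\<rho>, \<lambda>t x. \<psi> (t, x)) \<in> CE' lborel K \<rho>0 \<rho>1"
    unfolding CE'_def mem_Collect_eq prod.case
  proof (intro conjI ballI allI impI)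
    show "(\<lambda>(t, x). \<rho> t x) \<in> borel_measurable (restrict_space borel ({0..1} \<times> UNIV))"
      using \<rho>m unfolding measurable_borel_prod by (rule measurable_restrict_space1)
    show "(\<lambda>(t, x). \<psi> (t, x)) \<in> borel_measurable (restrict_space borel ({0..1} \<times> UNIV))"
      using \<psi> unfolding measurable_borel_prod by (simp add: measurable_restrict_space1)
    show "0 \<le> \<rho> t x" for t x by (rule \<rho>0)
    show "(\<integral>\<^sup>+x. ennreal (\<rho> t x) \<partial>lborel) = 1" for t by (rule \<rho>1)
    show "weakly_continuous_curve (\<lambda>t. density lborel (\<lambda>x. ennreal (\<rho> t x)))" unfolding \<rho>d by (rule wcR)
    show "\<rho> 0 = \<rho>0" "\<rho> 1 = \<rho>1" by (simp_all add: \<rho>_def)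
  next
    fix \<phi> :: "real \<times> 'a \<Rightarrow> real" assume \<phi>: "test_function \<phi>"
    have sc: "smooth_compact \<phi>" by (rule test_function_smooth_compact[OF \<phi>])
    note fl = weighted_integral_flux[OF Rm \<psi> test_function_measurable[OF sc] \<psi>i[OF \<phi>]]
    have "(\<integral>\<^sup>+t\<in>{0..1}. (\<integral>\<^sup>+(x, y). ennreal (\<bar>(\<phi> (t, y) - \<phi> (t, x)) * (\<psi> (t, y) - \<psi> (t, x))\<bar> * log_mean (\<rho> t x) (\<rho> t y)) \<partial>Jm) \<partial>lborel)
      = (\<integral>\<^sup>+t\<in>{0..1}. (\<integral>\<^sup>+(x, y). ennreal (\<bar>(\<phi> (t, y) - \<phi> (t, x)) * (\<psi> (t, y) - \<psi> (t, x))\<bar> * log_mean (R t x) (R t y)) \<partial>Jm) \<partial>lborel)"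
      by (rule disc_nn) (simp add: \<rho>R)
    then show "(\<integral>\<^sup>+t\<in>{0..1}. (\<integral>\<^sup>+(x, y). ennreal (\<bar>(\<phi> (t, y) - \<phi> (t, x)) * (\<psi> (t, y) - \<psi> (t, x))\<bar> * log_mean (\<rho> t x) (\<rho> t y)) \<partial>Jm) \<partial>lborel) < \<infinity>"
      using fl(1) by simp
    have "(LINT t:{0..1}|lborel. LINT x|lborel. deriv (\<lambda>s. \<phi> (s, x)) t * \<rho> t x) = (LINT t:{0..1}|lborel. LINT x|lborel. time_deriv \<phi> (t, x) * R t x)"
      unfolding set_lebesgue_integral_def deriv_eq_time_deriv[OF smooth_compact_smooth[OF sc]] by (rule disc) (simp add: \<rho>R)
    moreover have "(LINT t:{0..1}|lborel. LINT (x, y)|Jm. (\<phi> (t, y) - \<phi> (t, x)) * (\<psi> (t, y) - \<psi> (t, x)) * log_mean (\<rho> t x) (\<rho> t y))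
      = (LINT t:{0..1}|lborel. LINT (x, y)|Jm. (\<phi> (t, y) - \<phi> (t, x)) * (\<psi> (t, y) - \<psi> (t, x)) * log_mean (R t x) (R t y))"
      unfolding set_lebesgue_integral_def by (rule disc) (simp add: \<rho>R)
    ultimately show "(LINT t:{0..1}|lborel. LINT x|lborel. deriv (\<lambda>s. \<phi> (s, x)) t * \<rho> t x) +
      1 / 2 * (LINT t:{0..1}|lborel. LINT (x, y)|Jm. (\<phi> (t, y) - \<phi> (t, x)) * (\<psi> (t, y) - \<psi> (t, x)) * log_mean (\<rho> t x) (\<rho> t y)) = 0"
      using fl(2) \<psi>e[OF \<phi>] by simp
  qed
  have "(\<integral>\<^sup>+t\<in>{0..1}. action' lborel K (\<rho> t) (\<lambda>x. \<psi> (t, x)) \<partial>lborel) = (\<integral>\<^sup>+t\<in>{0..1}. action' lborel K (R t) (\<lambda>x. \<psi> (t, x)) \<partial>lborel)"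
    by (rule disc_nn) (simp add: \<rho>R)
  also have "\<dots> \<le> ennreal (c + \<delta>)" by (rule \<psi>E)
  also have "\<dots> = ?A + ennreal \<delta>" unfolding c(1) using c \<delta> by simp
  finally show ?thesis by (rule that[OF inCE])
qed

end

subsection \<open>Fluxes of potentials\<close>

text \<open>The equality case of the Legendre inequality: a flux d \<theta> has action d^2 \<theta>
  / 2, and both sides are 0 where the mean vanishes.\<close>

lemma action_density_flux:
  assumes "0 \<le> s" "0 \<le> t"
  shows "action_density (d * log_mean s t) s t = ennreal (d\<^sup>2 * log_mean s t) / 2"
proof (cases "log_mean s t = 0")
  case False
  have "(d * log_mean s t)\<^sup>2 / (2 * log_mean s t) = d\<^sup>2 * log_mean s t / 2"
    using False by (simp add: power2_eq_square)
  moreover have "0 \<le> d\<^sup>2 * log_mean s t" using log_mean_nonneg by simp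
  ultimately show ?thesis using False by (simp add: action_density_def ennreal_divide_numeral)
qed (simp add: action_density_def)

context levy_kernel
begin

text \<open>In the swapped measure the density moves to the second coordinate; that the reference
  measure remains the same is the symmetry of j.\<close>

lemma jump_measure_density:
  fixes \<rho> :: "'a \<Rightarrow> real"
  assumes \<rho> [measurable]: "\<rho> \<in> borel_measurable borel"
  shows "jump_measure (density lborel (\<lambda>x. ennreal (\<rho> x))) K = density Jm (\<lambda>p. ennreal (\<rho> (fst p)))"
    and "jump_measure_swap (density lborel (\<lambda>x. ennreal (\<rho> x))) K = density Jm (\<lambda>p. ennreal (\<rho> (snd p)))"
proof -
  let ?\<mu> = "density lborel (\<lambda>x. ennreal (\<rho> x))"
  have s: "sets ?\<mu> = sets borel" by simp
  have ss: "sets (jump_measure_swap ?\<mu> K) = sets offdiag_borel" by (simp add: jump_measure_swap_def)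
  have f1: "(\<lambda>p. ennreal (\<rho> (fst p))) \<in> borel_measurable Jm" "(\<lambda>p. ennreal (\<rho> (snd p))) \<in> borel_measurable Jm"
    by measurable
  have A: "A \<in> sets (borel \<Otimes>\<^sub>M borel)" "A \<in> sets borel" "A \<in> sets Jm" "A \<in> sets (jump_measure ?\<mu> K)" "A \<in> sets (jump_measure_swap ?\<mu> K)"
    if "A \<in> sets offdiag_borel" for A :: "('a \<times> 'a) set"
    using that unfolding sets_jump_measure ss sets_borel_prod by (simp_all add: sets_offdiag_borel_iff)
  show "jump_measure ?\<mu> K = density Jm (\<lambda>p. ennreal (\<rho> (fst p)))"
  proof (rule measure_eqI)
    fix A assume "A \<in> sets (jump_measure ?\<mu> K)"
    then have "A \<in> sets offdiag_borel" by (simp only: sets_jump_measure)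
    note A = A[OF this] and [measurable] = A(1)[OF this]
    have m1: "(indicator A :: 'a \<times> 'a \<Rightarrow> ennreal) \<in> borel_measurable borel" using A(2) by simp
    have m2: "(\<lambda>p. ennreal (\<rho> (fst p)) * indicator A p) \<in> borel_measurable borel"
      unfolding measurable_borel_prod[symmetric] by measurable
    have "emeasure (jump_measure ?\<mu> K) A = (\<integral>\<^sup>+p. indicator A p \<partial>jump_measure ?\<mu> K)"
      by (rule nn_integral_indicator[OF A(4), symmetric])
    also have "\<dots> = (\<integral>\<^sup>+x. \<integral>\<^sup>+y. indicator A (x, y) * ennreal (j (y - x)) \<partial>lborel \<partial>?\<mu>)"
      by (rule nn_integral_jump_measure[OF s m1])
    also have "\<dots> = (\<integral>\<^sup>+x. ennreal (\<rho> x) * (\<integral>\<^sup>+y. indicator A (x, y) * ennreal (j (y - x)) \<partial>lborel) \<partial>lborel)"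
      by (rule nn_integral_density) measurable
    also have "\<dots> = (\<integral>\<^sup>+x. \<integral>\<^sup>+y. (ennreal (\<rho> (fst (x, y))) * indicator A (x, y)) * ennreal (j (y - x)) \<partial>lborel \<partial>lborel)"
      unfolding mult.assoc fst_conv by (intro nn_integral_cong nn_integral_cmult[symmetric]) measurable
    also have "\<dots> = (\<integral>\<^sup>+p. ennreal (\<rho> (fst p)) * indicator A p \<partial>Jm)"
      by (rule nn_integral_Jm[OF m2, symmetric])
    also have "\<dots> = emeasure (density Jm (\<lambda>p. ennreal (\<rho> (fst p)))) A"
      by (rule emeasure_density[OF f1(1) A(3), symmetric])
    finally show "emeasure (jump_measure ?\<mu> K) A = emeasure (density Jm (\<lambda>p. ennreal (\<rho> (fst p)))) A" .
  qed (simp only: sets_jump_measure sets_density)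
  show "jump_measure_swap ?\<mu> K = density Jm (\<lambda>p. ennreal (\<rho> (snd p)))"
  proof (rule measure_eqI)
    fix A assume "A \<in> sets (jump_measure_swap ?\<mu> K)"
    then have "A \<in> sets offdiag_borel" by (simp only: ss)
    note A = A[OF this] and [measurable] = A(1)[OF this]
    have m1: "(indicator A :: 'a \<times> 'a \<Rightarrow> ennreal) \<in> borel_measurable borel" using A(2) by simp
    have m2: "(\<lambda>p. ennreal (\<rho> (snd p)) * indicator A p) \<in> borel_measurable borel"
      unfolding measurable_borel_prod[symmetric] by measurable
    have m3: "(\<lambda>p. ennreal (\<rho> (fst p)) * indicator A (prod.swap p)) \<in> borel_measurable (borel \<Otimes>\<^sub>M borel)"
      unfolding prod.swap_def by measurable
    have "emeasure (jump_measure_swap ?\<mu> K) A = (\<integral>\<^sup>+p. indicator A p \<partial>jump_measure_swap ?\<mu> K)"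
      by (rule nn_integral_indicator[OF A(5), symmetric])
    also have "\<dots> = (\<integral>\<^sup>+x. \<integral>\<^sup>+y. indicator A (y, x) * ennreal (j (y - x)) \<partial>lborel \<partial>?\<mu>)"
      by (rule nn_integral_jump_measure_swap[OF s m1])
    also have "\<dots> = (\<integral>\<^sup>+x. ennreal (\<rho> x) * (\<integral>\<^sup>+y. indicator A (y, x) * ennreal (j (y - x)) \<partial>lborel) \<partial>lborel)"
      by (rule nn_integral_density) measurable
    also have "\<dots> = (\<integral>\<^sup>+x. \<integral>\<^sup>+y. (ennreal (\<rho> (fst (x, y))) * indicator A (prod.swap (x, y))) * ennreal (j (y - x)) \<partial>lborel \<partial>lborel)"
      unfolding mult.assoc fst_conv swap_simp by (intro nn_integral_cong nn_integral_cmult[symmetric]) measurable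
    also have "\<dots> = (\<integral>\<^sup>+x. \<integral>\<^sup>+y. (ennreal (\<rho> (fst (y, x))) * indicator A (prod.swap (y, x))) * ennreal (j (y - x)) \<partial>lborel \<partial>lborel)"
      by (rule nn_integral_Jm_swap[OF m3])
    also have "\<dots> = (\<integral>\<^sup>+x. \<integral>\<^sup>+y. (ennreal (\<rho> (snd (x, y))) * indicator A (x, y)) * ennreal (j (y - x)) \<partial>lborel \<partial>lborel)"
      unfolding fst_conv snd_conv swap_simp ..
    also have "\<dots> = (\<integral>\<^sup>+p. ennreal (\<rho> (snd p)) * indicator A p \<partial>Jm)"
      by (rule nn_integral_Jm[OF m2, symmetric])
    also have "\<dots> = emeasure (density Jm (\<lambda>p. ennreal (\<rho> (snd p)))) A"
      by (rule emeasure_density[OF f1(2) A(3), symmetric])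
    finally show "emeasure (jump_measure_swap ?\<mu> K) A = emeasure (density Jm (\<lambda>p. ennreal (\<rho> (snd p)))) A" .
  qed (simp only: ss sets_jump_measure sets_density)
qed

text \<open>On a compact set off the diagonal the jump lengths are bounded below, so the Levy mass
  controls the integral in y uniformly, and x ranges over a compact projection of finite Lebesgue
  measure.\<close>

lemma radon_Jm: "radon_offdiag Jm"
proof -
  have "emeasure Jm S < \<infinity>" if S: "compact S" "S \<subseteq> offdiag" for S
  proof (cases "S = {}")
    case False
    have "continuous_on S (\<lambda>p. norm (snd p - fst p))" by (intro continuous_intros)
    then obtain q where q: "q \<in> S" "\<And>p. p \<in> S \<Longrightarrow> norm (snd q - fst q) \<le> norm (snd p - fst p)"
      using continuous_attains_inf[OF S(1) False] by blast
    define d where "d = min 1 ((norm (snd q - fst q))\<^sup>2)"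
    have "fst q \<noteq> snd q" using q(1) S(2) by (auto simp: offdiag_def)
    then have d: "0 < d" by (simp add: d_def)
    have Sb: "S \<in> sets borel" using S(1) by (intro borel_closed compact_imp_closed)
    then have SJ: "S \<in> sets Jm" using S(2) by (simp add: sets_jump_measure sets_offdiag_borel_iff)
    have Sp [measurable]: "S \<in> sets (borel \<Otimes>\<^sub>M borel)" using Sb by (simp only: sets_borel_prod)
    have C: "compact (fst ` S)" by (intro compact_continuous_image continuous_intros S)
    then have [measurable]: "fst ` S \<in> sets borel" by (intro borel_closed compact_imp_closed)
    let ?m = "\<lambda>z :: 'a. ennreal (min 1 ((norm z)\<^sup>2))"
    have "emeasure Jm S = (\<integral>\<^sup>+p. indicator S p \<partial>Jm)" by (rule nn_integral_indicator[OF SJ, symmetric])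
    also have "\<dots> = (\<integral>\<^sup>+x. \<integral>\<^sup>+y. indicator S (x, y) * ennreal (j (y - x)) \<partial>lborel \<partial>lborel)"
      using Sb by (intro nn_integral_Jm) simp
    also have "\<dots> \<le> (\<integral>\<^sup>+x. (ennreal (1 / d) * levy_mass) * indicator (fst ` S) x \<partial>lborel)"
    proof (rule nn_integral_mono)
      fix x :: 'a
      show "(\<integral>\<^sup>+y. indicator S (x, y) * ennreal (j (y - x)) \<partial>lborel) \<le> (ennreal (1 / d) * levy_mass) * indicator (fst ` S) x"
      proof (cases "x \<in> fst ` S")
        case False
        then have "indicator S (x, y) = (0 :: ennreal)" for y by (auto simp: indicator_def image_def)
        then show ?thesis by simp
      next
        case True
        have "(\<integral>\<^sup>+y. indicator S (x, y) * ennreal (j (y - x)) \<partial>lborel)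
          \<le> (\<integral>\<^sup>+y. ennreal (1 / d) * (?m (y - x) * ennreal (j (y - x))) \<partial>lborel)"
        proof (rule nn_integral_mono)
          fix y
          show "indicator S (x, y) * ennreal (j (y - x)) \<le> ennreal (1 / d) * (?m (y - x) * ennreal (j (y - x)))"
          proof (cases "(x, y) \<in> S")
            case True
            have "(norm (snd q - fst q))\<^sup>2 \<le> (norm (y - x))\<^sup>2" using q(2)[OF True] by (intro power_mono) auto
            then have "d \<le> min 1 ((norm (y - x))\<^sup>2)" unfolding d_def by (intro min.mono) auto
            then have "1 \<le> 1 / d * min 1 ((norm (y - x))\<^sup>2)" using d by (simp add: field_simps)
            then have "1 \<le> ennreal (1 / d * min 1 ((norm (y - x))\<^sup>2))" by (simp add: ennreal_leI flip: ennreal_1)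
            also have "\<dots> = ennreal (1 / d) * ?m (y - x)" using d by (intro ennreal_mult') simp
            finally have "1 * ennreal (j (y - x)) \<le> ennreal (1 / d) * ?m (y - x) * ennreal (j (y - x))"
              by (rule mult_right_mono) simp
            then show ?thesis using True by (simp add: mult.assoc)
          qed simp
        qed
        also have "\<dots> = ennreal (1 / d) * (\<integral>\<^sup>+y. ?m (y - x) * ennreal (j (y - x)) \<partial>lborel)"
          by (rule nn_integral_cmult) measurable
        also have "(\<integral>\<^sup>+y. ?m (y - x) * ennreal (j (y - x)) \<partial>lborel) = levy_mass"
          unfolding levy_mass_def by (rule nn_integral_lborel_shift_minus) measurable
        finally show ?thesis using True by simp
      qed
    qed
    also have "\<dots> = ennreal (1 / d) * levy_mass * emeasure lborel (fst ` S)"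
      by (rule nn_integral_cmult_indicator) simp
    also have "\<dots> < \<infinity>"
      using emeasure_compact_finite[OF C] levy_mass_finite by (simp add: ennreal_mult_less_top)
    finally show ?thesis .
  qed simp
  then show ?thesis unfolding radon_offdiag_def by (simp add: sets_jump_measure)
qed

definition flux :: "('a \<Rightarrow> real) \<Rightarrow> ('a \<Rightarrow> real) \<Rightarrow> 'a \<times> 'a \<Rightarrow> real"
  where "flux \<rho> \<psi> p = (\<psi> (snd p) - \<psi> (fst p)) * log_mean (\<rho> (fst p)) (\<rho> (snd p))"

lemma flux_measurable:
  assumes [measurable]: "\<rho> \<in> borel_measurable borel" "\<psi> \<in> borel_measurable borel"
  shows "flux \<rho> \<psi> \<in> borel_measurable borel"
  unfolding measurable_borel_prod[symmetric] flux_def[abs_def] by measurable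

text \<open>The infimum in the action is tested with the reference measure Jm, for which the
  densities of the two jump measures are \<rho>(x) and \<rho>(y).\<close>

lemma action_flux_le:
  assumes \<rho> [measurable]: "\<rho> \<in> borel_measurable borel" and \<rho>0: "\<And>x. 0 \<le> \<rho> x"
    and \<psi> [measurable]: "\<psi> \<in> borel_measurable borel"
  shows "action K (density lborel (\<lambda>x. ennreal (\<rho> x))) (signed_density Jm (flux \<rho> \<psi>)) \<le> action' lborel K \<rho> \<psi>"
proof -
  have "(\<integral>\<^sup>+p. action_density (flux \<rho> \<psi> p) (\<rho> (fst p)) (\<rho> (snd p)) \<partial>Jm)
    = (\<integral>\<^sup>+p. ennreal ((\<psi> (snd p) - \<psi> (fst p))\<^sup>2 * log_mean (\<rho> (fst p)) (\<rho> (snd p))) / 2 \<partial>Jm)"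
    unfolding flux_def by (simp only: action_density_flux[OF \<rho>0 \<rho>0])
  also have "\<dots> = action' lborel K \<rho> \<psi>"
    unfolding action'_def case_prod_beta' by (rule nn_integral_divide) measurable
  finally have eq: "action' lborel K \<rho> \<psi> = (\<integral>\<^sup>+p. action_density (flux \<rho> \<psi> p) (\<rho> (fst p)) (\<rho> (snd p)) \<partial>Jm)" ..
  have m: "flux \<rho> \<psi> \<in> borel_measurable Jm" by (rule measurable_jump_measure[OF flux_measurable[OF \<rho> \<psi>]])
  have m': "(\<lambda>p. \<rho> (fst p)) \<in> borel_measurable Jm" "(\<lambda>p. \<rho> (snd p)) \<in> borel_measurable Jm" by measurable
  show ?thesis unfolding action_def eq
    by (rule Inf_lower, rule CollectI, intro exI conjI)
      (rule refl radon_Jm m m' jump_measure_density[OF \<rho>] | use \<rho>0 in simp)+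
qed

lemma total_variation_signed_density:
  fixes W :: "'a \<times> 'a \<Rightarrow> real"
  assumes W: "W \<in> borel_measurable borel"
  shows "total_variation_nn_integral (signed_density Jm W) (\<lambda>(x, y). ennreal (min 1 (dist x y)))
    = (\<integral>\<^sup>+p. ennreal (min 1 (norm (snd p - fst p)) * \<bar>W p\<bar>) \<partial>Jm)"
proof -
  note [measurable] = measurable_jump_measure[OF W, of lborel]
  let ?f = "\<lambda>p :: 'a \<times> 'a. ennreal (min 1 (norm (snd p - fst p)))"
  have f: "(\<lambda>(x, y). ennreal (min 1 (dist x y))) = ?f" by (auto simp: fun_eq_iff dist_norm norm_minus_commute)
  have fm [measurable]: "?f \<in> borel_measurable Jm" by measurable
  have "integral\<^sup>N (density Jm (\<lambda>p. ennreal (W p))) ?f + integral\<^sup>N (density Jm (\<lambda>p. ennreal (- W p))) ?f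
    = (\<integral>\<^sup>+p. ennreal (W p) * ?f p \<partial>Jm) + (\<integral>\<^sup>+p. ennreal (- W p) * ?f p \<partial>Jm)"
    by (subst (1 2) nn_integral_density) measurable
  also have "\<dots> = (\<integral>\<^sup>+p. ennreal (W p) * ?f p + ennreal (- W p) * ?f p \<partial>Jm)"
    by (rule nn_integral_add[symmetric]) measurable
  also have "\<dots> = (\<integral>\<^sup>+p. ennreal (min 1 (norm (snd p - fst p)) * \<bar>W p\<bar>) \<partial>Jm)"
  proof (rule nn_integral_cong)
    fix p :: "'a \<times> 'a"
    have "ennreal (W p) + ennreal (- W p) = ennreal \<bar>W p\<bar>" by (cases "0 \<le> W p") (simp_all add: ennreal_neg)
    then show "ennreal (W p) * ?f p + ennreal (- W p) * ?f p = ennreal (min 1 (norm (snd p - fst p)) * \<bar>W p\<bar>)"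
      by (simp only: distrib_right[symmetric] ennreal_mult'[OF abs_ge_zero, symmetric] mult.commute)
  qed
  finally show ?thesis unfolding total_variation_nn_integral_def signed_density_def f fst_conv snd_conv .
qed

lemma borel_family_flux:
  fixes r :: "real \<Rightarrow> 'a \<Rightarrow> real" and f :: "real \<times> 'a \<Rightarrow> real"
  assumes r [measurable]: "(\<lambda>(t, x). r t x) \<in> borel_measurable (borel \<Otimes>\<^sub>M borel)"
    and f [measurable]: "f \<in> borel_measurable (borel \<Otimes>\<^sub>M borel)"
    and radon: "\<And>t. signed_radon_offdiag (signed_density Jm (flux (r t) (\<lambda>x. f (t, x))))"
  shows "borel_family_offdiag (\<lambda>t. signed_density Jm (flux (r t) (\<lambda>x. f (t, x))))"
proof -
  interpret J: sigma_finite_measure Jm by (rule sigma_finite_jump_measure)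
  let ?W = "\<lambda>t. flux (r t) (\<lambda>x. f (t, x))"
  have "(\<lambda>t. signed_measure_value (signed_density Jm (?W t)) B) \<in> borel_measurable (restrict_space borel {0..1})"
    if B: "B \<in> sets borel" "B \<subseteq> offdiag" for B
  proof -
    have BJ [measurable]: "B \<in> sets Jm" using B by (simp add: sets_jump_measure sets_offdiag_borel_iff)
    have Wm: "?W t \<in> borel_measurable Jm" for t
      by (rule measurable_jump_measure[OF flux_measurable]) measurable
    have "(\<lambda>t. enn2real (\<integral>\<^sup>+p. ennreal (?W t p) * indicator B p \<partial>Jm) - enn2real (\<integral>\<^sup>+p. ennreal (- ?W t p) * indicator B p \<partial>Jm)) \<in> borel_measurable borel"
      unfolding flux_def by measurable
    moreover have "signed_measure_value (signed_density Jm (?W t)) B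
      = enn2real (\<integral>\<^sup>+p. ennreal (?W t p) * indicator B p \<partial>Jm) - enn2real (\<integral>\<^sup>+p. ennreal (- ?W t p) * indicator B p \<partial>Jm)" for t
      using Wm[of t] BJ by (simp add: signed_measure_value_def signed_density_def measure_def emeasure_density)
    ultimately show ?thesis by (simp add: measurable_restrict_space1)
  qed
  then show ?thesis unfolding borel_family_offdiag_def using radon by (meson order_trans)
qed

text \<open>Finite action is assumed at every time, as a Borel family has to consist of signed Radon
  measures at every time and not just at almost every one. The integrability of the flux against
  differences of test functions follows from the jump bound.\<close>

lemma CE_of_densities:
  fixes r :: "real \<Rightarrow> 'a \<Rightarrow> real" and f :: "real \<times> 'a \<Rightarrow> real"
  assumes r [measurable]: "(\<lambda>(t, x). r t x) \<in> borel_measurable (borel \<Otimes>\<^sub>M borel)"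
    and r0: "\<And>t x. 0 \<le> r t x" and r1: "\<And>t. (\<integral>\<^sup>+x. ennreal (r t x) \<partial>lborel) = 1"
    and f [measurable]: "f \<in> borel_measurable (borel \<Otimes>\<^sub>M borel)"
    and fin: "\<And>t. action' lborel K (r t) (\<lambda>x. f (t, x)) < \<infinity>"
    and total: "(\<integral>\<^sup>+t\<in>{0..1}. action' lborel K (r t) (\<lambda>x. f (t, x)) \<partial>lborel) < \<infinity>"
    and wc: "weakly_continuous_curve (\<lambda>t. density lborel (\<lambda>x. ennreal (r t x)))"
    and eq: "\<And>\<phi>. test_function \<phi> \<Longrightarrow> (LINT t:{0..1}|lborel. LINT x|lborel. time_deriv \<phi> (t, x) * r t x)
      + 1 / 2 * (LINT t:{0..1}|lborel. LINT p|Jm. (\<phi> (t, snd p) - \<phi> (t, fst p)) * flux (r t) (\<lambda>x. f (t, x)) p) = 0"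
  shows "(\<lambda>t. density lborel (\<lambda>x. ennreal (r t x)), \<lambda>t. signed_density Jm (flux (r t) (\<lambda>x. f (t, x))))
    \<in> CE (density lborel (\<lambda>x. ennreal (r 0 x))) (density lborel (\<lambda>x. ennreal (r 1 x)))"
proof -
  let ?W = "\<lambda>t. flux (r t) (\<lambda>x. f (t, x))"
  have rt: "r t \<in> borel_measurable borel" and ft: "(\<lambda>x. f (t, x)) \<in> borel_measurable borel" for t by measurable
  have Wb: "?W t \<in> borel_measurable borel" for t by (rule flux_measurable[OF rt ft])
  have absW: "\<bar>?W t p\<bar> = \<bar>f (t, snd p) - f (t, fst p)\<bar> * log_mean (r t (fst p)) (r t (snd p))" for t p
    using log_mean_nonneg by (simp add: flux_def abs_mult)
  have W1: "(\<integral>\<^sup>+p. ennreal (min 1 (norm (snd p - fst p)) * \<bar>?W t p\<bar>) \<partial>Jm) \<le> 2 * levy_mass + 2 * action' lborel K (r t) (\<lambda>x. f (t, x))" for t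
    unfolding absW by (rule flux_integrable[OF rt r0 r1 ft])
  have W2: "(\<integral>\<^sup>+p. ennreal (min 1 (norm (snd p - fst p)) * \<bar>?W t p\<bar>) \<partial>Jm) < \<infinity>" for t
    using le_less_trans[OF W1] fin levy_mass_finite by (simp add: ennreal_mult_less_top)
  note radon = signed_radon_density[OF Wb W2]
  have Am: "(\<lambda>t. action' lborel K (r t) (\<lambda>x. f (t, x))) \<in> borel_measurable borel"
    by (rule action'_measurable[OF r f])
  have TV: "(\<integral>\<^sup>+t\<in>{0..1}. total_variation_nn_integral (signed_density Jm (?W t)) (\<lambda>(x, y). ennreal (min 1 (dist x y))) \<partial>lborel) < \<infinity>"
  proof -
    have "(\<integral>\<^sup>+t\<in>{0..1}. total_variation_nn_integral (signed_density Jm (?W t)) (\<lambda>(x, y). ennreal (min 1 (dist x y))) \<partial>lborel)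
      \<le> (\<integral>\<^sup>+t. (2 * levy_mass) * indicator {0..1::real} t + 2 * (action' lborel K (r t) (\<lambda>x. f (t, x)) * indicator {0..1} t) \<partial>lborel)"
      unfolding total_variation_signed_density[OF Wb]
    proof (rule nn_integral_mono)
      fix t :: real
      show "(\<integral>\<^sup>+p. ennreal (min 1 (norm (snd p - fst p)) * \<bar>?W t p\<bar>) \<partial>Jm) * indicator {0..1} t
        \<le> (2 * levy_mass) * indicator {0..1::real} t + 2 * (action' lborel K (r t) (\<lambda>x. f (t, x)) * indicator {0..1} t)"
        using W1[of t] by (simp add: indicator_def)
    qed
    also have "\<dots> = (2 * levy_mass) * emeasure lborel {0..1::real} + 2 * (\<integral>\<^sup>+t\<in>{0..1}. action' lborel K (r t) (\<lambda>x. f (t, x)) \<partial>lborel)"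
      using Am by (subst nn_integral_add) (simp_all add: nn_integral_cmult nn_integral_cmult_indicator)
    also have "\<dots> < \<infinity>" using total levy_mass_finite by (simp add: ennreal_mult_less_top)
    finally show ?thesis .
  qed
  have flow: "(LINT t:{0..1}|lborel. LINT x|density lborel (\<lambda>x. ennreal (r t x)). deriv (\<lambda>s. \<phi> (s, x)) t) +
      1 / 2 * (LINT t:{0..1}|lborel. signed_integral (signed_density Jm (?W t)) (\<lambda>(x, y). \<phi> (t, y) - \<phi> (t, x))) = 0"
    if \<phi>: "test_function \<phi>" for \<phi>
  proof -
    have sc: "smooth_compact \<phi>" by (rule test_function_smooth_compact[OF \<phi>])
    note [measurable] = test_function_measurable[OF sc] test_function_measurable[OF smooth_compact_time_deriv[OF sc]]
    have e1: "(LINT x|density lborel (\<lambda>x. ennreal (r t x)). deriv (\<lambda>s. \<phi> (s, x)) t) = (LINT x|lborel. time_deriv \<phi> (t, x) * r t x)" for t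
    proof -
      have m: "(\<lambda>x. time_deriv \<phi> (t, x)) \<in> borel_measurable lborel" by measurable
      have "(LINT x|density lborel (\<lambda>x. ennreal (r t x)). time_deriv \<phi> (t, x)) = (LINT x|lborel. r t x *\<^sub>R time_deriv \<phi> (t, x))"
        by (rule integral_density[OF m]) (use rt[of t] r0 in simp_all)
      then show ?thesis by (simp add: deriv_eq_time_deriv[OF smooth_compact_smooth[OF sc]] mult.commute)
    qed
    obtain L where L: "0 \<le> L" "\<And>t x y. \<bar>\<phi> (t, y) - \<phi> (t, x)\<bar> \<le> L * min 1 (norm (y - x))"
      using smooth_compact_jump_bound[OF sc] by metis
    have e2: "signed_integral (signed_density Jm (?W t)) (\<lambda>(x, y). \<phi> (t, y) - \<phi> (t, x))
      = (LINT p|Jm. (\<phi> (t, snd p) - \<phi> (t, fst p)) * ?W t p)" for t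
    proof -
      have m: "(\<lambda>p. \<phi> (t, snd p) - \<phi> (t, fst p)) \<in> borel_measurable borel"
        unfolding measurable_borel_prod[symmetric] by measurable
      have W [measurable]: "?W t \<in> borel_measurable Jm" by (rule measurable_jump_measure[OF Wb])
      have mJ [measurable]: "(\<lambda>p. \<phi> (t, snd p) - \<phi> (t, fst p)) \<in> borel_measurable Jm" by (rule measurable_jump_measure[OF m])
      have "integrable Jm (\<lambda>p. (\<phi> (t, snd p) - \<phi> (t, fst p)) * ?W t p)"
      proof (rule integrableI_bounded)
        have "(\<integral>\<^sup>+p. ennreal (norm ((\<phi> (t, snd p) - \<phi> (t, fst p)) * ?W t p)) \<partial>Jm)
          \<le> (\<integral>\<^sup>+p. ennreal L * ennreal (min 1 (norm (snd p - fst p)) * \<bar>?W t p\<bar>) \<partial>Jm)"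
        proof (rule nn_integral_mono)
          fix p :: "'a \<times> 'a"
          have "\<bar>\<phi> (t, snd p) - \<phi> (t, fst p)\<bar> * \<bar>?W t p\<bar> \<le> (L * min 1 (norm (snd p - fst p))) * \<bar>?W t p\<bar>"
            by (rule mult_right_mono[OF L(2)]) simp
          then have "norm ((\<phi> (t, snd p) - \<phi> (t, fst p)) * ?W t p) \<le> L * (min 1 (norm (snd p - fst p)) * \<bar>?W t p\<bar>)"
            by (simp add: abs_mult mult.assoc)
          then show "ennreal (norm ((\<phi> (t, snd p) - \<phi> (t, fst p)) * ?W t p)) \<le> ennreal L * ennreal (min 1 (norm (snd p - fst p)) * \<bar>?W t p\<bar>)"
            unfolding ennreal_mult'[OF L(1), symmetric] by (rule ennreal_leI)
        qed
        also have "\<dots> = ennreal L * (\<integral>\<^sup>+p. ennreal (min 1 (norm (snd p - fst p)) * \<bar>?W t p\<bar>) \<partial>Jm)"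
          by (rule nn_integral_cmult) measurable
        also have "\<dots> < \<infinity>" using W2[of t] by (simp add: ennreal_mult_less_top)
        finally show "(\<integral>\<^sup>+p. ennreal (norm ((\<phi> (t, snd p) - \<phi> (t, fst p)) * ?W t p)) \<partial>Jm) < \<infinity>" .
      qed measurable
      from signed_integral_density[OF Wb m this] show ?thesis by (simp add: case_prod_beta')
    qed
    show ?thesis unfolding e1 e2 by (rule eq[OF \<phi>])
  qed
  show ?thesis
    unfolding CE_def mem_Collect_eq prod.case
    using wc borel_family_flux[OF r f radon] TV flow by blast
qed

end

section \<open>Every admissible pair of density and potential is a competitor for the
  distance\<close>

context levy_kernel
begin

text \<open>Two adjustments come before the passage to fluxes: the data are continued to all times
  by clamping, and the potential is set to 0 at the times of infinite action. The latter form a null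
  set within [0, 1], so the equation persists, and the action only decreases.\<close>

lemma CE'_upper_bound:
  assumes CE': "(\<rho>, \<psi>) \<in> CE' lborel K \<rho>0 \<rho>1"
    and total: "(\<integral>\<^sup>+t\<in>{0..1}. action' lborel K (\<rho> t) (\<psi> t) \<partial>lborel) < \<infinity>"
  shows "(INF (\<mu>, N)\<in>CE (density lborel (\<lambda>x. ennreal (\<rho>0 x))) (density lborel (\<lambda>x. ennreal (\<rho>1 x))).
      \<integral>\<^sup>+t\<in>{0..1}. action K (\<mu> t) (N t) \<partial>lborel) \<le> (\<integral>\<^sup>+t\<in>{0..1}. action' lborel K (\<rho> t) (\<psi> t) \<partial>lborel)"
proof -
  interpret J: sigma_finite_measure Jm by (rule sigma_finite_jump_measure)
  have \<rho>m: "(\<lambda>(t, x). \<rho> t x) \<in> borel_measurable (restrict_space borel ({0..1} \<times> UNIV))"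
    and \<rho>: "\<And>t x. t \<in> {0..1} \<Longrightarrow> 0 \<le> \<rho> t x" "\<And>t. t \<in> {0..1} \<Longrightarrow> (\<integral>\<^sup>+x. ennreal (\<rho> t x) \<partial>lborel) = 1"
    and wc: "weakly_continuous_curve (\<lambda>t. density lborel (\<lambda>x. ennreal (\<rho> t x)))"
    and \<psi>m: "(\<lambda>(t, x). \<psi> t x) \<in> borel_measurable (restrict_space borel ({0..1} \<times> UNIV))"
    and ends: "\<rho> 0 = \<rho>0" "\<rho> 1 = \<rho>1"
    and flow: "\<And>\<phi>. test_function \<phi> \<Longrightarrow> (LINT t:{0..1}|lborel. LINT x|lborel. deriv (\<lambda>s. \<phi> (s, x)) t * \<rho> t x) +
      1 / 2 * (LINT t:{0..1}|lborel. LINT (x, y)|Jm. (\<phi> (t, y) - \<phi> (t, x)) * (\<psi> t y - \<psi> t x) * log_mean (\<rho> t x) (\<rho> t y)) = 0"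
    using CE' unfolding CE'_def mem_Collect_eq prod.case by blast+
  define r where "r t = \<rho> (clamp01 t)" for t
  define g where "g p = \<psi> (clamp01 (fst p)) (snd p)" for p
  define A where "A t = action' lborel K (r t) (\<lambda>x. g (t, x))" for t
  \<comment> \<open>Outside T the flux of the potential need not be a Radon measure, hence f is
    switched off there.\<close>
  define T where "T = {t. A t < \<infinity>}"
  define f where "f p = indicator T (fst p) * g p" for p
  have "(\<lambda>p. (clamp01 (fst p), snd p)) \<in> borel \<Otimes>\<^sub>M borel \<rightarrow>\<^sub>M ((borel :: real measure) \<Otimes>\<^sub>M (borel :: 'a measure))"
    by measurable
  then have "(\<lambda>p. (clamp01 (fst p), snd p)) \<in> borel \<Otimes>\<^sub>M borel \<rightarrow>\<^sub>M (borel :: (real \<times> 'a) measure)"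
    using measurable_cong_sets[OF refl sets_borel_prod] by blast
  then have cl: "(\<lambda>p. (clamp01 (fst p), snd p)) \<in> borel \<Otimes>\<^sub>M borel \<rightarrow>\<^sub>M restrict_space (borel :: (real \<times> 'a) measure) ({0..1} \<times> UNIV)"
    by (intro measurable_restrict_space2) auto
  have rm [measurable]: "(\<lambda>(t, x). r t x) \<in> borel_measurable (borel \<Otimes>\<^sub>M borel)"
    using measurable_compose[OF cl \<rho>m] by (simp add: r_def case_prod_beta')
  have gm [measurable]: "g \<in> borel_measurable (borel \<Otimes>\<^sub>M borel)"
    using measurable_compose[OF cl \<psi>m] by (simp add: g_def[abs_def] case_prod_beta')
  have Am [measurable]: "A \<in> borel_measurable borel" unfolding A_def[abs_def] by (rule action'_measurable[OF rm gm])
  have Tm [measurable]: "T \<in> sets borel" unfolding T_def by measurable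
  have fm [measurable]: "f \<in> borel_measurable (borel \<Otimes>\<^sub>M borel)" unfolding f_def[abs_def] by measurable
  have r0: "0 \<le> r t x" and r1: "(\<integral>\<^sup>+x. ennreal (r t x) \<partial>lborel) = 1" for t x
    using \<rho>[OF clamp01_in] by (simp_all add: r_def)
  have r_id: "r t = \<rho> t" and g_id: "g (t, x) = \<psi> t x" if "t \<in> {0..1}" for t x
    using that by (simp_all add: r_def g_def clamp01_id)
  have A_id: "A t = action' lborel K (\<rho> t) (\<psi> t)" if "t \<in> {0..1}" for t
    unfolding A_def r_id[OF that] g_id[OF that] ..
  have f_in: "f (t, x) = g (t, x)" if "t \<in> T" for t x using that by (simp add: f_def)
  have f_out: "f (t, x) = 0" if "t \<notin> T" for t x using that by (simp add: f_def)
  have Af: "action' lborel K (r t) (\<lambda>x. f (t, x)) \<le> A t" "action' lborel K (r t) (\<lambda>x. f (t, x)) < \<infinity>" for t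
  proof -
    have "action' lborel K (r t) (\<lambda>x. f (t, x)) = (if t \<in> T then A t else 0)"
    proof (cases "t \<in> T")
      case True then show ?thesis by (simp add: f_in A_def)
    next
      case False then show ?thesis by (simp add: f_out action'_def case_prod_beta')
    qed
    then show "action' lborel K (r t) (\<lambda>x. f (t, x)) \<le> A t" "action' lborel K (r t) (\<lambda>x. f (t, x)) < \<infinity>"
      by (auto simp: T_def)
  qed
  have Atot: "(\<integral>\<^sup>+t\<in>{0..1}. A t \<partial>lborel) = (\<integral>\<^sup>+t\<in>{0..1}. action' lborel K (\<rho> t) (\<psi> t) \<partial>lborel)"
    by (rule nn_integral_cong) (simp add: A_id indicator_def)
  have le: "(\<integral>\<^sup>+t\<in>{0..1}. action' lborel K (r t) (\<lambda>x. f (t, x)) \<partial>lborel) \<le> (\<integral>\<^sup>+t\<in>{0..1}. action' lborel K (\<rho> t) (\<psi> t) \<partial>lborel)"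
    unfolding Atot[symmetric] by (intro nn_integral_mono mult_right_mono Af(1)) simp
  have "AE t in lborel. A t * indicator {0..1} t \<noteq> \<infinity>"
    by (rule nn_integral_PInf_AE) (measurable, use total Atot in simp)
  then have AE_T: "AE t in lborel. t \<in> {0..1} \<longrightarrow> t \<in> T"
    by eventually_elim (auto simp: T_def top.not_eq_extremum)
  have wcr: "weakly_continuous_curve (\<lambda>t. density lborel (\<lambda>x. ennreal (r t x)))"
    using wc unfolding weakly_continuous_curve_def by (simp add: r_id cong: continuous_on_cong_simp)
  have eq: "(LINT t:{0..1}|lborel. LINT x|lborel. time_deriv \<phi> (t, x) * r t x)
      + 1 / 2 * (LINT t:{0..1}|lborel. LINT p|Jm. (\<phi> (t, snd p) - \<phi> (t, fst p)) * flux (r t) (\<lambda>x. f (t, x)) p) = 0"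
    if \<phi>: "test_function \<phi>" for \<phi>
  proof -
    have sc: "smooth_compact \<phi>" by (rule test_function_smooth_compact[OF \<phi>])
    note [measurable] = test_function_measurable[OF sc]
    have 1: "(LINT t:{0..1}|lborel. LINT x|lborel. time_deriv \<phi> (t, x) * r t x)
      = (LINT t:{0..1}|lborel. LINT x|lborel. deriv (\<lambda>s. \<phi> (s, x)) t * \<rho> t x)"
      unfolding deriv_eq_time_deriv[OF smooth_compact_smooth[OF sc]]
      by (rule set_lebesgue_integral_cong) (simp_all add: r_id)
    have "(LINT t:{0..1}|lborel. LINT p|Jm. (\<phi> (t, snd p) - \<phi> (t, fst p)) * flux (r t) (\<lambda>x. f (t, x)) p)
      = (LINT t:{0..1}|lborel. LINT p|Jm. (\<phi> (t, snd p) - \<phi> (t, fst p)) * flux (r t) (\<lambda>x. g (t, x)) p)"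
    proof (rule set_lebesgue_integral_cong_AE)
      show "(\<lambda>t. LINT p|Jm. (\<phi> (t, snd p) - \<phi> (t, fst p)) * flux (r t) (\<lambda>x. f (t, x)) p) \<in> borel_measurable lborel"
        "(\<lambda>t. LINT p|Jm. (\<phi> (t, snd p) - \<phi> (t, fst p)) * flux (r t) (\<lambda>x. g (t, x)) p) \<in> borel_measurable lborel"
        unfolding flux_def by measurable
      show "AE t\<in>{0..1} in lborel. (LINT p|Jm. (\<phi> (t, snd p) - \<phi> (t, fst p)) * flux (r t) (\<lambda>x. f (t, x)) p)
        = (LINT p|Jm. (\<phi> (t, snd p) - \<phi> (t, fst p)) * flux (r t) (\<lambda>x. g (t, x)) p)"
        using AE_T by eventually_elim (simp add: f_in)
    qed simp
    also have "\<dots> = (LINT t:{0..1}|lborel. LINT (x, y)|Jm. (\<phi> (t, y) - \<phi> (t, x)) * (\<psi> t y - \<psi> t x) * log_mean (\<rho> t x) (\<rho> t y))"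
      by (rule set_lebesgue_integral_cong) (simp_all add: r_id g_id flux_def case_prod_beta' mult.assoc)
    finally show ?thesis using flow[OF \<phi>] 1 by simp
  qed
  have "(\<lambda>t. density lborel (\<lambda>x. ennreal (r t x)), \<lambda>t. signed_density Jm (flux (r t) (\<lambda>x. f (t, x))))
    \<in> CE (density lborel (\<lambda>x. ennreal (\<rho>0 x))) (density lborel (\<lambda>x. ennreal (\<rho>1 x)))"
    using CE_of_densities[OF rm r0 r1 fm Af(2) le_less_trans[OF le total] wcr eq] by (simp add: r_id ends)
  then show ?thesis
  proof (rule INF_lower2)
    have rt: "r t \<in> borel_measurable borel" and ft: "(\<lambda>x. f (t, x)) \<in> borel_measurable borel" for t by measurable
    have "(\<integral>\<^sup>+t\<in>{0..1}. action K (density lborel (\<lambda>x. ennreal (r t x))) (signed_density Jm (flux (r t) (\<lambda>x. f (t, x)))) \<partial>lborel)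
      \<le> (\<integral>\<^sup>+t\<in>{0..1}. action' lborel K (r t) (\<lambda>x. f (t, x)) \<partial>lborel)"
      by (intro nn_integral_mono mult_right_mono action_flux_le rt ft r0) simp
    also note le
    finally show "(case (\<lambda>t. density lborel (\<lambda>x. ennreal (r t x)), \<lambda>t. signed_density Jm (flux (r t) (\<lambda>x. f (t, x)))) of
        (\<mu>, N) \<Rightarrow> \<integral>\<^sup>+t\<in>{0..1}. action K (\<mu> t) (N t) \<partial>lborel) \<le> (\<integral>\<^sup>+t\<in>{0..1}. action' lborel K (\<rho> t) (\<psi> t) \<partial>lborel)"
      by (simp only: prod.case)
  qed
qed

end

subsection \<open>Equality of the two infima\<close>

text \<open>The symmetric measure is tested with the product of Q(x) and A(y - x). Integrating out x
  over a set of measure 1 leaves the mass of A under the densities j(z) and j(-z). The result is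
  about \<open>ennreal\<close> values, which is all that a density sees.\<close>

lemma reversible_translation_kernel:
  fixes j :: "'a::euclidean_space \<Rightarrow> real"
  assumes j [measurable]: "j \<in> borel_measurable borel" and rev: "reversible lborel (translation_kernel j)"
  shows "AE z in lborel. ennreal (j z) = ennreal (j (- z))"
proof -
  interpret jump_density j by (rule jump_density.intro[OF j])
  have "density lborel (\<lambda>z. ennreal (j z)) = density lborel (\<lambda>z. ennreal (j (- z)))"
  proof (rule measure_eqI)
    fix A assume "A \<in> sets (density lborel (\<lambda>z. ennreal (j z)))"
    then have A [measurable]: "A \<in> sets borel" by simp
    \<comment> \<open>The unit cube localises x: without it both sides would be infinite whenever A
      has positive mass.\<close>
    define Q where "Q = (cbox 0 One :: 'a set)"
    have Q [measurable]: "Q \<in> sets borel" and Q1: "emeasure lborel Q = 1" by (simp_all add: Q_def emeasure_lborel_cbox_eq)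
    let ?h = "\<lambda>p. indicator Q (fst p) * indicator A (snd p - fst p) :: ennreal"
    have hm: "?h \<in> borel_measurable borel" unfolding measurable_borel_prod[symmetric] by measurable
    have "(\<integral>\<^sup>+x. \<integral>\<^sup>+y. ?h (x, y) * ennreal (j (y - x)) \<partial>lborel \<partial>lborel) = (\<integral>\<^sup>+x. \<integral>\<^sup>+y. ?h (y, x) * ennreal (j (y - x)) \<partial>lborel \<partial>lborel)"
      using nn_integral_jump_measure[OF sets_lborel hm] nn_integral_jump_measure_swap[OF sets_lborel hm] rev
      unfolding reversible_def by simp
    also have "(\<integral>\<^sup>+x. \<integral>\<^sup>+y. ?h (y, x) * ennreal (j (y - x)) \<partial>lborel \<partial>lborel) = (\<integral>\<^sup>+x. \<integral>\<^sup>+y. ?h (x, y) * ennreal (j (x - y)) \<partial>lborel \<partial>lborel)"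
      by (rule lborel_pair.Fubini') measurable
    finally have eq: "(\<integral>\<^sup>+x. \<integral>\<^sup>+y. ?h (x, y) * ennreal (j (y - x)) \<partial>lborel \<partial>lborel) = (\<integral>\<^sup>+x. \<integral>\<^sup>+y. ?h (x, y) * ennreal (j (x - y)) \<partial>lborel \<partial>lborel)" .
    have slice: "(\<integral>\<^sup>+x. \<integral>\<^sup>+y. ?h (x, y) * ennreal (i (y - x)) \<partial>lborel \<partial>lborel) = emeasure (density lborel (\<lambda>z. ennreal (i z))) A"
      if i [measurable]: "i \<in> borel_measurable borel" for i :: "'a \<Rightarrow> real"
    proof -
      let ?a = "\<integral>\<^sup>+z. indicator A z * ennreal (i z) \<partial>lborel"
      have "(\<integral>\<^sup>+y. ?h (x, y) * ennreal (i (y - x)) \<partial>lborel) = ?a * indicator Q x" for x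
      proof -
        have "(\<integral>\<^sup>+y. ?h (x, y) * ennreal (i (y - x)) \<partial>lborel) = (\<integral>\<^sup>+y. indicator Q x * (indicator A (y - x) * ennreal (i (y - x))) \<partial>lborel)"
          by (simp add: mult.assoc)
        also have "\<dots> = indicator Q x * (\<integral>\<^sup>+y. indicator A (y - x) * ennreal (i (y - x)) \<partial>lborel)"
          by (rule nn_integral_cmult) measurable
        also have "(\<integral>\<^sup>+y. indicator A (y - x) * ennreal (i (y - x)) \<partial>lborel) = ?a"
          by (rule nn_integral_lborel_shift_minus) measurable
        finally show ?thesis by (simp only: mult.commute)
      qed
      then have "(\<integral>\<^sup>+x. \<integral>\<^sup>+y. ?h (x, y) * ennreal (i (y - x)) \<partial>lborel \<partial>lborel) = ?a * emeasure lborel Q"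
        by (simp add: nn_integral_cmult_indicator)
      then show ?thesis by (simp add: Q1 emeasure_density mult.commute)
    qed
    have "(\<lambda>z. j (- z)) \<in> borel_measurable borel" by measurable
    from slice[OF this] slice[OF j] eq
    show "emeasure (density lborel (\<lambda>z. ennreal (j z))) A = emeasure (density lborel (\<lambda>z. ennreal (j (- z)))) A" by simp
  qed simp
  then show ?thesis by (intro sigma_finite_measure.density_unique[OF sigma_finite_lborel]) measurable
qed

lemma fisher_information_finite:
  assumes "fisher_information m J \<mu> < \<infinity>"
  obtains \<sigma> where "\<sigma> \<in> borel_measurable m" "\<And>x. 0 < \<sigma> x" "\<mu> = density m (\<lambda>x. ennreal (\<sigma> x))"
    "(\<integral>\<^sup>+ (x, y). ennreal ((\<sigma> y - \<sigma> x) * (ln (\<sigma> y) - ln (\<sigma> x))) \<partial>jump_measure m J) / 2 < \<infinity>"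
  using assms unfolding fisher_information_def Inf_less_iff by blast

lemma W_square:
  "(W J \<mu>0 \<mu>1)\<^sup>2 = (INF (\<mu>, N)\<in>CE \<mu>0 \<mu>1. \<integral>\<^sup>+ t\<in>{0..1}. action J (\<mu> t) (N t) \<partial>lborel)"
proof -
  have "(if c = \<infinity> then \<infinity> else ennreal (sqrt (enn2real c)))\<^sup>2 = c" for c :: ennreal
    by (cases c) (simp_all add: ennreal_power power_top_ennreal)
  then show ?thesis unfolding W_def Let_def by blast
qed

context levy_kernel
begin

lemma W_square_eq:
  assumes inf: "(\<integral>\<^sup>+z. ennreal (j z) \<partial>lborel) = \<infinity>"
    and \<rho>0: "\<rho>0 \<in> borel_measurable borel" "\<And>x. 0 \<le> \<rho>0 x" and \<rho>1: "\<rho>1 \<in> borel_measurable borel" "\<And>x. 0 \<le> \<rho>1 x"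
    and F0: "fisher_information lborel K (density lborel (\<lambda>x. ennreal (\<rho>0 x))) < \<infinity>"
    and F1: "fisher_information lborel K (density lborel (\<lambda>x. ennreal (\<rho>1 x))) < \<infinity>"
  shows "(W K (density lborel (\<lambda>x. ennreal (\<rho>0 x))) (density lborel (\<lambda>x. ennreal (\<rho>1 x))))\<^sup>2
    = (INF (\<rho>, \<psi>)\<in>CE' lborel K \<rho>0 \<rho>1. \<integral>\<^sup>+ t\<in>{0..1}. action' lborel K (\<rho> t) (\<psi> t) \<partial>lborel)" (is "_ = ?I")
  unfolding W_square
proof (rule antisym)
  let ?C = "CE (density lborel (\<lambda>x. ennreal (\<rho>0 x))) (density lborel (\<lambda>x. ennreal (\<rho>1 x)))"
  let ?W = "INF (\<mu>, N)\<in>?C. \<integral>\<^sup>+ t\<in>{0..1}. action K (\<mu> t) (N t) \<partial>lborel"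
  show "?W \<le> ?I"
  proof (rule INF_greatest)
    fix p assume p: "p \<in> CE' lborel K \<rho>0 \<rho>1"
    obtain \<rho> \<psi> where [simp]: "p = (\<rho>, \<psi>)" by (cases p)
    show "?W \<le> (case p of (\<rho>, \<psi>) \<Rightarrow> \<integral>\<^sup>+ t\<in>{0..1}. action' lborel K (\<rho> t) (\<psi> t) \<partial>lborel)"
    proof (cases "(\<integral>\<^sup>+ t\<in>{0..1}. action' lborel K (\<rho> t) (\<psi> t) \<partial>lborel) < \<infinity>")
      case True
      then show ?thesis using CE'_upper_bound[of \<rho> \<psi>] p by simp
    next
      case False
      then show ?thesis by (simp add: top.not_eq_extremum[symmetric])
    qed
  qed
  obtain \<sigma>0 where s0: "\<sigma>0 \<in> borel_measurable lborel" "\<And>x. 0 < \<sigma>0 x"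
      and e0: "density lborel (\<lambda>x. ennreal (\<rho>0 x)) = density lborel (\<lambda>x. ennreal (\<sigma>0 x))"
      and f0: "(\<integral>\<^sup>+ (x, y). ennreal ((\<sigma>0 y - \<sigma>0 x) * (ln (\<sigma>0 y) - ln (\<sigma>0 x))) \<partial>Jm) / 2 < \<infinity>"
    by (rule fisher_information_finite[OF F0], rule that, assumption+)
  obtain \<sigma>1 where s1: "\<sigma>1 \<in> borel_measurable lborel" "\<And>x. 0 < \<sigma>1 x"
      and e1: "density lborel (\<lambda>x. ennreal (\<rho>1 x)) = density lborel (\<lambda>x. ennreal (\<sigma>1 x))"
      and f1: "(\<integral>\<^sup>+ (x, y). ennreal ((\<sigma>1 y - \<sigma>1 x) * (ln (\<sigma>1 y) - ln (\<sigma>1 x))) \<partial>Jm) / 2 < \<infinity>"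
    by (rule fisher_information_finite[OF F1], rule that, assumption+)
  show "?I \<le> ?W"
  proof (rule INF_greatest)
    fix p assume p: "p \<in> ?C"
    obtain \<mu> N where pe: "p = (\<mu>, N)" by (cases p)
    let ?A = "\<integral>\<^sup>+ t\<in>{0..1}. action K (\<mu> t) (N t) \<partial>lborel"
    have "?I \<le> ?A"
    proof (cases "?A < \<infinity>")
      case True
      show ?thesis
      proof (rule ennreal_le_epsilon)
        fix \<delta> :: real assume \<delta>: "0 < \<delta>"
        have CE: "(\<mu>, N) \<in> CE (density lborel (\<lambda>x. ennreal (\<sigma>0 x))) (density lborel (\<lambda>x. ennreal (\<sigma>1 x)))"
          using p unfolding pe e0 e1 .
        obtain \<rho> \<psi> where "(\<rho>, \<psi>) \<in> CE' lborel K \<rho>0 \<rho>1"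
          "(\<integral>\<^sup>+t\<in>{0..1}. action' lborel K (\<rho> t) (\<psi> t) \<partial>lborel) \<le> ?A + ennreal \<delta>"
          using CE_approximation[OF inf _ s0(2) _ s1(2) f0 f1 CE True \<delta> \<rho>0 \<rho>1 e0 e1] s0(1) s1(1) by auto
        then show "?I \<le> ?A + ennreal \<delta>" by (intro INF_lower2[of "(\<rho>, \<psi>)"]) simp_all
      qed
    qed (simp add: top.not_eq_extremum[symmetric])
    then show "?I \<le> (case p of (\<mu>, N) \<Rightarrow> \<integral>\<^sup>+ t\<in>{0..1}. action K (\<mu> t) (N t) \<partial>lborel)" by (simp add: pe)
  qed
qed

end

theorem proposition5p8:
  fixes j :: "'a::euclidean_space \<Rightarrow> real"
    and \<rho>\<^sub>0 \<rho>\<^sub>1 :: "'a \<Rightarrow> real"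
    and M :: "'w measure" and X :: "real \<Rightarrow> 'w \<Rightarrow> 'a"
  defines "J \<equiv> translation_kernel j"
  assumes "j \<in> borel_measurable borel"
    and "\<And>z. z \<noteq> 0 \<Longrightarrow> 0 < j z"
    and "levy_measure (jump_law j)"
    and "reversible lborel J"
    and "regularity_assumption (jump_law j) M X"
    and "\<rho>\<^sub>0 \<in> borel_measurable borel" "\<And>x. 0 \<le> \<rho>\<^sub>0 x"
    and "\<rho>\<^sub>1 \<in> borel_measurable borel" "\<And>x. 0 \<le> \<rho>\<^sub>1 x"
    and "density lborel \<rho>\<^sub>0 \<in> space (prob_algebra borel)"
    and "density lborel \<rho>\<^sub>1 \<in> space (prob_algebra borel)"
    and "fisher_information lborel J (density lborel \<rho>\<^sub>0) < \<infinity>"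
    and "fisher_information lborel J (density lborel \<rho>\<^sub>1) < \<infinity>"
  shows "(W J (density lborel \<rho>\<^sub>0) (density lborel \<rho>\<^sub>1))\<^sup>2 =
    (INF (\<rho>, \<psi>)\<in>CE' lborel J \<rho>\<^sub>0 \<rho>\<^sub>1. \<integral>\<^sup>+ t\<in>{0..1}. action' lborel J (\<rho> t) (\<psi> t) \<partial>lborel)"
proof -
  note j = assms(2) and pos = assms(3) and levy = assms(4)
  note [measurable] = j
  have rev: "reversible lborel (translation_kernel j)" using assms(5) unfolding J_def .
  \<comment> \<open>The average of j and its reflection is even at every point and, by
    reversibility, equals j almost everywhere. At the origin j is unconstrained, so an arbitrary
    positive value is put there.\<close>
  define j' where "j' z = (if z = 0 then 1 else (j z + j (- z)) / 2)" for z
  have j' [measurable]: "j' \<in> borel_measurable borel" unfolding j'_def[abs_def] by measurable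
  have AE: "AE z in lborel. j z = j' z"
    using reversible_translation_kernel[OF j rev] AE_lborel_singleton[of 0]
  proof eventually_elim
    case (elim z)
    then have "0 < j z" "0 < j (- z)" using pos[of z] pos[of "- z"] by simp_all
    then have "j z = j (- z)" using elim by simp
    then show ?case using elim by (simp add: j'_def)
  qed
  have J: "J = translation_kernel j'" unfolding J_def by (rule translation_kernel_cong[OF j j' AE])
  have mass: "(\<integral>\<^sup>+z. f z \<partial>jump_law j) = (\<integral>\<^sup>+z. f z * ennreal (j' z) \<partial>lborel)" if [measurable]: "f \<in> borel_measurable borel" for f
  proof -
    have "(\<integral>\<^sup>+z. f z \<partial>jump_law j) = (\<integral>\<^sup>+z. ennreal (j z) * f z \<partial>lborel)"
      unfolding jump_law_def by (rule nn_integral_density) measurable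
    also have "\<dots> = (\<integral>\<^sup>+z. f z * ennreal (j' z) \<partial>lborel)"
      by (rule nn_integral_cong_AE) (use AE in eventually_elim, simp add: mult.commute)
    finally show ?thesis .
  qed
  interpret levy_kernel j'
  proof (unfold_locales)
    show "j' \<in> borel_measurable borel" by (rule j')
    show "0 < j' z" for z 
      using add_pos_pos[OF pos[of z] pos[of "- z"]] by (cases "z = 0") (simp_all add: j'_def)
    show "j' (- z) = j' z" for z by (simp add: j'_def)
    have "(\<integral>\<^sup>+z. ennreal (min 1 ((norm z)\<^sup>2)) \<partial>jump_law j) < \<infinity>" using levy unfolding levy_measure_def by blast
    then show "(\<integral>\<^sup>+z. ennreal (min 1 ((norm z)\<^sup>2)) * ennreal (j' z) \<partial>lborel) < \<infinity>" by (subst (asm) mass) measurable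
  qed
  have inf: "(\<integral>\<^sup>+z. ennreal (j' z) \<partial>lborel) = \<infinity>"
    using regularity_infinite_activity[OF assms(6)] mass[of "\<lambda>z. 1"] by (simp add: jump_law_def)
  show ?thesis
    using W_square_eq[OF inf assms(7-10)] assms(13,14) unfolding J by blast
qed

end
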